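(* Let $s\in(\frac34,1)$, $2<p<2+\frac{4s}{3}$ and $a>0$. Suppose that $V\in L^{\infty}(\mathbb{R}^{3})\cap C^{\alpha}(\mathbb{R}^{3})$ with $\alpha\in(0,1)$, and that $V_{\infty}:=\lim_{|x|\to\infty}V(x)=\sup_{x\in\mathbb{R}^{3}}V(x)$. Then for any $m>0$ the minimization problem $e_{m}(a)$ admits at least one minimizer, i.e. there is $u\in S_m$ with $E_a(u)=e_m(a)$.
   Context: $(-\Delta)^{s}$ is the fractional Laplacian on $\mathbb{R}^3$, $(-\Delta)^{s}u(x)=C_{s}\,\mathrm{P.V.}\int_{\mathbb{R}^{3}}\frac{u(x)-u(y)}{|x-y|^{3+2s}}dy$ with the usual normalization constant $C_s$. For $m>0$, $S_{m}:=\{u\in H^{s}(\mathbb{R}^{3}):\|u\|_{2}^{2}=m\}$, and for $a>0$ $$E_{a}(u):=\int_{\mathbb{R}^{3}}\big(|(-\Delta)^{\frac{s}{2}}u|^{2}+V(x)|u|^{2}\big)dx-\frac12\int_{\mathbb{R}^{3}}\int_{\mathbb{R}^{3}}\frac{|u(x)|^{2}|u(y)|^{2}}{|x-y|^{3-2s}}dxdy-\frac{2a^{p-2}}{p}\int_{\mathbb{R}^{3}}|u|^{p}dx,$$ $$e_{m}(a):=\inf_{u\in S_{m}}E_{a}(u).$$ *)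

theory Defs
  imports "HOL-Analysis.Analysis"
begin

text \<open>
  The scalar field \<open>'k\<close> is of sort \<open>{real_normed_field, euclidean_space}\<close>: a commutative,
  finite-dimensional real division algebra with multiplicative norm, i.e. the reals or the complex
  numbers. All integrals are taken with respect to \<^const>\<open>lebesgue\<close> (the completed measure),
  so that functions need to be specified only almost everywhere.
\<close>

text \<open>
  The usual normalization constant \<open>C\<^sub>\<sigma>\<close> in dimension 3; it makes the operator
  below the Fourier multiplier with symbol \<open>\<bar>\<xi>\<bar>\<close> to the power \<open>2\<sigma>\<close>.
\<close>

definition frac_laplace_const :: "real \<Rightarrow> real" where
  "frac_laplace_const \<sigma> =
     inverse (LINT z|lebesgue. (1 - cos ((z :: real ^ 3) $ 1)) / norm z powr (3 + 2 * \<sigma>))"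

text \<open>
  The fractional Laplacian of order \<open>\<sigma>\<close> as a principal value. For \<open>u\<close> in
  \<open>H\<^sup>s\<close> with \<open>s \<in> (0,1)\<close> and \<open>\<sigma> = s/2\<close> the limit exists for almost every
  \<open>x\<close> and defines a square-integrable function; where it does not exist \<^const>\<open>Lim\<close> is a
  fixed unspecified value.
\<close>

definition frac_laplace ::
    "real \<Rightarrow> (real ^ 3 \<Rightarrow> 'k :: {real_normed_field, euclidean_space}) \<Rightarrow> real ^ 3 \<Rightarrow> 'k" where
  "frac_laplace \<sigma> u x =
     frac_laplace_const \<sigma> *\<^sub>R
       Lim (at_right 0) (\<lambda>\<epsilon> :: real.
         LINT y:(- ball x \<epsilon>)|lebesgue. (u x - u y) /\<^sub>R norm (x - y) powr (3 + 2 * \<sigma>))"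

text \<open>
  \<open>H\<^sup>s\<close> for \<open>0 < s < 1\<close>: square-integrable functions with finite Gagliardo seminorm.
  Elements are functions rather than classes modulo null sets.
\<close>

definition Hs_space :: "real \<Rightarrow> (real ^ 3 \<Rightarrow> 'k :: {real_normed_field, euclidean_space}) set" where
  "Hs_space s = {u \<in> borel_measurable lebesgue.
     integrable lebesgue (\<lambda>x. norm (u x) ^ 2) \<and>
     (\<integral>\<^sup>+ x. (\<integral>\<^sup>+ y. ennreal (norm (u x - u y) ^ 2 / norm (x - y) powr (3 + 2 * s)) \<partial>lebesgue)
        \<partial>lebesgue) < \<infinity>}"

definition mass_sphere ::
    "real \<Rightarrow> real \<Rightarrow> (real ^ 3 \<Rightarrow> 'k :: {real_normed_field, euclidean_space}) set" where
  "mass_sphere s m = {u \<in> Hs_space s. (LINT x|lebesgue. norm (u x) ^ 2) = m}"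

definition energy ::
    "real \<Rightarrow> (real ^ 3 \<Rightarrow> real) \<Rightarrow> real \<Rightarrow> real \<Rightarrow>
     (real ^ 3 \<Rightarrow> 'k :: {real_normed_field, euclidean_space}) \<Rightarrow> real" where
  "energy s V p a u =
     (LINT x|lebesgue. norm (frac_laplace (s / 2) u x) ^ 2 + V x * norm (u x) ^ 2)
     - 1 / 2 * (LINT x|lebesgue. LINT y|lebesgue.
         norm (u x) ^ 2 * norm (u y) ^ 2 / norm (x - y) powr (3 - 2 * s))
     - 2 * a powr (p - 2) / p * (LINT x|lebesgue. norm (u x) powr p)"

text \<open>
  The infimum is taken in the extended reals, so it is meaningful without knowing beforehand that
  the energy is bounded below. The first argument only selects the scalar field.
\<close>

definition energy_inf ::
    "'k :: {real_normed_field, euclidean_space} itself \<Rightarrow>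
     real \<Rightarrow> (real ^ 3 \<Rightarrow> real) \<Rightarrow> real \<Rightarrow> real \<Rightarrow> real \<Rightarrow> ereal" where
  "energy_inf _ s V p a m = (INF u \<in> (mass_sphere s m :: (real ^ 3 \<Rightarrow> 'k) set). ereal (energy s V p a u))"

definition L_infinity :: "(real ^ 3 \<Rightarrow> real) set" where
  "L_infinity = {f \<in> borel_measurable lebesgue. \<exists>M. AE x in lebesgue. \<bar>f x\<bar> \<le> M}"

definition holder_continuous :: "real \<Rightarrow> (real ^ 3 \<Rightarrow> real) \<Rightarrow> bool" where
  "holder_continuous \<alpha> f \<longleftrightarrow> (\<exists>K. \<forall>x y. \<bar>f x - f y\<bar> \<le> K * norm (x - y) powr \<alpha>)"

end

theory Submission
  imports Defs "HOL-Library.Diagonal_Subsequence"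
begin

text \<open>
  A minimizing sequence is bounded in \<open>H\<^sup>s\<close> and can lose compactness in three ways only: it may
  spread out, run away to infinity, or split. Write \<open>I\<close> for the infimum at mass \<open>m\<close>.

  Boundedness (\<open>energy_coercive\<close>) holds because both attractive terms are subcritical with respect to
  the power \<open>2 + 4s/3\<close>, which the Gagliardo seminorm controls at fixed mass: for \<open>\<bar>u\<bar>\<^sup>p\<close> this is the
  upper bound on \<open>p\<close>, and for the Hartree term it is the condition \<open>s > 3/4\<close> (\<open>har_near_small\<close>).
  Bounded sequences have subsequences converging almost everywhere and in mean square on balls
  (\<open>local_compactness\<close>), by comparison with averages over dyadic cubes.

  Splitting and partial loss of mass are excluded by scaling. Along such a subsequence the energy
  decouples into that of the limit \<open>v\<close> and that of the remainder, which feels no potential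
  (\<open>splitting.energy_split\<close>, resting on the Brezis-Lieb lemma). After subtracting its supremum the
  potential is nonpositive and tends to zero, so dropping it only raises the energy. Since
  multiplying the mass by \<open>t > 1\<close> lowers the energy below \<open>t\<close> times its value
  (\<open>energy_amplify\<close>), a limit with \<open>0 < mass v < m\<close> would lead to an energy below \<open>I\<close>. So every
  nonzero limit is a minimizer (\<open>minimizer_of_nonzero_limit\<close>).

  It remains to obtain a nonzero limit. Without potential, \<open>I < 0\<close> by dilating a bump
  (\<open>negative_energy\<close>), while the nonlinear terms vanish along a sequence whose mass in unit balls
  tends to zero uniformly (\<open>critical_interpolation\<close>); so some unit ball keeps mass, and translating
  it to the origin gives a nonzero limit (\<open>free_minimizer\<close>). With a potential that is negative
  somewhere, a translate of this free minimizer has strictly less energy than the free infimum,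
  whereas a minimizing sequence with zero limit would have at least the free infimum as its energy
  (\<open>minimizer_nonpositive_potential\<close>).

  The kinetic term is given by the pointwise principal value of the fractional Laplacian, and for all
  of this it has to be identified with a multiple of the Gagliardo seminorm
  (\<open>frac_laplace_of_Hs\<close>). This is done without the Fourier transform. The square integral of a
  convolution operator acting on differences of \<open>u\<close> is an integral of the squared modulus of
  continuity against an explicit kernel (\<open>norm_diff_avg_square\<close>); for truncated power kernels these
  kernels converge to that of the seminorm, so the truncated operators converge in mean square
  (\<open>truncated_operators_converge\<close>). That the sharply truncated integrals also converge almost
  everywhere, and to the same limit, follows by comparison with mollifications of this limit at its
  Lebesgue points (\<open>sharp_truncation_converges\<close>).
\<close>

type_synonym R3 = "real ^ 3"

abbreviation lborel2 :: "('a :: euclidean_space \<times> 'b :: euclidean_space) measure" where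
  "lborel2 \<equiv> lborel \<Otimes>\<^sub>M lborel"

section \<open>Lebesgue measure on three-space\<close>

lemma distr_lborel_affine:
  assumes "\<bar>c\<bar> = 1"
  shows "distr lborel borel (\<lambda>x :: 'a :: euclidean_space. t + c *\<^sub>R x) = lborel"
proof -
  have "density (distr lborel borel (\<lambda>x :: 'a. t + c *\<^sub>R x)) (\<lambda>_. \<bar>c\<bar> ^ DIM('a)) = lborel"
    using assms by (intro lborel_affine[symmetric]) auto
  with assms show ?thesis by (simp add: density_1)
qed

lemma nn_integral_lborel_shift:
  fixes f :: "'a :: euclidean_space \<Rightarrow> ennreal"
  assumes [measurable]: "f \<in> borel_measurable borel"
  shows "(\<integral>\<^sup>+x. f (a + x) \<partial>lborel) = (\<integral>\<^sup>+x. f x \<partial>lborel)"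
    and "(\<integral>\<^sup>+x. f (x + a) \<partial>lborel) = (\<integral>\<^sup>+x. f x \<partial>lborel)"
    and "(\<integral>\<^sup>+x. f (x - a) \<partial>lborel) = (\<integral>\<^sup>+x. f x \<partial>lborel)"
    and "(\<integral>\<^sup>+x. f (a - x) \<partial>lborel) = (\<integral>\<^sup>+x. f x \<partial>lborel)"
    and "(\<integral>\<^sup>+x. f (- x) \<partial>lborel) = (\<integral>\<^sup>+x. f x \<partial>lborel)"
proof -
  have *: "(\<integral>\<^sup>+x. f (t + c *\<^sub>R x) \<partial>lborel) = (\<integral>\<^sup>+x. f x \<partial>lborel)" if "\<bar>c\<bar> = 1" for c t
    by (subst (2) distr_lborel_affine[OF that, of t, symmetric]) (simp add: nn_integral_distr)
  show "(\<integral>\<^sup>+x. f (a + x) \<partial>lborel) = (\<integral>\<^sup>+x. f x \<partial>lborel)" using *[of 1 a] by simp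
  show "(\<integral>\<^sup>+x. f (x + a) \<partial>lborel) = (\<integral>\<^sup>+x. f x \<partial>lborel)" using *[of 1 a] by (simp add: add.commute)
  show "(\<integral>\<^sup>+x. f (x - a) \<partial>lborel) = (\<integral>\<^sup>+x. f x \<partial>lborel)" using *[of 1 "-a"] by simp
  show "(\<integral>\<^sup>+x. f (a - x) \<partial>lborel) = (\<integral>\<^sup>+x. f x \<partial>lborel)" using *[of "-1" a] by simp
  show "(\<integral>\<^sup>+x. f (- x) \<partial>lborel) = (\<integral>\<^sup>+x. f x \<partial>lborel)" using *[of "-1" 0] by simp
qed

lemma integral_lborel_shift:
  fixes f :: "'a :: euclidean_space \<Rightarrow> 'b :: {banach, second_countable_topology}"
  assumes [measurable]: "f \<in> borel_measurable borel"
  shows "(LINT x|lborel. f (a + x)) = (LINT x|lborel. f x)"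
    and "(LINT x|lborel. f (x + a)) = (LINT x|lborel. f x)"
    and "(LINT x|lborel. f (x - a)) = (LINT x|lborel. f x)"
    and "(LINT x|lborel. f (a - x)) = (LINT x|lborel. f x)"
    and "(LINT x|lborel. f (- x)) = (LINT x|lborel. f x)"
    and "integrable lborel (\<lambda>x. f (a + x)) \<longleftrightarrow> integrable lborel f"
    and "integrable lborel (\<lambda>x. f (x + a)) \<longleftrightarrow> integrable lborel f"
    and "integrable lborel (\<lambda>x. f (x - a)) \<longleftrightarrow> integrable lborel f"
    and "integrable lborel (\<lambda>x. f (a - x)) \<longleftrightarrow> integrable lborel f"
    and "integrable lborel (\<lambda>x. f (- x)) \<longleftrightarrow> integrable lborel f"
proof -
  have *: "(LINT x|lborel. f (t + c *\<^sub>R x)) = (LINT x|lborel. f x)" if "\<bar>c\<bar> = 1" for c t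
    by (subst (2) distr_lborel_affine[OF that, of t, symmetric]) (simp add: integral_distr)
  have **: "integrable lborel (\<lambda>x. f (t + c *\<^sub>R x)) \<longleftrightarrow> integrable lborel f" if "\<bar>c\<bar> = 1" for c t
    by (subst (2) distr_lborel_affine[OF that, of t, symmetric]) (simp add: integrable_distr_eq)
  show "(LINT x|lborel. f (a + x)) = (LINT x|lborel. f x)" using *[of 1 a] by simp
  show "(LINT x|lborel. f (x + a)) = (LINT x|lborel. f x)" using *[of 1 a] by (simp add: add.commute)
  show "(LINT x|lborel. f (x - a)) = (LINT x|lborel. f x)" using *[of 1 "-a"] by simp
  show "(LINT x|lborel. f (a - x)) = (LINT x|lborel. f x)" using *[of "-1" a] by simp
  show "(LINT x|lborel. f (- x)) = (LINT x|lborel. f x)" using *[of "-1" 0] by simp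
  show "integrable lborel (\<lambda>x. f (a + x)) \<longleftrightarrow> integrable lborel f" using **[of 1 a] by simp
  show "integrable lborel (\<lambda>x. f (x + a)) \<longleftrightarrow> integrable lborel f" using **[of 1 a] by (simp add: add.commute)
  show "integrable lborel (\<lambda>x. f (x - a)) \<longleftrightarrow> integrable lborel f" using **[of 1 "-a"] by simp
  show "integrable lborel (\<lambda>x. f (a - x)) \<longleftrightarrow> integrable lborel f" using **[of "-1" a] by simp
  show "integrable lborel (\<lambda>x. f (- x)) \<longleftrightarrow> integrable lborel f" using **[of "-1" 0] by simp
qed

lemma nn_integral_lborel_scale:
  fixes f :: "'a :: euclidean_space \<Rightarrow> ennreal"
  assumes [measurable]: "f \<in> borel_measurable borel" and c: "c > 0"
  shows "(\<integral>\<^sup>+x. f (c *\<^sub>R x) \<partial>lborel) = ennreal (1 / c ^ DIM('a)) * (\<integral>\<^sup>+x. f x \<partial>lborel)"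
proof -
  have eq: "lborel = density (distr lborel borel (\<lambda>x :: 'a. 0 + c *\<^sub>R x)) (\<lambda>_. \<bar>c\<bar> ^ DIM('a))"
    using c by (intro lborel_affine) auto
  have "(\<integral>\<^sup>+x. f x \<partial>lborel) = ennreal (c ^ DIM('a)) * (\<integral>\<^sup>+x. f (c *\<^sub>R x) \<partial>lborel)"
    using c by (subst eq) (simp add: nn_integral_density nn_integral_distr nn_integral_cmult)
  moreover have "ennreal (1 / c ^ DIM('a)) * (ennreal (c ^ DIM('a)) * y) = y" for y
    using c by (simp add: mult.assoc[symmetric] ennreal_mult[symmetric])
  ultimately show ?thesis by simp
qed

lemma distr_lborel_orthogonal:
  fixes f :: "R3 \<Rightarrow> R3"
  assumes f: "orthogonal_transformation f"
  shows "distr lborel borel f = lborel"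
proof (rule lborel_eqI[symmetric])
  have lin: "linear f" using f by (rule orthogonal_transformation_linear)
  then have [measurable]: "f \<in> borel_measurable borel"
    by (intro borel_measurable_continuous_onI linear_continuous_on) (simp add: linear_conv_bounded_linear)
  obtain g where g: "orthogonal_transformation g" "g \<circ> f = id" "f \<circ> g = id"
    using orthogonal_transformation_bij[OF f] orthogonal_transformation_inv[OF f]
    by (metis bij_is_inj bij_is_surj inv_o_cancel surj_iff)
  fix l u :: R3
  assume le: "\<And>b. b \<in> Basis \<Longrightarrow> l \<bullet> b \<le> u \<bullet> b"
  have eq: "f -` box l u = g ` box l u"
    using g(2,3) by (auto simp: image_iff o_def id_def fun_eq_iff) metis
  have "emeasure (distr lborel borel f) (box l u) = emeasure lborel (f -` box l u)"
    by (simp add: emeasure_distr)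
  also have "\<dots> = emeasure lebesgue (g ` box l u)"
    unfolding eq[symmetric] using measurable_sets_borel[of f borel "box l u"] by simp
  also have "\<dots> = ennreal (measure lebesgue (g ` box l u))"
    using measurable_orthogonal_image[OF g(1) lmeasurable_box, of l u]
    by (rule emeasure_eq_measure2)
  also have "\<dots> = ennreal (measure lebesgue (box l u))"
    by (subst measure_orthogonal_image[OF g(1)]) auto
  also have "\<dots> = emeasure lebesgue (box l u)"
    by (rule emeasure_eq_measure2[symmetric]) simp
  also have "\<dots> = (\<Prod>b\<in>Basis. (u - l) \<bullet> b)"
    using le by simp
  finally show "emeasure (distr lborel borel f) (box l u) = (\<Prod>b\<in>Basis. (u - l) \<bullet> b)" .
qed simp

lemma integrable_from_nn_integral_le:
  fixes f :: "'a \<Rightarrow> real"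
  assumes [measurable]: "f \<in> borel_measurable M" and f: "AE x in M. 0 \<le> f x"
    and le: "(\<integral>\<^sup>+x. ennreal (f x) \<partial>M) \<le> ennreal c" and c: "0 \<le> c"
  shows "integrable M f" and "(LINT x|M. f x) \<le> c"
proof -
  have "(\<integral>\<^sup>+x. ennreal (f x) \<partial>M) < \<infinity>" using le by (auto simp: less_top[symmetric] top_unique)
  then show int: "integrable M f" using f by (intro integrableI_nonneg) auto
  have "ennreal (LINT x|M. f x) = (\<integral>\<^sup>+x. ennreal (f x) \<partial>M)"
    by (rule nn_integral_eq_integral[symmetric, OF int f])
  with le have "ennreal (LINT x|M. f x) \<le> ennreal c" by simp
  then show "(LINT x|M. f x) \<le> c" using c by (simp add: ennreal_le_iff)
qed

lemmas integrable_dominated = Bochner_Integration.integrable_bound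

lemma integrable_majorant:
  fixes f :: "'a \<Rightarrow> 'b :: {banach, second_countable_topology}"
  assumes "integrable M g" "f \<in> borel_measurable M" "\<And>x. norm (f x) \<le> g x"
  shows "integrable M f"
  by (rule integrable_dominated[OF assms(1,2)]) (auto intro!: AE_I2 order_trans[OF assms(3)])

lemma integrable_majorant_nonneg:
  fixes f :: "'a \<Rightarrow> real"
  assumes "integrable M g" "f \<in> borel_measurable M" "\<And>x. 0 \<le> f x" "\<And>x. f x \<le> g x"
  shows "integrable M f"
  by (rule integrable_majorant[OF assms(1,2)]) (use assms(3,4) in simp)

section \<open>Integrals of powers\<close>

lemma emeasure_lborel_ball3:
  "r \<ge> 0 \<Longrightarrow> emeasure lborel (ball (c :: R3) r) = ennreal (unit_ball_vol 3 * r ^ 3)"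
  by (simp add: emeasure_ball)

text \<open>
  On each dyadic shell the power is constant up to a factor, so the integral is a geometric series
  with ratio \<open>t\<close> to the power \<open>3 + c\<close>: the shells grow for \<open>t = 2\<close> and shrink for \<open>t = 1/2\<close>.
\<close>

lemma integral_power_dyadic_shells:
  fixes S :: "real \<Rightarrow> R3 set"
  assumes t: "t > 0" and q: "t powr (3 + c) < 1" and [measurable]: "\<And>r. S r \<in> sets borel"
    and S: "\<And>r w. r > 0 \<Longrightarrow> w \<in> S r \<Longrightarrow> w \<noteq> 0 \<Longrightarrow> \<exists>j. t ^ j * r / 2 \<le> norm w \<and> norm w \<le> 2 * (t ^ j * r)"
  shows "\<exists>C>0. \<forall>r>0. integrable lborel (\<lambda>w. indicator (S r) w * norm w powr c)
    \<and> (LINT w|lborel. indicator (S r) w * norm w powr c) \<le> C * r powr (3 + c)"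
proof -
  define V where "V = unit_ball_vol 3"
  have V: "V > 0" unfolding V_def by simp
  let ?q = "t powr (3 + c)"
  define D where "D = 27 * V * 2 powr \<bar>c\<bar>"
  have D: "D > 0" using V by (simp add: D_def)
  have tj: "(t ^ j) powr x = (t powr x) ^ j" for j x using t by (induction j) (auto simp: powr_mult)
  show ?thesis
  proof (intro exI[of _ "D / (1 - ?q)"] conjI allI impI)
    show "D / (1 - ?q) > 0" using D q by simp
    fix r :: real assume r: "r > 0"
    define \<rho> where "\<rho> j = t ^ j * r" for j
    have \<rho>: "\<rho> j > 0" for j using t r by (simp add: \<rho>_def)
    define g where "g = (\<lambda>j w. ennreal (2 powr \<bar>c\<bar> * \<rho> j powr c) * indicator (ball (0 :: R3) (3 * \<rho> j)) w)"
    have gm: "g j \<in> borel_measurable lborel" for j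
      unfolding g_def by (intro borel_measurable_times_ennreal borel_measurable_const borel_measurable_indicator) simp
    have pt: "ennreal (indicator (S r) w * norm w powr c) \<le> (\<Sum>j. g j w)" for w
    proof (cases "w \<in> S r \<and> w \<noteq> 0")
      case True
      then obtain j where j: "\<rho> j / 2 \<le> norm w" "norm w \<le> 2 * \<rho> j" using S[OF r] unfolding \<rho>_def by blast
      have "norm w powr c \<le> 2 powr \<bar>c\<bar> * \<rho> j powr c"
      proof (cases "c \<ge> 0")
        case True
        then have "norm w powr c \<le> (2 * \<rho> j) powr c" using j(2) by (intro powr_mono2) auto
        then show ?thesis using True \<rho>[of j] by (simp add: powr_mult)
      next
        case False
        then have "norm w powr c \<le> (\<rho> j / 2) powr c" using j(1) \<rho>[of j] by (intro powr_mono2') auto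
        then show ?thesis using False \<rho>[of j] by (simp add: powr_divide powr_minus_divide)
      qed
      then have "ennreal (indicator (S r) w * norm w powr c) \<le> g j w"
        using True j(2) \<rho>[of j] by (auto simp: g_def intro!: ennreal_leI)
      also have "\<dots> \<le> (\<Sum>j. g j w)" using sum_le_suminf[of "\<lambda>j. g j w" "{j}"] by simp
      finally show ?thesis .
    qed auto
    have "(\<integral>\<^sup>+w. ennreal (indicator (S r) w * norm w powr c) \<partial>lborel) \<le> (\<integral>\<^sup>+w. (\<Sum>j. g j w) \<partial>lborel)"
      by (intro nn_integral_mono pt)
    also have "\<dots> = (\<Sum>j. \<integral>\<^sup>+w. g j w \<partial>lborel)"
      by (rule nn_integral_suminf) (rule gm)
    also have "\<dots> = (\<Sum>j. ennreal (D * r powr (3 + c) * ?q ^ j))"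
    proof (intro suminf_cong)
      fix j
      have "(\<integral>\<^sup>+w. g j w \<partial>lborel) = ennreal (2 powr \<bar>c\<bar> * \<rho> j powr c * (V * (3 * \<rho> j) ^ 3))"
        using \<rho>[of j] V by (simp add: g_def nn_integral_cmult_indicator emeasure_lborel_ball3 V_def ennreal_mult[symmetric])
      also have "2 powr \<bar>c\<bar> * \<rho> j powr c * (V * (3 * \<rho> j) ^ 3) = D * (\<rho> j powr 3 * \<rho> j powr c)"
        using \<rho>[of j] by (simp add: D_def power_mult_distrib powr_numeral)
      also have "\<rho> j powr 3 * \<rho> j powr c = \<rho> j powr (3 + c)" by (rule powr_add[symmetric])
      also have "\<dots> = r powr (3 + c) * ?q ^ j" using r t by (simp add: \<rho>_def powr_mult tj)
      finally show "(\<integral>\<^sup>+w. g j w \<partial>lborel) = ennreal (D * r powr (3 + c) * ?q ^ j)" by (simp add: mult.assoc)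
    qed
    also have "\<dots> = ennreal (D * r powr (3 + c) * (1 / (1 - ?q)))"
      using D q by (intro suminf_ennreal_eq sums_mult geometric_sums) auto
    also have "D * r powr (3 + c) * (1 / (1 - ?q)) = D / (1 - ?q) * r powr (3 + c)" by simp
    finally have le: "(\<integral>\<^sup>+w. ennreal (indicator (S r) w * norm w powr c) \<partial>lborel) \<le> ennreal (D / (1 - ?q) * r powr (3 + c))" .
    have nn: "0 \<le> D / (1 - ?q) * r powr (3 + c)" using D q by simp
    show "integrable lborel (\<lambda>w. indicator (S r) w * norm w powr c)"
      "(LINT w|lborel. indicator (S r) w * norm w powr c) \<le> D / (1 - ?q) * r powr (3 + c)"
      by (rule integrable_from_nn_integral_le[OF _ _ le nn]; simp)+
  qed
qed

lemma integral_power_outside_ball: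
  assumes b: "b > 3"
  shows "\<exists>C>0. \<forall>r>0. integrable lborel (\<lambda>w :: R3. indicator {w. r \<le> norm w} w * norm w powr (- b))
    \<and> (LINT w|lborel. indicator {w :: R3. r \<le> norm w} w * norm w powr (- b)) \<le> C * r powr (3 - b)"
  unfolding diff_conv_add_uminus
proof (rule integral_power_dyadic_shells)
  fix r and w :: R3 assume r: "r > 0" and "w \<in> {w. r \<le> norm w}"
  then have n: "norm w / r \<ge> 1" by simp
  define j where "j = nat \<lfloor>log 2 (norm w / r)\<rfloor>"
  have jl: "real j \<le> log 2 (norm w / r)" "log 2 (norm w / r) < real (Suc j)"
    unfolding j_def using n zero_le_log_cancel_iff[of 2 "norm w / r"] by linarith+
  have "2 powr real j \<le> norm w / r" using jl(1) n by (simp add: le_log_iff)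
  moreover have "norm w / r < 2 powr real (Suc j)" using jl(2) n by (simp add: log_less_iff)
  ultimately show "\<exists>j. 2 ^ j * r / 2 \<le> norm w \<and> norm w \<le> 2 * (2 ^ j * r)"
    using r by (intro exI[of _ j]) (simp add: powr_realpow field_simps powr_add)
qed (use b in \<open>auto simp: powr_less_one\<close>)

lemma integral_power_inside_ball:
  assumes a: "a < 3"
  shows "\<exists>C>0. \<forall>r>0. integrable lborel (\<lambda>w :: R3. indicator {w. norm w < r} w * norm w powr (- a))
    \<and> (LINT w|lborel. indicator {w :: R3. norm w < r} w * norm w powr (- a)) \<le> C * r powr (3 - a)"
  unfolding diff_conv_add_uminus
proof (rule integral_power_dyadic_shells)
  fix r and w :: R3 assume r: "r > 0" and "w \<in> {w. norm w < r}" "w \<noteq> 0"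
  then have n: "r / norm w > 1" and w: "norm w > 0" by auto
  define j where "j = nat \<lfloor>log 2 (r / norm w)\<rfloor>"
  have jl: "real j \<le> log 2 (r / norm w)" "log 2 (r / norm w) < real (Suc j)"
    unfolding j_def using n zero_less_log_cancel_iff[of 2 "r / norm w"] by linarith+
  have "2 powr real j \<le> r / norm w" using jl(1) n by (simp add: le_log_iff)
  moreover have "r / norm w < 2 powr real (Suc j)" using jl(2) n by (simp add: log_less_iff)
  ultimately show "\<exists>j. (1 / 2) ^ j * r / 2 \<le> norm w \<and> norm w \<le> 2 * ((1 / 2) ^ j * r)"
    using w r by (intro exI[of _ j]) (simp add: powr_realpow field_simps powr_add)
next
  show "(1 / 2) powr (3 + - a) < 1" using a powr_less_mono2[of "3 - a" "1 / 2" 1] by simp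
qed auto

section \<open>Completeness and representatives\<close>

lemma lebesgue_borel_representative:
  fixes u :: "R3 \<Rightarrow> 'b :: euclidean_space"
  assumes u: "u \<in> borel_measurable lebesgue"
  shows "\<exists>v \<in> borel_measurable borel. AE x in lborel. u x = v x"
proof -
  have "\<exists>v \<in> borel_measurable lborel. AE x in lborel. u x \<bullet> b = v x" for b
    by (rule completion_ex_borel_measurable_real[OF borel_measurable_inner[OF u borel_measurable_const]])
  then have "\<forall>b. \<exists>v. v \<in> borel_measurable lborel \<and> (AE x in lborel. u x \<bullet> b = v x)" by blast
  from choice[OF this] obtain v where v: "\<And>b. v b \<in> borel_measurable lborel"
      "\<And>b. AE x in lborel. u x \<bullet> b = v b x"
    by blast
  have "AE x in lborel. \<forall>b\<in>Basis. u x \<bullet> b = v b x" using v(2) by (intro AE_finite_allI) auto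
  then have "AE x in lborel. u x = (\<Sum>b\<in>Basis. v b x *\<^sub>R b)"
  proof eventually_elim
    case (elim x)
    then have "(\<Sum>b\<in>Basis. v b x *\<^sub>R b) = (\<Sum>b\<in>Basis. (u x \<bullet> b) *\<^sub>R b)" by simp
    then show ?case by (simp add: euclidean_representation)
  qed
  moreover have "(\<lambda>x. \<Sum>b\<in>Basis. v b x *\<^sub>R b) \<in> borel_measurable borel" using v(1) by simp
  ultimately show ?thesis by (rule bexI)
qed

text \<open>
  A rapidly converging subsequence converges almost everywhere by the Borel-Cantelli lemma, and
  Fatou's lemma carries the Cauchy estimates over to its limit.
\<close>

lemma L2_complete:
  fixes f :: "nat \<Rightarrow> 'a \<Rightarrow> 'b :: euclidean_space"
  assumes [measurable]: "\<And>n. f n \<in> borel_measurable M"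
    and Cau: "\<And>e. e > 0 \<Longrightarrow> \<exists>N. \<forall>m\<ge>N. \<forall>n\<ge>N. (\<integral>\<^sup>+x. ennreal (norm (f m x - f n x) ^ 2) \<partial>M) \<le> ennreal e"
  obtains g r where "g \<in> borel_measurable M" "strict_mono r" "AE x in M. (\<lambda>k. f (r k) x) \<longlonglongrightarrow> g x"
    "\<And>e. e > 0 \<Longrightarrow> \<exists>N. \<forall>n\<ge>N. (\<integral>\<^sup>+x. ennreal (norm (f n x - g x) ^ 2) \<partial>M) \<le> ennreal e"
proof -
  have "\<exists>N. \<forall>k. \<forall>m\<ge>N k. \<forall>n\<ge>N k. (\<integral>\<^sup>+x. ennreal (norm (f m x - f n x) ^ 2) \<partial>M) \<le> ennreal ((1/8) ^ k)"
    if "\<And>k. \<exists>N. \<forall>m\<ge>N. \<forall>n\<ge>N. (\<integral>\<^sup>+x. ennreal (norm (f m x - f n x) ^ 2) \<partial>M) \<le> ennreal ((1/8) ^ k)"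
    using that by (rule choice[OF allI])
  moreover have "\<exists>N. \<forall>m\<ge>N. \<forall>n\<ge>N. (\<integral>\<^sup>+x. ennreal (norm (f m x - f n x) ^ 2) \<partial>M) \<le> ennreal ((1/8) ^ k)" for k
    by (rule Cau) simp
  ultimately obtain N where N: "\<And>k m n. m \<ge> N k \<Longrightarrow> n \<ge> N k \<Longrightarrow>
      (\<integral>\<^sup>+x. ennreal (norm (f m x - f n x) ^ 2) \<partial>M) \<le> ennreal ((1/8) ^ k)"
    by blast
  define r where "r = rec_nat (N 0) (\<lambda>k rk. max (Suc rk) (N (Suc k)))"
  have r0: "r 0 = N 0" and rS: "r (Suc k) = max (Suc (r k)) (N (Suc k))" for k by (auto simp: r_def)
  have sm: "strict_mono r" by (rule strict_mono_Suc_iff[THEN iffD2]) (auto simp: rS)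
  have rN: "r k \<ge> N k" for k by (cases k) (auto simp: r0 rS)
  \<comment> \<open>By Chebyshev, steps of square integral at most \<open>1/8\<^sup>k\<close> exceed \<open>1/2\<^sup>k\<close> only on a set of measure \<open>1/2\<^sup>k\<close>.\<close>
  define A where "A k = {x \<in> space M. (1/2) ^ k < norm (f (r (Suc k)) x - f (r k) x)}" for k
  have Am[measurable]: "A k \<in> sets M" for k unfolding A_def by measurable
  have emA: "emeasure M (A k) \<le> ennreal ((1/2) ^ k)" for k
  proof -
    have "ennreal ((1/4) ^ k) * emeasure M (A k) = (\<integral>\<^sup>+x. ennreal ((1/4) ^ k) * indicator (A k) x \<partial>M)"
      by (simp add: nn_integral_cmult_indicator)
    also have "\<dots> \<le> (\<integral>\<^sup>+x. ennreal (norm (f (r (Suc k)) x - f (r k) x) ^ 2) \<partial>M)"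
    proof (intro nn_integral_mono)
      fix x
      have "(1/4) ^ k \<le> norm (f (r (Suc k)) x - f (r k) x) ^ 2" if "x \<in> A k"
      proof -
        have "(1/4 :: real) ^ k = ((1/2) ^ k) ^ 2" by (simp add: power2_eq_square power_mult_distrib[symmetric])
        also have "\<dots> \<le> norm (f (r (Suc k)) x - f (r k) x) ^ 2" using that by (intro power_mono) (auto simp: A_def)
        finally show ?thesis .
      qed
      then show "ennreal ((1/4) ^ k) * indicator (A k) x \<le> ennreal (norm (f (r (Suc k)) x - f (r k) x) ^ 2)"
        by (auto simp: indicator_def intro: ennreal_leI)
    qed
    also have "\<dots> \<le> ennreal ((1/8) ^ k)"
      using rN[of k] by (intro N) (auto simp: rS)
    finally have "ennreal (4 ^ k) * (ennreal ((1/4) ^ k) * emeasure M (A k)) \<le> ennreal (4 ^ k) * ennreal ((1/8) ^ k)"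
      by (intro mult_left_mono) auto
    then show ?thesis
      by (simp add: mult.assoc[symmetric] ennreal_mult[symmetric] power_mult_distrib[symmetric])
  qed
  have "AE x in M. eventually (\<lambda>n. x \<in> space M - A n) sequentially"
  proof (rule borel_cantelli_AE1[OF Am])
    show "emeasure M (A n) < \<infinity>" for n
      using emA[of n] by (auto simp: less_top[symmetric] top_unique)
    have "measure M (A n) \<le> (1/2) ^ n" for n
      unfolding measure_def using emA[of n] by (intro enn2real_leI) auto
    then show "summable (\<lambda>n. measure M (A n))"
      by (intro summable_comparison_test'[OF summable_geometric[of "1/2 :: real"], of 0]) auto
  qed
  then have conv: "AE x in M. convergent (\<lambda>k. f (r k) x)"
  proof (eventually_elim)
    case (elim x)
    then have "eventually (\<lambda>k. norm (f (r (Suc k)) x - f (r k) x) \<le> (1/2) ^ k) sequentially"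
      by eventually_elim (auto simp: A_def)
    then have "summable (\<lambda>k. f (r (Suc k)) x - f (r k) x)"
      by (intro summable_comparison_test_ev[OF _ summable_geometric[of "1/2 :: real"]]) auto
    then have "convergent (\<lambda>n. \<Sum>k<n. f (r (Suc k)) x - f (r k) x)" by (simp add: summable_iff_convergent)
    then have "convergent (\<lambda>n. f (r n) x - f (r 0) x)"
      unfolding sum_lessThan_telescope[of "\<lambda>k. f (r k) x"] .
    then have "convergent (\<lambda>n. (f (r n) x - f (r 0) x) + f (r 0) x)" by (intro convergent_add convergent_const)
    then show ?case by simp
  qed
  define g where "g x = lim (\<lambda>k. f (r k) x)" for x
  have gm[measurable]: "g \<in> borel_measurable M" unfolding g_def by measurable
  have lim: "AE x in M. (\<lambda>k. f (r k) x) \<longlonglongrightarrow> g x"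
    using conv by eventually_elim (simp add: g_def convergent_LIMSEQ_iff)
  have "\<exists>N. \<forall>n\<ge>N. (\<integral>\<^sup>+x. ennreal (norm (f n x - g x) ^ 2) \<partial>M) \<le> ennreal e" if e: "e > 0" for e
  proof -
    obtain N' where N': "\<And>m n. m \<ge> N' \<Longrightarrow> n \<ge> N' \<Longrightarrow> (\<integral>\<^sup>+x. ennreal (norm (f m x - f n x) ^ 2) \<partial>M) \<le> ennreal e"
      using Cau[OF e] by blast
    show ?thesis
    proof (intro exI[of _ N'] allI impI)
      fix n assume n: "n \<ge> N'"
      have "(\<integral>\<^sup>+x. ennreal (norm (f n x - g x) ^ 2) \<partial>M)
          = (\<integral>\<^sup>+x. liminf (\<lambda>k. ennreal (norm (f n x - f (r k) x) ^ 2)) \<partial>M)"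
      proof (rule nn_integral_cong_AE, use lim in eventually_elim)
        case (elim x)
        then have "(\<lambda>k. ennreal (norm (f n x - f (r k) x) ^ 2)) \<longlonglongrightarrow> ennreal (norm (f n x - g x) ^ 2)"
          by (intro tendsto_ennrealI tendsto_intros)
        then show ?case by (intro lim_imp_Liminf[symmetric]) auto
      qed
      also have "\<dots> \<le> liminf (\<lambda>k. \<integral>\<^sup>+x. ennreal (norm (f n x - f (r k) x) ^ 2) \<partial>M)"
        by (intro nn_integral_liminf) measurable
      also have "\<dots> \<le> ennreal e"
      proof (rule Liminf_le)
        have "\<forall>k\<ge>N'. r k \<ge> N'" using seq_suble[OF sm] order_trans by blast
        then show "\<forall>\<^sub>F k in sequentially. (\<integral>\<^sup>+x. ennreal (norm (f n x - f (r k) x) ^ 2) \<partial>M) \<le> ennreal e"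
          unfolding eventually_sequentially using N' n by blast
      qed simp
      finally show "(\<integral>\<^sup>+x. ennreal (norm (f n x - g x) ^ 2) \<partial>M) \<le> ennreal e" .
    qed
  qed
  then show ?thesis using that[OF gm sm lim] by blast
qed

section \<open>Averages of differences\<close>

definition sq_modulus :: "(R3 \<Rightarrow> 'k :: euclidean_space) \<Rightarrow> R3 \<Rightarrow> real" where
  "sq_modulus u z = (LINT x|lborel. norm (u x - u (x - z)) ^ 2)"

definition diff_avg :: "(R3 \<Rightarrow> real) \<Rightarrow> (R3 \<Rightarrow> 'k :: euclidean_space) \<Rightarrow> R3 \<Rightarrow> 'k" where
  "diff_avg k u x = (LINT z|lborel. k z *\<^sub>R (u x - u (x - z)))"

lemma norm_diff_square_le:
  fixes a b :: "'b :: real_normed_vector"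
  shows "norm (a - b) ^ 2 \<le> 2 * norm a ^ 2 + 2 * norm b ^ 2"
proof -
  have "norm (a - b) ^ 2 \<le> (norm a + norm b) ^ 2"
    by (intro power_mono norm_triangle_ineq4) auto
  also have "\<dots> \<le> 2 * norm a ^ 2 + 2 * norm b ^ 2"
    using zero_le_power2[of "norm a - norm b"] by (simp add: power2_eq_square algebra_simps)
  finally show ?thesis .
qed

lemma sq_modulus_props:
  fixes u :: "R3 \<Rightarrow> 'k :: euclidean_space"
  assumes um[measurable]: "u \<in> borel_measurable borel" and u2: "integrable lborel (\<lambda>x. norm (u x) ^ 2)"
  shows "integrable lborel (\<lambda>x. norm (u x - u (x - z)) ^ 2)"
    and "0 \<le> sq_modulus u z"
    and "sq_modulus u z \<le> 4 * (LINT x|lborel. norm (u x) ^ 2)"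
    and "sq_modulus u \<in> borel_measurable borel"
    and "(\<integral>\<^sup>+x. ennreal (norm (u x - u (x - z)) ^ 2) \<partial>lborel) = ennreal (sq_modulus u z)"
proof -
  have sh: "integrable lborel (\<lambda>x. norm (u (x - z)) ^ 2)"
    using integral_lborel_shift(8)[of "\<lambda>x. norm (u x) ^ 2" z] u2 by simp
  have shi: "(LINT x|lborel. norm (u (x - z)) ^ 2) = (LINT x|lborel. norm (u x) ^ 2)"
    using integral_lborel_shift(3)[of "\<lambda>x. norm (u x) ^ 2" z] by simp
  have maj: "integrable lborel (\<lambda>x. 2 * norm (u x) ^ 2 + 2 * norm (u (x - z)) ^ 2)"
    using u2 sh by simp
  show int: "integrable lborel (\<lambda>x. norm (u x - u (x - z)) ^ 2)"
    by (rule integrable_dominated[OF maj]) (auto intro!: AE_I2 norm_diff_square_le)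
  show "0 \<le> sq_modulus u z" unfolding sq_modulus_def by simp
  have "sq_modulus u z \<le> (LINT x|lborel. 2 * norm (u x) ^ 2 + 2 * norm (u (x - z)) ^ 2)"
    unfolding sq_modulus_def by (intro integral_mono int maj norm_diff_square_le)
  also have "\<dots> = 4 * (LINT x|lborel. norm (u x) ^ 2)"
    using u2 sh shi by simp
  finally show "sq_modulus u z \<le> 4 * (LINT x|lborel. norm (u x) ^ 2)" .
  show "sq_modulus u \<in> borel_measurable borel" unfolding sq_modulus_def by measurable
  show "(\<integral>\<^sup>+x. ennreal (norm (u x - u (x - z)) ^ 2) \<partial>lborel) = ennreal (sq_modulus u z)"
    unfolding sq_modulus_def by (rule nn_integral_eq_integral[OF int]) simp
qed

lemma integrable_lborel_product:
  fixes f g :: "R3 \<Rightarrow> real"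
  assumes f: "integrable lborel f" and g: "integrable lborel g"
  shows "integrable lborel2 (\<lambda>p. f (fst p) * g (snd p))"
proof -
  have [measurable]: "f \<in> borel_measurable borel" "g \<in> borel_measurable borel"
    using f g by (auto dest: borel_measurable_integrable)
  have "integrable lborel2 (\<lambda>(x, y). f x * g y)"
    by (rule lborel_pair.Fubini_integrable) (use f g in \<open>auto simp: norm_mult abs_mult\<close>)
  then show ?thesis by (simp add: case_prod_beta')
qed

lemma integral_inner_integral:
  fixes a :: "R3 \<Rightarrow> 'k :: euclidean_space"
  assumes a: "integrable lborel a"
  shows "(LINT p|lborel2. a (fst p) \<bullet> a (snd p)) = norm (LINT z|lborel. a z) ^ 2"
    and "integrable lborel2 (\<lambda>p. a (fst p) \<bullet> a (snd p))"
proof -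
  have [measurable]: "a \<in> borel_measurable borel" using a by (auto dest: borel_measurable_integrable)
  have n: "integrable lborel (\<lambda>z. norm (a z))" using a by simp
  have maj: "integrable lborel2 (\<lambda>p. norm (a (fst p)) * norm (a (snd p)))"
    by (rule integrable_lborel_product[OF n n])
  show int: "integrable lborel2 (\<lambda>p. a (fst p) \<bullet> a (snd p))"
    by (rule integrable_dominated[OF maj]) (auto intro!: AE_I2 simp: Cauchy_Schwarz_ineq2 abs_mult)
  have "(LINT p|lborel2. a (fst p) \<bullet> a (snd p)) = (LINT x|lborel. LINT y|lborel. a x \<bullet> a y)"
    using lborel_pair.integral_fst'[OF int] by simp
  also have "\<dots> = (LINT x|lborel. a x \<bullet> (LINT y|lborel. a y))"
    by (simp add: integral_inner_right[OF a])
  also have "\<dots> = (LINT x|lborel. a x) \<bullet> (LINT y|lborel. a y)"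
    by (simp add: integral_inner_left[OF a])
  finally show "(LINT p|lborel2. a (fst p) \<bullet> a (snd p)) = norm (LINT z|lborel. a z) ^ 2"
    by (simp add: power2_norm_eq_inner)
qed

lemma inner_differences:
  fixes a b c :: "'k :: real_inner"
  shows "(a - b) \<bullet> (a - c) = (norm (a - b) ^ 2 + norm (a - c) ^ 2 - norm (b - c) ^ 2) / 2"
  by (simp add: power2_norm_eq_inner inner_diff_left inner_diff_right inner_commute algebra_simps)

text \<open>
  The square of \<^const>\<open>diff_avg\<close> is a double integral of inner products of differences, and
  polarisation rewrites each of them by three values of the squared modulus of continuity. This
  replaces Plancherel's theorem: it turns the \<open>L\<^sup>2\<close> norm of a convolution operator into an
  integral of \<^const>\<open>sq_modulus\<close> against an explicit kernel.
\<close>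

lemma norm_diff_avg_square:
  fixes u :: "R3 \<Rightarrow> 'k :: euclidean_space"
  assumes um[measurable]: "u \<in> borel_measurable borel" and u2: "integrable lborel (\<lambda>x. norm (u x) ^ 2)"
    and k: "integrable lborel k" and keven: "\<And>z. k (- z) = k z"
  defines "m \<equiv> \<lambda>z. 2 * (LINT w|lborel. k w) * k z - (LINT w|lborel. k w * k (z - w))"
  shows "integrable lborel (\<lambda>x. norm (diff_avg k u x) ^ 2)"
    and "integrable lborel (\<lambda>z. sq_modulus u z * m z)"
    and "(LINT x|lborel. norm (diff_avg k u x) ^ 2) = (LINT z|lborel. sq_modulus u z * m z) / 2"
    and "AE x in lborel. integrable lborel (\<lambda>z. k z *\<^sub>R (u x - u (x - z)))"
proof -
  let ?G = "sq_modulus u" and ?k = "\<lambda>p. k (fst p) * k (snd p)"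
  note G = sq_modulus_props[OF um u2]
  have km[measurable]: "k \<in> borel_measurable borel" using k by (auto dest: borel_measurable_integrable)
  have Gm[measurable]: "?G \<in> borel_measurable borel" by (rule G)
  define N where "N = 4 * (LINT x|lborel. norm (u x) ^ 2)"
  define a where "a x z = k z *\<^sub>R (u x - u (x - z))" for x z
  define F where "F = (\<lambda>(x, p). a x (fst p) \<bullet> a x (snd p))"
  interpret P2: sigma_finite_measure "lborel2 :: (R3 \<times> R3) measure"
    by unfold_locales
  interpret PP: pair_sigma_finite "lborel :: R3 measure" "lborel2 :: (R3 \<times> R3) measure"
    by unfold_locales
  have Fm[measurable]: "F \<in> borel_measurable (lborel \<Otimes>\<^sub>M lborel2)"
    unfolding F_def a_def by measurable
  have kk: "integrable lborel2 (\<lambda>p. ?k p)"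
    by (rule integrable_lborel_product[OF k k])
  have kka: "integrable lborel2 (\<lambda>p. \<bar>?k p\<bar>)"
    using kk by simp
  \<comment> \<open>The inner integral over \<open>x\<close> for fixed shifts.\<close>
  have Fx: "integrable lborel (\<lambda>x. F (x, p))"
    "(LINT x|lborel. F (x, p)) = ?k p *
       ((?G (fst p) + ?G (snd p) - ?G (snd p - fst p)) / 2)"
    "(LINT x|lborel. norm (F (x, p))) \<le> \<bar>?k p\<bar> * N" for p
  proof -
    obtain z w where p: "p = (z, w)" by (cases p)
    have int3: "integrable lborel (\<lambda>x. norm (u (x - z) - u (x - w)) ^ 2)"
      and eq3: "(LINT x|lborel. norm (u (x - z) - u (x - w)) ^ 2) = ?G (w - z)"
      using integral_lborel_shift(8)[of "\<lambda>x. norm (u x - u (x - (w - z))) ^ 2" z]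
        integral_lborel_shift(3)[of "\<lambda>x. norm (u x - u (x - (w - z))) ^ 2" z] G(1)[of "w - z"]
      by (auto simp: sq_modulus_def)
    have Feq: "F (x, p) = k z * k w * ((norm (u x - u (x - z)) ^ 2 + norm (u x - u (x - w)) ^ 2
        - norm (u (x - z) - u (x - w)) ^ 2) / 2)" for x
      by (simp add: F_def a_def p inner_differences)
    show "integrable lborel (\<lambda>x. F (x, p))" unfolding Feq using G(1)[of z] G(1)[of w] int3 by simp
    show "(LINT x|lborel. F (x, p)) = ?k p *
       ((?G (fst p) + ?G (snd p) - ?G (snd p - fst p)) / 2)"
      unfolding Feq using G(1)[of z] G(1)[of w] int3 eq3 by (simp add: p sq_modulus_def)
    have le: "norm (F (x, p)) \<le> \<bar>k z * k w\<bar> * ((norm (u x - u (x - z)) ^ 2 + norm (u x - u (x - w)) ^ 2) / 2)" for x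
    proof -
      have "\<bar>(u x - u (x - z)) \<bullet> (u x - u (x - w))\<bar> \<le> norm (u x - u (x - z)) * norm (u x - u (x - w))"
        by (rule Cauchy_Schwarz_ineq2)
      also have "\<dots> \<le> (norm (u x - u (x - z)) ^ 2 + norm (u x - u (x - w)) ^ 2) / 2"
        using sum_squares_bound[of "norm (u x - u (x - z))" "norm (u x - u (x - w))"] by simp
      finally have "\<bar>k z * k w\<bar> * \<bar>(u x - u (x - z)) \<bullet> (u x - u (x - w))\<bar>
          \<le> \<bar>k z * k w\<bar> * ((norm (u x - u (x - z)) ^ 2 + norm (u x - u (x - w)) ^ 2) / 2)"
        by (rule mult_left_mono) simp
      then show ?thesis by (simp add: F_def a_def p abs_mult mult_ac)
    qed
    have "(LINT x|lborel. norm (F (x, p))) \<le>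
        (LINT x|lborel. \<bar>k z * k w\<bar> * ((norm (u x - u (x - z)) ^ 2 + norm (u x - u (x - w)) ^ 2) / 2))"
      using \<open>integrable lborel (\<lambda>x. F (x, p))\<close> G(1)[of z] G(1)[of w] le by (intro integral_mono) auto
    also have "\<dots> = \<bar>k z * k w\<bar> * ((?G z + ?G w) / 2)"
      using G(1)[of z] G(1)[of w] by (simp add: sq_modulus_def)
    also have "\<dots> \<le> \<bar>k z * k w\<bar> * N"
      using G(3)[of z] G(3)[of w] by (intro mult_left_mono) (auto simp: N_def)
    finally show "(LINT x|lborel. norm (F (x, p))) \<le> \<bar>?k p\<bar> * N" by (simp add: p)
  qed
  have Fint: "integrable (lborel \<Otimes>\<^sub>M lborel2) F"
  proof -
    have "integrable (lborel2 \<Otimes>\<^sub>M lborel) (\<lambda>(p, x). F (x, p))"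
    proof (rule pair_sigma_finite.Fubini_integrable)
      show "pair_sigma_finite (lborel2 :: (R3 \<times> R3) measure) (lborel :: R3 measure)"
        by unfold_locales
      have "integrable lborel2 (\<lambda>p. \<bar>?k p\<bar> * N)" using kka by simp
      then show "integrable lborel2 (\<lambda>p. LINT x|lborel. norm (case (p, x) of (p, x) \<Rightarrow> F (x, p)))"
      proof (rule integrable_dominated, goal_cases)
        case 2
        have "norm (LINT x|lborel. norm (F (x, p))) \<le> norm (\<bar>?k p\<bar> * N)" for p
          using Fx(3)[of p] by simp
        then show ?case by (intro AE_I2) simp
      qed measurable
      show "AE p in lborel2. integrable lborel (\<lambda>x. case (p, x) of (p, x) \<Rightarrow> F (x, p))"
        using Fx(1) by simp
    qed measurable
    then show ?thesis by (subst PP.integrable_product_swap_iff[symmetric]) (simp add: case_prod_beta')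
  qed
  have kx: "AE x in lborel. integrable lborel (a x)"
  proof -
    have "integrable lborel2 (\<lambda>(z, x). norm (k z) * norm (u x - u (x - z)) ^ 2)"
    proof (rule lborel_pair.Fubini_integrable)
      have "integrable lborel (\<lambda>z. \<bar>k z\<bar> * N)" using k by simp
      then show "integrable lborel (\<lambda>z. LINT x|lborel. norm (case (z, x) of (z, x) \<Rightarrow> norm (k z) * norm (u x - u (x - z)) ^ 2))"
      proof (rule integrable_dominated, goal_cases)
        case 2
        then show ?case
          using G by (auto intro!: AE_I2 mult_left_mono simp: abs_mult N_def sq_modulus_def[symmetric])
      qed measurable
      show "AE z in lborel. integrable lborel (\<lambda>x. case (z, x) of (z, x) \<Rightarrow> norm (k z) * norm (u x - u (x - z)) ^ 2)"
        using G(1) by simp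
    qed measurable
    from lborel_pair.AE_integrable_snd[OF this]
    have "AE x in lborel. integrable lborel (\<lambda>z. norm (k z) * norm (u x - u (x - z)) ^ 2)" by simp
    then show ?thesis
    proof eventually_elim
      case (elim x)
      have "integrable lborel (\<lambda>z. norm (k z) * norm (u x - u (x - z)) ^ 2 + norm (k z))"
        using elim k by simp
      then show ?case
      proof (rule integrable_dominated, goal_cases)
        case 2
        have "t \<le> t ^ 2 + 1" for t :: real using zero_le_power2[of "t - 1/2"] by (simp add: power2_eq_square algebra_simps)
        then have "\<bar>k z\<bar> * norm (u x - u (x - z)) \<le> \<bar>k z\<bar> * (norm (u x - u (x - z)) ^ 2 + 1)" for z
          by (intro mult_left_mono) auto
        moreover have "norm (a x z) = \<bar>k z\<bar> * norm (u x - u (x - z))" for z by (simp add: a_def)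
        moreover have "norm (norm (k z) * norm (u x - u (x - z)) ^ 2 + norm (k z))
            = \<bar>k z\<bar> * (norm (u x - u (x - z)) ^ 2 + 1)" for z
          by (simp add: distrib_left)
        ultimately show ?case by (intro AE_I2) presburger
      qed (simp add: a_def[abs_def])
    qed
  qed
  then show "AE x in lborel. integrable lborel (\<lambda>z. k z *\<^sub>R (u x - u (x - z)))"
    unfolding a_def[abs_def] .
  have sq: "AE x in lborel. (LINT p|lborel2. F (x, p)) = norm (diff_avg k u x) ^ 2"
    using kx
  proof eventually_elim
    case (elim x)
    have "(LINT p|lborel2. F (x, p)) = norm (LINT z|lborel. a x z) ^ 2"
      unfolding F_def using integral_inner_integral(1)[OF elim] by simp
    then show ?case by (simp only: diff_avg_def a_def)
  qed
  have dm: "(\<lambda>x. diff_avg k u x) \<in> borel_measurable borel" unfolding diff_avg_def by measurable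
  have "integrable lborel (\<lambda>x. LINT p|lborel2. F (x, p))"
    using PP.integrable_fst'[OF Fint] .
  then show "integrable lborel (\<lambda>x. norm (diff_avg k u x) ^ 2)"
    by (rule integrable_cong_AE_imp) (use sq dm in auto)
  have i1: "integrable lborel2 (\<lambda>p. ?k p * ?G (fst p))"
    and i2: "integrable lborel2 (\<lambda>p. ?k p * ?G (snd p))"
    and i3: "integrable lborel2 (\<lambda>p. ?k p * ?G (snd p - fst p))"
  proof -
    have maj: "integrable lborel2 (\<lambda>p. \<bar>?k p\<bar> * N)" using kka by simp
    have Gb: "\<bar>?G z\<bar> \<le> N" for z using G(2,3)[of z] by (simp add: N_def)
    have *: "norm (?k p * ?G z) \<le> norm (\<bar>?k p\<bar> * N)" for p z
      using Gb[of z] by (auto simp: abs_mult intro!: mult_left_mono)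
    show "integrable lborel2 (\<lambda>p. ?k p * ?G (fst p))"
      by (rule integrable_dominated[OF maj _ AE_I2[OF *]]) measurable
    show "integrable lborel2 (\<lambda>p. ?k p * ?G (snd p))"
      by (rule integrable_dominated[OF maj _ AE_I2[OF *]]) measurable
    show "integrable lborel2 (\<lambda>p. ?k p * ?G (snd p - fst p))"
      by (rule integrable_dominated[OF maj _ AE_I2[OF *]]) measurable
  qed
  define A where "A = (LINT w|lborel. k w)"
  define I where "I = (LINT z|lborel. k z * ?G z)"
  have e1: "(LINT p|lborel2. ?k p * ?G (fst p)) = A * I"
  proof -
    have "(LINT p|lborel2. ?k p * ?G (fst p))
        = (LINT z|lborel. LINT w|lborel. (k z * ?G z) * k w)"
      using lborel_pair.integral_fst'[OF i1] by (simp add: mult_ac)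
    also have "\<dots> = A * I" by (simp add: A_def I_def mult.commute)
    finally show ?thesis .
  qed
  have e2: "(LINT p|lborel2. ?k p * ?G (snd p)) = A * I"
  proof -
    have "(LINT p|lborel2. ?k p * ?G (snd p))
        = (LINT z|lborel. LINT w|lborel. k z * (k w * ?G w))"
      using lborel_pair.integral_fst'[OF i2] by (simp add: mult_ac)
    also have "\<dots> = A * I" by (simp add: A_def I_def mult.commute)
    finally show ?thesis .
  qed
  define c where "c z = (LINT w|lborel. k w * k (z - w))" for z
  have i4: "integrable lborel2 (\<lambda>(z, y). k z * k (z + y) * ?G y)"
  proof (rule lborel_pair.Fubini_integrable)
    have "AE z in lborel. integrable lborel (\<lambda>w. k z * k w * ?G (w - z))"
      using lborel_pair.AE_integrable_fst'[OF i3] by simp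
    then show "AE z in lborel. integrable lborel (\<lambda>y. case (z, y) of (z, y) \<Rightarrow> k z * k (z + y) * ?G y)"
    proof eventually_elim
      case (elim z)
      then show ?case
        using integral_lborel_shift(6)[of "\<lambda>w. k z * k w * ?G (w - z)" z] by simp
    qed
    have "integrable lborel (\<lambda>z. LINT w|lborel. norm (k z * k w * ?G (w - z)))"
      using lborel_pair.integrable_fst'[OF integrable_norm[OF i3]] by simp
    then show "integrable lborel (\<lambda>z. LINT y|lborel. norm (case (z, y) of (z, y) \<Rightarrow> k z * k (z + y) * ?G y))"
    proof (rule Bochner_Integration.integrable_cong[THEN iffD1, rotated -1, OF _ refl], goal_cases)
      case (1 z)
      show ?case
        using integral_lborel_shift(1)[of "\<lambda>w. norm (k z * k w * ?G (w - z))" z] by simp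
    qed
  qed measurable
  have cz: "(LINT z|lborel. k z * k (z + y) * ?G y) = ?G y * c y" for y
  proof -
    have "(LINT z|lborel. k z * k (z + y) * ?G y) = ?G y * (LINT z|lborel. k z * k (z + y))"
      by (simp add: mult.commute)
    also have "(LINT z|lborel. k z * k (z + y)) = (LINT z|lborel. k (- z) * k (- z + y))"
      by (rule integral_lborel_shift(5)[of "\<lambda>z. k z * k (z + y)", symmetric]) measurable
    also have "\<dots> = c y" by (simp add: keven c_def)
    finally show ?thesis .
  qed
  have e3: "(LINT p|lborel2. ?k p * ?G (snd p - fst p))
      = (LINT y|lborel. ?G y * c y)"
  proof -
    have "(LINT p|lborel2. ?k p * ?G (snd p - fst p))
        = (LINT z|lborel. LINT w|lborel. k z * k w * ?G (w - z))"
      using lborel_pair.integral_fst'[OF i3] by simp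
    also have "\<dots> = (LINT z|lborel. LINT y|lborel. k z * k (z + y) * ?G y)"
    proof (rule Bochner_Integration.integral_cong[OF refl], goal_cases)
      case (1 z)
      show ?case
        using integral_lborel_shift(1)[of "\<lambda>w. k z * k w * ?G (w - z)" z] by simp
    qed
    also have "\<dots> = (LINT y|lborel. LINT z|lborel. k z * k (z + y) * ?G y)"
      by (rule lborel_pair.Fubini_integral[OF i4, symmetric])
    finally show ?thesis unfolding cz .
  qed
  have i5: "integrable lborel (\<lambda>y. ?G y * c y)"
    using lborel_pair.integrable_snd[OF i4] unfolding cz .
  have i6: "integrable lborel (\<lambda>z. k z * ?G z)"
  proof -
    have maj: "integrable lborel (\<lambda>z. \<bar>k z\<bar> * N)" using k by simp
    show ?thesis
      by (rule integrable_dominated[OF maj])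
         (use G in \<open>auto intro!: AE_I2 mult_left_mono simp: abs_mult N_def\<close>)
  qed
  have meq: "?G z * m z = 2 * A * (k z * ?G z) - ?G z * c z" for z
    by (simp add: m_def A_def c_def algebra_simps)
  show "integrable lborel (\<lambda>z. ?G z * m z)" unfolding meq using i5 i6 by simp
  have "(LINT x|lborel. norm (diff_avg k u x) ^ 2) = (LINT x|lborel. LINT p|lborel2. F (x, p))"
    by (rule integral_cong_AE) (use sq dm in auto)
  also have "\<dots> = (LINT p|lborel2. LINT x|lborel. F (x, p))"
    using PP.Fubini_integral[of "\<lambda>x p. F (x, p)"] Fint by simp
  also have "\<dots> = (LINT p|lborel2. (?k p * ?G (fst p)
      + ?k p * ?G (snd p)
      - ?k p * ?G (snd p - fst p)) / 2)"
    unfolding Fx(2) by (rule Bochner_Integration.integral_cong) (auto simp: algebra_simps)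
  also have "\<dots> = (A * I + A * I - (LINT y|lborel. ?G y * c y)) / 2"
    using i1 i2 i3 e1 e2 e3 by simp
  also have "\<dots> = (LINT z|lborel. ?G z * m z) / 2"
    unfolding meq using i5 i6 by (simp add: I_def)
  finally show "(LINT x|lborel. norm (diff_avg k u x) ^ 2) = (LINT z|lborel. ?G z * m z) / 2" .
qed

section \<open>Truncated power kernels and their convolutions\<close>

lemma integral_lborel_scale:
  fixes f :: "'a :: euclidean_space \<Rightarrow> real"
  assumes [measurable]: "f \<in> borel_measurable borel" and c: "c > 0"
  shows "(LINT x|lborel. f x) = c ^ DIM('a) * (LINT x|lborel. f (c *\<^sub>R x))"
proof -
  have eq: "lborel = density (distr lborel borel (\<lambda>x :: 'a. 0 + c *\<^sub>R x)) (\<lambda>_. \<bar>c\<bar> ^ DIM('a))"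
    using c by (intro lborel_affine) auto
  show ?thesis
    using c by (subst eq) (simp add: integral_density integral_distr)
qed

lemma integral_lborel_orthogonal:
  fixes f :: "R3 \<Rightarrow> real" and O' :: "R3 \<Rightarrow> R3"
  assumes [measurable]: "f \<in> borel_measurable borel" and O: "orthogonal_transformation O'"
  shows "(LINT x|lborel. f (O' x)) = (LINT x|lborel. f x)"
proof -
  have lin: "linear O'" using O by (rule orthogonal_transformation_linear)
  then have [measurable]: "O' \<in> borel_measurable borel"
    by (intro borel_measurable_continuous_onI linear_continuous_on) (simp add: linear_conv_bounded_linear)
  show ?thesis
    by (subst (2) distr_lborel_orthogonal[OF O, symmetric]) (simp add: integral_distr)
qed

lemma powr_neg_lipschitz:
  fixes a b c r :: real
  assumes "0 < r" "r \<le> a" "r \<le> b" "0 \<le> c"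
  shows "\<bar>a powr (- c) - b powr (- c)\<bar> \<le> c * r powr (- c - 1) * \<bar>a - b\<bar>"
proof -
  have *: "\<bar>a powr (- c) - b powr (- c)\<bar> \<le> c * r powr (- c - 1) * \<bar>a - b\<bar>" if "r \<le> a" "a < b" for a b
  proof -
    have "\<exists>z. a < z \<and> z < b \<and> b powr (- c) - a powr (- c) = (b - a) * (- c * z powr (- c - 1))"
      using that \<open>0 < r\<close> by (intro MVT2 has_real_derivative_powr) auto
    then obtain z where z: "a < z" "z < b" "b powr (- c) - a powr (- c) = (b - a) * (- c * z powr (- c - 1))"
      by blast
    have "z powr (- c - 1) \<le> r powr (- c - 1)"
      using z that assms by (intro powr_mono2') auto
    then have "(b - a) * (c * z powr (- c - 1)) \<le> (b - a) * (c * r powr (- c - 1))"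
      using that assms by (intro mult_left_mono) auto
    moreover have "0 \<le> (b - a) * (c * z powr (- c - 1))" using that assms by simp
    ultimately show ?thesis using z(3) that by (simp add: mult.commute mult.left_commute)
  qed
  show ?thesis
    using *[of a b] *[of b a] assms by (cases a b rule: linorder_cases) (auto simp: abs_minus_commute)
qed

lemma half_powr: "x \<ge> 0 \<Longrightarrow> (x / 2) powr (- c) = 2 powr c * x powr (- c)" for x c :: real
  by (simp add: powr_divide powr_minus_divide)

text \<open>
  The kernel of the fractional Laplacian of order \<open>s/2\<close>, capped at radius \<open>d\<close> instead of cut off:
  so it stays Lipschitz, and differences of its translates are small.
\<close>

definition trunc_ker :: "real \<Rightarrow> real \<Rightarrow> R3 \<Rightarrow> real" where
  "trunc_ker s d z = max (norm z) d powr (- (3 + s))"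

lemma trunc_ker_measurable[measurable]: "trunc_ker s d \<in> borel_measurable borel"
  unfolding trunc_ker_def[abs_def] by measurable

lemma trunc_ker_even: "trunc_ker s d (- z) = trunc_ker s d z"
  by (simp add: trunc_ker_def)

lemma trunc_ker_nonneg: "0 \<le> trunc_ker s d z"
  by (simp add: trunc_ker_def)

lemma trunc_ker_le:
  assumes "s > 0" "0 < r" "r \<le> norm z"
  shows "trunc_ker s d z \<le> r powr (- (3 + s))"
  unfolding trunc_ker_def using assms by (intro powr_mono2') auto

lemma trunc_ker_le_delta:
  assumes "s > 0" "0 < d"
  shows "trunc_ker s d z \<le> d powr (- (3 + s))"
  unfolding trunc_ker_def using assms by (intro powr_mono2') auto

lemma trunc_ker_eq: "d \<le> norm z \<Longrightarrow> trunc_ker s d z = norm z powr (- (3 + s))"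
  by (simp add: trunc_ker_def max_def)

lemma trunc_ker_lipschitz:
  assumes "s > 0" "0 < r" "r \<le> norm z" "r \<le> norm z'"
  shows "\<bar>trunc_ker s d z - trunc_ker s d z'\<bar> \<le> (3 + s) * r powr (- (4 + s)) * norm (z - z')"
proof -
  have "\<bar>trunc_ker s d z - trunc_ker s d z'\<bar>
      \<le> (3 + s) * r powr (- (3 + s) - 1) * \<bar>max (norm z) d - max (norm z') d\<bar>"
    unfolding trunc_ker_def using assms by (intro powr_neg_lipschitz) auto
  also have "\<dots> \<le> (3 + s) * r powr (- (3 + s) - 1) * norm (z - z')"
    using assms norm_triangle_ineq3[of z z'] by (intro mult_left_mono) (auto simp: max_def)
  finally show ?thesis by (simp add: algebra_simps)
qed

lemma trunc_ker_integrable: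
  assumes "s > 0" "0 < d"
  shows "integrable lborel (trunc_ker s d)"
proof -
  have 1: "integrable lborel (\<lambda>w :: R3. indicator {w. d \<le> norm w} w * norm w powr (- (3 + s)))"
    using integral_power_outside_ball[of "3 + s"] assms by auto
  have 2: "integrable lborel (\<lambda>w :: R3. d powr (- (3 + s)) * indicator (ball 0 d) w)"
    by (intro integrable_mult_right integrable_real_indicator) (use assms in \<open>auto simp: emeasure_lborel_ball3\<close>)
  show ?thesis
    by (rule integrable_dominated[OF Bochner_Integration.integrable_add[OF 1 2]])
       (use assms trunc_ker_le_delta[of s d] in
         \<open>auto intro!: AE_I2 simp: trunc_ker_nonneg trunc_ker_eq indicator_def\<close>)
qed

text \<open>
  A weight that selects, for a fixed \<open>z\<close>, the points \<open>w\<close> closer to \<open>0\<close> than to \<open>z\<close>; the value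
  \<open>1/2\<close> on the median plane makes it and its reflection add up to one everywhere. Restricted to
  this half space the second factor of a convolution at \<open>z\<close> stays away from its singularity.
\<close>

definition half_wt :: "R3 \<Rightarrow> R3 \<Rightarrow> real" where
  "half_wt z w = (if norm w < norm (z - w) then 1 else if norm w = norm (z - w) then 1 / 2 else 0)"

lemma half_wt_measurable[measurable]: "half_wt z \<in> borel_measurable borel"
  unfolding half_wt_def[abs_def] by measurable

lemma half_wt_sum: "half_wt z w + half_wt z (z - w) = 1"
  by (auto simp: half_wt_def)

lemma half_wt_bounds: "0 \<le> half_wt z w" "half_wt z w \<le> 1"
  by (auto simp: half_wt_def)

lemma half_wt_pos: "half_wt z w \<noteq> 0 \<Longrightarrow> norm z / 2 \<le> norm (z - w)"
  using norm_triangle_ineq[of w "z - w"] by (auto simp: half_wt_def split: if_splits)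

lemma half_wt_near: "norm w < norm z / 2 \<Longrightarrow> half_wt z w = 1"
  using norm_triangle_ineq2[of z w] by (auto simp: half_wt_def)

text \<open>
  Where the weight is positive, \<open>z - w\<close> is at least as long as \<open>w\<close> and hence as \<open>z/2\<close>, so both
  terms are of the order of \<open>norm z powr - (3 + s)\<close>; for short \<open>w\<close> the weight is one and the Lipschitz
  bound gains the factor \<open>norm w / norm z\<close>.
\<close>

lemma trunc_ker_difference_bound:
  assumes s: "0 < s" and z: "z \<noteq> 0"
  shows "\<bar>trunc_ker s d z - half_wt z w * trunc_ker s d (z - w)\<bar>
    \<le> (3 + s) * 2 powr (4 + s) * norm z powr (- (3 + s)) * min 1 (norm w / norm z)"
proof (cases "norm w < norm z / 2")
  case True
  have nz: "norm z > 0" using z by simp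
  have "norm z / 2 \<le> norm (z - w)" using norm_triangle_ineq2[of z w] True by linarith
  then have "\<bar>trunc_ker s d z - trunc_ker s d (z - w)\<bar> \<le> (3 + s) * (norm z / 2) powr (- (4 + s)) * norm (z - (z - w))"
    using s nz by (intro trunc_ker_lipschitz) auto
  also have "(norm z / 2) powr (- (4 + s)) = 2 powr (4 + s) * norm z powr (- (4 + s))"
    by (rule half_powr) simp
  also have "norm z powr (- (4 + s)) = norm z powr (- (3 + s)) / norm z"
    using nz powr_diff[of "norm z" "- (3 + s)" 1] by (simp add: algebra_simps)
  finally have "\<bar>trunc_ker s d z - trunc_ker s d (z - w)\<bar>
      \<le> (3 + s) * 2 powr (4 + s) * norm z powr (- (3 + s)) * (norm w / norm z)" by simp
  moreover have "norm w \<le> norm z" using True norm_ge_zero[of z] by linarith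
  then have "min 1 (norm w / norm z) = norm w / norm z" using nz by (simp add: min_absorb2)
  ultimately show ?thesis using half_wt_near[OF True] by simp
next
  case False
  have nz: "norm z > 0" using z by simp
  have a: "trunc_ker s d z \<le> (norm z / 2) powr (- (3 + s))"
    using s nz by (intro trunc_ker_le) auto
  have b: "half_wt z w * trunc_ker s d (z - w) \<le> (norm z / 2) powr (- (3 + s))"
  proof (cases "half_wt z w = 0")
    case False
    have "half_wt z w * trunc_ker s d (z - w) \<le> 1 * trunc_ker s d (z - w)"
      using half_wt_bounds trunc_ker_nonneg by (intro mult_right_mono) auto
    also have "\<dots> \<le> (norm z / 2) powr (- (3 + s))"
      using s nz half_wt_pos[OF False] trunc_ker_le[of s "norm z / 2" "z - w" d] by simp
    finally show ?thesis .
  qed simp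
  have "\<bar>trunc_ker s d z - half_wt z w * trunc_ker s d (z - w)\<bar> \<le> (norm z / 2) powr (- (3 + s))"
    using a b trunc_ker_nonneg[of s d z] mult_nonneg_nonneg[OF half_wt_bounds(1)[of z w] trunc_ker_nonneg[of s d "z - w"]]
    by linarith
  also have "\<dots> = 2 powr (3 + s) * norm z powr (- (3 + s))"
    by (rule half_powr) simp
  also have "\<dots> \<le> ((3 + s) * 2 powr (4 + s) * norm z powr (- (3 + s))) * (1 / 2)"
  proof -
    have e: "2 powr (4 + s) = 2 * 2 powr (3 + s)" using powr_add[of 2 1 "3 + s"] by simp
    have "1 * (2 powr (3 + s) * norm z powr (- (3 + s))) \<le> (3 + s) * (2 powr (3 + s) * norm z powr (- (3 + s)))"
      using s by (intro mult_right_mono) auto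
    then show ?thesis by (simp add: e)
  qed
  also have "\<dots> \<le> ((3 + s) * 2 powr (4 + s) * norm z powr (- (3 + s))) * min 1 (norm w / norm z)"
    using s False nz by (intro mult_left_mono) (auto simp: field_simps)
  finally show ?thesis .
qed

text \<open>
  Near the origin the extra factor \<open>norm w\<close> makes the kernel integrable because \<open>s < 1\<close>, and far
  out the kernel is integrable by itself; both parts scale like \<open>norm z powr - s\<close>.
\<close>

lemma dominating_kernel:
  assumes s: "0 < s" "s < 1"
  shows "\<exists>C>0. \<forall>z :: R3. z \<noteq> 0 \<longrightarrow>
    integrable lborel (\<lambda>w :: R3. norm w powr (- (3 + s)) * min 1 (norm w / norm z)) \<and>
    (LINT w|lborel. norm (w :: R3) powr (- (3 + s)) * min 1 (norm w / norm z)) \<le> C * norm z powr (- s)"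
proof -
  obtain C1 where C1: "C1 > 0" "\<And>r. r > 0 \<Longrightarrow> integrable lborel (\<lambda>w :: R3. indicator {w. r \<le> norm w} w * norm w powr (- (3 + s)))"
    "\<And>r. r > 0 \<Longrightarrow> (LINT w|lborel. indicator {w :: R3. r \<le> norm w} w * norm w powr (- (3 + s))) \<le> C1 * r powr (3 - (3 + s))"
    using integral_power_outside_ball[of "3 + s"] s by auto
  obtain C2 where C2: "C2 > 0" "\<And>r. r > 0 \<Longrightarrow> integrable lborel (\<lambda>w :: R3. indicator {w. norm w < r} w * norm w powr (- (2 + s)))"
    "\<And>r. r > 0 \<Longrightarrow> (LINT w|lborel. indicator {w :: R3. norm w < r} w * norm w powr (- (2 + s))) \<le> C2 * r powr (3 - (2 + s))"
    using integral_power_inside_ball[of "2 + s"] s by auto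
  show ?thesis
  proof (intro exI[of _ "C1 + C2"] conjI allI impI)
    show "C1 + C2 > 0" using C1 C2 by simp
    fix z :: R3 assume "z \<noteq> 0"
    then have nz: "norm z > 0" by simp
    have eq: "norm w powr (- (3 + s)) * min 1 (norm w / norm z) =
       (indicator {w. norm w < norm z} w * norm w powr (- (2 + s))) / norm z
       + indicator {w. norm z \<le> norm w} w * norm w powr (- (3 + s))" for w :: R3
    proof (cases "w = 0")
      case False
      then have "norm w powr (- (2 + s)) = norm w powr (- (3 + s)) * norm w"
        using powr_add[of "norm w" "- (3 + s)" 1] by simp
      then show ?thesis using nz by (auto simp: min_def indicator_def)
    qed simp
    show "integrable lborel (\<lambda>w :: R3. norm w powr (- (3 + s)) * min 1 (norm w / norm z))"
      unfolding eq using C1(2)[OF nz] C2(2)[OF nz] by simp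
    have "(LINT w|lborel. norm (w :: R3) powr (- (3 + s)) * min 1 (norm w / norm z))
       = (LINT w|lborel. indicator {w. norm w < norm z} w * norm (w :: R3) powr (- (2 + s))) / norm z
       + (LINT w|lborel. indicator {w. norm z \<le> norm w} w * norm (w :: R3) powr (- (3 + s)))"
      unfolding eq using C1(2)[OF nz] C2(2)[OF nz] by simp
    also have "\<dots> \<le> (C2 * norm z powr (3 - (2 + s))) / norm z + C1 * norm z powr (3 - (3 + s))"
      using C1(3)[OF nz] C2(3)[OF nz] nz by (intro add_mono divide_right_mono) auto
    also have "norm z powr (3 - (2 + s)) = norm z powr (- s) * norm z"
      using nz powr_add[of "norm z" "- s" 1] by simp
    finally show "(LINT w|lborel. norm (w :: R3) powr (- (3 + s)) * min 1 (norm w / norm z)) \<le> (C1 + C2) * norm z powr (- s)"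
      using nz by (simp add: algebra_simps)
  qed
qed

text \<open>
  One of the two symmetric halves of the kernel \<open>A\<^sub>d k\<^sub>e + A\<^sub>e k\<^sub>d - k\<^sub>e * k\<^sub>d\<close>, where \<open>A\<close> is
  the mass of \<open>k\<close>. Because \<open>s < 1\<close> the integrand is absolutely integrable even for
  \<open>e = d = 0\<close>, with bounds that are uniform in the truncation.
\<close>

definition half_cross :: "real \<Rightarrow> real \<Rightarrow> real \<Rightarrow> R3 \<Rightarrow> real" where
  "half_cross s e d z =
     (LINT w|lborel. trunc_ker s e w * (trunc_ker s d z - half_wt z w * trunc_ker s d (z - w)))"

text \<open>
  The polarisation of the kernel that \<open>norm_diff_avg_square\<close> attaches to a convolution operator:
  for \<open>e = d\<close> it is that kernel for \<open>trunc_ker s d\<close>. Both terms with a total mass diverge as the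
  truncation is removed, but their singular parts cancel against the convolution.
\<close>

definition cross_ker :: "real \<Rightarrow> real \<Rightarrow> real \<Rightarrow> R3 \<Rightarrow> real" where
  "cross_ker s e d z = (LINT w|lborel. trunc_ker s d w) * trunc_ker s e z
     + (LINT w|lborel. trunc_ker s e w) * trunc_ker s d z
     - (LINT w|lborel. trunc_ker s e w * trunc_ker s d (z - w))"

definition cross_const :: "real \<Rightarrow> real" where
  "cross_const s = 2 * half_cross s 0 0 (axis 1 1)"

lemma half_cross_integrand:
  assumes s: "0 < s" and z: "z \<noteq> 0" and e: "0 \<le> h"
  shows "\<bar>trunc_ker s h w * (trunc_ker s d z - half_wt z w * trunc_ker s d (z - w))\<bar>
    \<le> (3 + s) * 2 powr (4 + s) * norm z powr (- (3 + s)) * (norm w powr (- (3 + s)) * min 1 (norm w / norm z))"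
proof (cases "w = 0")
  case True
  then show ?thesis using z by (simp add: half_wt_near)
next
  case False
  have "\<bar>trunc_ker s h w * (trunc_ker s d z - half_wt z w * trunc_ker s d (z - w))\<bar>
    \<le> norm w powr (- (3 + s)) * ((3 + s) * 2 powr (4 + s) * norm z powr (- (3 + s)) * min 1 (norm w / norm z))"
    unfolding abs_mult using False s z
    using trunc_ker_le[of s "norm w" w h]
    by (intro mult_mono trunc_ker_difference_bound) (auto simp: trunc_ker_nonneg)
  then show ?thesis by (simp add: mult_ac)
qed

text \<open>
  Capping the first factor changes the integrand only on the ball of radius \<open>h\<close>, where the bracket is
  of order \<open>norm w * norm z powr - (4 + s)\<close>. Capping the second one at \<open>q \<le> norm z / 2\<close> changes
  nothing, and for larger \<open>q\<close> the first bound is already of the size claimed in the second.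
\<close>

lemma half_cross_estimates:
  assumes s: "0 < s" "s < 1"
  shows "\<exists>C>0. \<forall>h\<ge>0. \<forall>q\<ge>0. \<forall>z. z \<noteq> 0 \<longrightarrow>
     \<bar>half_cross s h q z\<bar> \<le> C * norm z powr (- (3 + 2 * s)) \<and>
     \<bar>half_cross s h q z - half_cross s 0 0 z\<bar> \<le> C * max h q powr (1 - s) * norm z powr (- (4 + s))"
proof -
  define C1 where "C1 = (3 + s) * 2 powr (4 + s)"
  have C1: "C1 > 0" using s by (simp add: C1_def)
  obtain C2 where C2: "C2 > 0"
    "\<And>z :: R3. z \<noteq> 0 \<Longrightarrow> integrable lborel (\<lambda>w :: R3. norm w powr (- (3 + s)) * min 1 (norm w / norm z))"
    "\<And>z :: R3. z \<noteq> 0 \<Longrightarrow> (LINT w|lborel. norm (w :: R3) powr (- (3 + s)) * min 1 (norm w / norm z)) \<le> C2 * norm z powr (- s)"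
    using dominating_kernel[OF s] by auto
  obtain C3 where C3: "C3 > 0" "\<And>r. r > 0 \<Longrightarrow> integrable lborel (\<lambda>w :: R3. indicator {w. norm w < r} w * norm w powr (- (2 + s)))"
    "\<And>r. r > 0 \<Longrightarrow> (LINT w|lborel. indicator {w :: R3. norm w < r} w * norm w powr (- (2 + s))) \<le> C3 * r powr (3 - (2 + s))"
    using integral_power_inside_ball[of "2 + s"] s by auto
  have int: "integrable lborel (\<lambda>w. trunc_ker s h w * (trunc_ker s q z - half_wt z w * trunc_ker s q (z - w)))"
    if "z \<noteq> 0" "0 \<le> h" for h q z
  proof (rule integrable_majorant)
    show "integrable lborel (\<lambda>w :: R3. C1 * norm z powr (- (3 + s)) * (norm w powr (- (3 + s)) * min 1 (norm w / norm z)))"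
      using C2(2)[OF that(1)] by simp
  qed (measurable, use half_cross_integrand[OF s(1) that, of _ q] in \<open>simp add: C1_def\<close>)
  have bound: "\<bar>half_cross s h q z\<bar> \<le> C1 * C2 * norm z powr (- (3 + 2 * s))" if z: "z \<noteq> 0" and e: "0 \<le> h" for h q z
  proof -
    have "\<bar>half_cross s h q z\<bar> \<le> (LINT w|lborel. \<bar>trunc_ker s h w * (trunc_ker s q z - half_wt z w * trunc_ker s q (z - w))\<bar>)"
      unfolding half_cross_def by (rule integral_abs_bound)
    also have "\<dots> \<le> (LINT w|lborel. C1 * norm z powr (- (3 + s)) * (norm (w :: R3) powr (- (3 + s)) * min 1 (norm w / norm z)))"
      using int[OF z e] C2(2)[OF z] half_cross_integrand[OF s(1) z e] unfolding C1_def by (intro integral_mono) auto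
    also have "\<dots> \<le> C1 * norm z powr (- (3 + s)) * (C2 * norm z powr (- s))"
      unfolding integral_mult_right_zero using C2(3)[OF z] C1 by (intro mult_left_mono) auto
    also have "\<dots> = C1 * C2 * (norm z powr (- (3 + s)) * norm z powr (- s))" by simp
    also have "norm z powr (- (3 + s)) * norm z powr (- s) = norm z powr (- (3 + 2 * s))"
      unfolding powr_add[symmetric] by (rule arg_cong[where f = "\<lambda>t. norm z powr t"]) simp
    finally show ?thesis .
  qed
  have rate: "\<bar>half_cross s h q z - half_cross s 0 0 z\<bar> \<le> C1 * C3 * h powr (1 - s) * norm z powr (- (4 + s))"
    if z: "z \<noteq> 0" and e: "0 \<le> h" and d: "0 \<le> q" "q \<le> norm z / 2" for h q z
  proof (cases "h = 0")
    case False
    with e have e: "h > 0" by simp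
    have nz: "norm z > 0" using z by simp
    have deq: "trunc_ker s q z - half_wt z w * trunc_ker s q (z - w) = trunc_ker s 0 z - half_wt z w * trunc_ker s 0 (z - w)" for w
      using d half_wt_pos[of z w] by (cases "half_wt z w = 0") (auto simp: trunc_ker_eq)
    define R where "R w = trunc_ker s 0 z - half_wt z w * trunc_ker s 0 (z - w)" for w
    have i1: "integrable lborel (\<lambda>w. trunc_ker s h w * R w)" and i2: "integrable lborel (\<lambda>w. trunc_ker s 0 w * R w)"
      using int[OF z, of h 0] int[OF z, of 0 0] e by (auto simp: R_def)
    have "half_cross s h q z - half_cross s 0 0 z = (LINT w|lborel. trunc_ker s h w * R w - trunc_ker s 0 w * R w)"
      unfolding half_cross_def deq using i1 i2 by (simp add: R_def)
    also have "\<bar>\<dots>\<bar> \<le> (LINT w|lborel. \<bar>trunc_ker s h w * R w - trunc_ker s 0 w * R w\<bar>)"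
      by (rule integral_abs_bound)
    also have "\<dots> \<le> (LINT w|lborel. C1 * norm z powr (- (4 + s)) * (indicator {w. norm w < h} w * norm (w :: R3) powr (- (2 + s))))"
    proof (rule integral_mono)
      show "integrable lborel (\<lambda>w. \<bar>trunc_ker s h w * R w - trunc_ker s 0 w * R w\<bar>)" using i1 i2 by simp
      show "integrable lborel (\<lambda>w. C1 * norm z powr (- (4 + s)) * (indicator {w. norm w < h} w * norm (w :: R3) powr (- (2 + s))))"
        using C3(2)[OF e] by simp
      fix w
      show "\<bar>trunc_ker s h w * R w - trunc_ker s 0 w * R w\<bar> \<le> C1 * norm z powr (- (4 + s)) * (indicator {w. norm w < h} w * norm w powr (- (2 + s)))"
      proof (cases "norm w < h \<and> w \<noteq> 0")
        case True
        have k: "0 \<le> trunc_ker s h w" "trunc_ker s h w \<le> trunc_ker s 0 w" "trunc_ker s 0 w = norm w powr (- (3 + s))"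
          using True s trunc_ker_le[of s "norm w" w h] by (auto simp: trunc_ker_nonneg trunc_ker_eq)
        have "\<bar>trunc_ker s h w * R w - trunc_ker s 0 w * R w\<bar> = (trunc_ker s 0 w - trunc_ker s h w) * \<bar>R w\<bar>"
          using k by (simp add: left_diff_distrib[symmetric] abs_mult)
        also have "\<dots> \<le> norm w powr (- (3 + s)) * (C1 * norm z powr (- (3 + s)) * min 1 (norm w / norm z))"
          using k trunc_ker_difference_bound[OF s(1) z, of 0 w] unfolding R_def C1_def by (intro mult_mono) auto
        also have "\<dots> \<le> norm w powr (- (3 + s)) * (C1 * norm z powr (- (3 + s)) * (norm w / norm z))"
          using C1 by (intro mult_left_mono) auto
        also have "\<dots> = C1 * (norm z powr (- (3 + s)) / norm z) * (norm w powr (- (3 + s)) * norm w)" by simp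
        also have "norm z powr (- (3 + s)) / norm z = norm z powr (- (4 + s))"
          using nz powr_diff[of "norm z" "- (3 + s)" 1] by (simp add: algebra_simps)
        also have "norm w powr (- (3 + s)) * norm w = norm w powr (- (2 + s))"
          using True powr_add[of "norm w" "- (3 + s)" 1] by simp
        finally show ?thesis using True by simp
      next
        case False
        then show ?thesis
        proof (cases "w = 0")
          case True
          then show ?thesis using z by (simp add: R_def half_wt_near)
        qed (use False e in \<open>simp add: trunc_ker_eq\<close>)
      qed
    qed
    also have "\<dots> \<le> C1 * norm z powr (- (4 + s)) * (C3 * h powr (3 - (2 + s)))"
      unfolding integral_mult_right_zero using C3(3)[OF e] C1 by (intro mult_left_mono) auto
    finally show ?thesis by (simp add: mult_ac)
  next
    case True
    have deq: "trunc_ker s q z - half_wt z w * trunc_ker s q (z - w) = trunc_ker s 0 z - half_wt z w * trunc_ker s 0 (z - w)" for w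
      using d half_wt_pos[of z w] by (cases "half_wt z w = 0") (auto simp: trunc_ker_eq)
    show ?thesis unfolding half_cross_def deq True by simp
  qed
  define C where "C = C1 * C3 + 4 * (C1 * C2)"
  have le: "C1 * C3 \<le> C" "C1 * C2 \<le> C" "C > 0" using C1 C2 C3 by (auto simp: C_def add_pos_pos)
  show ?thesis
  proof (intro exI[of _ C] conjI allI impI)
    show "C > 0" by (rule le)
    fix h q :: real and z :: R3 assume e: "0 \<le> h" and d: "0 \<le> q" and z: "z \<noteq> 0"
    have "\<bar>half_cross s h q z\<bar> \<le> C1 * C2 * norm z powr (- (3 + 2 * s))" by (rule bound[OF z e])
    also have "\<dots> \<le> C * norm z powr (- (3 + 2 * s))" using le by (intro mult_right_mono) auto
    finally show "\<bar>half_cross s h q z\<bar> \<le> C * norm z powr (- (3 + 2 * s))" .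
    show "\<bar>half_cross s h q z - half_cross s 0 0 z\<bar> \<le> C * max h q powr (1 - s) * norm z powr (- (4 + s))"
    proof (cases "q \<le> norm z / 2")
      case True
      have "\<bar>half_cross s h q z - half_cross s 0 0 z\<bar> \<le> C1 * C3 * h powr (1 - s) * norm z powr (- (4 + s))"
        by (rule rate[OF z e d True])
      also have "\<dots> \<le> C * max h q powr (1 - s) * norm z powr (- (4 + s))"
        using le e s C1 C3 by (intro mult_right_mono mult_mono powr_mono2) auto
      finally show ?thesis .
    next
      case False
      have nz: "norm z > 0" using z by simp
      have "\<bar>half_cross s h q z - half_cross s 0 0 z\<bar> \<le> 2 * (C1 * C2) * norm z powr (- (3 + 2 * s))"
        using bound[OF z e, of q] bound[OF z order_refl, of 0] by linarith
      also have "norm z powr (- (3 + 2 * s)) = norm z powr (1 - s) * norm z powr (- (4 + s))"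
        by (simp add: powr_add[symmetric])
      also have "2 * (C1 * C2) * (norm z powr (1 - s) * norm z powr (- (4 + s)))
          \<le> 2 * (C1 * C2) * ((2 * max h q) powr (1 - s) * norm z powr (- (4 + s)))"
        using C1 C2 s False nz by (intro mult_left_mono mult_right_mono powr_mono2) auto
      also have "(2 * max h q) powr (1 - s) = 2 powr (1 - s) * max h q powr (1 - s)"
        by (rule powr_mult)
      also have "2 * (C1 * C2) * (2 powr (1 - s) * max h q powr (1 - s) * norm z powr (- (4 + s)))
          = (2 * 2 powr (1 - s) * (C1 * C2)) * (max h q powr (1 - s) * norm z powr (- (4 + s)))"
        by simp
      also have "\<dots> \<le> C * (max h q powr (1 - s) * norm z powr (- (4 + s)))"
      proof (rule mult_right_mono)
        have "2 powr (1 - s) \<le> 2 powr 1" using s by (intro powr_mono) auto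
        then have "2 * 2 powr (1 - s) * (C1 * C2) \<le> 4 * (C1 * C2)"
          using C1 C2 by (intro mult_right_mono) auto
        then show "2 * 2 powr (1 - s) * (C1 * C2) \<le> C"
          using mult_pos_pos[OF C1 C3(1)] unfolding C_def by linarith
      qed simp
      finally show ?thesis by (simp add: mult.assoc)
    qed
  qed
qed

text \<open>
  The reflection \<open>w \<mapsto> z - w\<close> exchanges the two factors of the convolution, and the weight and its
  reflection add up to one.
\<close>

lemma cross_ker_eq_halves:
  assumes s: "0 < s" and e: "0 < r" and d: "0 < q"
  shows "cross_ker s r q z = half_cross s r q z + half_cross s q r z"
proof -
  have int: "integrable lborel (\<lambda>w. trunc_ker s r w * (h w * trunc_ker s q (z - w)))"
    if e: "0 < r" and d: "0 < q" and h: "h \<in> borel_measurable borel" "\<And>w. 0 \<le> h w \<and> h w \<le> 1" for r q h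
  proof (rule integrable_dominated)
    show "integrable lborel (\<lambda>w. trunc_ker s r w * q powr (- (3 + s)))"
      using trunc_ker_integrable[OF s e] by simp
    have "h w * trunc_ker s q (z - w) \<le> 1 * q powr (- (3 + s))" for w
      using h(2)[of w] trunc_ker_le_delta[OF s d] by (intro mult_mono) (auto simp: trunc_ker_nonneg)
    then show "AE w in lborel. norm (trunc_ker s r w * (h w * trunc_ker s q (z - w))) \<le> norm (trunc_ker s r w * q powr (- (3 + s)))"
      using h(2) by (intro AE_I2) (auto simp: abs_mult trunc_ker_nonneg intro!: mult_left_mono)
  qed (use h(1) in measurable)
  have i0: "integrable lborel (\<lambda>w. trunc_ker s r w * (half_wt z w * trunc_ker s q (z - w)))"
    by (rule int[OF e d]) (auto simp: half_wt_bounds)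
  have i1: "integrable lborel (\<lambda>w. trunc_ker s q w * (half_wt z w * trunc_ker s r (z - w)))"
    by (rule int[OF d e]) (auto simp: half_wt_bounds)
  have i2: "integrable lborel (\<lambda>w. trunc_ker s r w * (half_wt z (z - w) * trunc_ker s q (z - w)))"
    by (rule int[OF e d]) (auto simp: half_wt_bounds)
  have h1: "half_cross s r q z = (LINT w|lborel. trunc_ker s r w) * trunc_ker s q z
      - (LINT w|lborel. trunc_ker s r w * (half_wt z w * trunc_ker s q (z - w)))"
    using i0 trunc_ker_integrable[OF s e] by (simp add: half_cross_def right_diff_distrib)
  have h2: "half_cross s q r z = (LINT w|lborel. trunc_ker s q w) * trunc_ker s r z
      - (LINT w|lborel. trunc_ker s q w * (half_wt z w * trunc_ker s r (z - w)))"
    using i1 trunc_ker_integrable[OF s d] by (simp add: half_cross_def right_diff_distrib)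
  have "(LINT w|lborel. trunc_ker s q w * (half_wt z w * trunc_ker s r (z - w)))
      = (LINT w|lborel. trunc_ker s q (z - w) * (half_wt z (z - w) * trunc_ker s r (z - (z - w))))"
    by (rule integral_lborel_shift(4)[symmetric]) measurable
  also have "\<dots> = (LINT w|lborel. trunc_ker s r w * (half_wt z (z - w) * trunc_ker s q (z - w)))"
    by (simp add: mult_ac)
  finally have "(LINT w|lborel. trunc_ker s r w * (half_wt z w * trunc_ker s q (z - w)))
      + (LINT w|lborel. trunc_ker s q w * (half_wt z w * trunc_ker s r (z - w)))
      = (LINT w|lborel. trunc_ker s r w * (half_wt z w * trunc_ker s q (z - w))
          + trunc_ker s r w * (half_wt z (z - w) * trunc_ker s q (z - w)))"
    using i0 i2 by simp
  also have "\<dots> = (LINT w|lborel. trunc_ker s r w * trunc_ker s q (z - w))"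
  proof (rule Bochner_Integration.integral_cong[OF refl])
    fix w
    have "trunc_ker s r w * (half_wt z w * trunc_ker s q (z - w)) + trunc_ker s r w * (half_wt z (z - w) * trunc_ker s q (z - w))
      = trunc_ker s r w * trunc_ker s q (z - w) * (half_wt z w + half_wt z (z - w))"
      by (simp add: algebra_simps)
    then show "trunc_ker s r w * (half_wt z w * trunc_ker s q (z - w)) + trunc_ker s r w * (half_wt z (z - w) * trunc_ker s q (z - w))
      = trunc_ker s r w * trunc_ker s q (z - w)"
      by (simp add: half_wt_sum)
  qed
  finally show ?thesis unfolding cross_ker_def h1 h2 by linarith
qed

text \<open>
  The untruncated kernel is invariant under rotations and homogeneous under dilations, so its value
  on one unit vector determines it.
\<close>

lemma half_cross_homogeneous:
  assumes z: "z \<noteq> 0"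
  shows "2 * half_cross s 0 0 z = cross_const s * norm z powr (- (3 + 2 * s))"
proof -
  define r where "r = norm z"
  have r: "r > 0" using z by (simp add: r_def)
  define e where "e = (axis 1 1 :: R3)"
  have "norm e = norm (z /\<^sub>R r)" using r by (simp add: e_def r_def)
  then obtain O' where O': "orthogonal_transformation O'" "O' e = z /\<^sub>R r"
    using orthogonal_transformation_exists by blast
  have lin: "linear O'" using O'(1) by (rule orthogonal_transformation_linear)
  have nO: "norm (O' x) = norm x" for x using O'(1) by (simp add: orthogonal_transformation_norm)
  have z_eq: "z = r *\<^sub>R O' e" using O'(2) r by simp
  define f where "f w = trunc_ker s 0 w * (trunc_ker s 0 z - half_wt z w * trunc_ker s 0 (z - w))" for w
  have fm: "f \<in> borel_measurable borel" unfolding f_def by measurable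
  define g where "g w = f (r *\<^sub>R w)" for w
  have gm: "g \<in> borel_measurable borel" unfolding g_def using fm by measurable
  have "half_cross s 0 0 z = r ^ 3 * (LINT w|lborel. g w)"
    unfolding half_cross_def using integral_lborel_scale[OF fm r] by (simp add: f_def g_def)
  also have "(LINT w|lborel. g w) = (LINT w|lborel. g (O' w))"
    by (rule integral_lborel_orthogonal[OF gm O'(1), symmetric])
  also have "\<dots> = (LINT w|lborel. r powr (- (6 + 2 * s)) *
      (trunc_ker s 0 w * (trunc_ker s 0 e - half_wt e w * trunc_ker s 0 (e - w))))"
  proof (rule Bochner_Integration.integral_cong[OF refl])
    fix w
    have diff: "z - r *\<^sub>R O' w = r *\<^sub>R O' (e - w)"
      unfolding z_eq by (simp add: linear_diff[OF lin] scaleR_diff_right)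
    have k: "trunc_ker s 0 (r *\<^sub>R O' x) = r powr (- (3 + s)) * trunc_ker s 0 x" for x
      using r by (simp add: trunc_ker_def nO powr_mult)
    have h: "half_wt z (r *\<^sub>R O' w) = half_wt e w"
      using r by (simp add: half_wt_def diff nO)
    have kz: "trunc_ker s 0 z = r powr (- (3 + s)) * trunc_ker s 0 e" using k[of e] z_eq by simp
    have "g (O' w) = r powr (- (3 + s)) * r powr (- (3 + s)) *
      (trunc_ker s 0 w * (trunc_ker s 0 e - half_wt e w * trunc_ker s 0 (e - w)))"
      unfolding g_def f_def diff h k kz by (simp add: algebra_simps)
    also have "r powr (- (3 + s)) * r powr (- (3 + s)) = r powr (- (6 + 2 * s))"
      by (simp add: powr_add[symmetric])
    finally show "g (O' w) = r powr (- (6 + 2 * s)) *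
      (trunc_ker s 0 w * (trunc_ker s 0 e - half_wt e w * trunc_ker s 0 (e - w)))" .
  qed
  also have "\<dots> = r powr (- (6 + 2 * s)) * half_cross s 0 0 e"
    by (simp add: half_cross_def)
  also have "r ^ 3 * (r powr (- (6 + 2 * s)) * half_cross s 0 0 e) = r powr (- (3 + 2 * s)) * half_cross s 0 0 e"
  proof -
    have "r ^ 3 = r powr 3" using r by simp
    then have "r ^ 3 * r powr (- (6 + 2 * s)) = r powr (- (3 + 2 * s))"
      by (simp add: powr_add[symmetric])
    then show ?thesis by (simp add: mult.assoc[symmetric])
  qed
  finally show ?thesis by (simp add: cross_const_def e_def r_def)
qed

lemma cross_ker_asymptotics:
  assumes s: "0 < s" "s < 1"
  shows "\<exists>C>0. \<forall>r>0. \<forall>q>0. \<forall>z. z \<noteq> 0 \<longrightarrow>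
     \<bar>cross_ker s r q z\<bar> \<le> C * norm z powr (- (3 + 2 * s)) \<and>
     \<bar>cross_ker s r q z - cross_const s * norm z powr (- (3 + 2 * s))\<bar>
       \<le> C * max r q powr (1 - s) * norm z powr (- (4 + s))"
proof -
  obtain C where C: "C > 0" "\<And>r q z. 0 \<le> r \<Longrightarrow> 0 \<le> q \<Longrightarrow> z \<noteq> 0 \<Longrightarrow>
     \<bar>half_cross s r q z\<bar> \<le> C * norm z powr (- (3 + 2 * s)) \<and>
     \<bar>half_cross s r q z - half_cross s 0 0 z\<bar> \<le> C * max r q powr (1 - s) * norm z powr (- (4 + s))"
    using half_cross_estimates[OF s] by blast
  show ?thesis
  proof (intro exI[of _ "2 * C"] conjI allI impI)
    show "2 * C > 0" using C by simp
    fix r q :: real and z :: R3 assume e: "0 < r" and d: "0 < q" and z: "z \<noteq> 0"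
    note c1 = C(2)[of r q z] and c2 = C(2)[of q r z] and h = half_cross_homogeneous[OF z, of s]
    show "\<bar>cross_ker s r q z\<bar> \<le> 2 * C * norm z powr (- (3 + 2 * s))"
      unfolding cross_ker_eq_halves[OF s(1) e d] using c1 c2 e d z by auto
    show "\<bar>cross_ker s r q z - cross_const s * norm z powr (- (3 + 2 * s))\<bar>
       \<le> 2 * C * max r q powr (1 - s) * norm z powr (- (4 + s))"
      unfolding cross_ker_eq_halves[OF s(1) e d] h[symmetric] using c1 c2 e d z by (auto simp: max.commute)
  qed
qed

section \<open>The fractional Laplacian in mean square\<close>

text \<open>
  The Gagliardo integrand in the variables \<open>x\<close> and \<open>z = x - y\<close>, in which the singular kernel depends
  on \<open>z\<close> alone.
\<close>

definition gag_dens :: "real \<Rightarrow> (R3 \<Rightarrow> 'k :: euclidean_space) \<Rightarrow> R3 \<times> R3 \<Rightarrow> real" where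
  "gag_dens s u p = norm (u (fst p) - u (fst p - snd p)) ^ 2 * norm (snd p) powr (- (3 + 2 * s))"

definition gag :: "real \<Rightarrow> (R3 \<Rightarrow> 'k :: euclidean_space) \<Rightarrow> real" where
  "gag s u = (LINT p|lborel2. gag_dens s u p)"

definition mass :: "(R3 \<Rightarrow> 'k :: euclidean_space) \<Rightarrow> real" where
  "mass u = (LINT x|lborel. norm (u x) ^ 2)"

definition Hs :: "real \<Rightarrow> (R3 \<Rightarrow> 'k :: euclidean_space) set" where
  "Hs s = {u \<in> borel_measurable borel. integrable lborel (\<lambda>x. norm (u x) ^ 2) \<and>
     integrable lborel2 (gag_dens s u)}"

lemma HsD:
  assumes "u \<in> Hs s"
  shows "u \<in> borel_measurable borel" "integrable lborel (\<lambda>x. norm (u x) ^ 2)"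
    "integrable lborel2 (gag_dens s u)"
  using assms by (auto simp: Hs_def)

lemma gag_dens_nonneg: "0 \<le> gag_dens s u p"
  by (simp add: gag_dens_def)

lemma gag_nonneg: "0 \<le> gag s u"
  unfolding gag_def by (intro Bochner_Integration.integral_nonneg gag_dens_nonneg)

lemma mass_nonneg: "0 \<le> mass u"
  unfolding mass_def by simp

lemma gag_dens_measurable[measurable]:
  assumes [measurable]: "u \<in> borel_measurable borel"
  shows "gag_dens s u \<in> borel_measurable lborel2"
  unfolding gag_dens_def[abs_def] by measurable

lemma gag_via_modulus:
  assumes u: "u \<in> Hs s"
  shows "integrable lborel (\<lambda>z. sq_modulus u z * norm z powr (- (3 + 2 * s)))"
    and "(LINT z|lborel. sq_modulus u z * norm z powr (- (3 + 2 * s))) = gag s u"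
    and "AE x in lborel. integrable lborel (\<lambda>z. gag_dens s u (x, z))"
    and "integrable lborel (\<lambda>x. LINT z|lborel. gag_dens s u (x, z))"
    and "(LINT x|lborel. LINT z|lborel. gag_dens s u (x, z)) = gag s u"
proof -
  note h = HsD[OF u]
  have eq: "(LINT x|lborel. gag_dens s u (x, z)) = sq_modulus u z * norm z powr (- (3 + 2 * s))" for z
    by (simp add: gag_dens_def sq_modulus_def)
  have i: "integrable lborel2 (\<lambda>(x, z). gag_dens s u (x, z))" using h(3) by simp
  show "integrable lborel (\<lambda>z. sq_modulus u z * norm z powr (- (3 + 2 * s)))"
    using lborel_pair.integrable_snd[OF i] unfolding eq .
  show "(LINT z|lborel. sq_modulus u z * norm z powr (- (3 + 2 * s))) = gag s u"
    using lborel_pair.integral_snd[OF i] unfolding eq by (simp add: gag_def)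
  show "AE x in lborel. integrable lborel (\<lambda>z. gag_dens s u (x, z))"
    using lborel_pair.AE_integrable_fst[OF i] .
  show "integrable lborel (\<lambda>x. LINT z|lborel. gag_dens s u (x, z))"
    using lborel_pair.integrable_fst[OF i] .
  show "(LINT x|lborel. LINT z|lborel. gag_dens s u (x, z)) = gag s u"
    using lborel_pair.integral_fst[OF i] by (simp add: gag_def)
qed

lemma norm_square_perturb:
  fixes a b :: "'b :: real_normed_vector"
  assumes t: "t > 0"
  shows "norm a ^ 2 \<le> (1 + t) * norm b ^ 2 + (1 + 1 / t) * norm (a - b) ^ 2"
proof -
  define x where "x = norm b" define y where "y = norm (a - b)"
  have "norm a \<le> x + y" unfolding x_def y_def using norm_triangle_sub[of a b] by simp
  then have "norm a ^ 2 \<le> (x + y) ^ 2" by (intro power_mono) auto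
  also have "\<dots> = x ^ 2 + 2 * x * y + y ^ 2" by (simp add: power2_eq_square algebra_simps)
  also have "2 * x * y \<le> t * x ^ 2 + (1 / t) * y ^ 2"
  proof -
    have "0 \<le> (t * x - y) ^ 2 / t" using t by simp
    also have "(t * x - y) ^ 2 / t = t * x ^ 2 - 2 * x * y + (1 / t) * y ^ 2"
      using t by (simp add: power2_eq_square field_simps)
    finally show ?thesis by simp
  qed
  finally show ?thesis by (simp add: x_def y_def algebra_simps)
qed

text \<open>
  Perturbing squares with the weights \<open>1 + t\<close> and \<open>1 + 1/t\<close> does the work of the triangle inequality
  for the \<open>L\<^sup>2\<close> norm.
\<close>

lemma L2_norm_limit:
  fixes f :: "nat \<Rightarrow> 'a \<Rightarrow> 'b :: euclidean_space"
  assumes [measurable]: "\<And>n. f n \<in> borel_measurable M" "g \<in> borel_measurable M"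
    and f2: "\<And>n. integrable M (\<lambda>x. norm (f n x) ^ 2)"
    and lim: "(\<lambda>n. LINT x|M. norm (f n x) ^ 2) \<longlonglongrightarrow> L"
    and conv: "\<And>e. e > 0 \<Longrightarrow> \<exists>N. \<forall>n\<ge>N. (\<integral>\<^sup>+x. ennreal (norm (f n x - g x) ^ 2) \<partial>M) \<le> ennreal e"
  shows "integrable M (\<lambda>x. norm (g x) ^ 2)" "(LINT x|M. norm (g x) ^ 2) = L"
proof -
  obtain N1 where N1: "(\<integral>\<^sup>+x. ennreal (norm (f N1 x - g x) ^ 2) \<partial>M) \<le> ennreal 1"
    using conv[of 1] by auto
  have d1: "integrable M (\<lambda>x. norm (f N1 x - g x) ^ 2)"
    by (rule integrable_from_nn_integral_le(1)[OF _ _ N1]) auto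
  have "integrable M (\<lambda>x. (1 + 1) * norm (f N1 x) ^ 2 + (1 + 1 / 1) * norm (f N1 x - g x) ^ 2)"
    using f2[of N1] d1 by simp
  then show g2: "integrable M (\<lambda>x. norm (g x) ^ 2)"
    by (rule integrable_majorant_nonneg)
      (use norm_square_perturb[of 1 "g _" "f N1 _"] in \<open>auto simp: norm_minus_commute\<close>)
  define I where "I = (LINT x|M. norm (g x) ^ 2)"
  have I0: "I \<ge> 0" unfolding I_def by simp
  have L0: "L \<ge> 0" using lim by (rule LIMSEQ_le_const) auto
  have both: "I \<le> (1 + t) * L" "L \<le> (1 + t) * I" if t: "t > 0" for t
  proof -
    define dd where "dd n = (LINT x|M. norm (f n x - g x) ^ 2)" for n
    have di: "integrable M (\<lambda>x. norm (f n x - g x) ^ 2)" for n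
    proof -
      have "integrable M (\<lambda>x. 2 * norm (f n x) ^ 2 + 2 * norm (g x) ^ 2)" using f2 g2 by simp
      then show ?thesis
        by (rule integrable_dominated) (auto intro!: AE_I2 norm_diff_square_le)
    qed
    have dd0: "dd \<longlonglongrightarrow> 0"
    proof (rule LIMSEQ_I)
      fix e :: real assume e: "e > 0"
      obtain N where N: "\<And>n. n \<ge> N \<Longrightarrow> (\<integral>\<^sup>+x. ennreal (norm (f n x - g x) ^ 2) \<partial>M) \<le> ennreal (e / 2)"
        using conv[of "e / 2"] e by auto
      show "\<exists>no. \<forall>n\<ge>no. norm (dd n - 0) < e"
      proof (intro exI[of _ N] allI impI)
        fix n assume "n \<ge> N"
        then have "dd n \<le> e / 2"
          unfolding dd_def using e by (intro integrable_from_nn_integral_le(2) N) auto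
        moreover have "dd n \<ge> 0" unfolding dd_def by simp
        ultimately show "norm (dd n - 0) < e" using e by simp
      qed
    qed
    have a: "I \<le> (1 + t) * (LINT x|M. norm (f n x) ^ 2) + (1 + 1 / t) * dd n" for n
    proof -
      have "I \<le> (LINT x|M. (1 + t) * norm (f n x) ^ 2 + (1 + 1 / t) * norm (f n x - g x) ^ 2)"
        unfolding I_def
      proof (rule integral_mono)
        show "norm (g x) ^ 2 \<le> (1 + t) * norm (f n x) ^ 2 + (1 + 1 / t) * norm (f n x - g x) ^ 2" for x
          using norm_square_perturb[OF t, of "g x" "f n x"] by (simp add: norm_minus_commute)
      qed (use f2[of n] di[of n] g2 in auto)
      then show ?thesis using f2[of n] di[of n] by (simp add: dd_def)
    qed
    have b: "(LINT x|M. norm (f n x) ^ 2) \<le> (1 + t) * I + (1 + 1 / t) * dd n" for n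
    proof -
      have "(LINT x|M. norm (f n x) ^ 2) \<le> (LINT x|M. (1 + t) * norm (g x) ^ 2 + (1 + 1 / t) * norm (f n x - g x) ^ 2)"
      proof (rule integral_mono)
        show "norm (f n x) ^ 2 \<le> (1 + t) * norm (g x) ^ 2 + (1 + 1 / t) * norm (f n x - g x) ^ 2" for x
          using norm_square_perturb[OF t, of "f n x" "g x"] .
      qed (use f2[of n] di[of n] g2 in auto)
      then show ?thesis using g2 di[of n] by (simp add: dd_def I_def)
    qed
    have "(\<lambda>n. (1 + t) * (LINT x|M. norm (f n x) ^ 2) + (1 + 1 / t) * dd n) \<longlonglongrightarrow> (1 + t) * L + (1 + 1 / t) * 0"
      by (intro tendsto_intros lim dd0)
    then show "I \<le> (1 + t) * L" using a by (intro LIMSEQ_le_const[of _ "(1 + t) * L"]) auto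
    have "(\<lambda>n. (1 + t) * I + (1 + 1 / t) * dd n) \<longlonglongrightarrow> (1 + t) * I + (1 + 1 / t) * 0"
      by (intro tendsto_intros dd0)
    then show "L \<le> (1 + t) * I" using b by (intro LIMSEQ_le[OF lim, of _ "(1 + t) * I"]) auto
  qed
  have ta: "((\<lambda>t. (1 + t) * c) \<longlongrightarrow> (1 + 0) * c) (at_right 0)" for c :: real
    by (intro tendsto_intros)
  have "I \<le> (1 + 0) * L"
    by (rule tendsto_lowerbound[OF ta]) (use both(1) in \<open>auto simp: eventually_at_right_less intro!: eventually_at_rightI[of 0 1]\<close>)
  moreover have "L \<le> (1 + 0) * I"
    by (rule tendsto_lowerbound[OF ta]) (use both(2) in \<open>auto simp: eventually_at_right_less intro!: eventually_at_rightI[of 0 1]\<close>)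
  ultimately show "(LINT x|M. norm (g x) ^ 2) = L" by (simp add: I_def)
qed

text \<open>
  The truncated operators form a Cauchy family: by \<open>norm_diff_avg_square\<close> the distance of two of
  them is an integral of \<^const>\<open>sq_modulus\<close> against a combination of cross kernels whose limits
  cancel, and dominated convergence applies because every cross kernel is bounded by the kernel of
  the Gagliardo seminorm.
\<close>

lemma truncated_operators_converge:
  fixes u :: "R3 \<Rightarrow> 'k :: euclidean_space"
  assumes s: "0 < s" "s < 1" and u: "u \<in> Hs s"
  shows "\<exists>D \<in> borel_measurable borel. integrable lborel (\<lambda>x. norm (D x) ^ 2) \<and>
    (LINT x|lborel. norm (D x) ^ 2) = cross_const s / 2 * gag s u \<and>
    (\<forall>e>0. \<exists>N. \<forall>n\<ge>N. (\<integral>\<^sup>+x. ennreal (norm (diff_avg (trunc_ker s (1 / real (Suc n))) u x - D x) ^ 2) \<partial>lborel) \<le> ennreal e)"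
proof -
  let ?G = "sq_modulus u"
  note h = HsD[OF u]
  note G = sq_modulus_props[OF h(1,2)]
  have um[measurable]: "u \<in> borel_measurable borel" by (rule h)
  have Gm[measurable]: "sq_modulus u \<in> borel_measurable borel" by (rule G)
  obtain C where C: "C > 0" "\<And>t j z. t > 0 \<Longrightarrow> j > 0 \<Longrightarrow> z \<noteq> 0 \<Longrightarrow>
     \<bar>cross_ker s t j z\<bar> \<le> C * norm z powr (- (3 + 2 * s)) \<and>
     \<bar>cross_ker s t j z - cross_const s * norm z powr (- (3 + 2 * s))\<bar>
       \<le> C * max t j powr (1 - s) * norm z powr (- (4 + s))"
    using cross_ker_asymptotics[OF s] by blast
  define t where "t n = 1 / real (Suc n)" for n
  have e0: "t n > 0" for n by (simp add: t_def)
  let ?c = "\<lambda>n. cross_ker s (t n) (t n)"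
  have emono: "t m \<le> t n" if "n \<le> m" for m n using that by (simp add: t_def field_simps)
  define K where "K n = trunc_ker s (t n)" for n
  have Kint: "integrable lborel (K n)" for n unfolding K_def by (rule trunc_ker_integrable[OF s(1) e0])
  have Keven: "K n (- z) = K n z" for n z by (simp add: K_def trunc_ker_even)
  have Km[measurable]: "K n \<in> borel_measurable borel" for n by (simp add: K_def)
  define P where "P z = norm z powr (- (3 + 2 * s))" for z :: R3
  define q where "q N z = min ((C + \<bar>cross_const s\<bar>) * P z) (C * t N powr (1 - s) * norm z powr (- (4 + s)))" for N and z :: R3
  define J where "J N = (LINT z|lborel. ?G z * q N z)" for N
  have q0: "0 \<le> q N z" for N z using C(1) by (simp add: q_def P_def)
  have qP: "q N z \<le> (C + \<bar>cross_const s\<bar>) * P z" for N z by (simp add: q_def)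
  have qm[measurable]: "q N \<in> borel_measurable borel" for N unfolding q_def P_def by measurable
  have GP: "integrable lborel (\<lambda>z. ?G z * P z)" unfolding P_def by (rule gag_via_modulus(1)[OF u])
  have maj: "integrable lborel (\<lambda>z. (C + \<bar>cross_const s\<bar>) * (?G z * P z))" using GP by simp
  have Gq: "integrable lborel (\<lambda>z. ?G z * q N z)" for N
  proof (rule integrable_majorant_nonneg[OF maj])
    show "?G z * q N z \<le> (C + \<bar>cross_const s\<bar>) * (?G z * P z)" for z
      using mult_left_mono[OF qP G(2)] by (simp add: mult_ac P_def)
  qed (use G(2) q0 in auto)
  have Jlim: "J \<longlonglongrightarrow> 0"
  proof -
    have "(\<lambda>N. LINT z|lborel. ?G z * q N z) \<longlonglongrightarrow> (LINT z|(lborel :: R3 measure). 0)"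
    proof (rule integral_dominated_convergence[OF _ _ maj])
      have "t \<longlonglongrightarrow> 0" unfolding t_def using LIMSEQ_inverse_real_of_nat by (simp add: inverse_eq_divide)
      then have "(\<lambda>N. t N powr (1 - s)) \<longlonglongrightarrow> 0 powr (1 - s)"
        using s e0 by (intro tendsto_powr2 tendsto_const always_eventually) (auto intro: less_imp_le)
      then have ep: "(\<lambda>N. t N powr (1 - s)) \<longlonglongrightarrow> 0" by simp
      show "AE z in lborel. (\<lambda>N. ?G z * q N z) \<longlonglongrightarrow> 0"
      proof (rule AE_I2)
        fix z :: R3
        have up: "(\<lambda>N. C * t N powr (1 - s) * norm z powr (- (4 + s))) \<longlonglongrightarrow> C * 0 * norm z powr (- (4 + s))"
          by (intro tendsto_intros ep)
        have "(\<lambda>N. q N z) \<longlonglongrightarrow> 0"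
        proof (rule tendsto_sandwich[OF _ _ tendsto_const])
          show "(\<lambda>N. C * t N powr (1 - s) * norm z powr (- (4 + s))) \<longlonglongrightarrow> 0" using up by simp
          show "\<forall>\<^sub>F N in sequentially. 0 \<le> q N z" by (intro always_eventually allI q0)
          show "\<forall>\<^sub>F N in sequentially. q N z \<le> C * t N powr (1 - s) * norm z powr (- (4 + s))"
            by (intro always_eventually allI) (simp add: q_def)
        qed
        then have "(\<lambda>N. ?G z * q N z) \<longlonglongrightarrow> ?G z * 0" by (intro tendsto_intros)
        then show "(\<lambda>N. ?G z * q N z) \<longlonglongrightarrow> 0" by simp
      qed
      show "AE z in lborel. norm (?G z * q N z) \<le> (C + \<bar>cross_const s\<bar>) * (?G z * P z)" for N
      proof (rule AE_I2)
        fix z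
        have "?G z * q N z \<le> ?G z * ((C + \<bar>cross_const s\<bar>) * P z)"
          by (rule mult_left_mono[OF qP G(2)])
        then show "norm (?G z * q N z) \<le> (C + \<bar>cross_const s\<bar>) * (?G z * P z)"
          using G(2)[of z] q0[of N z] by (simp add: abs_mult mult_ac)
      qed
    qed measurable
    then show ?thesis unfolding J_def[abs_def] by simp
  qed
  have cross: "\<bar>cross_ker s (t m) (t n) z - cross_const s * P z\<bar> \<le> q N z"
    if "m \<ge> N" "n \<ge> N" "z \<noteq> 0" for m n N z
  proof -
    have mx: "0 \<le> max (t m) (t n)" "max (t m) (t n) \<le> t N" using that e0[of m] by (auto intro: emono simp: max_def)
    note c = C(2)[OF e0 e0 that(3), of m n, folded P_def]
    have "\<bar>cross_ker s (t m) (t n) z - cross_const s * P z\<bar> \<le> C * P z + \<bar>cross_const s * P z\<bar>"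
      using c by linarith
    then have a: "\<bar>cross_ker s (t m) (t n) z - cross_const s * P z\<bar> \<le> (C + \<bar>cross_const s\<bar>) * P z"
      by (simp add: abs_mult P_def distrib_right)
    have "C * max (t m) (t n) powr (1 - s) * norm z powr (- (4 + s)) \<le> C * t N powr (1 - s) * norm z powr (- (4 + s))"
      using mx s C(1) by (intro mult_right_mono mult_left_mono powr_mono2) auto
    with c have b: "\<bar>cross_ker s (t m) (t n) z - cross_const s * P z\<bar> \<le> C * t N powr (1 - s) * norm z powr (- (4 + s))"
      by linarith
    show ?thesis using a b by (simp add: q_def)
  qed
  define f where "f n = diff_avg (K n) u" for n
  have fm[measurable]: "f n \<in> borel_measurable borel" for n unfolding f_def diff_avg_def[abs_def] by measurable
  note fsq = norm_diff_avg_square[OF h(1,2) Kint Keven, folded f_def]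
  have nz: "AE z in (lborel :: R3 measure). z \<noteq> 0" by (rule AE_lborel_singleton)
  have KK: "integrable lborel (\<lambda>w. K m w * K n (z - w))" for m n z
  proof (rule integrable_majorant_nonneg)
    show "integrable lborel (\<lambda>w. K m w * t n powr (- (3 + s)))" using Kint by simp
  qed (use trunc_ker_le_delta[OF s(1) e0] in \<open>auto simp: K_def trunc_ker_nonneg intro!: mult_left_mono\<close>)
  have crossE: "cross_ker s (t m) (t n) z = (LINT w|lborel. K n w) * K m z + (LINT w|lborel. K m w) * K n z
      - (LINT w|lborel. K m w * K n (z - w))" for m n z
    by (simp add: cross_ker_def K_def)
  have Cauchy: "(\<integral>\<^sup>+x. ennreal (norm (f m x - f n x) ^ 2) \<partial>lborel) \<le> ennreal (2 * J N)"
    if mn: "m \<ge> N" "n \<ge> N" for m n N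
  proof -
    define k where "k z = K m z - K n z" for z
    have k: "integrable lborel k" unfolding k_def using Kint by simp
    have keven: "k (- z) = k z" for z by (simp add: k_def Keven)
    define mk where "mk z = 2 * (LINT w|lborel. k w) * k z - (LINT w|lborel. k w * k (z - w))" for z
    note d = norm_diff_avg_square[OF h(1,2) k keven, folded mk_def]
    have mkE: "mk z = cross_ker s (t m) (t m) z + ?c n z - 2 * cross_ker s (t m) (t n) z" for z
    proof -
      have sw: "(LINT w|lborel. K n w * K m (z - w)) = (LINT w|lborel. K m w * K n (z - w))"
      proof -
        have "(LINT w|lborel. K n w * K m (z - w)) = (LINT w|lborel. K n (z - w) * K m (z - (z - w)))"
          by (rule integral_lborel_shift(4)[symmetric]) measurable
        then show ?thesis by (simp add: mult.commute)
      qed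
      have "(LINT w|lborel. k w * k (z - w)) = (LINT w|lborel. (K m w * K m (z - w) + K n w * K n (z - w))
          - (K m w * K n (z - w) + K n w * K m (z - w)))"
        by (simp add: k_def algebra_simps)
      also have "\<dots> = (LINT w|lborel. K m w * K m (z - w)) + (LINT w|lborel. K n w * K n (z - w))
          - 2 * (LINT w|lborel. K m w * K n (z - w))"
        using KK sw by simp
      finally have c1: "(LINT w|lborel. k w * k (z - w)) = (LINT w|lborel. K m w * K m (z - w)) + (LINT w|lborel. K n w * K n (z - w))
          - 2 * (LINT w|lborel. K m w * K n (z - w))" .
      have c2: "(LINT w|lborel. k w) = (LINT w|lborel. K m w) - (LINT w|lborel. K n w)"
        unfolding k_def using Kint by simp
      show ?thesis unfolding mk_def crossE c1 c2 by (simp add: k_def algebra_simps)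
    qed
    have mkb: "\<bar>mk z\<bar> \<le> 4 * q N z" if "z \<noteq> 0" for z
      unfolding mkE using cross[OF mn(1) mn(1) that] cross[OF mn(2) mn(2) that] cross[OF mn that] by linarith
    have "AE x in lborel. f m x - f n x = diff_avg k u x"
      using fsq(4)[of m] fsq(4)[of n]
    proof eventually_elim
      case (elim x)
      have "f m x - f n x = (LINT z|lborel. K m z *\<^sub>R (u x - u (x - z)) - K n z *\<^sub>R (u x - u (x - z)))"
        unfolding f_def diff_avg_def using elim by simp
      then show ?case by (simp add: diff_avg_def k_def scaleR_diff_left)
    qed
    then have "(\<integral>\<^sup>+x. ennreal (norm (f m x - f n x) ^ 2) \<partial>lborel) = (\<integral>\<^sup>+x. ennreal (norm (diff_avg k u x) ^ 2) \<partial>lborel)"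
      by (intro nn_integral_cong_AE) auto
    also have "\<dots> = ennreal (LINT x|lborel. norm (diff_avg k u x) ^ 2)"
      by (rule nn_integral_eq_integral[OF d(1)]) simp
    also have "(LINT x|lborel. norm (diff_avg k u x) ^ 2) = (LINT z|lborel. ?G z * mk z) / 2" by (rule d(3))
    also have "(LINT z|lborel. ?G z * mk z) \<le> (LINT z|lborel. 4 * (?G z * q N z))"
    proof (rule integral_mono_AE[OF d(2)])
      show "integrable lborel (\<lambda>z. 4 * (?G z * q N z))" using Gq by simp
      show "AE z in lborel. ?G z * mk z \<le> 4 * (?G z * q N z)"
        using nz
      proof eventually_elim
        case (elim z)
        have "?G z * mk z \<le> ?G z * (4 * q N z)"
          using mkb[OF elim] by (intro mult_left_mono G(2)) linarith
        then show ?case by simp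
      qed
    qed
    also have "\<dots> = 4 * J N" by (simp add: J_def)
    finally show ?thesis by (simp add: ennreal_leI)
  qed
  obtain D r where D: "D \<in> borel_measurable lborel"
    "\<And>e. e > 0 \<Longrightarrow> \<exists>N. \<forall>n\<ge>N. (\<integral>\<^sup>+x. ennreal (norm (f n x - D x) ^ 2) \<partial>lborel) \<le> ennreal e"
  proof (rule L2_complete[of f lborel])
    show "f n \<in> borel_measurable lborel" for n by simp
    fix e :: real assume e: "e > 0"
    have "eventually (\<lambda>N. J N < e / 2) sequentially" using Jlim e by (intro order_tendstoD) auto
    then obtain N where N: "J N < e / 2" by (auto simp: eventually_sequentially)
    show "\<exists>N. \<forall>m\<ge>N. \<forall>n\<ge>N. (\<integral>\<^sup>+x. ennreal (norm (f m x - f n x) ^ 2) \<partial>lborel) \<le> ennreal e"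
    proof (intro exI[of _ N] allI impI)
      fix m n assume "m \<ge> N" "n \<ge> N"
      from Cauchy[OF this] show "(\<integral>\<^sup>+x. ennreal (norm (f m x - f n x) ^ 2) \<partial>lborel) \<le> ennreal e"
        by (rule order_trans) (use N in \<open>auto intro: ennreal_leI\<close>)
    qed
  qed blast
  have lim: "(\<lambda>n. LINT x|lborel. norm (f n x) ^ 2) \<longlonglongrightarrow> cross_const s / 2 * gag s u"
  proof -
    have eq: "(LINT x|lborel. norm (f n x) ^ 2) = (LINT z|lborel. ?G z * ?c n z) / 2"
      and int: "integrable lborel (\<lambda>z. ?G z * ?c n z)" for n
    proof -
      have cEE: "?c n z = 2 * (LINT w|lborel. K n w) * K n z - (LINT w|lborel. K n w * K n (z - w))" for z
        by (simp add: crossE)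
      show "(LINT x|lborel. norm (f n x) ^ 2) = (LINT z|lborel. ?G z * ?c n z) / 2"
        unfolding cEE by (rule fsq(3))
      show "integrable lborel (\<lambda>z. ?G z * ?c n z)"
        unfolding cEE by (rule fsq(2))
    qed
    have "\<bar>(LINT z|lborel. ?G z * ?c n z) - cross_const s * gag s u\<bar> \<le> J n" for n
    proof -
      have "(LINT z|lborel. ?G z * ?c n z) - cross_const s * gag s u
          = (LINT z|lborel. ?G z * ?c n z - cross_const s * (?G z * P z))"
        using int[of n] GP gag_via_modulus(2)[OF u] by (simp add: P_def)
      also have "\<bar>\<dots>\<bar> \<le> (LINT z|lborel. \<bar>?G z * ?c n z - cross_const s * (?G z * P z)\<bar>)"
        by (rule integral_abs_bound)
      also have "\<dots> \<le> (LINT z|lborel. ?G z * q n z)"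
      proof (rule integral_mono_AE)
        show "AE z in lborel. \<bar>?G z * ?c n z - cross_const s * (?G z * P z)\<bar> \<le> ?G z * q n z"
          using nz
        proof eventually_elim
          case (elim z)
          have "\<bar>?G z * ?c n z - cross_const s * (?G z * P z)\<bar>
              = ?G z * \<bar>?c n z - cross_const s * P z\<bar>"
          proof -
            have "?G z * ?c n z - cross_const s * (?G z * P z)
              = ?G z * (?c n z - cross_const s * P z)" by (simp add: algebra_simps)
            then show ?thesis using G(2)[of z] by (simp add: abs_mult)
          qed
          also have "\<dots> \<le> ?G z * q n z"
            by (intro mult_left_mono G(2) cross elim order_refl)
          finally show ?case .
        qed
      qed (use int[of n] GP Gq in auto)
      finally show ?thesis by (simp add: J_def)
    qed
    then have "(\<lambda>n. (LINT z|lborel. ?G z * ?c n z) - cross_const s * gag s u) \<longlonglongrightarrow> 0"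
      by (intro Lim_null_comparison[OF _ Jlim]) auto
    then have "(\<lambda>n. (LINT z|lborel. ?G z * ?c n z)) \<longlonglongrightarrow> cross_const s * gag s u"
      by (rule LIM_zero_cancel)
    then have "(\<lambda>n. (LINT z|lborel. ?G z * ?c n z) / 2) \<longlonglongrightarrow> cross_const s * gag s u / 2"
      by (intro tendsto_divide tendsto_const) auto
    then show ?thesis unfolding eq by simp
  qed
  note res = L2_norm_limit[of f lborel D, OF _ D(1) _ lim D(2)]
  show ?thesis
  proof (intro bexI[of _ D] conjI)
    show "D \<in> borel_measurable borel" using D(1) by simp
    show "integrable lborel (\<lambda>x. norm (D x) ^ 2)" using fsq(1) by (intro res) auto
    show "(LINT x|lborel. norm (D x) ^ 2) = cross_const s / 2 * gag s u" using fsq(1) by (intro res) auto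
    show "\<forall>e>0. \<exists>N. \<forall>n\<ge>N. (\<integral>\<^sup>+x. ennreal (norm (diff_avg (trunc_ker s (1 / real (Suc n))) u x - D x) ^ 2) \<partial>lborel) \<le> ennreal e"
      using D(2) unfolding f_def K_def t_def by blast
  qed
qed

section \<open>Pointwise convergence of the truncated integrals\<close>

lemma integrable_kernel_difference:
  fixes u :: "R3 \<Rightarrow> 'k :: euclidean_space"
  assumes [measurable]: "u \<in> borel_measurable borel" and u2: "integrable lborel (\<lambda>x. norm (u x) ^ 2)"
    and k: "integrable lborel k" and kB: "\<And>z. \<bar>k z\<bar> \<le> B"
  shows "integrable lborel (\<lambda>z. k z *\<^sub>R (u x - u (x - z)))"
proof (rule integrable_dominated)
  have [measurable]: "k \<in> borel_measurable borel" using k by (auto dest: borel_measurable_integrable)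
  have sh: "integrable lborel (\<lambda>z. norm (u (x - z)) ^ 2)"
    using integral_lborel_shift(9)[of "\<lambda>x. norm (u x) ^ 2" x] u2 by simp
  show "integrable lborel (\<lambda>z. (norm (u x) + 1) * \<bar>k z\<bar> + B * norm (u (x - z)) ^ 2)"
    using k sh by simp
  show "(\<lambda>z. k z *\<^sub>R (u x - u (x - z))) \<in> borel_measurable lborel" by measurable
  show "AE z in lborel. norm (k z *\<^sub>R (u x - u (x - z))) \<le> norm ((norm (u x) + 1) * \<bar>k z\<bar> + B * norm (u (x - z)) ^ 2)"
  proof (rule AE_I2)
    fix z
    have t: "t \<le> 1 + t ^ 2" for t :: real using zero_le_power2[of "t - 1/2"] by (simp add: power2_eq_square algebra_simps)
    have "norm (u x - u (x - z)) \<le> norm (u x) + (1 + norm (u (x - z)) ^ 2)"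
      using norm_triangle_ineq4[of "u x" "u (x - z)"] t[of "norm (u (x - z))"] by linarith
    then have "\<bar>k z\<bar> * norm (u x - u (x - z)) \<le> \<bar>k z\<bar> * (norm (u x) + (1 + norm (u (x - z)) ^ 2))"
      by (intro mult_left_mono) auto
    also have "\<dots> = (norm (u x) + 1) * \<bar>k z\<bar> + \<bar>k z\<bar> * norm (u (x - z)) ^ 2" by (simp add: algebra_simps)
    also have "\<dots> \<le> (norm (u x) + 1) * \<bar>k z\<bar> + B * norm (u (x - z)) ^ 2"
      using kB[of z] by (intro add_left_mono mult_right_mono) auto
    finally show "norm (k z *\<^sub>R (u x - u (x - z))) \<le> norm ((norm (u x) + 1) * \<bar>k z\<bar> + B * norm (u (x - z)) ^ 2)"
      by simp
  qed
qed

lemma convolution_integrable: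
  fixes f k :: "R3 \<Rightarrow> real"
  assumes f: "integrable lborel f" and k: "integrable lborel k" and kB: "\<And>z. \<bar>k z\<bar> \<le> B"
  shows "integrable lborel (\<lambda>y. f y * k (z - y))"
    and "integrable lborel (\<lambda>z. LINT y|lborel. \<bar>f y * k (z - y)\<bar>)"
    and "(LINT y|lborel. \<bar>f y * k (z - y)\<bar>) \<le> B * (LINT y|lborel. \<bar>f y\<bar>)"
proof -
  have [measurable]: "f \<in> borel_measurable borel" "k \<in> borel_measurable borel"
    using f k by (auto dest: borel_measurable_integrable)
  have fB: "integrable lborel (\<lambda>y. B * \<bar>f y\<bar>)" using f by simp
  have le: "\<bar>f y * k (z - y)\<bar> \<le> B * \<bar>f y\<bar>" for y z
    using mult_left_mono[OF kB[of "z - y"], of "\<bar>f y\<bar>"] by (simp add: abs_mult mult.commute)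
  show int: "integrable lborel (\<lambda>y. f y * k (z - y))" for z
    by (rule integrable_dominated[OF fB]) (auto intro!: AE_I2 order_trans[OF le])
  have "(LINT y|lborel. \<bar>f y * k (z - y)\<bar>) \<le> (LINT y|lborel. B * \<bar>f y\<bar>)"
    using int fB le by (intro integral_mono) auto
  then show "(LINT y|lborel. \<bar>f y * k (z - y)\<bar>) \<le> B * (LINT y|lborel. \<bar>f y\<bar>)" by simp
  have "integrable lborel2 (\<lambda>(y, z). \<bar>f y * k (z - y)\<bar>)"
  proof (rule lborel_pair.Fubini_integrable)
    have sh: "(LINT z|lborel. \<bar>f y * k (z - y)\<bar>) = \<bar>f y\<bar> * (LINT z|lborel. \<bar>k z\<bar>)" for y
      using integral_lborel_shift(3)[of "\<lambda>z. \<bar>k z\<bar>" y] by (simp add: abs_mult)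
    have "integrable lborel (\<lambda>y. \<bar>f y\<bar> * (LINT z|lborel. \<bar>k z\<bar>))" using f by simp
    then show "integrable lborel (\<lambda>y. LINT z|lborel. norm (case (y, z) of (y, z) \<Rightarrow> \<bar>f y * k (z - y)\<bar>))"
      using sh by simp
    show "AE y in lborel. integrable lborel (\<lambda>z. case (y, z) of (y, z) \<Rightarrow> \<bar>f y * k (z - y)\<bar>)"
    proof (rule AE_I2)
      fix y
      show "integrable lborel (\<lambda>z. case (y, z) of (y, z) \<Rightarrow> \<bar>f y * k (z - y)\<bar>)"
        using integral_lborel_shift(8)[of "\<lambda>z. f y * k z" y] k by simp
    qed
  qed measurable
  from lborel_pair.integrable_snd[OF this]
  show "integrable lborel (\<lambda>z. LINT y|lborel. \<bar>f y * k (z - y)\<bar>)" .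
qed

text \<open>
  By Fubini's theorem, convolving such an operator with \<open>f\<close> gives an operator of the same form, with
  kernel \<open>f * k\<close> minus \<open>f\<close> times the mass of \<open>k\<close>.
\<close>

lemma mollified_diff_avg:
  fixes u :: "R3 \<Rightarrow> 'k :: euclidean_space"
  assumes um[measurable]: "u \<in> borel_measurable borel" and u2: "integrable lborel (\<lambda>x. norm (u x) ^ 2)"
    and k: "integrable lborel k" and kB: "\<And>z. \<bar>k z\<bar> \<le> B"
    and f: "integrable lborel f" and fB: "\<And>z. \<bar>f z\<bar> \<le> B'"
  shows "(LINT y|lborel. f y *\<^sub>R diff_avg k u (x - y))
     = (LINT z|lborel. ((LINT y|lborel. f y * k (z - y)) - (LINT w|lborel. k w) * f z) *\<^sub>R (u x - u (x - z)))"
    and "integrable lborel (\<lambda>z. ((LINT y|lborel. f y * k (z - y)) - (LINT w|lborel. k w) * f z) *\<^sub>R (u x - u (x - z)))"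
proof -
  have [measurable]: "f \<in> borel_measurable borel" "k \<in> borel_measurable borel"
    using f k by (auto dest: borel_measurable_integrable)
  define A where "A = (LINT w|lborel. k w)"
  define a where "a z = u x - u (x - z)" for z
  have am[measurable]: "a \<in> borel_measurable borel" unfolding a_def by measurable
  note conv = convolution_integrable[OF f k kB]
  define p where "p z = (LINT y|lborel. f y * k (z - y))" for z
  define pa where "pa z = (LINT y|lborel. \<bar>f y * k (z - y)\<bar>)" for z
  have pa: "integrable lborel pa" unfolding pa_def by (rule conv)
  have paB: "\<bar>pa z\<bar> \<le> B * (LINT y|lborel. \<bar>f y\<bar>)" for z
    using conv(3)[of z] unfolding pa_def by (subst abs_of_nonneg) auto
  have pint: "integrable lborel p"
  proof (rule integrable_dominated[OF pa])
    show "AE z in lborel. norm (p z) \<le> norm (pa z)"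
      unfolding p_def pa_def by (auto intro!: AE_I2 order_trans[OF integral_abs_bound])
  qed (simp add: p_def[abs_def])
  have pB: "\<bar>p z\<bar> \<le> B * (LINT y|lborel. \<bar>f y\<bar>)" for z
    unfolding p_def by (rule order_trans[OF integral_abs_bound conv(3)])
  have ip: "integrable lborel (\<lambda>z. p z *\<^sub>R a z)"
    unfolding a_def by (rule integrable_kernel_difference[OF um u2 pint pB])
  have ipa: "integrable lborel (\<lambda>z. pa z *\<^sub>R a z)"
    unfolding a_def by (rule integrable_kernel_difference[OF um u2 pa paB])
  have if': "integrable lborel (\<lambda>z. f z *\<^sub>R a z)"
    unfolding a_def by (rule integrable_kernel_difference[OF um u2 f fB])
  have Hint: "integrable lborel2 (\<lambda>(z, y). (f y * k (z - y)) *\<^sub>R a z)"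
  proof (rule lborel_pair.Fubini_integrable)
    have eq: "norm (pa z *\<^sub>R a z) = (LINT y|lborel. norm ((f y * k (z - y)) *\<^sub>R a z))" for z
    proof -
      have "0 \<le> pa z" unfolding pa_def by simp
      then show ?thesis by (simp add: pa_def)
    qed
    show "integrable lborel (\<lambda>z. LINT y|lborel. norm (case (z, y) of (z, y) \<Rightarrow> (f y * k (z - y)) *\<^sub>R a z))"
      using integrable_norm[OF ipa] unfolding eq prod.case .
    show "AE z in lborel. integrable lborel (\<lambda>y. case (z, y) of (z, y) \<Rightarrow> (f y * k (z - y)) *\<^sub>R a z)"
      using conv(1) by simp
  qed measurable
  have inner: "f y *\<^sub>R diff_avg k u (x - y) = (LINT z|lborel. (f y * k (z - y)) *\<^sub>R a z) - (A * f y) *\<^sub>R a y" for y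
  proof -
    have i1: "integrable lborel (\<lambda>w. k w *\<^sub>R (u (x - y) - u (x - y - w)))"
      by (rule integrable_kernel_difference[OF um u2 k kB])
    have i3: "integrable lborel (\<lambda>w. k w *\<^sub>R a y)" using k by simp
    have ksum: "k w *\<^sub>R a (y + w) = k w *\<^sub>R (u (x - y) - u (x - y - w)) + k w *\<^sub>R a y" for w
      by (simp add: a_def scaleR_add_right[symmetric] diff_diff_eq add.commute)
    have i2: "integrable lborel (\<lambda>w. k w *\<^sub>R a (y + w))" unfolding ksum using i1 i3 by simp
    have "diff_avg k u (x - y) = (LINT w|lborel. k w *\<^sub>R a (y + w) - k w *\<^sub>R a y)"
      unfolding diff_avg_def ksum by simp
    also have "\<dots> = (LINT w|lborel. k w *\<^sub>R a (y + w)) - A *\<^sub>R a y"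
      using i2 i3 k by (simp add: A_def)
    also have "(LINT w|lborel. k w *\<^sub>R a (y + w)) = (LINT z|lborel. k (z - y) *\<^sub>R a z)"
      using integral_lborel_shift(3)[of "\<lambda>w. k w *\<^sub>R a (y + w)" y] by simp
    finally have "f y *\<^sub>R diff_avg k u (x - y) = f y *\<^sub>R (LINT z|lborel. k (z - y) *\<^sub>R a z) - (A * f y) *\<^sub>R a y"
      by (simp add: scaleR_diff_right mult.commute)
    also have "f y *\<^sub>R (LINT z|lborel. k (z - y) *\<^sub>R a z) = (LINT z|lborel. f y *\<^sub>R (k (z - y) *\<^sub>R a z))"
      by (rule integral_scaleR_right[symmetric])
    finally show ?thesis by simp
  qed
  have Hint': "integrable lborel2 (\<lambda>(y, z). (f y * k (z - y)) *\<^sub>R a z)"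
    using lborel_pair.integrable_product_swap[OF Hint] by (simp add: case_prod_beta')
  have iy: "integrable lborel (\<lambda>y. LINT z|lborel. (f y * k (z - y)) *\<^sub>R a z)"
    using lborel_pair.integrable_fst[OF Hint'] by simp
  have "(LINT y|lborel. f y *\<^sub>R diff_avg k u (x - y))
      = (LINT y|lborel. LINT z|lborel. (f y * k (z - y)) *\<^sub>R a z) - (LINT y|lborel. (A * f y) *\<^sub>R a y)"
    unfolding inner using iy if' by (simp add: scaleR_scaleR[symmetric] del: scaleR_scaleR)
  also have "(LINT y|lborel. LINT z|lborel. (f y * k (z - y)) *\<^sub>R a z) = (LINT z|lborel. LINT y|lborel. (f y * k (z - y)) *\<^sub>R a z)"
    by (rule lborel_pair.Fubini_integral[OF Hint])
  also have "\<dots> = (LINT z|lborel. p z *\<^sub>R a z)"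
    using conv(1) by (simp add: p_def)
  also have "(LINT z|lborel. p z *\<^sub>R a z) - (LINT y|lborel. (A * f y) *\<^sub>R a y) = (LINT z|lborel. (p z - A * f z) *\<^sub>R a z)"
    using ip if' by (simp add: scaleR_diff_left scaleR_scaleR[symmetric] del: scaleR_scaleR)
  finally show "(LINT y|lborel. f y *\<^sub>R diff_avg k u (x - y))
     = (LINT z|lborel. ((LINT y|lborel. f y * k (z - y)) - (LINT w|lborel. k w) * f z) *\<^sub>R (u x - u (x - z)))"
    by (simp add: p_def A_def a_def)
  have "integrable lborel (\<lambda>z. (p z - A * f z) *\<^sub>R a z)"
    using ip if' by (simp add: scaleR_diff_left scaleR_scaleR[symmetric] del: scaleR_scaleR)
  then show "integrable lborel (\<lambda>z. ((LINT y|lborel. f y * k (z - y)) - (LINT w|lborel. k w) * f z) *\<^sub>R (u x - u (x - z)))"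
    by (simp add: p_def A_def a_def)
qed

lemma sum_Basis_nth[simp]: "(\<Sum>x\<in>(Basis :: R3 set). x $ i) = 1"
proof -
  have ax: "axis i (1 :: real) \<in> Basis" by (simp add: axis_in_Basis_iff)
  have "(\<Sum>x\<in>(Basis :: R3 set). x $ i) = (\<Sum>x\<in>Basis. 1 *\<^sub>R x) \<bullet> axis i (1 :: real)"
    unfolding inner_sum_left by (simp add: cart_eq_inner_axis)
  also have "\<dots> = 1" by (rule inner_sum_left_Basis[OF ax])
  finally show ?thesis .
qed

text \<open>
  The profile of a Lipschitz mollifier. It is supported in the cube \<open>[-1, 0]\<^sup>3\<close>, so that the
  mollification at \<open>x\<close> averages over a cube with corner \<open>x\<close>; for such cubes Lebesgue's
  differentiation theorem is available.
\<close>

definition tent :: "R3 \<Rightarrow> real" where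
  "tent y = max 0 (1 / 2 - norm (y + (1 / 2) *\<^sub>R One))"

definition tent_mass :: real where "tent_mass = (LINT y|lborel. tent y)"

definition mollifier :: "real \<Rightarrow> R3 \<Rightarrow> real" where
  "mollifier e y = tent (y /\<^sub>R e) / (tent_mass * e ^ 3)"

lemma tent_measurable[measurable]: "tent \<in> borel_measurable borel"
  unfolding tent_def[abs_def] by measurable

lemma tent_bounds: "0 \<le> tent y" "tent y \<le> 1 / 2"
  by (auto simp: tent_def max_def)

lemma tent_lipschitz: "\<bar>tent y - tent y'\<bar> \<le> norm (y - y')"
  using norm_triangle_ineq3[of "y + (1 / 2) *\<^sub>R One" "y' + (1 / 2) *\<^sub>R One"] by (auto simp: tent_def max_def)

lemma tent_support:
  assumes "tent y \<noteq> 0"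
  shows "norm y < 2" "y \<in> cbox (- One) 0"
proof -
  have n: "norm (y + (1 / 2) *\<^sub>R One) < 1 / 2" using assms by (auto simp: tent_def)
  have c: "\<bar>y $ i + 1 / 2\<bar> < 1 / 2" for i
    using order_le_less_trans[OF component_le_norm_cart n, of i] by simp
  have b: "-1 < y $ i \<and> y $ i < 0" for i using c[of i] by (simp add: abs_less_iff field_simps)
  then show "y \<in> cbox (- One) 0" by (auto simp: mem_box_cart intro: less_imp_le)
  have "norm ((1 / 2) *\<^sub>R One :: R3) \<le> 1"
  proof -
    have "norm (One :: R3) ^ 2 = 3" by (simp add: norm_vec_def L2_set_def sum_3)
    then have "norm (One :: R3) = sqrt 3" by (metis norm_ge_zero real_sqrt_unique)
    moreover have "sqrt 3 \<le> (2 :: real)" by (rule real_le_lsqrt) auto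
    ultimately show ?thesis by simp
  qed
  moreover have "norm y \<le> norm (y + (1 / 2) *\<^sub>R One) + norm ((1 / 2) *\<^sub>R One :: R3)"
    using norm_triangle_ineq4[of "y + (1 / 2) *\<^sub>R One" "(1 / 2) *\<^sub>R One"] by simp
  ultimately show "norm y < 2" using n by linarith
qed

lemma tent_integrable: "integrable lborel tent"
proof -
  have "integrable lborel (\<lambda>y. (1 / 2 :: real) * indicator (ball (0 :: R3) 2) y)"
    by (intro integrable_mult_right integrable_real_indicator) (auto simp: emeasure_lborel_ball3)
  then show ?thesis
    by (rule integrable_dominated)
       (use tent_bounds tent_support(1) in \<open>force intro!: AE_I2 simp: indicator_def\<close>)+
qed

lemma tent_mass_pos: "tent_mass > 0"
proof -
  have "(1 / 4) * measure lborel (ball (- (1 / 2) *\<^sub>R One :: R3) (1 / 4))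
      = (LINT y|lborel. (1 / 4 :: real) * indicator (ball (- (1 / 2) *\<^sub>R One :: R3) (1 / 4)) y)"
    by simp
  also have "\<dots> \<le> tent_mass"
    unfolding tent_mass_def
  proof (rule integral_mono[OF _ tent_integrable])
    show "integrable lborel (\<lambda>y. (1 / 4 :: real) * indicator (ball (- (1 / 2) *\<^sub>R One :: R3) (1 / 4)) y)"
      by (intro integrable_mult_right integrable_real_indicator) (auto simp: emeasure_lborel_ball3)
    fix y :: R3
    have "1 / 4 \<le> tent y" if "y \<in> ball (- (1 / 2) *\<^sub>R One :: R3) (1 / 4)"
    proof -
      have "norm (y + (1 / 2) *\<^sub>R One) < 1 / 4"
        using that by (simp add: dist_norm norm_minus_commute)
      then show ?thesis by (simp add: tent_def)
    qed
    then show "(1 / 4 :: real) * indicator (ball (- (1 / 2) *\<^sub>R One :: R3) (1 / 4)) y \<le> tent y"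
      using tent_bounds by (auto simp: indicator_def)
  qed
  finally have "(1 / 4) * measure lborel (ball (- (1 / 2) *\<^sub>R One :: R3) (1 / 4)) \<le> tent_mass" .
  moreover have "measure lborel (ball (- (1 / 2) *\<^sub>R One :: R3) (1 / 4)) > 0"
    using content_ball_gt_0_iff[of "- (1 / 2) *\<^sub>R One :: R3" "1 / 4"] by simp
  ultimately show ?thesis by linarith
qed

lemma mollifier_props:
  assumes e: "h > 0"
  shows "mollifier h \<in> borel_measurable borel" "0 \<le> mollifier h y"
    and "mollifier h y \<le> 1 / (tent_mass * h ^ 3)"
    and "\<bar>mollifier h y - mollifier h y'\<bar> \<le> 1 / (tent_mass * h ^ 3) * min 1 (norm (y - y') / h)"
    and "mollifier h y \<noteq> 0 \<Longrightarrow> norm y < 2 * h"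
    and "mollifier h (x - v) \<noteq> 0 \<Longrightarrow> v \<in> cbox x (x + h *\<^sub>R One)"
    and "integrable lborel (mollifier h)" and "(LINT y|lborel. mollifier h y) = 1"
proof -
  have M: "tent_mass * h ^ 3 > 0" using e tent_mass_pos by simp
  show mm[measurable]: "mollifier h \<in> borel_measurable borel" unfolding mollifier_def[abs_def] by measurable
  have m2: "0 \<le> mollifier h y" for y using M tent_bounds by (auto simp: mollifier_def)
  show "0 \<le> mollifier h y" by (rule m2)
  have t1: "tent y \<le> 1" for y using tent_bounds(2)[of y] by simp
  show "mollifier h y \<le> 1 / (tent_mass * h ^ 3)" unfolding mollifier_def using M t1 by (intro divide_right_mono) auto
  have "\<bar>tent (y /\<^sub>R h) - tent (y' /\<^sub>R h)\<bar> \<le> min 1 (norm (y - y') / h)"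
  proof -
    have "\<bar>tent (y /\<^sub>R h) - tent (y' /\<^sub>R h)\<bar> \<le> norm (y /\<^sub>R h - y' /\<^sub>R h)" by (rule tent_lipschitz)
    also have "\<dots> = norm (y - y') / h" using e by (simp add: scaleR_diff_right[symmetric] divide_inverse mult.commute)
    finally have "\<bar>tent (y /\<^sub>R h) - tent (y' /\<^sub>R h)\<bar> \<le> norm (y - y') / h" .
    moreover have "\<bar>tent (y /\<^sub>R h) - tent (y' /\<^sub>R h)\<bar> \<le> 1"
      using tent_bounds[of "y /\<^sub>R h"] tent_bounds[of "y' /\<^sub>R h"] by linarith
    ultimately show ?thesis by simp
  qed
  then have "\<bar>tent (y /\<^sub>R h) - tent (y' /\<^sub>R h)\<bar> / (tent_mass * h ^ 3) \<le> min 1 (norm (y - y') / h) / (tent_mass * h ^ 3)"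
    using M by (intro divide_right_mono) auto
  moreover have "\<bar>mollifier h y - mollifier h y'\<bar> = \<bar>tent (y /\<^sub>R h) - tent (y' /\<^sub>R h)\<bar> / (tent_mass * h ^ 3)"
    unfolding mollifier_def diff_divide_distrib[symmetric] abs_divide using M by simp
  ultimately show "\<bar>mollifier h y - mollifier h y'\<bar> \<le> 1 / (tent_mass * h ^ 3) * min 1 (norm (y - y') / h)" by simp
  show "norm y < 2 * h" if "mollifier h y \<noteq> 0"
    using tent_support(1)[of "y /\<^sub>R h"] that e by (simp add: mollifier_def field_simps)
  show "v \<in> cbox x (x + h *\<^sub>R One)" if "mollifier h (x - v) \<noteq> 0"
  proof -
    have "(x - v) /\<^sub>R h \<in> cbox (- One) 0" using tent_support(2)[of "(x - v) /\<^sub>R h"] that by (auto simp: mollifier_def)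
    then have "- 1 \<le> (x $ i - v $ i) / h \<and> (x $ i - v $ i) / h \<le> 0" for i
      by (auto simp: mem_box_cart divide_inverse mult.commute)
    then have "x $ i \<le> v $ i \<and> v $ i \<le> x $ i + h" for i
      using e by (auto simp: field_simps)
    then show ?thesis by (auto simp: mem_box_cart)
  qed
  have nn: "(\<integral>\<^sup>+y. ennreal (mollifier h y) \<partial>lborel) = ennreal 1"
  proof -
    have "(\<integral>\<^sup>+y. ennreal (mollifier h y) \<partial>lborel) = (\<integral>\<^sup>+y. ennreal (1 / (tent_mass * h ^ 3)) * ennreal (tent ((1 / h) *\<^sub>R y)) \<partial>lborel)"
      using M tent_bounds by (intro nn_integral_cong) (simp add: mollifier_def ennreal_mult[symmetric] inverse_eq_divide)
    also have "\<dots> = ennreal (1 / (tent_mass * h ^ 3)) * (\<integral>\<^sup>+y. ennreal (tent ((1 / h) *\<^sub>R y)) \<partial>lborel)"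
      by (rule nn_integral_cmult) measurable
    also have "(\<integral>\<^sup>+y. ennreal (tent ((1 / h) *\<^sub>R y)) \<partial>lborel) = ennreal (1 / (1 / h) ^ 3) * (\<integral>\<^sup>+y. ennreal (tent y) \<partial>lborel)"
      using nn_integral_lborel_scale[of "\<lambda>y. ennreal (tent y)" "1 / h"] e by simp
    also have "(\<integral>\<^sup>+y. ennreal (tent y) \<partial>lborel) = ennreal tent_mass"
      unfolding tent_mass_def by (rule nn_integral_eq_integral[OF tent_integrable]) (simp add: tent_bounds)
    also have "ennreal (1 / (tent_mass * h ^ 3)) * (ennreal (1 / (1 / h) ^ 3) * ennreal tent_mass) = ennreal 1"
      using e tent_mass_pos by (simp add: ennreal_mult[symmetric] power_divide)
    finally show ?thesis .
  qed
  show int: "integrable lborel (mollifier h)"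
    by (rule integrable_from_nn_integral_le(1)[where c = 1]) (use nn m2 in auto)
  have "ennreal (LINT y|lborel. mollifier h y) = ennreal 1"
    unfolding nn[symmetric] by (rule nn_integral_eq_integral[OF int, symmetric]) (simp add: m2)
  moreover have "(LINT y|lborel. mollifier h y) \<ge> 0"
    by (intro Bochner_Integration.integral_nonneg m2)
  ultimately show "(LINT y|lborel. mollifier h y) = 1" by simp
qed

definition sharp_ker :: "real \<Rightarrow> real \<Rightarrow> R3 \<Rightarrow> real" where
  "sharp_ker s e z = indicator {z. e \<le> norm z} z * norm z powr (- (3 + s))"

text \<open>
  Mollifying the kernel of the operator at scale \<open>h\<close> reproduces the sharply truncated kernel up to
  an error which is bounded near the origin and decays one power faster at infinity.
\<close>

lemma sharp_ker_vs_mollified: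
  assumes s: "0 < s" "s < 1"
  shows "\<exists>C>0. \<forall>h>0. \<forall>r>0. r \<le> h \<longrightarrow> (\<forall>z.
    \<bar>sharp_ker s h z - ((LINT y|lborel. mollifier h y * trunc_ker s r (z - y))
       - (LINT w|lborel. trunc_ker s r w) * mollifier h z)\<bar> \<le> C * (h * (h + norm z) powr (- (4 + s))))"
proof -
  obtain C2 where C2: "C2 > 0"
    "\<And>z :: R3. z \<noteq> 0 \<Longrightarrow> integrable lborel (\<lambda>w :: R3. norm w powr (- (3 + s)) * min 1 (norm w / norm z))"
    "\<And>z :: R3. z \<noteq> 0 \<Longrightarrow> (LINT w|lborel. norm (w :: R3) powr (- (3 + s)) * min 1 (norm w / norm z)) \<le> C2 * norm z powr (- s)"
    using dominating_kernel[OF s] by auto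
  define Ca where "Ca = (3 + s) * 2 powr (4 + s) * 2 * 2 powr (4 + s)"
  define Cb where "Cb = (1 + C2 / tent_mass) * 5 powr (4 + s)"
  have pos: "Ca > 0" "Cb > 0" using s C2 tent_mass_pos by (auto simp: Ca_def Cb_def add_pos_pos)
  show ?thesis
  proof (intro exI[of _ "Ca + Cb"] conjI allI impI)
    show "Ca + Cb > 0" using pos by simp
    fix h r :: real and z :: R3 assume e: "h > 0" and d: "r > 0" "r \<le> h"
    note m = mollifier_props[OF e]
    have [measurable]: "mollifier h \<in> borel_measurable borel" by (rule m)
    have kint: "integrable lborel (trunc_ker s r)" by (rule trunc_ker_integrable[OF s(1) d(1)])
    have kB: "\<bar>trunc_ker s r z\<bar> \<le> r powr (- (3 + s))" for z
      using trunc_ker_le_delta[OF s(1) d(1)] by (simp add: trunc_ker_nonneg)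
    define P where "P = (h * (h + norm z) powr (- (4 + s)))"
    have P0: "P \<ge> 0" using e by (simp add: P_def)
    define p where "p = (LINT y|lborel. mollifier h y * trunc_ker s r (z - y))"
    have pint: "integrable lborel (\<lambda>y. mollifier h y * trunc_ker s r (z - y))"
      by (rule convolution_integrable(1)[OF m(7) kint kB])
    define q where "q = p - (LINT w|lborel. trunc_ker s r w) * mollifier h z"
    have "\<bar>sharp_ker s h z - q\<bar> \<le> (Ca + Cb) * P"
    proof (cases "4 * h \<le> norm z")
      case True
      have nz: "norm z > 0" using True e by linarith
      have mz: "mollifier h z = 0" using m(5)[of z] True e by fastforce
      have sk: "sharp_ker s h z = trunc_ker s r z"
        using True e d by (simp add: sharp_ker_def trunc_ker_eq)
      have "sharp_ker s h z - q = (LINT y|lborel. mollifier h y * trunc_ker s r z) - p"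
        using m(7,8) by (simp add: sk q_def mz)
      also have "\<dots> = (LINT y|lborel. mollifier h y * trunc_ker s r z - mollifier h y * trunc_ker s r (z - y))"
        using m(7) pint by (simp add: p_def)
      also have "\<bar>\<dots>\<bar> \<le> (LINT y|lborel. \<bar>mollifier h y * trunc_ker s r z - mollifier h y * trunc_ker s r (z - y)\<bar>)"
        by (rule integral_abs_bound)
      also have "\<dots> \<le> (LINT y|lborel. mollifier h y * ((3 + s) * (norm z / 2) powr (- (4 + s)) * (2 * h)))"
      proof (rule integral_mono)
        show "integrable lborel (\<lambda>y. \<bar>mollifier h y * trunc_ker s r z - mollifier h y * trunc_ker s r (z - y)\<bar>)"
          using m(7) pint by (intro integrable_abs Bochner_Integration.integrable_diff) auto
        show "integrable lborel (\<lambda>y. mollifier h y * ((3 + s) * (norm z / 2) powr (- (4 + s)) * (2 * h)))" using m(7) by simp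
        fix y
        show "\<bar>mollifier h y * trunc_ker s r z - mollifier h y * trunc_ker s r (z - y)\<bar>
          \<le> mollifier h y * ((3 + s) * (norm z / 2) powr (- (4 + s)) * (2 * h))"
        proof (cases "mollifier h y = 0")
          case False
          have y: "norm y < 2 * h" by (rule m(5)[OF False])
          have "norm z / 2 \<le> norm (z - y)" using norm_triangle_ineq2[of z y] y True by linarith
          then have "\<bar>trunc_ker s r z - trunc_ker s r (z - y)\<bar> \<le> (3 + s) * (norm z / 2) powr (- (4 + s)) * norm (z - (z - y))"
            using s nz by (intro trunc_ker_lipschitz) auto
          also have "\<dots> \<le> (3 + s) * (norm z / 2) powr (- (4 + s)) * (2 * h)"
            using y s by (intro mult_left_mono) auto
          finally have "mollifier h y * \<bar>trunc_ker s r z - trunc_ker s r (z - y)\<bar>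
            \<le> mollifier h y * ((3 + s) * (norm z / 2) powr (- (4 + s)) * (2 * h))"
            by (rule mult_left_mono[OF _ m(2)])
          then show ?thesis
            using m(2)[of y] by (simp add: right_diff_distrib[symmetric] abs_mult)
        qed simp
      qed
      also have "\<dots> = (3 + s) * (norm z / 2) powr (- (4 + s)) * (2 * h)" using m(8) by simp
      also have "(norm z / 2) powr (- (4 + s)) = 2 powr (4 + s) * norm z powr (- (4 + s))" by (rule half_powr) simp
      also have "norm z powr (- (4 + s)) \<le> 2 powr (4 + s) * (h + norm z) powr (- (4 + s))"
      proof -
        have "norm z powr (- (4 + s)) \<le> ((h + norm z) / 2) powr (- (4 + s))"
          using True e s by (intro powr_mono2') auto
        also have "\<dots> = 2 powr (4 + s) * (h + norm z) powr (- (4 + s))" using e by (intro half_powr) auto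
        finally show ?thesis .
      qed
      then have "(3 + s) * (2 powr (4 + s) * norm z powr (- (4 + s))) * (2 * h)
          \<le> (3 + s) * (2 powr (4 + s) * (2 powr (4 + s) * (h + norm z) powr (- (4 + s)))) * (2 * h)"
        using s e by (intro mult_right_mono mult_left_mono) auto
      also have "\<dots> = Ca * P" by (simp add: Ca_def P_def)
      also have "\<dots> \<le> (Ca + Cb) * P" using pos P0 by (intro mult_right_mono) auto
      finally show ?thesis .
    next
      case False
      have nz: "norm z < 4 * h" using False by simp
      have sk: "0 \<le> sharp_ker s h z" "sharp_ker s h z \<le> h powr (- (3 + s))"
        using e s by (auto simp: sharp_ker_def indicator_def intro!: powr_mono2')
      define e1 where "e1 = (h *\<^sub>R axis 1 1 :: R3)"
      have e1: "norm e1 = h" "e1 \<noteq> 0" using e by (auto simp: e1_def axis_eq_0_iff)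
      have psh: "p = (LINT w|lborel. mollifier h (z - w) * trunc_ker s r w)"
        unfolding p_def
        using integral_lborel_shift(4)[of "\<lambda>y. mollifier h y * trunc_ker s r (z - y)" z] by simp
      have pint': "integrable lborel (\<lambda>w. mollifier h (z - w) * trunc_ker s r w)"
        using integral_lborel_shift(9)[of "\<lambda>y. mollifier h y * trunc_ker s r (z - y)" z] pint by simp
      have "q = (LINT w|lborel. mollifier h (z - w) * trunc_ker s r w - trunc_ker s r w * mollifier h z)"
        unfolding q_def psh using pint' kint by simp
      also have "\<bar>\<dots>\<bar> \<le> (LINT w|lborel. \<bar>mollifier h (z - w) * trunc_ker s r w - trunc_ker s r w * mollifier h z\<bar>)"
        by (rule integral_abs_bound)
      also have "\<dots> \<le> (LINT w|lborel. 1 / (tent_mass * h ^ 3) * (norm (w :: R3) powr (- (3 + s)) * min 1 (norm w / norm e1)))"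
      proof (rule integral_mono)
        show "integrable lborel (\<lambda>w. \<bar>mollifier h (z - w) * trunc_ker s r w - trunc_ker s r w * mollifier h z\<bar>)"
          using pint' kint by (intro integrable_abs Bochner_Integration.integrable_diff) auto
        show "integrable lborel (\<lambda>w. 1 / (tent_mass * h ^ 3) * (norm (w :: R3) powr (- (3 + s)) * min 1 (norm w / norm e1)))"
          using C2(2)[OF e1(2)] by (intro integrable_mult_right) auto
        fix w :: R3
        show "\<bar>mollifier h (z - w) * trunc_ker s r w - trunc_ker s r w * mollifier h z\<bar>
          \<le> 1 / (tent_mass * h ^ 3) * (norm w powr (- (3 + s)) * min 1 (norm w / norm e1))"
        proof (cases "w = 0")
          case False
          have "\<bar>mollifier h (z - w) * trunc_ker s r w - trunc_ker s r w * mollifier h z\<bar>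
              = trunc_ker s r w * \<bar>mollifier h (z - w) - mollifier h z\<bar>"
            using trunc_ker_nonneg[of s r w] by (simp add: mult.commute[of "mollifier h (z - w)"] right_diff_distrib[symmetric] abs_mult)
          also have "\<dots> \<le> norm w powr (- (3 + s)) * (1 / (tent_mass * h ^ 3) * min 1 (norm ((z - w) - z) / h))"
            using False s(1) by (intro mult_mono m(4) trunc_ker_le) auto
          finally show ?thesis using e1 by (simp add: mult_ac)
        qed simp
      qed
      also have "\<dots> \<le> 1 / (tent_mass * h ^ 3) * (C2 * norm e1 powr (- s))"
        unfolding integral_mult_right_zero using C2(3)[OF e1(2)] e tent_mass_pos by (intro mult_left_mono) auto
      also have "\<dots> = C2 / tent_mass * h powr (- (3 + s))"
      proof -
        have "h powr (- (3 + s)) = h powr (- s) / h ^ 3"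
          using e powr_diff[of h "- s" 3] by (simp add: algebra_simps)
        then show ?thesis using e1 by (simp add: field_simps)
      qed
      finally have "\<bar>q\<bar> \<le> C2 / tent_mass * h powr (- (3 + s))" .
      with sk have "\<bar>sharp_ker s h z - q\<bar> \<le> (1 + C2 / tent_mass) * h powr (- (3 + s))"
        by (simp add: distrib_right)
      also have "h powr (- (3 + s)) \<le> 5 powr (4 + s) * P"
      proof -
        have "5 powr (4 + s) * (5 * h) powr (- (4 + s)) = (5 powr (4 + s) * 5 powr (- (4 + s))) * h powr (- (4 + s))"
          by (simp add: powr_mult)
        also have "5 powr (4 + s) * 5 powr (- (4 + s)) = (1 :: real)" by (simp add: powr_add[symmetric])
        finally have h5: "5 powr (4 + s) * (5 * h) powr (- (4 + s)) = h powr (- (4 + s))" by simp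
        have "h powr (- (3 + s)) = h * h powr (- (4 + s))"
          using e powr_add[of h 1 "- (4 + s)"] by simp
        also have "\<dots> = 5 powr (4 + s) * (h * (5 * h) powr (- (4 + s)))" using h5 by simp
        also have "\<dots> \<le> 5 powr (4 + s) * (h * (h + norm z) powr (- (4 + s)))"
          using e nz s by (intro mult_left_mono powr_mono2') (auto intro: add_pos_nonneg)
        finally show ?thesis by (simp add: P_def)
      qed
      then have "(1 + C2 / tent_mass) * h powr (- (3 + s)) \<le> (1 + C2 / tent_mass) * (5 powr (4 + s) * P)"
        using C2(1) tent_mass_pos by (intro mult_left_mono) (auto simp: add_nonneg_nonneg)
      also have "\<dots> = Cb * P" by (simp add: Cb_def)
      also have "\<dots> \<le> (Ca + Cb) * P" using pos P0 by (intro mult_right_mono) auto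
      finally show ?thesis .
    qed
    then show "\<bar>sharp_ker s h z - ((LINT y|lborel. mollifier h y * trunc_ker s r (z - y))
       - (LINT w|lborel. trunc_ker s r w) * mollifier h z)\<bar> \<le> (Ca + Cb) * (h * (h + norm z) powr (- (4 + s)))"
      by (simp add: q_def p_def P_def)
  qed
qed

lemma sharp_ker_integrable:
  assumes "0 < s" "0 < e"
  shows "integrable lborel (sharp_ker s e)" "\<bar>sharp_ker s e z\<bar> \<le> e powr (- (3 + s))"
proof -
  show "integrable lborel (sharp_ker s e)"
    unfolding sharp_ker_def[abs_def] using integral_power_outside_ball[of "3 + s"] assms by auto
  show "\<bar>sharp_ker s e z\<bar> \<le> e powr (- (3 + s))"
    using assms by (auto simp: sharp_ker_def indicator_def intro!: powr_mono2')
qed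

lemma integrable_cbox_difference:
  fixes f :: "R3 \<Rightarrow> 'k :: euclidean_space"
  assumes [measurable]: "f \<in> borel_measurable borel" and f2: "integrable lborel (\<lambda>x. norm (f x) ^ 2)"
  shows "integrable lborel (\<lambda>v. indicator (cbox a b) v * norm (f v - q))"
proof (rule integrable_majorant_nonneg)
  have "integrable lborel (\<lambda>v. (1 + norm q) * indicator (cbox a b) v)"
    by (intro integrable_mult_right integrable_real_indicator) (auto simp: emeasure_lborel_cbox_eq)
  then show "integrable lborel (\<lambda>v. (1 + norm q) * indicator (cbox a b) v + norm (f v) ^ 2)" using f2 by simp
  fix v
  have "norm (f v - q) \<le> (1 + norm q) + norm (f v) ^ 2"
    using norm_triangle_ineq4[of "f v" q] zero_le_power2[of "norm (f v) - 1/2"] by (simp add: power2_eq_square algebra_simps)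
  then show "indicator (cbox a b) v * norm (f v - q) \<le> (1 + norm q) * indicator (cbox a b) v + norm (f v) ^ 2"
    by (auto simp: indicator_def)
qed auto

text \<open>
  The differentiation theorem is applied to the functions \<open>norm (f - q)\<close> for \<open>q\<close> in a countable
  dense set; approximating the value \<open>f x\<close> by such \<open>q\<close> gives all \<open>x\<close> outside one null set.
\<close>

lemma lebesgue_points:
  fixes f :: "R3 \<Rightarrow> 'k :: euclidean_space"
  assumes [measurable]: "f \<in> borel_measurable borel" and f2: "integrable lborel (\<lambda>x. norm (f x) ^ 2)"
  shows "AE x in lborel. ((\<lambda>h. (LINT v|lborel. indicator (cbox x (x + h *\<^sub>R One)) v * norm (f v - f x)) / h ^ 3) \<longlongrightarrow> 0) (at_right 0)"
proof -
  obtain Q :: "'k set" where Q: "countable Q" "\<And>X. open X \<Longrightarrow> X \<noteq> {} \<Longrightarrow> \<exists>d\<in>Q. d \<in> X"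
    using countable_dense_exists by blast
  have loc: "integrable lborel (\<lambda>v. indicator (cbox a b) v * norm (f v - q))" for a b q
    by (rule integrable_cbox_difference[OF _ f2]) measurable
  have int: "integral (cbox a b) (\<lambda>v. norm (f v - q)) = (LINT v|lborel. indicator (cbox a b) v * norm (f v - q))"
    and intable: "(\<lambda>v. norm (f v - q)) integrable_on cbox a b" for a b q
  proof -
    have si: "set_integrable lborel (cbox a b) (\<lambda>v. norm (f v - q))"
      unfolding set_integrable_def using loc by simp
    show "(\<lambda>v. norm (f v - q)) integrable_on cbox a b" by (rule set_borel_integral_eq_integral(1)[OF si])
    show "integral (cbox a b) (\<lambda>v. norm (f v - q)) = (LINT v|lborel. indicator (cbox a b) v * norm (f v - q))"
      using set_borel_integral_eq_integral(2)[OF si] by (simp add: set_lebesgue_integral_def)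
  qed
  have "AE x in lborel. ((\<lambda>h. (LINT v|lborel. indicator (cbox x (x + h *\<^sub>R One)) v * norm (f v - q)) / h ^ 3) \<longlongrightarrow> norm (f x - q)) (at_right 0)" for q
  proof -
    obtain N where N: "negligible N" "\<And>x e. x \<notin> N \<Longrightarrow> 0 < e \<Longrightarrow> \<exists>d>0. \<forall>h. 0 < h \<and> h < d \<longrightarrow>
        norm (integral (cbox x (x + h *\<^sub>R One)) (\<lambda>v. norm (f v - q)) /\<^sub>R h ^ DIM(R3) - norm (f x - q)) < e"
      by (rule integrable_ccontinuous_explicit[of "\<lambda>v. norm (f v - q)", OF intable]) (rule that, assumption+)
    have "N \<in> null_sets lebesgue" using N(1) by (simp add: negligible_iff_null_sets)
    then have "AE x in lebesgue. x \<notin> N" by (rule AE_not_in)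
    then have "AE x in lborel. x \<notin> N" by (simp add: AE_completion_iff)
    then show ?thesis
    proof eventually_elim
      case (elim x)
      show ?case
      proof (rule tendstoI)
        fix e :: real assume "e > 0"
        from N(2)[OF elim this] obtain d where d: "d > 0" "\<And>h. 0 < h \<Longrightarrow> h < d \<Longrightarrow>
          norm (integral (cbox x (x + h *\<^sub>R One)) (\<lambda>v. norm (f v - q)) /\<^sub>R h ^ DIM(R3) - norm (f x - q)) < e"
          by blast
        show "\<forall>\<^sub>F h in at_right 0. dist ((LINT v|lborel. indicator (cbox x (x + h *\<^sub>R One)) v * norm (f v - q)) / h ^ 3) (norm (f x - q)) < e"
        proof (rule eventually_at_rightI[OF _ d(1)])
          fix h :: real assume "h \<in> {0<..<d}"
          then show "dist ((LINT v|lborel. indicator (cbox x (x + h *\<^sub>R One)) v * norm (f v - q)) / h ^ 3) (norm (f x - q)) < e"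
            using d(2)[of h] unfolding int by (simp add: dist_norm divide_inverse mult.commute)
        qed
      qed
    qed
  qed
  then have "AE x in lborel. \<forall>q\<in>Q. ((\<lambda>h. (LINT v|lborel. indicator (cbox x (x + h *\<^sub>R One)) v * norm (f v - q)) / h ^ 3) \<longlongrightarrow> norm (f x - q)) (at_right 0)"
    using Q(1) by (simp add: AE_ball_countable)
  then show ?thesis
  proof eventually_elim
    case (elim x)
    show ?case
    proof (rule tendstoI)
      fix e :: real assume e: "e > 0"
      obtain q where q: "q \<in> Q" "norm (f x - q) < e / 3"
        using Q(2)[of "ball (f x) (e / 3)"] e by (auto simp: dist_norm)
      have "\<forall>\<^sub>F h in at_right 0. (LINT v|lborel. indicator (cbox x (x + h *\<^sub>R One)) v * norm (f v - q)) / h ^ 3 < 2 * e / 3"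
        using elim q e by (intro order_tendstoD(2)[of _ "norm (f x - q)"]) auto
      moreover have "\<forall>\<^sub>F h in at_right 0. (0 :: real) < h" by (simp add: eventually_at_right_less)
      ultimately show "\<forall>\<^sub>F h in at_right 0. dist ((LINT v|lborel. indicator (cbox x (x + h *\<^sub>R One)) v * norm (f v - f x)) / h ^ 3) 0 < e"
      proof eventually_elim
        case (elim h)
        have vol: "measure lborel (cbox x (x + h *\<^sub>R One)) = h ^ 3"
          using elim by (subst measure_lborel_cbox) (auto simp: inner_simps)
        have ii: "integrable lborel (\<lambda>v. norm (f x - q) * indicator (cbox x (x + h *\<^sub>R One)) v)"
          by (intro integrable_mult_right integrable_real_indicator) (auto simp: emeasure_lborel_cbox_eq)
        have "(LINT v|lborel. indicator (cbox x (x + h *\<^sub>R One)) v * norm (f v - f x))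
            \<le> (LINT v|lborel. indicator (cbox x (x + h *\<^sub>R One)) v * norm (f v - q) + norm (f x - q) * indicator (cbox x (x + h *\<^sub>R One)) v)"
        proof (rule integral_mono[OF loc Bochner_Integration.integrable_add[OF loc ii]])
          fix v
          have "norm (f v - f x) \<le> norm (f v - q) + norm (f x - q)"
            using norm_triangle_ineq4[of "f v - q" "f x - q"] by simp
          then show "indicator (cbox x (x + h *\<^sub>R One)) v * norm (f v - f x)
            \<le> indicator (cbox x (x + h *\<^sub>R One)) v * norm (f v - q) + norm (f x - q) * indicator (cbox x (x + h *\<^sub>R One)) v"
            by (auto simp: indicator_def)
        qed
        also have "\<dots> = (LINT v|lborel. indicator (cbox x (x + h *\<^sub>R One)) v * norm (f v - q)) + norm (f x - q) * h ^ 3"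
          using loc ii vol by simp
        finally have "(LINT v|lborel. indicator (cbox x (x + h *\<^sub>R One)) v * norm (f v - f x)) / h ^ 3
            \<le> (LINT v|lborel. indicator (cbox x (x + h *\<^sub>R One)) v * norm (f v - q)) / h ^ 3 + norm (f x - q)"
          using elim by (simp add: field_simps)
        moreover have "0 \<le> (LINT v|lborel. indicator (cbox x (x + h *\<^sub>R One)) v * norm (f v - f x)) / h ^ 3"
          using elim by (intro divide_nonneg_nonneg Bochner_Integration.integral_nonneg) auto
        ultimately show ?case using elim q(2) by (simp only: dist_real_def diff_zero abs_of_nonneg)
      qed
    qed
  qed
qed

lemma integral_error_kernel:
  assumes s: "0 < s" "s < 1"
  shows "\<exists>C>0. \<forall>h>0. integrable lborel (\<lambda>z :: R3. h * (h + norm z) powr (- (4 + s))) \<and>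
    (LINT z|lborel. h * (h + norm (z :: R3)) powr (- (4 + s))) \<le> C * h powr (- s)"
proof -
  obtain C1 where C1: "C1 > 0" "\<And>r. r > 0 \<Longrightarrow> integrable lborel (\<lambda>w :: R3. indicator {w. r \<le> norm w} w * norm w powr (- (4 + s)))"
    "\<And>r. r > 0 \<Longrightarrow> (LINT w|lborel. indicator {w :: R3. r \<le> norm w} w * norm w powr (- (4 + s))) \<le> C1 * r powr (3 - (4 + s))"
    using integral_power_outside_ball[of "4 + s"] s by auto
  define V where "V = unit_ball_vol 3"
  have V: "V > 0" by (simp add: V_def)
  show ?thesis
  proof (intro exI[of _ "V + C1"] conjI allI impI)
    show "V + C1 > 0" using V C1 by simp
    fix h :: real assume e: "h > 0"
    have i1: "integrable lborel (\<lambda>z. h powr (- (3 + s)) * indicator (ball (0 :: R3) h) z)"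
      by (intro integrable_mult_right integrable_real_indicator) (use e in \<open>auto simp: emeasure_lborel_ball3\<close>)
    have i2: "integrable lborel (\<lambda>z :: R3. h * (indicator {w. h \<le> norm w} z * norm z powr (- (4 + s))))"
      using C1(2)[OF e] by simp
    have le: "h * (h + norm z) powr (- (4 + s)) \<le> h powr (- (3 + s)) * indicator (ball 0 h) z
        + h * (indicator {w. h \<le> norm w} z * norm z powr (- (4 + s)))" for z :: R3
    proof (cases "norm z < h")
      case True
      have "h * (h + norm z) powr (- (4 + s)) \<le> h * h powr (- (4 + s))"
        using e s by (intro mult_left_mono powr_mono2') auto
      also have "\<dots> = h powr (- (3 + s))" using e powr_add[of h 1 "- (4 + s)"] by simp
      finally show ?thesis using True by simp
    next
      case False
      have "h * (h + norm z) powr (- (4 + s)) \<le> h * norm z powr (- (4 + s))"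
        using e s False by (intro mult_left_mono powr_mono2') auto
      then show ?thesis using False by simp
    qed
    show int: "integrable lborel (\<lambda>z :: R3. h * (h + norm z) powr (- (4 + s)))"
      by (rule integrable_dominated[OF Bochner_Integration.integrable_add[OF i1 i2]])
         (use le e in \<open>auto intro!: AE_I2 order_trans[OF le abs_ge_self]\<close>)
    have "(LINT z|lborel. h * (h + norm (z :: R3)) powr (- (4 + s))) \<le>
        (LINT z|lborel. h powr (- (3 + s)) * indicator (ball (0 :: R3) h) z
        + h * (indicator {w. h \<le> norm w} z * norm z powr (- (4 + s))))"
      by (rule integral_mono[OF int Bochner_Integration.integrable_add[OF i1 i2] le])
    also have "\<dots> = h powr (- (3 + s)) * measure lborel (ball (0 :: R3) h)
        + h * (LINT z|lborel. indicator {w. h \<le> norm w} z * norm (z :: R3) powr (- (4 + s)))"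
      using i1 i2 by simp
    also have "measure lborel (ball (0 :: R3) h) = V * h ^ 3"
      using e V by (simp add: measure_def emeasure_lborel_ball3 V_def)
    also have "h powr (- (3 + s)) * (V * h ^ 3) + h * (LINT z|lborel. indicator {w. h \<le> norm w} z * norm (z :: R3) powr (- (4 + s)))
        \<le> V * h powr (- s) + h * (C1 * h powr (3 - (4 + s)))"
    proof -
      have "h powr (- (3 + s)) * h ^ 3 = h powr (- s)"
        using e powr_add[of h "- (3 + s)" 3] by simp
      then show ?thesis using C1(3)[OF e] e by (simp add: mult_ac)
    qed
    also have "\<dots> = (V + C1) * h powr (- s)"
      using e powr_add[of h 1 "3 - (4 + s)"] by (simp add: algebra_simps)
    finally show "(LINT z|lborel. h * (h + norm (z :: R3)) powr (- (4 + s))) \<le> (V + C1) * h powr (- s)" .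
  qed
qed

lemma mult_le_squares:
  fixes a b t :: real
  assumes "t > 0"
  shows "a * b \<le> t * a ^ 2 / 2 + b ^ 2 / (2 * t)"
proof -
  have "0 \<le> (t * a - b) ^ 2 / (2 * t)" using assms by simp
  also have "(t * a - b) ^ 2 / (2 * t) = t * a ^ 2 / 2 + b ^ 2 / (2 * t) - a * b"
    using assms by (simp add: power2_eq_square field_simps)
  finally show ?thesis by simp
qed

text \<open>
  Where the inner Gagliardo integral is finite, the error kernel contributes nothing in the limit:
  after the arithmetic-geometric mean inequality its quadratic part is the Gagliardo integrand times
  a factor that is at most one and tends to zero.
\<close>

lemma error_kernel_vanishes:
  fixes u :: "R3 \<Rightarrow> 'k :: euclidean_space"
  assumes s: "0 < s" "s < 1" and um[measurable]: "u \<in> borel_measurable borel"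
    and g: "integrable lborel (\<lambda>z. gag_dens s u (x, z))"
  shows "\<And>h. h > 0 \<Longrightarrow> integrable lborel (\<lambda>z. (h * (h + norm z) powr (- (4 + s))) * norm (u x - u (x - z)))"
    and "((\<lambda>h. LINT z|lborel. (h * (h + norm z) powr (- (4 + s))) * norm (u x - u (x - z))) \<longlongrightarrow> 0) (at_right 0)"
proof -
  obtain C where C: "C > 0" "\<And>h. h > 0 \<Longrightarrow> integrable lborel (\<lambda>z :: R3. h * (h + norm z) powr (- (4 + s)))"
    "\<And>h. h > 0 \<Longrightarrow> (LINT z|lborel. h * (h + norm (z :: R3)) powr (- (4 + s))) \<le> C * h powr (- s)"
    using integral_error_kernel[OF s] by blast
  define \<Phi> where "\<Phi> h z = h * (h + norm z) powr (- (4 + s))" for h and z :: R3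
  define a where "a z = norm (u x - u (x - z))" for z
  define W where "W h z = gag_dens s u (x, z) * min 1 ((h / norm z) powr (1 - s))" for h z
  have am[measurable]: "a \<in> borel_measurable borel" unfolding a_def by measurable
  have gm[measurable]: "(\<lambda>z. gag_dens s u (x, z)) \<in> borel_measurable borel"
    using g by (auto dest: borel_measurable_integrable)
  have \<Phi>0: "\<Phi> h z \<ge> 0" if "h > 0" for h z using that by (simp add: \<Phi>_def)
  have Wint: "integrable lborel (W h)" if "h > 0" for h
  proof (rule integrable_dominated[OF g])
    show "AE z in lborel. norm (W h z) \<le> norm (gag_dens s u (x, z))"
      by (rule AE_I2) (auto simp: W_def abs_mult gag_dens_nonneg intro!: mult_left_le)
  qed (unfold W_def, measurable)
  have key: "h powr (- s) * \<Phi> h z * a z ^ 2 \<le> W h z" if e: "h > 0" for h z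
  proof (cases "z = 0")
    case True
    then show ?thesis by (simp add: a_def W_def gag_dens_def)
  next
    case False
    then have nz: "norm z > 0" by simp
    define r where "r = h + norm z"
    have r: "r > 0" "h \<le> r" "norm z \<le> r" using e nz unfolding r_def by linarith+
    have "h powr (- s) * \<Phi> h z = h powr (1 - s) * r powr (- (4 + s))"
      using e powr_add[of h 1 "- s"] by (simp add: \<Phi>_def r_def)
    also have "\<dots> = (h / r) powr (1 - s) * r powr (- (3 + 2 * s))"
    proof -
      have "r powr (- (4 + s)) * r powr (1 - s) = r powr (- (3 + 2 * s))"
        by (simp add: powr_add[symmetric] algebra_simps)
      then have "r powr (- (4 + s)) = r powr (- (3 + 2 * s)) / r powr (1 - s)" using r by (simp add: field_simps)
      then show ?thesis using e r by (simp add: powr_divide)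
    qed
    also have "\<dots> \<le> min 1 ((h / norm z) powr (1 - s)) * norm z powr (- (3 + 2 * s))"
    proof (intro mult_mono)
      have "(h / r) powr (1 - s) \<le> 1" using e r s by (intro powr_le1) auto
      moreover have "(h / r) powr (1 - s) \<le> (h / norm z) powr (1 - s)"
        using e r nz s by (intro powr_mono2 divide_left_mono) auto
      ultimately show "(h / r) powr (1 - s) \<le> min 1 ((h / norm z) powr (1 - s))" by simp
      show "r powr (- (3 + 2 * s)) \<le> norm z powr (- (3 + 2 * s))" using nz r s by (intro powr_mono2') auto
    qed auto
    finally have "h powr (- s) * \<Phi> h z * a z ^ 2 \<le> (min 1 ((h / norm z) powr (1 - s)) * norm z powr (- (3 + 2 * s))) * a z ^ 2"
      by (intro mult_right_mono) auto
    then show ?thesis by (simp add: W_def gag_dens_def a_def mult_ac)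
  qed
  have amgm: "\<Phi> h z * a z \<le> t * W h z / 2 + h powr s * \<Phi> h z / (2 * t)" if e: "h > 0" and t: "t > 0" for h z t
  proof -
    have "a z * h powr s \<le> t * a z ^ 2 / 2 + (h powr s) ^ 2 / (2 * t)" by (rule mult_le_squares[OF t])
    then have "(h powr (- s) * \<Phi> h z) * (a z * h powr s) \<le> (h powr (- s) * \<Phi> h z) * (t * a z ^ 2 / 2 + (h powr s) ^ 2 / (2 * t))"
      using \<Phi>0[OF e] by (intro mult_left_mono) auto
    moreover have ee: "h powr (- s) * h powr s = 1" using e by (simp add: powr_add[symmetric])
    have "(h powr (- s) * \<Phi> h z) * (a z * h powr s) = (h powr (- s) * h powr s) * (\<Phi> h z * a z)" by simp
    moreover have "(h powr (- s) * \<Phi> h z) * (t * a z ^ 2 / 2 + (h powr s) ^ 2 / (2 * t))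
        = t * (h powr (- s) * \<Phi> h z * a z ^ 2) / 2 + (h powr (- s) * h powr s) * (h powr s * \<Phi> h z) / (2 * t)"
      by (simp add: power2_eq_square algebra_simps)
    moreover have "t * (h powr (- s) * \<Phi> h z * a z ^ 2) / 2 \<le> t * W h z / 2"
      using key[OF e, of z] t by (intro divide_right_mono mult_left_mono) auto
    ultimately show ?thesis using ee by simp
  qed
  have \<Phi>i: "integrable lborel (\<Phi> h)" if "h > 0" for h unfolding \<Phi>_def using C(2)[OF that] by simp
  have Si: "integrable lborel (\<lambda>z. \<Phi> h z * a z)" if e: "h > 0" for h
  proof (rule integrable_majorant_nonneg)
    show "integrable lborel (\<lambda>z. 1 * W h z / 2 + h powr s * \<Phi> h z / (2 * 1))"
      using Wint[OF e] \<Phi>i[OF e] by simp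
  qed (use amgm[OF e, of 1] \<Phi>0[OF e] in \<open>auto simp: a_def\<close>, unfold \<Phi>_def, measurable)
  then show "\<And>h. h > 0 \<Longrightarrow> integrable lborel (\<lambda>z. (h * (h + norm z) powr (- (4 + s))) * norm (u x - u (x - z)))"
    by (simp add: \<Phi>_def a_def)
  have SW: "(LINT z|lborel. \<Phi> h z * a z) \<le> t * (LINT z|lborel. W h z) / 2 + C / (2 * t)" if e: "h > 0" and t: "t > 0" for h t
  proof -
    have "(LINT z|lborel. \<Phi> h z * a z) \<le> (LINT z|lborel. t * W h z / 2 + h powr s * \<Phi> h z / (2 * t))"
      using Wint[OF e] \<Phi>i[OF e] by (intro integral_mono Si e amgm t) auto
    also have "\<dots> = t * (LINT z|lborel. W h z) / 2 + h powr s * (LINT z|lborel. \<Phi> h z) / (2 * t)"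
      using Wint[OF e] \<Phi>i[OF e] by simp
    also have "\<dots> \<le> t * (LINT z|lborel. W h z) / 2 + h powr s * (C * h powr (- s)) / (2 * t)"
      using C(3)[OF e] t unfolding \<Phi>_def by (intro add_left_mono divide_right_mono mult_left_mono) auto
    also have "h powr s * (C * h powr (- s)) = C"
      using e powr_add[of h s "- s"] by simp
    finally show ?thesis .
  qed
  show "((\<lambda>h. LINT z|lborel. (h * (h + norm z) powr (- (4 + s))) * norm (u x - u (x - z))) \<longlongrightarrow> 0) (at_right 0)"
    unfolding \<Phi>_def[symmetric] a_def[symmetric]
  proof (rule tendsto_at_right_sequentially[of 0 1])
    show "(0 :: real) < 1" by simp
    fix S :: "nat \<Rightarrow> real" assume S: "\<And>n. 0 < S n" "S \<longlonglongrightarrow> 0"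
    have Wl: "(\<lambda>n. LINT z|lborel. W (S n) z) \<longlonglongrightarrow> (LINT z|(lborel :: R3 measure). 0)"
    proof (rule integral_dominated_convergence[OF _ _ g])
      show "AE z in lborel. (\<lambda>n. W (S n) z) \<longlonglongrightarrow> 0"
      proof (rule AE_I2)
        fix z :: R3
        have "(\<lambda>n. (S n / norm z) powr (1 - s)) \<longlonglongrightarrow> (0 / norm z) powr (1 - s)" if "z \<noteq> 0"
          using S s that by (intro tendsto_powr2 tendsto_divide tendsto_const always_eventually) (auto intro: less_imp_le)
        then have "(\<lambda>n. W (S n) z) \<longlonglongrightarrow> gag_dens s u (x, z) * min 1 0" if "z \<noteq> 0"
          unfolding W_def using that by (intro tendsto_intros) auto
        then show "(\<lambda>n. W (S n) z) \<longlonglongrightarrow> 0"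
          by (cases "z = 0") (auto simp: W_def gag_dens_def)
      qed
      show "AE z in lborel. norm (W (S n) z) \<le> gag_dens s u (x, z)" for n
        by (rule AE_I2) (auto simp: W_def abs_mult gag_dens_nonneg intro!: mult_left_le)
    qed (unfold W_def, measurable)
    show "(\<lambda>n. LINT z|lborel. \<Phi> (S n) z * a z) \<longlonglongrightarrow> 0"
    proof (rule LIMSEQ_I)
      fix r :: real assume r: "r > 0"
      define t where "t = C / r"
      have t: "t > 0" using C r by (simp add: t_def)
      have "\<forall>\<^sub>F n in sequentially. (LINT z|lborel. W (S n) z) < r / t"
        using Wl r t by (intro order_tendstoD(2)[OF Wl]) auto
      then obtain N where N: "\<And>n. n \<ge> N \<Longrightarrow> (LINT z|lborel. W (S n) z) < r / t"
        by (auto simp: eventually_sequentially)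
      show "\<exists>no. \<forall>n\<ge>no. norm ((LINT z|lborel. \<Phi> (S n) z * a z) - 0) < r"
      proof (intro exI[of _ N] allI impI)
        fix n assume "n \<ge> N"
        from N[OF this] have "t * (LINT z|lborel. W (S n) z) < r" using t by (simp add: field_simps)
        moreover have "C / (2 * t) = r / 2" using C r by (simp add: t_def)
        ultimately have "(LINT z|lborel. \<Phi> (S n) z * a z) < r" using SW[OF S(1) t, of n] by linarith
        moreover have "(LINT z|lborel. \<Phi> (S n) z * a z) \<ge> 0"
          using \<Phi>0[OF S(1)] by (intro Bochner_Integration.integral_nonneg) (auto simp: a_def)
        ultimately show "norm ((LINT z|lborel. \<Phi> (S n) z * a z) - 0) < r" by simp
      qed
    qed
  qed
qed

text \<open>
  The sharply truncated singular integrals converge almost everywhere to the mean square limit.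
  The truncation at \<open>r\<close> differs from the mollification of the limit by the error kernel alone, and
  the mollification converges at Lebesgue points.
\<close>

lemma sharp_truncation_converges:
  fixes u :: "R3 \<Rightarrow> 'k :: euclidean_space"
  assumes s: "0 < s" "s < 1" and u: "u \<in> Hs s"
    and D[measurable]: "D \<in> borel_measurable borel" and D2: "integrable lborel (\<lambda>x. norm (D x) ^ 2)"
    and conv: "\<And>e. e > 0 \<Longrightarrow> \<exists>N. \<forall>n\<ge>N. (\<integral>\<^sup>+x. ennreal (norm (diff_avg (trunc_ker s (1 / real (Suc n))) u x - D x) ^ 2) \<partial>lborel) \<le> ennreal e"
  shows "AE x in lborel. ((\<lambda>r. LINT z|lborel. sharp_ker s r z *\<^sub>R (u x - u (x - z))) \<longlongrightarrow> D x) (at_right 0)"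
proof -
  note h = HsD[OF u]
  have um[measurable]: "u \<in> borel_measurable borel" by (rule h)
  obtain C where C: "C > 0" "\<And>r d z. r > 0 \<Longrightarrow> d > 0 \<Longrightarrow> d \<le> r \<Longrightarrow>
    \<bar>sharp_ker s r z - ((LINT y|lborel. mollifier r y * trunc_ker s d (z - y))
       - (LINT w|lborel. trunc_ker s d w) * mollifier r z)\<bar> \<le> C * (r * (r + norm z) powr (- (4 + s)))"
    using sharp_ker_vs_mollified[OF s] by blast
  define T where "T n = diff_avg (trunc_ker s (1 / real (Suc n))) u" for n
  have Tm[measurable]: "T n \<in> borel_measurable borel" for n unfolding T_def diff_avg_def[abs_def] by measurable
  have "AE x in lborel. integrable lborel (\<lambda>z. gag_dens s u (x, z))" by (rule gag_via_modulus(3)[OF u])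
  moreover note lebesgue_points[OF D D2]
  ultimately show ?thesis
  proof eventually_elim
    case (elim x)
    define S where "S r = (LINT z|lborel. (r * (r + norm z) powr (- (4 + s))) * norm (u x - u (x - z)))" for r
    define L where "L r = (LINT v|lborel. indicator (cbox x (x + r *\<^sub>R One)) v * norm (D v - D x)) / r ^ 3" for r
    define E where "E r = (LINT z|lborel. sharp_ker s r z *\<^sub>R (u x - u (x - z)))" for r
    note err = error_kernel_vanishes[OF s um elim(1)]
    have bound: "norm (E r - D x) \<le> C * S r + L r / tent_mass" if e: "r > 0" for r
    proof (rule field_le_epsilon)
      fix t :: real assume t: "t > 0"
      note m = mollifier_props[OF e]
      have [measurable]: "mollifier r \<in> borel_measurable borel" by (rule m)
      define B where "B = 1 / (tent_mass * r ^ 3)"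
      have B: "B > 0" using e tent_mass_pos by (simp add: B_def)
      obtain N where N: "\<And>n. n \<ge> N \<Longrightarrow> (\<integral>\<^sup>+x. ennreal (norm (T n x - D x) ^ 2) \<partial>lborel) \<le> ennreal (t ^ 2 / B)"
        using conv[of "t ^ 2 / B"] t B unfolding T_def by auto
      obtain n0 where n0: "1 / real (Suc n0) < r" using nat_approx_posE[OF e] by blast
      define n where "n = max N n0"
      have "1 / real (Suc n) \<le> 1 / real (Suc n0)" by (simp add: n_def field_simps)
      then have dn: "0 < 1 / real (Suc n)" "1 / real (Suc n) \<le> r" using n0 by auto
      define k where "k = trunc_ker s (1 / real (Suc n))"
      have kint: "integrable lborel k" unfolding k_def by (rule trunc_ker_integrable[OF s(1) dn(1)])
      have kB: "\<bar>k z\<bar> \<le> (1 / real (Suc n)) powr (- (3 + s))" for z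
        using trunc_ker_le_delta[OF s(1) dn(1)] by (simp add: trunc_ker_nonneg k_def)
      have mB: "\<bar>mollifier r z\<bar> \<le> B" for z using m(2)[of z] m(3)[of z] by (simp add: B_def)
      have vsq: "integrable lborel (\<lambda>y. norm (T n y - D y) ^ 2)" "(LINT y|lborel. norm (T n y - D y) ^ 2) \<le> t ^ 2 / B"
        using integrable_from_nn_integral_le[OF _ _ N[of n]] B by (auto simp: n_def)
      define v where "v y = T n (x - y) - D (x - y)" for y
      have vm[measurable]: "v \<in> borel_measurable borel" unfolding v_def by measurable
      have v2: "integrable lborel (\<lambda>y. norm (v y) ^ 2)" "(LINT y|lborel. norm (v y) ^ 2) \<le> t ^ 2 / B"
        unfolding v_def using integral_lborel_shift(9)[of "\<lambda>y. norm (T n y - D y) ^ 2" x]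
          integral_lborel_shift(4)[of "\<lambda>y. norm (T n y - D y) ^ 2" x] vsq by auto
      have mv_le: "mollifier r y * norm (v y) \<le> t * mollifier r y / 2 + B * norm (v y) ^ 2 / (2 * t)" for y
      proof -
        have "1 * norm (v y) \<le> t * 1 ^ 2 / 2 + norm (v y) ^ 2 / (2 * t)" by (rule mult_le_squares[OF t])
        then have "mollifier r y * norm (v y) \<le> mollifier r y * (t / 2 + norm (v y) ^ 2 / (2 * t))"
          using m(2) by (intro mult_left_mono) auto
        also have "\<dots> = t * mollifier r y / 2 + mollifier r y * (norm (v y) ^ 2 / (2 * t))" by (simp add: algebra_simps)
        also have "\<dots> \<le> t * mollifier r y / 2 + B * (norm (v y) ^ 2 / (2 * t))"
          using mB[of y] t by (intro add_left_mono mult_right_mono) auto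
        finally show ?thesis by simp
      qed
      have majv: "integrable lborel (\<lambda>y. t * mollifier r y / 2 + B * norm (v y) ^ 2 / (2 * t))"
        using m(7) v2(1) by simp
      have mvn: "integrable lborel (\<lambda>y. mollifier r y * norm (v y))"
        by (rule integrable_dominated[OF majv])
           (use m(2) in \<open>auto intro!: AE_I2 order_trans[OF mv_le abs_ge_self]\<close>)
      have mv: "integrable lborel (\<lambda>y. mollifier r y *\<^sub>R v y)"
        by (rule integrable_dominated[OF mvn]) (use m(2) in auto)
      have mv_small: "norm (LINT y|lborel. mollifier r y *\<^sub>R v y) \<le> t"
      proof -
        have "norm (LINT y|lborel. mollifier r y *\<^sub>R v y) \<le> (LINT y|lborel. norm (mollifier r y *\<^sub>R v y))"
          by (rule integral_norm_bound)
        also have "\<dots> = (LINT y|lborel. mollifier r y * norm (v y))" using m(2) by simp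
        also have "\<dots> \<le> (LINT y|lborel. t * mollifier r y / 2 + B * norm (v y) ^ 2 / (2 * t))"
          by (rule integral_mono[OF mvn majv mv_le])
        also have "\<dots> = t / 2 + B * (LINT y|lborel. norm (v y) ^ 2) / (2 * t)"
          using m(7,8) v2(1) by simp
        also have "\<dots> \<le> t / 2 + B * (t ^ 2 / B) / (2 * t)"
          using v2(2) B t by (intro add_left_mono divide_right_mono mult_left_mono) auto
        also have "\<dots> = t" using B t by (simp add: power2_eq_square)
        finally show ?thesis .
      qed
      have mDi: "integrable lborel (\<lambda>y. mollifier r y *\<^sub>R (D x - D (x - y)))"
        by (rule integrable_kernel_difference[OF D D2 m(7) mB])
      have mDx: "integrable lborel (\<lambda>y. mollifier r y *\<^sub>R D x)" using m(7) by simp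
      have mDxy: "integrable lborel (\<lambda>y. mollifier r y *\<^sub>R D (x - y))"
        using Bochner_Integration.integrable_diff[OF mDx mDi] by (simp add: scaleR_diff_right)
      have moll: "norm ((LINT y|lborel. mollifier r y *\<^sub>R D (x - y)) - D x) \<le> L r / tent_mass"
      proof -
        have "norm ((LINT y|lborel. mollifier r y *\<^sub>R D (x - y)) - D x) = norm (LINT y|lborel. mollifier r y *\<^sub>R (D x - D (x - y)))"
        proof -
          have "(LINT y|lborel. mollifier r y *\<^sub>R (D x - D (x - y))) = D x - (LINT y|lborel. mollifier r y *\<^sub>R D (x - y))"
            using mDx mDxy m(7,8) by (simp add: scaleR_diff_right)
          then show ?thesis by (simp add: norm_minus_commute)
        qed
        also have "\<dots> \<le> (LINT y|lborel. norm (mollifier r y *\<^sub>R (D x - D (x - y))))" by (rule integral_norm_bound)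
        also have "\<dots> = (LINT w|lborel. norm (mollifier r (x - w) *\<^sub>R (D x - D w)))"
          using integral_lborel_shift(4)[of "\<lambda>y. norm (mollifier r y *\<^sub>R (D x - D (x - y)))" x] by simp
        also have "\<dots> \<le> (LINT w|lborel. B * (indicator (cbox x (x + r *\<^sub>R One)) w * norm (D w - D x)))"
        proof (rule integral_mono)
          show "integrable lborel (\<lambda>w. norm (mollifier r (x - w) *\<^sub>R (D x - D w)))"
            using integral_lborel_shift(9)[of "\<lambda>y. norm (mollifier r y *\<^sub>R (D x - D (x - y)))" x] integrable_norm[OF mDi] by simp
          have "integrable lborel (\<lambda>v. indicator (cbox x (x + r *\<^sub>R One)) v * norm (D v - D x))"
            by (rule integrable_cbox_difference[OF D D2(1)])
          then show "integrable lborel (\<lambda>w. B * (indicator (cbox x (x + r *\<^sub>R One)) w * norm (D w - D x)))" by simp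
          fix w
          show "norm (mollifier r (x - w) *\<^sub>R (D x - D w)) \<le> B * (indicator (cbox x (x + r *\<^sub>R One)) w * norm (D w - D x))"
          proof (cases "mollifier r (x - w) = 0")
            case False
            then show ?thesis
              using m(6)[of x w] mult_right_mono[OF mB[of "x - w"], of "norm (D x - D w)"] by (simp add: norm_minus_commute)
          qed (use B in simp)
        qed
        also have "\<dots> = L r / tent_mass" by (simp add: L_def B_def)
        finally show ?thesis .
      qed
      have kern: "norm (E r - (LINT y|lborel. mollifier r y *\<^sub>R T n (x - y))) \<le> C * S r"
      proof -
        define q where "q z = (LINT y|lborel. mollifier r y * k (z - y)) - (LINT w|lborel. k w) * mollifier r z" for z
        note mda = mollified_diff_avg[OF um h(2) kint kB m(7) mB, folded q_def]
        have Ei: "integrable lborel (\<lambda>z. sharp_ker s r z *\<^sub>R (u x - u (x - z)))"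
          by (rule integrable_kernel_difference[OF um h(2) sharp_ker_integrable[OF s(1) e]])
        have "E r - (LINT y|lborel. mollifier r y *\<^sub>R T n (x - y)) = (LINT z|lborel. (sharp_ker s r z - q z) *\<^sub>R (u x - u (x - z)))"
          using Ei mda by (simp add: E_def T_def k_def scaleR_diff_left)
        also have "norm \<dots> \<le> (LINT z|lborel. norm ((sharp_ker s r z - q z) *\<^sub>R (u x - u (x - z))))"
          by (rule integral_norm_bound)
        also have "\<dots> \<le> (LINT z|lborel. C * ((r * (r + norm z) powr (- (4 + s))) * norm (u x - u (x - z))))"
        proof (rule integral_mono)
          show "integrable lborel (\<lambda>z. norm ((sharp_ker s r z - q z) *\<^sub>R (u x - u (x - z))))"
          proof (rule integrable_norm)
            show "integrable lborel (\<lambda>z. (sharp_ker s r z - q z) *\<^sub>R (u x - u (x - z)))"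
              using Bochner_Integration.integrable_diff[OF Ei mda(2)[of x]] by (simp add: scaleR_diff_left)
          qed
          show "integrable lborel (\<lambda>z. C * ((r * (r + norm z) powr (- (4 + s))) * norm (u x - u (x - z))))"
            using err(1)[OF e] by (rule integrable_mult_right)
          fix z
          have "\<bar>sharp_ker s r z - q z\<bar> \<le> C * (r * (r + norm z) powr (- (4 + s)))"
            unfolding q_def k_def by (rule C(2)[OF e dn])
          then have "\<bar>sharp_ker s r z - q z\<bar> * norm (u x - u (x - z)) \<le> C * (r * (r + norm z) powr (- (4 + s))) * norm (u x - u (x - z))"
            by (rule mult_right_mono) simp
          then show "norm ((sharp_ker s r z - q z) *\<^sub>R (u x - u (x - z))) \<le> C * ((r * (r + norm z) powr (- (4 + s))) * norm (u x - u (x - z)))"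
            by (simp only: norm_scaleR mult.assoc)
        qed
        also have "\<dots> = C * S r" unfolding S_def by (rule integral_mult_right_zero)
        finally show ?thesis .
      qed
      have split: "(LINT y|lborel. mollifier r y *\<^sub>R T n (x - y)) = (LINT y|lborel. mollifier r y *\<^sub>R v y) + (LINT y|lborel. mollifier r y *\<^sub>R D (x - y))"
      proof -
        have "mollifier r y *\<^sub>R T n (x - y) = mollifier r y *\<^sub>R v y + mollifier r y *\<^sub>R D (x - y)" for y
          by (simp add: v_def scaleR_diff_right)
        then show ?thesis using mv mDxy by simp
      qed
      have "E r - D x = (E r - (LINT y|lborel. mollifier r y *\<^sub>R T n (x - y))) + (LINT y|lborel. mollifier r y *\<^sub>R v y)
        + ((LINT y|lborel. mollifier r y *\<^sub>R D (x - y)) - D x)"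
        unfolding split by simp
      also have "norm \<dots> \<le> norm (E r - (LINT y|lborel. mollifier r y *\<^sub>R T n (x - y))) + norm (LINT y|lborel. mollifier r y *\<^sub>R v y)
        + norm ((LINT y|lborel. mollifier r y *\<^sub>R D (x - y)) - D x)"
        by (intro norm_triangle_le add_mono norm_triangle_ineq order_refl)
      also have "\<dots> \<le> C * S r + t + L r / tent_mass"
        using kern mv_small moll by linarith
      finally show "norm (E r - D x) \<le> C * S r + L r / tent_mass + t" by simp
    qed
    have "((\<lambda>r. C * S r + L r / tent_mass) \<longlongrightarrow> C * 0 + 0 / tent_mass) (at_right 0)"
      using err(2) elim(2) tent_mass_pos unfolding S_def[abs_def] L_def[abs_def] by (intro tendsto_intros) auto
    then have lim0: "((\<lambda>r. C * S r + L r / tent_mass) \<longlongrightarrow> 0) (at_right 0)" by simp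
    have "((\<lambda>r. E r - D x) \<longlongrightarrow> 0) (at_right 0)"
    proof (rule Lim_null_comparison[OF _ lim0])
      show "\<forall>\<^sub>F r in at_right 0. norm (E r - D x) \<le> C * S r + L r / tent_mass"
        by (rule eventually_at_rightI[of 0 1]) (auto intro: bound)
    qed
    then show ?case unfolding E_def[abs_def] by (simp add: LIM_zero_iff)
  qed
qed

section \<open>The kinetic energy\<close>

lemma integrable_power_outside_ball:
  "b > 3 \<Longrightarrow> r > 0 \<Longrightarrow> integrable lborel (\<lambda>w :: R3. indicator {w. r \<le> norm w} w * norm w powr (- b))"
  using integral_power_outside_ball[of b] by auto

lemma integrable_power_inside_ball:
  "a < 3 \<Longrightarrow> r > 0 \<Longrightarrow> integrable lborel (\<lambda>w :: R3. indicator {w. norm w < r} w * norm w powr (- a))"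
  using integral_power_inside_ball[of a] by auto

definition bump :: "R3 \<Rightarrow> 'k :: {real_normed_field, euclidean_space}" where
  "bump x = of_real (max 0 (1 - norm x))"

lemma bump_measurable[measurable]: "bump \<in> borel_measurable borel"
  unfolding bump_def[abs_def] by measurable

lemma norm_bump: "norm (bump x) = max 0 (1 - norm x)"
  by (simp add: bump_def)

lemma norm_bump_diff: "norm (bump x - bump y :: 'k :: {real_normed_field, euclidean_space}) \<le> min 1 (norm (x - y))"
proof -
  have gen: "\<bar>max 0 (1 - a) - max 0 (1 - b)\<bar> \<le> min 1 \<bar>a - b\<bar>" if "0 \<le> a" "0 \<le> b" for a b :: real
    using that by (auto simp: max_def min_def abs_if)
  have "(bump x - bump y :: 'k) = of_real (max 0 (1 - norm x) - max 0 (1 - norm y))"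
    by (simp add: bump_def)
  then have "norm (bump x - bump y :: 'k) = \<bar>max 0 (1 - norm x) - max 0 (1 - norm y)\<bar>"
    by (simp only: norm_of_real)
  also have "\<dots> \<le> min 1 \<bar>norm x - norm y\<bar>"
    by (rule gen) auto
  also have "\<dots> \<le> min 1 (norm (x - y))"
    using norm_triangle_ineq3[of x y] by (intro min.mono) auto
  finally show ?thesis .
qed

lemma bump_square_integrable: "integrable lborel (\<lambda>x. norm (bump x :: 'k :: {real_normed_field, euclidean_space}) ^ 2)"
proof (rule integrable_dominated)
  show "integrable lborel (indicator (ball (0 :: R3) 1) :: _ \<Rightarrow> real)"
    by (intro integrable_real_indicator) (auto simp: emeasure_lborel_ball3)
  show "AE x in lborel. norm (norm (bump x :: 'k) ^ 2) \<le> norm (indicator (ball (0 :: R3) 1) x :: real)"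
    by (rule AE_I2) (auto simp: norm_bump indicator_def power_le_one)
qed measurable

lemma bump_in_Hs:
  assumes s: "0 < s" "s < 1"
  shows "(bump :: R3 \<Rightarrow> 'k :: {real_normed_field, euclidean_space}) \<in> Hs s"
proof -
  let ?u = "bump :: R3 \<Rightarrow> 'k"
  define V where "V = measure lborel (ball (0 :: R3) 1)"
  note G = sq_modulus_props[of ?u, OF bump_measurable bump_square_integrable]
  have ib: "integrable lborel (\<lambda>x. indicator (ball (0 :: R3) 1) x :: real)"
    by (intro integrable_real_indicator) (auto simp: emeasure_lborel_ball3)
  have ibz: "integrable lborel (\<lambda>x. indicator (ball (0 :: R3) 1) (x - z) :: real)"
    and ibz': "(LINT x|lborel. indicator (ball (0 :: R3) 1) (x - z) :: real) = V" for z
    using integral_lborel_shift(8)[of "\<lambda>x. indicator (ball (0 :: R3) 1) x :: real" z] ib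
      integral_lborel_shift(3)[of "\<lambda>x. indicator (ball (0 :: R3) 1) x :: real" z] by (auto simp: V_def)
  have Gle: "sq_modulus ?u z \<le> 2 * V * min 1 (norm z) ^ 2" for z
  proof -
    have "sq_modulus ?u z \<le> (LINT x|lborel. min 1 (norm z) ^ 2 * (indicator (ball (0 :: R3) 1) x + indicator (ball 0 1) (x - z)))"
      unfolding sq_modulus_def
    proof (rule integral_mono[OF G(1)])
      show "integrable lborel (\<lambda>x. min 1 (norm z) ^ 2 * (indicator (ball (0 :: R3) 1) x + indicator (ball 0 1) (x - z)))"
        using ib ibz[of z] by simp
      fix x
      show "norm (?u x - ?u (x - z)) ^ 2 \<le> min 1 (norm z) ^ 2 * (indicator (ball (0 :: R3) 1) x + indicator (ball 0 1) (x - z))"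
      proof (cases "norm x < 1 \<or> norm (x - z) < 1")
        case True
        have "norm (?u x - ?u (x - z)) ^ 2 \<le> min 1 (norm z) ^ 2 * 1"
          using norm_bump_diff[of x "x - z", where 'k = 'k] by (simp add: power_mono)
        also have "\<dots> \<le> min 1 (norm z) ^ 2 * (indicator (ball (0 :: R3) 1) x + indicator (ball 0 1) (x - z))"
          using True by (intro mult_left_mono) (auto simp: indicator_def)
        finally show ?thesis .
      qed (simp add: bump_def)
    qed
    also have "\<dots> = 2 * V * min 1 (norm z) ^ 2" using ib ibz[of z] ibz'[of z] by (simp add: V_def)
    finally show ?thesis .
  qed
  have i1: "integrable lborel (\<lambda>w :: R3. indicator {w. 1 \<le> norm w} w * norm w powr (- (3 + 2 * s)))"
    by (rule integrable_power_outside_ball) (use s in auto)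
  have i2: "integrable lborel (\<lambda>w :: R3. indicator {w. norm w < 1} w * norm w powr (- (1 + 2 * s)))"
    by (rule integrable_power_inside_ball) (use s in auto)
  have sw: "integrable lborel2 (\<lambda>(z, x). gag_dens s ?u (x, z))"
  proof (rule lborel_pair.Fubini_integrable)
    have eq: "(LINT x|lborel. norm (case (z, x) of (z, x) \<Rightarrow> gag_dens s ?u (x, z))) = sq_modulus ?u z * norm z powr (- (3 + 2 * s))" for z
      by (simp add: gag_dens_def sq_modulus_def)
    show "integrable lborel (\<lambda>z. LINT x|lborel. norm (case (z, x) of (z, x) \<Rightarrow> gag_dens s ?u (x, z)))"
      unfolding eq
    proof (rule integrable_majorant_nonneg)
      let ?P = "\<lambda>w :: R3. indicator {w. norm w < 1} w * norm w powr (- (1 + 2 * s)) + indicator {w. 1 \<le> norm w} w * norm w powr (- (3 + 2 * s))"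
      show "integrable lborel (\<lambda>w. 2 * V * ?P w)" using i1 i2 by simp
      fix z :: R3
      have "sq_modulus ?u z * norm z powr (- (3 + 2 * s)) \<le> (2 * V * min 1 (norm z) ^ 2) * norm z powr (- (3 + 2 * s))"
        by (intro mult_right_mono Gle) simp
      also have "\<dots> = 2 * V * ?P z"
      proof (cases "z = 0")
        case False
        then have "norm z ^ 2 * norm z powr (- (3 + 2 * s)) = norm z powr (- (1 + 2 * s))"
          using powr_add[of "norm z" 2 "- (3 + 2 * s)"] by simp
        then show ?thesis by (auto simp: min_def indicator_def)
      qed simp
      finally show "sq_modulus ?u z * norm z powr (- (3 + 2 * s)) \<le> 2 * V * ?P z" .
    qed (use G(2,4) in auto)
    show "AE z in lborel. integrable lborel (\<lambda>x. case (z, x) of (z, x) \<Rightarrow> gag_dens s ?u (x, z))"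
      using G(1) by (simp add: gag_dens_def)
  qed (simp add: case_prod_beta' gag_dens_def)
  have "integrable lborel2 (gag_dens s ?u)"
    using lborel_pair.integrable_product_swap[OF sw] by (simp add: case_prod_beta')
  then show ?thesis by (simp add: Hs_def bump_square_integrable)
qed

text \<open>
  The constant cannot vanish: the operator maps a nonnegative bump to a function that is strictly
  negative at a distance from its support.
\<close>

lemma cross_const_pos:
  assumes s: "0 < s" "s < 1"
  shows "cross_const s > 0"
proof (rule ccontr)
  assume "\<not> cross_const s > 0"
  then have c: "cross_const s \<le> 0" by simp
  let ?u = "bump :: R3 \<Rightarrow> real"
  have uH: "?u \<in> Hs s" by (rule bump_in_Hs[OF s])
  obtain D where D[measurable]: "D \<in> borel_measurable borel" and D2: "integrable lborel (\<lambda>x. norm (D x) ^ 2)"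
    "(LINT x|lborel. norm (D x) ^ 2) = cross_const s / 2 * gag s ?u"
    and conv: "\<And>e. e > 0 \<Longrightarrow> \<exists>N. \<forall>n\<ge>N. (\<integral>\<^sup>+x. ennreal (norm (diff_avg (trunc_ker s (1 / real (Suc n))) ?u x - D x) ^ 2) \<partial>lborel) \<le> ennreal e"
    using truncated_operators_converge[OF s uH] by blast
  have "(LINT x|lborel. norm (D x) ^ 2) \<le> 0"
    unfolding D2(2) using c gag_nonneg[of s ?u] by (simp add: mult_nonpos_nonneg)
  moreover have "(LINT x|lborel. norm (D x) ^ 2) \<ge> 0" by simp
  ultimately have "(LINT x|lborel. norm (D x) ^ 2) = 0" by linarith
  then have D0: "AE x in lborel. D x = 0"
    using integral_nonneg_eq_0_iff_AE[OF D2(1)] by simp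
  have bi: "integrable lborel ?u"
  proof (rule integrable_dominated)
    show "integrable lborel (indicator (ball (0 :: R3) 1) :: _ \<Rightarrow> real)"
      by (intro integrable_real_indicator) (auto simp: emeasure_lborel_ball3)
    show "AE x in lborel. norm (?u x) \<le> norm (indicator (ball (0 :: R3) 1) x :: real)"
      by (rule AE_I2) (auto simp: bump_def indicator_def)
  qed measurable
  define B where "B = (LINT x|lborel. ?u x)"
  have ub: "?u x = max 0 (1 - norm x)" for x by (simp add: bump_def)
  have B: "B > 0"
  proof -
    have "(1 / 2) * measure lborel (ball (0 :: R3) (1 / 2)) = (LINT y|lborel. (1 / 2 :: real) * indicator (ball (0 :: R3) (1 / 2)) y)"
      by simp
    also have "\<dots> \<le> B" unfolding B_def
    proof (rule integral_mono[OF _ bi])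
      show "integrable lborel (\<lambda>y. (1 / 2 :: real) * indicator (ball (0 :: R3) (1 / 2)) y)"
        by (intro integrable_mult_right integrable_real_indicator) (auto simp: emeasure_lborel_ball3)
    qed (auto simp: ub indicator_def max_def)
    finally have "(1 / 2) * measure lborel (ball (0 :: R3) (1 / 2)) \<le> B" .
    moreover have "measure lborel (ball (0 :: R3) (1 / 2)) > 0"
      using content_ball_gt_0_iff[of "0 :: R3" "1 / 2"] by simp
    ultimately show ?thesis by linarith
  qed
  define A where "A = ball ((5 / 2) *\<^sub>R axis 1 1 :: R3) (1 / 4)"
  have A: "norm x \<ge> 2 \<and> norm x \<le> 3" if "x \<in> A" for x
  proof -
    have "norm ((5 / 2) *\<^sub>R axis 1 1 :: R3) = 5 / 2" by simp
    moreover have "norm ((5 / 2) *\<^sub>R axis 1 1 - x) < 1 / 4" using that by (simp add: A_def dist_norm)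
    ultimately show ?thesis
      using norm_triangle_ineq2[of "(5 / 2) *\<^sub>R axis 1 1 :: R3" x] norm_triangle_ineq2[of x "(5 / 2) *\<^sub>R axis 1 1 :: R3"]
      by (simp add: norm_minus_commute)
  qed
  define c0 where "c0 = 4 powr (- (3 + s)) * B"
  have c0: "c0 > 0" using B by (simp add: c0_def)
  have lower: "c0 \<le> norm (diff_avg (trunc_ker s h) ?u x)" if x: "x \<in> A" and d: "0 < h" "h \<le> 1" for x h
  proof -
    have ux: "?u x = 0" using A[OF x] by (simp add: ub)
    have "diff_avg (trunc_ker s h) ?u x = - (LINT z|lborel. trunc_ker s h z * ?u (x - z))"
      unfolding diff_avg_def ux by simp
    also have "(LINT z|lborel. trunc_ker s h z * ?u (x - z)) = (LINT y|lborel. trunc_ker s h (x - y) * ?u y)"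
      using integral_lborel_shift(4)[of "\<lambda>z. trunc_ker s h z * ?u (x - z)" x] by simp
    finally have eq: "norm (diff_avg (trunc_ker s h) ?u x) = \<bar>LINT y|lborel. trunc_ker s h (x - y) * ?u y\<bar>" by simp
    have "c0 = (LINT y|lborel. 4 powr (- (3 + s)) * ?u y)" by (simp add: c0_def B_def)
    also have "\<dots> \<le> (LINT y|lborel. trunc_ker s h (x - y) * ?u y)"
    proof (rule integral_mono)
      show "integrable lborel (\<lambda>y. 4 powr (- (3 + s)) * ?u y)" using bi by simp
      show "integrable lborel (\<lambda>y. trunc_ker s h (x - y) * ?u y)"
      proof (rule integrable_dominated)
        show "integrable lborel (\<lambda>y. h powr (- (3 + s)) * ?u y)" using bi by simp
        show "AE y in lborel. norm (trunc_ker s h (x - y) * ?u y) \<le> norm (h powr (- (3 + s)) * ?u y)"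
          using trunc_ker_le_delta[OF s(1) d(1)] by (intro AE_I2) (auto simp: abs_mult trunc_ker_nonneg intro!: mult_right_mono)
      qed measurable
      fix y
      show "4 powr (- (3 + s)) * ?u y \<le> trunc_ker s h (x - y) * ?u y"
      proof (cases "norm y < 1")
        case True
        have "norm (x - y) \<le> 4" using norm_triangle_ineq4[of x y] A[OF x] True by linarith
        moreover have "max (norm (x - y)) h > 0" using d by (simp add: less_max_iff_disj)
        ultimately have "4 powr (- (3 + s)) \<le> trunc_ker s h (x - y)"
          unfolding trunc_ker_def using d s by (intro powr_mono2') auto
        then show ?thesis by (intro mult_right_mono) (auto simp: ub)
      qed (simp add: ub)
    qed
    finally show ?thesis unfolding eq by linarith
  qed
  have mA: "measure lborel A > 0" unfolding A_def
    using content_ball_gt_0_iff[of "(5 / 2) *\<^sub>R axis 1 1 :: R3" "1 / 4"] by simp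
  have emA: "emeasure lborel A = ennreal (measure lborel A)"
    unfolding A_def by (intro emeasure_eq_ennreal_measure) (simp add: emeasure_lborel_ball3)
  define e where "e = c0 ^ 2 * measure lborel A / 2"
  have e: "e > 0" using c0 mA by (simp add: e_def)
  obtain N where N: "\<And>n. n \<ge> N \<Longrightarrow> (\<integral>\<^sup>+x. ennreal (norm (diff_avg (trunc_ker s (1 / real (Suc n))) ?u x - D x) ^ 2) \<partial>lborel) \<le> ennreal e"
    using conv[OF e] by blast
  have "ennreal (c0 ^ 2) * emeasure lborel A = (\<integral>\<^sup>+x. ennreal (c0 ^ 2) * indicator A x \<partial>lborel)"
    by (simp add: nn_integral_cmult_indicator A_def)
  also have "\<dots> \<le> (\<integral>\<^sup>+x. ennreal (norm (diff_avg (trunc_ker s (1 / real (Suc N))) ?u x - D x) ^ 2) \<partial>lborel)"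
  proof (rule nn_integral_mono_AE, use D0 in eventually_elim)
    case (elim x)
    have "c0 ^ 2 \<le> norm (diff_avg (trunc_ker s (1 / real (Suc N))) ?u x) ^ 2" if "x \<in> A"
      using lower[OF that, of "1 / real (Suc N)"] c0 by (intro power_mono) auto
    then show ?case using elim by (auto simp: indicator_def intro: ennreal_leI)
  qed
  also have "\<dots> \<le> ennreal e" by (rule N) simp
  finally have "ennreal (c0 ^ 2 * measure lborel A) \<le> ennreal e" unfolding emA by (simp add: ennreal_mult)
  then have "c0 ^ 2 * measure lborel A \<le> e" using e by (simp add: ennreal_le_iff)
  then show False using e unfolding e_def by linarith
qed

text \<open>
  The integral behind the constant has to converge, since a divergent one has the value zero and would
  make the constant vanish. It does because \<open>1 - cos\<close> vanishes to second order at the origin.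
\<close>

lemma frac_laplace_const_pos:
  assumes \<sigma>: "0 < \<sigma>" "\<sigma> < 1"
  shows "frac_laplace_const \<sigma> > 0"
proof -
  define f where "f z = (1 - cos ((z :: R3) $ 1)) / norm z powr (3 + 2 * \<sigma>)" for z
  have fm[measurable]: "f \<in> borel_measurable borel"
  proof -
    have [measurable]: "(\<lambda>z :: R3. z $ 1) \<in> borel_measurable borel"
      by (intro borel_measurable_continuous_onI continuous_intros)
    show ?thesis unfolding f_def[abs_def] by measurable
  qed
  have f0: "0 \<le> f z" for z by (simp add: f_def)
  have i1: "integrable lborel (\<lambda>w :: R3. indicator {w. 1 \<le> norm w} w * norm w powr (- (3 + 2 * \<sigma>)))"
    by (rule integrable_power_outside_ball) (use \<sigma> in auto)
  have i2: "integrable lborel (\<lambda>w :: R3. indicator {w. norm w < 1} w * norm w powr (- (1 + 2 * \<sigma>)))"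
    by (rule integrable_power_inside_ball) (use \<sigma> in auto)
  have fle: "f z \<le> indicator {w. norm w < 1} z * norm z powr (- (1 + 2 * \<sigma>)) + 2 * (indicator {w. 1 \<le> norm w} z * norm z powr (- (3 + 2 * \<sigma>)))" for z
  proof (cases "z = 0")
    case False
    have fe: "f z = (1 - cos (z $ 1)) * norm z powr (- (3 + 2 * \<sigma>))" by (simp only: f_def powr_minus_divide times_divide_eq_right mult_1_right)
    show ?thesis
    proof (cases "norm z < 1")
      case True
      have "1 - cos (z $ 1) = 2 * sin (z $ 1 / 2) ^ 2" using cos_double_sin[of "z $ 1 / 2"] by simp
      also have "\<dots> \<le> 2 * (z $ 1 / 2) ^ 2"
        using abs_sin_x_le_abs_x[of "z $ 1 / 2"] by (intro mult_left_mono) (simp_all add: abs_le_square_iff[symmetric])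
      also have "\<dots> \<le> \<bar>z $ 1\<bar> ^ 2" by (simp add: power2_eq_square)
      also have "\<dots> \<le> norm z ^ 2" by (intro power_mono component_le_norm_cart) auto
      finally have "f z \<le> norm z ^ 2 * norm z powr (- (3 + 2 * \<sigma>))" unfolding fe by (intro mult_right_mono) auto
      also have "\<dots> = norm z powr (- (1 + 2 * \<sigma>))"
        using False powr_add[of "norm z" 2 "- (3 + 2 * \<sigma>)"] by simp
      finally show ?thesis using True by simp
    next
      case F: False
      have "f z \<le> 2 * norm z powr (- (3 + 2 * \<sigma>))" unfolding fe
        using cos_ge_minus_one[of "z $ 1"] by (intro mult_right_mono) auto
      then show ?thesis using F by simp
    qed
  qed (simp add: f_def)
  have maj: "integrable lborel (\<lambda>z :: R3. indicator {w. norm w < 1} z * norm z powr (- (1 + 2 * \<sigma>)) + 2 * (indicator {w. 1 \<le> norm w} z * norm z powr (- (3 + 2 * \<sigma>))))"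
    using i1 i2 by simp
  have fi: "integrable lborel f"
    by (rule integrable_majorant_nonneg[OF maj _ f0 fle]) simp
  have "(LINT z|lborel. f z) \<noteq> 0"
  proof
    assume "(LINT z|lborel. f z) = 0"
    then have "AE z in lborel. f z = 0" using integral_nonneg_eq_0_iff_AE[OF fi] f0 by simp
    then have "AE z in lborel. z \<notin> ball (axis 1 1 :: R3) (1 / 2)"
    proof eventually_elim
      case (elim z)
      show ?case
      proof
        assume "z \<in> ball (axis 1 1 :: R3) (1 / 2)"
        then have n: "norm (axis 1 1 - z) < 1 / 2" by (simp add: dist_norm)
        have "\<bar>1 - z $ 1\<bar> < 1 / 2" using order_le_less_trans[OF component_le_norm_cart n, of 1] by simp
        then have z1: "0 < z $ 1" "z $ 1 < 3 / 2" by linarith+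
        then have "cos (z $ 1) < cos 0" using pi_gt3 by (intro cos_monotone_0_pi) auto
        moreover have "z \<noteq> 0" using z1 by auto
        ultimately have "f z > 0" by (simp add: f_def)
        with elim show False by simp
      qed
    qed
    then have "ball (axis 1 1 :: R3) (1 / 2) \<in> null_sets lborel"
      by (subst AE_iff_null_sets) auto
    then have "emeasure lborel (ball (axis 1 1 :: R3) (1 / 2)) = 0" by (rule null_setsD1)
    then have "measure lborel (ball (axis 1 1 :: R3) (1 / 2)) = 0" by (simp add: measure_def)
    then show False using content_ball_gt_0_iff[of "axis 1 1 :: R3" "1 / 2"] by simp
  qed
  moreover have "(LINT z|lborel. f z) \<ge> 0" using f0 by simp
  ultimately have "(LINT z|lborel. f z) > 0" by linarith
  moreover have "(LINT z|lebesgue. f z) = (LINT z|lborel. f z)" by (rule integral_completion) simp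
  ultimately show ?thesis unfolding frac_laplace_const_def f_def by simp
qed

text \<open>
  The factor between the Gagliardo seminorm and the square integral of the fractional Laplacian; the
  existence of minimizers depends on its sign only.
\<close>

definition kin_const :: "real \<Rightarrow> real" where
  "kin_const s = frac_laplace_const (s / 2) ^ 2 * (cross_const s / 2)"

lemma kin_const_pos: "0 < s \<Longrightarrow> s < 1 \<Longrightarrow> kin_const s > 0"
  unfolding kin_const_def using frac_laplace_const_pos[of "s / 2"] cross_const_pos[of s] by simp

lemma integral_lebesgue_cong:
  fixes f g :: "R3 \<Rightarrow> 'b :: euclidean_space"
  assumes [measurable]: "g \<in> borel_measurable borel" and ae: "AE x in lborel. f x = g x"
  shows "(LINT x|lebesgue. f x) = (LINT x|lborel. g x)"
proof -
  have ae': "AE x in lebesgue. g x = f x"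
    by (rule AE_completion) (use ae in \<open>auto elim: eventually_mono\<close>)
  have g: "g \<in> borel_measurable lebesgue" by (rule measurable_completion) simp
  then have f: "f \<in> borel_measurable lebesgue"
    by (rule borel_measurable_AE[OF _ ae'])
  have "(LINT x|lebesgue. f x) = (LINT x|lebesgue. g x)"
    by (rule integral_cong_AE[OF f g]) (use ae' in \<open>auto elim: eventually_mono\<close>)
  also have "\<dots> = (LINT x|lborel. g x)" by (rule integral_completion) simp
  finally show ?thesis .
qed

text \<open>
  For \<open>u\<close> of finite Gagliardo seminorm the principal value defining the fractional Laplacian exists
  almost everywhere, and its square integral is a positive multiple of the seminorm.
\<close>

lemma frac_laplace_of_Hs:
  fixes u v :: "R3 \<Rightarrow> 'k :: {real_normed_field, euclidean_space}"
  assumes s: "0 < s" "s < 1" and u: "u \<in> Hs s" and vu: "AE x in lborel. v x = u x"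
    and vm: "v \<in> borel_measurable lebesgue"
  shows "\<exists>D \<in> borel_measurable borel. integrable lborel (\<lambda>x. norm (D x) ^ 2) \<and>
    (LINT x|lborel. norm (D x) ^ 2) = kin_const s * gag s u \<and>
    (AE x in lborel. frac_laplace (s / 2) v x = D x)"
proof -
  note h = HsD[OF u]
  have um[measurable]: "u \<in> borel_measurable borel" by (rule h)
  obtain D where D[measurable]: "D \<in> borel_measurable borel" and D2: "integrable lborel (\<lambda>x. norm (D x) ^ 2)"
    "(LINT x|lborel. norm (D x) ^ 2) = cross_const s / 2 * gag s u"
    and conv: "\<And>e. e > 0 \<Longrightarrow> \<exists>N. \<forall>n\<ge>N. (\<integral>\<^sup>+x. ennreal (norm (diff_avg (trunc_ker s (1 / real (Suc n))) u x - D x) ^ 2) \<partial>lborel) \<le> ennreal e"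
    using truncated_operators_converge[OF s u] by blast
  define c where "c = frac_laplace_const (s / 2)"
  have sharp: "AE x in lborel. ((\<lambda>r. LINT z|lborel. sharp_ker s r z *\<^sub>R (u x - u (x - z))) \<longlongrightarrow> D x) (at_right 0)"
    by (rule sharp_truncation_converges[OF s u D D2(1)]) (rule conv)
  have ae: "AE x in lborel. frac_laplace (s / 2) v x = c *\<^sub>R D x"
    using sharp vu
  proof eventually_elim
    case (elim x)
    have eq: "(LINT y:(- ball x r)|lebesgue. (v x - v y) /\<^sub>R norm (x - y) powr (3 + 2 * (s / 2)))
        = (LINT z|lborel. sharp_ker s r z *\<^sub>R (u x - u (x - z)))" for r
    proof -
      have "(LINT y:(- ball x r)|lebesgue. (v x - v y) /\<^sub>R norm (x - y) powr (3 + 2 * (s / 2)))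
          = (LINT y|lebesgue. indicator (- ball x r) y *\<^sub>R ((v x - v y) /\<^sub>R norm (x - y) powr (3 + 2 * (s / 2))))"
        by (simp add: set_lebesgue_integral_def)
      also have "\<dots> = (LINT y|lborel. sharp_ker s r (x - y) *\<^sub>R (u x - u y))"
      proof (rule integral_lebesgue_cong)
        show "AE y in lborel. indicator (- ball x r) y *\<^sub>R ((v x - v y) /\<^sub>R norm (x - y) powr (3 + 2 * (s / 2)))
          = sharp_ker s r (x - y) *\<^sub>R (u x - u y)"
          using vu
        proof eventually_elim
          case (elim y)
          have "inverse (norm (x - y) powr (3 + s)) = norm (x - y) powr (- (3 + s))"
            by (rule powr_minus[symmetric])
          then show ?case using elim \<open>v x = u x\<close>
            by (auto simp: sharp_ker_def indicator_def dist_norm)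
        qed
        show "(\<lambda>y. sharp_ker s r (x - y) *\<^sub>R (u x - u y)) \<in> borel_measurable borel"
          unfolding sharp_ker_def by measurable
      qed
      also have "\<dots> = (LINT z|lborel. sharp_ker s r z *\<^sub>R (u x - u (x - z)))"
        using integral_lborel_shift(4)[of "\<lambda>z. sharp_ker s r z *\<^sub>R (u x - u (x - z))" x]
        unfolding sharp_ker_def by simp
      finally show ?thesis .
    qed
    have "Lim (at_right 0) (\<lambda>r. LINT z|lborel. sharp_ker s r z *\<^sub>R (u x - u (x - z))) = D x"
      by (rule tendsto_Lim[OF _ elim(1)]) simp
    then show ?case unfolding frac_laplace_def eq c_def by (simp only:)
  qed
  show ?thesis
  proof (intro bexI[of _ "\<lambda>x. c *\<^sub>R D x"] conjI ae)
    show "integrable lborel (\<lambda>x. norm (c *\<^sub>R D x) ^ 2)" using D2(1) by (simp add: power_mult_distrib)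
    show "(LINT x|lborel. norm (c *\<^sub>R D x) ^ 2) = kin_const s * gag s u"
      using D2(2) by (simp add: power_mult_distrib kin_const_def c_def)
  qed measurable
qed

section \<open>Interpolation inequalities\<close>

definition lp :: "real \<Rightarrow> (R3 \<Rightarrow> 'k :: euclidean_space) \<Rightarrow> real" where
  "lp p u = (LINT x|lborel. norm (u x) powr p)"

lemma lp_nonneg: "0 \<le> lp p u"
  unfolding lp_def by (intro Bochner_Integration.integral_nonneg) auto

text \<open>
  Comparing \<open>u x\<close> with its average over a ball of radius \<open>r\<close> bounds \<open>\<bar>u x\<bar>\<^sup>2\<close> by
  \<open>r\<^sup>-\<^sup>3\<close> times the local mass plus \<open>r\<close> to the power \<open>2s\<close> times the inner Gagliardo integral. Optimising in \<open>r\<close>, pointwise, gives the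
  mass-critical power; keeping the local mass makes the same estimate serve for Lions' vanishing
  lemma.
\<close>

lemma pointwise_interpolation:
  assumes s: "0 < s"
  shows "\<exists>C>0. \<forall>(u :: R3 \<Rightarrow> 'k :: euclidean_space) \<in> Hs s. \<forall>w>0.
    (\<forall>x. (LINT y|lborel. indicator (ball x 1) y * norm (u y) ^ 2) \<le> w) \<longrightarrow>
    (AE x in lborel. norm (u x) powr (2 + 4 * s / 3) \<le>
       C * w powr (2 * s / 3) * ((LINT z|lborel. gag_dens s u (x, z)) + norm (u x) ^ 2))"
proof -
  define V where "V = unit_ball_vol 3"
  have V: "V > 0" by (simp add: V_def)
  define c where "c = 4 / V"
  have c: "c > 0" using V by (simp add: c_def)
  define \<tau> where "\<tau> = 2 * s / 3"
  have \<tau>: "\<tau> > 0" using s by (simp add: \<tau>_def)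
  define C where "C = c powr \<tau> + c powr (1 + \<tau>)"
  have C: "C > 0" using c by (simp add: C_def add_pos_pos)
  show ?thesis
  proof (intro exI[of _ C] conjI C ballI allI impI)
    fix u :: "R3 \<Rightarrow> 'k" and w :: real
    assume u: "u \<in> Hs s" and d: "w > 0" and loc: "\<forall>x. (LINT y|lborel. indicator (ball x 1) y * norm (u y) ^ 2) \<le> w"
    note h = HsD[OF u]
    have um[measurable]: "u \<in> borel_measurable borel" by (rule h)
    show "AE x in lborel. norm (u x) powr (2 + 4 * s / 3) \<le>
       C * w powr (2 * s / 3) * ((LINT z|lborel. gag_dens s u (x, z)) + norm (u x) ^ 2)"
      using gag_via_modulus(3)[OF u]
    proof eventually_elim
      case (elim x)
      define g where "g = (LINT z|lborel. gag_dens s u (x, z))"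
      have g0: "g \<ge> 0" unfolding g_def by (intro Bochner_Integration.integral_nonneg gag_dens_nonneg)
      define N where "N = norm (u x) ^ 2"
      have N0: "N \<ge> 0" by (simp add: N_def)
      have pw: "V * r ^ 3 * N \<le> 2 * w + 2 * r powr (3 + 2 * s) * g" if r: "0 < r" "r \<le> 1" for r
      proof -
        have ib: "integrable lborel (\<lambda>z. N * indicator (ball (0 :: R3) r) z)"
          by (intro integrable_mult_right integrable_real_indicator) (use r in \<open>auto simp: emeasure_lborel_ball3\<close>)
        have il0: "integrable lborel (\<lambda>y. indicator (ball x 1) y * norm (u y) ^ 2)"
          by (rule integrable_dominated[OF h(2)]) (auto intro!: AE_I2 simp: indicator_def)
        have il: "integrable lborel (\<lambda>z. indicator (ball x 1) (x - z) * norm (u (x - z)) ^ 2)"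
          and le: "(LINT z|lborel. indicator (ball x 1) (x - z) * norm (u (x - z)) ^ 2) \<le> w"
          using integral_lborel_shift(9)[of "\<lambda>y. indicator (ball x 1) y * norm (u y) ^ 2" x] il0
            integral_lborel_shift(4)[of "\<lambda>y. indicator (ball x 1) y * norm (u y) ^ 2" x] loc by auto
        have "V * r ^ 3 * N = (LINT z|lborel. N * indicator (ball (0 :: R3) r) z)"
          using r V by (simp add: measure_def emeasure_lborel_ball3 V_def)
        also have "\<dots> \<le> (LINT z|lborel. 2 * (indicator (ball x 1) (x - z) * norm (u (x - z)) ^ 2) + 2 * (r powr (3 + 2 * s) * gag_dens s u (x, z)))"
        proof (rule integral_mono[OF ib])
          show "integrable lborel (\<lambda>z. 2 * (indicator (ball x 1) (x - z) * norm (u (x - z)) ^ 2) + 2 * (r powr (3 + 2 * s) * gag_dens s u (x, z)))"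
            using il elim by simp
          fix z
          show "N * indicator (ball 0 r) z \<le> 2 * (indicator (ball x 1) (x - z) * norm (u (x - z)) ^ 2) + 2 * (r powr (3 + 2 * s) * gag_dens s u (x, z))"
          proof (cases "norm z < r")
            case True
            have xz: "x - z \<in> ball x 1" using True r by (simp add: dist_norm)
            have a: "N \<le> 2 * norm (u (x - z)) ^ 2 + 2 * norm (u x - u (x - z)) ^ 2"
              using norm_square_perturb[of 1 "u x" "u (x - z)"] by (simp add: N_def)
            have b: "norm (u x - u (x - z)) ^ 2 \<le> r powr (3 + 2 * s) * gag_dens s u (x, z)"
            proof (cases "z = 0")
              case False
              have "1 \<le> (r / norm z) powr (3 + 2 * s)" using False True s by (intro ge_one_powr_ge_zero) auto
              then have "norm (u x - u (x - z)) ^ 2 * 1 \<le> norm (u x - u (x - z)) ^ 2 * (r / norm z) powr (3 + 2 * s)"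
                by (intro mult_left_mono) auto
              also have "(r / norm z) powr (3 + 2 * s) = r powr (3 + 2 * s) * norm z powr (- (3 + 2 * s))"
                by (simp only: powr_divide powr_minus_divide times_divide_eq_right mult_1_right)
              finally show ?thesis by (simp add: gag_dens_def mult_ac)
            qed (simp add: gag_dens_nonneg)
            show ?thesis using a b xz True by simp
          qed (simp add: gag_dens_nonneg)
        qed
        also have "\<dots> = 2 * (LINT z|lborel. indicator (ball x 1) (x - z) * norm (u (x - z)) ^ 2) + 2 * (r powr (3 + 2 * s) * g)"
          using il elim by (simp add: g_def)
        finally show ?thesis using le by simp
      qed
      have q: "norm (u x) powr (2 + 4 * s / 3) = N powr (1 + \<tau>)"
      proof -
        have "norm (u x) powr (2 + 4 * s / 3) = (norm (u x) powr 2) powr (1 + \<tau>)"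
          unfolding powr_powr by (rule arg_cong[where f = "\<lambda>t. norm (u x) powr t"]) (simp add: \<tau>_def)
        then show ?thesis by (simp add: N_def)
      qed
      have "N powr (1 + \<tau>) \<le> C * w powr \<tau> * (g + N)"
      proof (cases "g \<le> w")
        case True
        have "V * N \<le> 4 * w" using pw[of 1] True by simp
        then have Nc: "N \<le> c * w" using V by (simp add: c_def field_simps)
        have "N powr (1 + \<tau>) = N powr \<tau> * N" using N0 by (cases "N = 0") (auto simp: powr_add)
        also have "\<dots> \<le> (c * w) powr \<tau> * N"
          using Nc N0 \<tau> by (intro mult_right_mono powr_mono2) auto
        also have "\<dots> = c powr \<tau> * w powr \<tau> * N" using c d by (simp add: powr_mult)
        also have "\<dots> \<le> C * w powr \<tau> * (g + N)"
          using g0 N0 by (intro mult_mono) (auto simp: C_def)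
        finally show ?thesis .
      next
        case False
        then have gd: "g > w" "g > 0" using d by auto
        define r where "r = (w / g) powr (1 / (3 + 2 * s))"
        have r: "0 < r" "r \<le> 1" using gd d s by (auto simp: r_def intro!: powr_le1)
        have r1: "r powr (3 + 2 * s) = w / g" unfolding r_def powr_powr using s gd d by simp
        have "V * r ^ 3 * N \<le> 4 * w" using pw[OF r] gd unfolding r1 by simp
        then have "N \<le> c * (w / r ^ 3)" using V r by (simp add: c_def field_simps)
        also have "w / r ^ 3 = g * r powr (2 * s)"
        proof -
          have "r powr (3 + 2 * s) = r ^ 3 * r powr (2 * s)" using r by (simp add: powr_add)
          then show ?thesis using r1 r gd by (simp add: field_simps)
        qed
        finally have "N \<le> c * (g * r powr (2 * s))" .
        then have "N powr (1 + \<tau>) \<le> (c * (g * r powr (2 * s))) powr (1 + \<tau>)"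
          using N0 \<tau> by (intro powr_mono2) auto
        also have "\<dots> = c powr (1 + \<tau>) * (g powr (1 + \<tau>) * (r powr (2 * s)) powr (1 + \<tau>))"
          using c gd by (simp add: powr_mult)
        also have "(r powr (2 * s)) powr (1 + \<tau>) = (w / g) powr \<tau>"
        proof -
          have "(r powr (2 * s)) powr (1 + \<tau>) = (r powr (3 + 2 * s)) powr \<tau>"
            unfolding powr_powr by (rule arg_cong[where f = "\<lambda>t. r powr t"]) (simp add: \<tau>_def field_simps)
          then show ?thesis by (simp only: r1)
        qed
        also have "g powr (1 + \<tau>) * (w / g) powr \<tau> = w powr \<tau> * g"
          using gd d by (simp add: powr_divide powr_add)
        also have "c powr (1 + \<tau>) * (w powr \<tau> * g) \<le> C * w powr \<tau> * (g + N)"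
        proof -
          have "c powr (1 + \<tau>) * (w powr \<tau> * g) = c powr (1 + \<tau>) * w powr \<tau> * g" by simp
          also have "\<dots> \<le> C * w powr \<tau> * (g + N)"
            using g0 N0 by (intro mult_mono) (auto simp: C_def)
          finally show ?thesis .
        qed
        finally show ?thesis .
      qed
      then show "norm (u x) powr (2 + 4 * s / 3) \<le> C * w powr (2 * s / 3) * ((LINT z|lborel. gag_dens s u (x, z)) + norm (u x) ^ 2)"
        by (simp add: q \<tau>_def g_def N_def)
    qed
  qed
qed

lemma local_mass_le:
  assumes "u \<in> Hs s"
  shows "integrable lborel (\<lambda>y. indicator (ball x r) y * norm (u y) ^ 2)"
    and "(LINT y|lborel. indicator (ball x r) y * norm (u y) ^ 2) \<le> mass u"
proof -
  note h = HsD[OF assms]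
  have [measurable]: "u \<in> borel_measurable borel" by (rule h)
  show i: "integrable lborel (\<lambda>y. indicator (ball x r) y * norm (u y) ^ 2)"
    by (rule integrable_dominated[OF h(2)]) (auto intro!: AE_I2 simp: indicator_def)
  show "(LINT y|lborel. indicator (ball x r) y * norm (u y) ^ 2) \<le> mass u"
    unfolding mass_def by (intro integral_mono i h) (auto simp: indicator_def)
qed

lemma critical_interpolation:
  assumes s: "0 < s"
  shows "\<exists>C>0. \<forall>(u :: R3 \<Rightarrow> 'k :: euclidean_space) \<in> Hs s.
    integrable lborel (\<lambda>x. norm (u x) powr (2 + 4 * s / 3)) \<and>
    (\<forall>r>0. (\<forall>x. (LINT y|lborel. indicator (ball x 1) y * norm (u y) ^ 2) \<le> r) \<longrightarrow>
      lp (2 + 4 * s / 3) u \<le> C * r powr (2 * s / 3) * (gag s u + mass u))"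
proof -
  obtain C where C: "C > 0" "\<And>(u :: R3 \<Rightarrow> 'k) r. u \<in> Hs s \<Longrightarrow> r > 0 \<Longrightarrow>
    (\<forall>x. (LINT y|lborel. indicator (ball x 1) y * norm (u y) ^ 2) \<le> r) \<Longrightarrow>
    (AE x in lborel. norm (u x) powr (2 + 4 * s / 3) \<le>
       C * r powr (2 * s / 3) * ((LINT z|lborel. gag_dens s u (x, z)) + norm (u x) ^ 2))"
    using pointwise_interpolation[OF s] by blast
  show ?thesis
  proof (intro exI[of _ C] conjI C(1) ballI)
    fix u :: "R3 \<Rightarrow> 'k" assume u: "u \<in> Hs s"
    note h = HsD[OF u] and g = gag_via_modulus[OF u]
    have [measurable]: "u \<in> borel_measurable borel" by (rule h)
    have maj: "integrable lborel (\<lambda>x. C * r powr (2 * s / 3) * ((LINT z|lborel. gag_dens s u (x, z)) + norm (u x) ^ 2))" for r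
      using g(4) h(2) by simp
    have main: "integrable lborel (\<lambda>x. norm (u x) powr (2 + 4 * s / 3)) \<and> lp (2 + 4 * s / 3) u \<le> C * r powr (2 * s / 3) * (gag s u + mass u)"
      if d: "r > 0" and loc: "\<forall>x. (LINT y|lborel. indicator (ball x 1) y * norm (u y) ^ 2) \<le> r" for r
    proof
      note ae = C(2)[OF u d loc]
      show i: "integrable lborel (\<lambda>x. norm (u x) powr (2 + 4 * s / 3))"
        by (rule integrable_dominated[OF maj[of r]]) (use ae in \<open>auto elim!: eventually_mono\<close>)
      have "lp (2 + 4 * s / 3) u \<le> (LINT x|lborel. C * r powr (2 * s / 3) * ((LINT z|lborel. gag_dens s u (x, z)) + norm (u x) ^ 2))"
        unfolding lp_def by (rule integral_mono_AE[OF i maj ae])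
      also have "\<dots> = C * r powr (2 * s / 3) * (gag s u + mass u)"
        using g(4,5) h(2) by (simp add: mass_def)
      finally show "lp (2 + 4 * s / 3) u \<le> C * r powr (2 * s / 3) * (gag s u + mass u)" .
    qed
    show "integrable lborel (\<lambda>x. norm (u x) powr (2 + 4 * s / 3))"
      using main[of "mass u + 1"] local_mass_le(2)[OF u, of _ 1] mass_nonneg[of u] by (meson add_increasing2 add_nonneg_pos order_trans zero_le_one zero_less_one)
    show "\<forall>r>0. (\<forall>x. (LINT y|lborel. indicator (ball x 1) y * norm (u y) ^ 2) \<le> r) \<longrightarrow>
      lp (2 + 4 * s / 3) u \<le> C * r powr (2 * s / 3) * (gag s u + mass u)"
      using main by blast
  qed
qed

lemma powr_interpolation:
  fixes p q \<eta> :: real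
  assumes "2 < p" "p < q" "\<eta> > 0"
  shows "\<exists>K>0. \<forall>t\<ge>0. t powr p \<le> \<eta> * t powr q + K * t ^ 2" "\<exists>K>0. \<forall>t\<ge>0. t powr p \<le> \<eta> * t ^ 2 + K * t powr q"
proof -
  have main: "t powr p \<le> T powr (p - q) * t powr q + T powr (p - 2) * t ^ 2" if "T > 0" "t \<ge> 0" for T t :: real
  proof (cases "t = 0")
    case False
    with that have t: "t > 0" by simp
    show ?thesis
    proof (cases "t \<le> T")
      case True
      have "t powr p = t powr (p - 2) * t ^ 2" using t powr_add[of t "p - 2" 2] by simp
      also have "\<dots> \<le> T powr (p - 2) * t ^ 2" using True t assms by (intro mult_right_mono powr_mono2) auto
      finally show ?thesis by (simp add: add_increasing)
    next
      case False
      have "t powr p = t powr (p - q) * t powr q" by (simp add: powr_add[symmetric])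
      also have "\<dots> \<le> T powr (p - q) * t powr q" using False that assms by (intro mult_right_mono powr_mono2') auto
      finally show ?thesis by (simp add: add_increasing2)
    qed
  qed (use assms in simp)
  define T where "T = \<eta> powr (1 / (p - q))"
  have T: "T > 0" "T powr (p - q) = \<eta>" using assms by (auto simp: T_def powr_powr)
  show "\<exists>K>0. \<forall>t\<ge>0. t powr p \<le> \<eta> * t powr q + K * t ^ 2"
    using main[OF T(1)] T by (intro exI[of _ "T powr (p - 2)"]) auto
  define S where "S = \<eta> powr (1 / (p - 2))"
  have S: "S > 0" "S powr (p - 2) = \<eta>" using assms by (auto simp: S_def powr_powr)
  show "\<exists>K>0. \<forall>t\<ge>0. t powr p \<le> \<eta> * t ^ 2 + K * t powr q"
    using main[OF S(1)] S by (intro exI[of _ "S powr (p - q)"]) (auto simp: add.commute)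
qed

lemma lp_interpolation:
  assumes s: "0 < s" and p: "2 < p" "p < 2 + 4 * s / 3"
  shows "(u :: R3 \<Rightarrow> 'k :: euclidean_space) \<in> Hs s \<Longrightarrow> integrable lborel (\<lambda>x. norm (u x) powr p)"
    and "\<eta> > 0 \<Longrightarrow> \<exists>K>0. \<forall>(u :: R3 \<Rightarrow> 'k) \<in> Hs s. lp p u \<le> \<eta> * lp (2 + 4 * s / 3) u + K * mass u"
    and "\<eta> > 0 \<Longrightarrow> \<exists>K>0. \<forall>(u :: R3 \<Rightarrow> 'k) \<in> Hs s. lp p u \<le> \<eta> * mass u + K * lp (2 + 4 * s / 3) u"
proof -
  let ?q = "2 + 4 * s / 3"
  have qi: "integrable lborel (\<lambda>x. norm (u x) powr ?q)" if "u \<in> Hs s" for u :: "R3 \<Rightarrow> 'k"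
    using critical_interpolation[OF s, where 'k = 'k] that by blast
  have pint: "integrable lborel (\<lambda>x. norm (u x) powr p)" if u: "u \<in> Hs s" for u :: "R3 \<Rightarrow> 'k"
  proof -
    note h = HsD[OF u]
    have [measurable]: "u \<in> borel_measurable borel" by (rule h)
    obtain K where K: "K > 0" "\<And>t. t \<ge> 0 \<Longrightarrow> t powr p \<le> 1 * t powr ?q + K * t ^ 2"
      using powr_interpolation(1)[OF p, of 1] by auto
    show ?thesis
    proof (rule integrable_majorant_nonneg)
      show "integrable lborel (\<lambda>x. 1 * norm (u x) powr ?q + K * norm (u x) ^ 2)" using qi[OF u] h(2) by simp
    qed (use K(2) in auto)
  qed
  then show "u \<in> Hs s \<Longrightarrow> integrable lborel (\<lambda>x. norm (u x) powr p)" for u :: "R3 \<Rightarrow> 'k" .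
  have bound: "lp p u \<le> a * lp ?q u + b * mass u"
    if u: "u \<in> Hs s" and ab: "\<And>t. t \<ge> 0 \<Longrightarrow> t powr p \<le> a * t powr ?q + b * t ^ 2" for a b and u :: "R3 \<Rightarrow> 'k"
  proof -
    have "lp p u \<le> (LINT x|lborel. a * norm (u x) powr ?q + b * norm (u x) ^ 2)"
      unfolding lp_def using pint[OF u] qi[OF u] HsD(2)[OF u] by (intro integral_mono ab) auto
    also have "\<dots> = a * lp ?q u + b * mass u" using qi[OF u] HsD(2)[OF u] by (simp add: lp_def mass_def)
    finally show ?thesis .
  qed
  show "\<exists>K>0. \<forall>(u :: R3 \<Rightarrow> 'k) \<in> Hs s. lp p u \<le> \<eta> * lp ?q u + K * mass u" if e: "\<eta> > 0"
  proof -
    obtain K where K: "K > 0" "\<And>t. t \<ge> 0 \<Longrightarrow> t powr p \<le> \<eta> * t powr ?q + K * t ^ 2"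
      using powr_interpolation(1)[OF p e] by auto
    then show ?thesis using bound[of _ \<eta> K] by blast
  qed
  show "\<exists>K>0. \<forall>(u :: R3 \<Rightarrow> 'k) \<in> Hs s. lp p u \<le> \<eta> * mass u + K * lp ?q u" if e: "\<eta> > 0"
  proof -
    obtain K where K: "K > 0" "\<And>t. t \<ge> 0 \<Longrightarrow> t powr p \<le> \<eta> * t ^ 2 + K * t powr ?q"
      using powr_interpolation(2)[OF p e] by auto
    then have "lp p u \<le> \<eta> * mass u + K * lp ?q u" if "u \<in> Hs s" for u :: "R3 \<Rightarrow> 'k"
      using bound[OF that, of K \<eta>] by (simp add: add.commute)
    then show ?thesis using K(1) by blast
  qed
qed

section \<open>The Hartree energy\<close>

definition har_dens :: "real \<Rightarrow> (R3 \<Rightarrow> 'k :: euclidean_space) \<Rightarrow> R3 \<times> R3 \<Rightarrow> real" where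
  "har_dens s u p = norm (u (fst p)) ^ 2 * norm (u (snd p)) ^ 2 / norm (fst p - snd p) powr (3 - 2 * s)"

definition har :: "real \<Rightarrow> (R3 \<Rightarrow> 'k :: euclidean_space) \<Rightarrow> real" where
  "har s u = (LINT p|lborel2. har_dens s u p)"

definition near_wt :: "real \<Rightarrow> R3 \<times> R3 \<Rightarrow> real" where
  "near_wt R p = (if norm (fst p - snd p) < R then 1 else 0)"

lemma near_wt_measurable[measurable]: "near_wt R \<in> borel_measurable lborel2"
  unfolding near_wt_def[abs_def] by measurable

lemma har_dens_measurable[measurable]:
  assumes [measurable]: "u \<in> borel_measurable borel"
  shows "har_dens s u \<in> borel_measurable lborel2"
  unfolding har_dens_def[abs_def] by measurable

lemma har_dens_nonneg: "0 \<le> har_dens s u p"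
  by (simp add: har_dens_def)

lemma young_powr:
  fixes a b t :: real
  assumes "0 \<le> a" "0 \<le> b" "0 < t" "t < 1"
  shows "a powr (1 - t) * b powr t \<le> a + b"
proof -
  have "a powr (1 - t) * b powr t \<le> (a + b) powr (1 - t) * (a + b) powr t"
    using assms by (intro mult_mono powr_mono2) auto
  also have "\<dots> = a + b" using assms by (simp add: powr_add[symmetric])
  finally show ?thesis .
qed

text \<open>
  The part of the Riesz interaction near the diagonal, for densities in \<open>L\<^sup>1\<close> and
  \<open>L\<^sup>1\<^sup>+\<^sup>t\<close>: the product \<open>f(x) f(y)\<close> is at most \<open>f(x) powr (1 + t) * f(y) powr (1 - t)\<close> plus its mirror
  image, and Young's inequality bounds the potential of \<open>f powr (1 - t)\<close> uniformly because \<open>\<beta> / t < 3\<close>.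
\<close>

lemma riesz_near_diagonal:
  assumes t: "0 < t" "t < 1" and \<beta>: "0 < \<beta>" "\<beta> / t < 3"
  shows "\<exists>C>0. \<forall>R>0. \<forall>l>0. \<forall>f :: R3 \<Rightarrow> real. integrable lborel f \<longrightarrow> (\<forall>x. 0 \<le> f x) \<longrightarrow>
    integrable lborel (\<lambda>x. f x powr (1 + t)) \<longrightarrow>
    (\<integral>\<^sup>+p. ennreal (near_wt R p * (f (fst p) * f (snd p) / norm (fst p - snd p) powr \<beta>)) \<partial>lborel2)
      \<le> ennreal (2 * (l * (LINT x|lborel. f x) + l powr (- ((1 - t) / t)) * (C * R powr (3 - \<beta> / t)))
          * (LINT x|lborel. f x powr (1 + t)))"
proof -
  obtain C where C: "C > 0" "\<And>r. r > 0 \<Longrightarrow> integrable lborel (\<lambda>w :: R3. indicator {w. norm w < r} w * norm w powr (- (\<beta> / t)))"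
    "\<And>r. r > 0 \<Longrightarrow> (LINT w|lborel. indicator {w :: R3. norm w < r} w * norm w powr (- (\<beta> / t))) \<le> C * r powr (3 - \<beta> / t)"
    using integral_power_inside_ball[OF \<beta>(2)] by auto
  show ?thesis
  proof (intro exI[of _ C] conjI C(1) allI impI)
    fix R l :: real and f :: "R3 \<Rightarrow> real"
    assume R: "R > 0" and l: "l > 0" and f: "integrable lborel f" and f0: "\<forall>x. 0 \<le> f x"
      and f1: "integrable lborel (\<lambda>x. f x powr (1 + t))"
    have [measurable]: "f \<in> borel_measurable borel" using f by (auto dest: borel_measurable_integrable)
    define \<Gamma> where "\<Gamma> = l * (LINT x|lborel. f x) + l powr (- ((1 - t) / t)) * (C * R powr (3 - \<beta> / t))"
    define k where "k w = indicator {w. norm w < R} w * norm w powr (- (\<beta> / t))" for w :: R3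
    have km[measurable]: "k \<in> borel_measurable borel" unfolding k_def by measurable
    have k0: "k w \<ge> 0" for w by (simp add: k_def)
    have kp: "k w powr t = indicator {w. norm w < R} w / norm w powr \<beta>" for w
    proof (cases "norm w < R")
      case True
      then have "k w powr t = norm w powr (- \<beta>)" using t by (simp add: k_def powr_powr)
      then show ?thesis using True by (simp add: powr_minus_divide)
    qed (simp add: k_def)
    define h where "h x y = f y powr (1 - t) * k (x - y) powr t" for x y
    have \<Gamma>0: "\<Gamma> \<ge> 0" unfolding \<Gamma>_def using l C(1) f0 by (intro add_nonneg_nonneg mult_nonneg_nonneg Bochner_Integration.integral_nonneg) auto
    have pot: "(\<integral>\<^sup>+y. ennreal (h x y) \<partial>lborel) \<le> ennreal \<Gamma>" for x
    proof -
      have hle: "h x y \<le> l * f y + l powr (- ((1 - t) / t)) * k (x - y)" for y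
      proof -
        have "(l * f y) powr (1 - t) * (l powr (- ((1 - t) / t)) * k (x - y)) powr t \<le> l * f y + l powr (- ((1 - t) / t)) * k (x - y)"
          using l f0 k0 t by (intro young_powr) auto
        also have "(l * f y) powr (1 - t) = l powr (1 - t) * f y powr (1 - t)" using l f0 by (simp add: powr_mult)
        also have "(l powr (- ((1 - t) / t)) * k (x - y)) powr t = l powr (- (1 - t)) * k (x - y) powr t"
          using l k0[of "x - y"] t by (simp add: powr_mult powr_powr)
        also have "l powr (1 - t) * f y powr (1 - t) * (l powr (- (1 - t)) * k (x - y) powr t) = (l powr (1 - t) * l powr (- (1 - t))) * h x y"
          by (simp add: h_def)
        also have "l powr (1 - t) * l powr (- (1 - t)) = 1" using l by (simp add: powr_add[symmetric])
        finally show ?thesis by simp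
      qed
      have k1: "integrable lborel k" "(LINT y|lborel. k y) \<le> C * R powr (3 - \<beta> / t)"
        unfolding k_def[abs_def] using C(2,3)[OF R] by auto
      have ki: "integrable lborel (\<lambda>y. k (x - y))" and kle: "(LINT y|lborel. k (x - y)) \<le> C * R powr (3 - \<beta> / t)"
        using integral_lborel_shift(9)[of k x] integral_lborel_shift(4)[of k x] k1 km by auto
      have mi: "integrable lborel (\<lambda>y. l * f y + l powr (- ((1 - t) / t)) * k (x - y))" using f ki by simp
      have "(\<integral>\<^sup>+y. ennreal (h x y) \<partial>lborel) \<le> (\<integral>\<^sup>+y. ennreal (l * f y + l powr (- ((1 - t) / t)) * k (x - y)) \<partial>lborel)"
        by (intro nn_integral_mono ennreal_leI hle)
      also have "\<dots> = ennreal (LINT y|lborel. l * f y + l powr (- ((1 - t) / t)) * k (x - y))"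
        using l f0 k0 by (intro nn_integral_eq_integral[OF mi]) (auto intro!: AE_I2 add_nonneg_nonneg)
      also have "\<dots> \<le> ennreal \<Gamma>"
        using f ki kle by (intro ennreal_leI) (simp add: \<Gamma>_def mult_left_mono)
      finally show ?thesis .
    qed
    define L where "L = (\<integral>\<^sup>+x. ennreal (f x powr (1 + t)) \<partial>lborel)"
    have Leq: "L = ennreal (LINT x|lborel. f x powr (1 + t))"
      unfolding L_def by (rule nn_integral_eq_integral[OF f1]) simp
    have hm: "(\<lambda>(x, y). h x y) \<in> borel_measurable lborel2" unfolding h_def by measurable
    have hm'[measurable]: "(\<lambda>p. h (fst p) (snd p)) \<in> borel_measurable lborel2"
      using hm by (simp add: case_prod_beta')
    have hm2[measurable]: "(\<lambda>p. h (snd p) (fst p)) \<in> borel_measurable lborel2"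
      unfolding h_def by measurable
    have half: "(\<integral>\<^sup>+x. \<integral>\<^sup>+y. ennreal (f x powr (1 + t) * h x y) \<partial>lborel \<partial>lborel) \<le> ennreal \<Gamma> * L"
    proof -
      have "(\<integral>\<^sup>+x. \<integral>\<^sup>+y. ennreal (f x powr (1 + t) * h x y) \<partial>lborel \<partial>lborel)
          = (\<integral>\<^sup>+x. ennreal (f x powr (1 + t)) * (\<integral>\<^sup>+y. ennreal (h x y) \<partial>lborel) \<partial>lborel)"
        by (intro nn_integral_cong) (subst nn_integral_cmult[symmetric], auto simp: h_def ennreal_mult intro!: nn_integral_cong)
      also have "\<dots> \<le> (\<integral>\<^sup>+x. ennreal \<Gamma> * ennreal (f x powr (1 + t)) \<partial>lborel)"
      proof (rule nn_integral_mono)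
        fix x
        show "ennreal (f x powr (1 + t)) * (\<integral>\<^sup>+y. ennreal (h x y) \<partial>lborel) \<le> ennreal \<Gamma> * ennreal (f x powr (1 + t))"
          using mult_left_mono[OF pot, of "ennreal (f x powr (1 + t))" x] by (simp add: mult.commute)
      qed
      also have "\<dots> = ennreal \<Gamma> * L" unfolding L_def by (rule nn_integral_cmult) measurable
      finally show ?thesis .
    qed
    have pt: "near_wt R p * (f (fst p) * f (snd p) / norm (fst p - snd p) powr \<beta>)
       \<le> f (fst p) powr (1 + t) * h (fst p) (snd p) + f (snd p) powr (1 + t) * h (snd p) (fst p)" for p
    proof -
      obtain x y where p: "p = (x, y)" by (cases p)
      have nn: "norm (y - x) = norm (x - y)" by (rule norm_minus_commute)
      have kk: "k (y - x) powr t = k (x - y) powr t" unfolding kp by (simp add: nn indicator_def)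
      have prod: "a * b \<le> a powr (1 + t) * b powr (1 - t)" if "0 \<le> b" "b \<le> a" for a b :: real
      proof -
        have "b = b powr (1 - t) * b powr t" using that t by (cases "b = 0") (auto simp: powr_add[symmetric])
        also have "\<dots> \<le> b powr (1 - t) * a powr t" using that t by (intro mult_left_mono powr_mono2) auto
        finally have "a * b \<le> a * (b powr (1 - t) * a powr t)" using that by (intro mult_left_mono) auto
        also have "\<dots> = a powr (1 + t) * b powr (1 - t)" using that by (cases "a = 0") (auto simp: powr_add)
        finally show ?thesis .
      qed
      have "f x * f y \<le> f x powr (1 + t) * f y powr (1 - t) + f y powr (1 + t) * f x powr (1 - t)"
      proof (cases "f y \<le> f x")
        case True
        then show ?thesis using prod[of "f y" "f x"] f0 by (simp add: add_increasing2)
      next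
        case False
        then show ?thesis using prod[of "f x" "f y"] f0 by (simp add: add_increasing mult.commute)
      qed
      then have "k (x - y) powr t * (f x * f y) \<le> k (x - y) powr t * (f x powr (1 + t) * f y powr (1 - t) + f y powr (1 + t) * f x powr (1 - t))"
        by (intro mult_left_mono) auto
      also have "k (x - y) powr t * (f x * f y) = near_wt R p * (f (fst p) * f (snd p) / norm (fst p - snd p) powr \<beta>)"
        by (simp add: kp p near_wt_def indicator_def)
      also have "k (x - y) powr t * (f x powr (1 + t) * f y powr (1 - t) + f y powr (1 + t) * f x powr (1 - t))
         = f (fst p) powr (1 + t) * h (fst p) (snd p) + f (snd p) powr (1 + t) * h (snd p) (fst p)"
        by (simp add: p h_def kk algebra_simps)
      finally show ?thesis .
    qed
    have h0: "h x y \<ge> 0" for x y by (simp add: h_def)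
    have "(\<integral>\<^sup>+p. ennreal (near_wt R p * (f (fst p) * f (snd p) / norm (fst p - snd p) powr \<beta>)) \<partial>lborel2)
      \<le> (\<integral>\<^sup>+p. ennreal (f (fst p) powr (1 + t) * h (fst p) (snd p)) + ennreal (f (snd p) powr (1 + t) * h (snd p) (fst p)) \<partial>lborel2)"
      by (intro nn_integral_mono) (use pt h0 in \<open>simp add: ennreal_plus[symmetric] ennreal_leI del: ennreal_plus\<close>)
    also have "\<dots> = (\<integral>\<^sup>+p. ennreal (f (fst p) powr (1 + t) * h (fst p) (snd p)) \<partial>lborel2)
        + (\<integral>\<^sup>+p. ennreal (f (snd p) powr (1 + t) * h (snd p) (fst p)) \<partial>lborel2)"
      by (rule nn_integral_add) measurable
    also have "(\<integral>\<^sup>+p. ennreal (f (fst p) powr (1 + t) * h (fst p) (snd p)) \<partial>lborel2)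
        = (\<integral>\<^sup>+x. \<integral>\<^sup>+y. ennreal (f x powr (1 + t) * h x y) \<partial>lborel \<partial>lborel)"
      by (subst lborel.nn_integral_fst[symmetric]) auto
    also have "(\<integral>\<^sup>+p. ennreal (f (snd p) powr (1 + t) * h (snd p) (fst p)) \<partial>lborel2)
        = (\<integral>\<^sup>+y. \<integral>\<^sup>+x. ennreal (f y powr (1 + t) * h y x) \<partial>lborel \<partial>lborel)"
      by (subst lborel_pair.nn_integral_snd[symmetric]) auto
    also have "(\<integral>\<^sup>+x. \<integral>\<^sup>+y. ennreal (f x powr (1 + t) * h x y) \<partial>lborel \<partial>lborel)
        + (\<integral>\<^sup>+y. \<integral>\<^sup>+x. ennreal (f y powr (1 + t) * h y x) \<partial>lborel \<partial>lborel) \<le> ennreal \<Gamma> * L + ennreal \<Gamma> * L"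
      by (intro add_mono half)
    also have "\<dots> = ennreal (2 * \<Gamma> * (LINT x|lborel. f x powr (1 + t)))"
      unfolding Leq using \<Gamma>0 by (simp add: ennreal_mult[symmetric] ennreal_plus[symmetric] del: ennreal_plus)
    finally show "(\<integral>\<^sup>+p. ennreal (near_wt R p * (f (fst p) * f (snd p) / norm (fst p - snd p) powr \<beta>)) \<partial>lborel2)
      \<le> ennreal (2 * (l * (LINT x|lborel. f x) + l powr (- ((1 - t) / t)) * (C * R powr (3 - \<beta> / t)))
          * (LINT x|lborel. f x powr (1 + t)))"
      by (simp add: \<Gamma>_def)
  qed
qed

text \<open>
  The estimate \<open>riesz_near_diagonal\<close> for the density \<open>\<bar>u\<bar>\<^sup>2\<close> with \<open>t = 2s/3\<close>, for which the density to the power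
  \<open>1 + t\<close> is the mass-critical power of \<open>u\<close>.
\<close>

lemma har_near:
  assumes s: "3 / 4 < s" "s < 1"
  shows "\<exists>C>0. \<forall>(u :: R3 \<Rightarrow> 'k :: euclidean_space) \<in> Hs s. \<forall>R>0. \<forall>l>0.
    integrable lborel2 (\<lambda>p. near_wt R p * har_dens s u p) \<and>
    (LINT p|lborel2. near_wt R p * har_dens s u p) \<le>
      2 * (l * mass u + l powr (- ((1 - 2 * s / 3) / (2 * s / 3))) * (C * R powr (3 - (3 - 2 * s) / (2 * s / 3)))) * lp (2 + 4 * s / 3) u"
proof -
  let ?c = "2 * s / 3" and ?\<beta> = "3 - 2 * s"
  have th: "0 < ?c" "?c < 1" "0 < ?\<beta>" "?\<beta> / ?c < 3" using s by (auto simp: field_simps)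
  obtain C where C0: "C > 0" and C1: "\<forall>R>0. \<forall>l>0. \<forall>f :: R3 \<Rightarrow> real. integrable lborel f \<longrightarrow> (\<forall>x. 0 \<le> f x) \<longrightarrow>
    integrable lborel (\<lambda>x. f x powr (1 + ?c)) \<longrightarrow>
    (\<integral>\<^sup>+p. ennreal (near_wt R p * (f (fst p) * f (snd p) / norm (fst p - snd p) powr ?\<beta>)) \<partial>lborel2)
      \<le> ennreal (2 * (l * (LINT x|lborel. f x) + l powr (- ((1 - ?c) / ?c)) * (C * R powr (3 - ?\<beta> / ?c)))
          * (LINT x|lborel. f x powr (1 + ?c)))"
    using riesz_near_diagonal[OF th] by (elim exE conjE) (rule that)
  note C = C0 C1[rule_format]
  show ?thesis
  proof (intro exI[of _ C] conjI C(1) ballI allI impI)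
    fix u :: "R3 \<Rightarrow> 'k" and R l :: real
    assume u: "u \<in> Hs s" and R: "R > 0" and l: "l > 0"
    note h = HsD[OF u]
    have [measurable]: "u \<in> borel_measurable borel" by (rule h)
    have qi: "integrable lborel (\<lambda>x. norm (u x) powr (2 + 4 * s / 3))"
      using critical_interpolation[of s, where 'k = 'k] s u by auto
    have pw: "(norm (u x) ^ 2) powr (1 + ?c) = norm (u x) powr (2 + 4 * s / 3)" for x
    proof -
      have "(norm (u x) powr 2) powr (1 + ?c) = norm (u x) powr (2 + 4 * s / 3)"
        unfolding powr_powr by (rule arg_cong[where f = "\<lambda>t. norm (u x) powr t"]) simp
      then show ?thesis by simp
    qed
    let ?B = "2 * (l * mass u + l powr (- ((1 - ?c) / ?c)) * (C * R powr (3 - ?\<beta> / ?c))) * lp (2 + 4 * s / 3) u"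
    have le: "(\<integral>\<^sup>+p. ennreal (near_wt R p * har_dens s u p) \<partial>lborel2) \<le> ennreal ?B"
      using C(2)[OF R l h(2)] qi unfolding pw har_dens_def mass_def lp_def by simp
    have B0: "0 \<le> ?B" using l C(1) mass_nonneg[of u] lp_nonneg[of "2 + 4 * s / 3" u] by (intro mult_nonneg_nonneg add_nonneg_nonneg) auto
    have nn: "AE p in lborel2. 0 \<le> near_wt R p * har_dens s u p"
      by (intro AE_I2 mult_nonneg_nonneg har_dens_nonneg) (simp add: near_wt_def)
    show "integrable lborel2 (\<lambda>p. near_wt R p * har_dens s u p)"
      by (rule integrable_from_nn_integral_le(1)[OF _ nn le B0]) measurable
    show "(LINT p|lborel2. near_wt R p * har_dens s u p) \<le> ?B"
      by (rule integrable_from_nn_integral_le(2)[OF _ nn le B0]) measurable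
  qed
qed

lemma har_far:
  assumes s: "s < 1" and u: "u \<in> Hs s" and R: "R > 0"
  shows "integrable lborel2 (\<lambda>p. (1 - near_wt R p) * har_dens s u p)"
    and "(LINT p|lborel2. (1 - near_wt R p) * har_dens s u p) \<le> R powr (- (3 - 2 * s)) * mass u ^ 2"
proof -
  note h = HsD[OF u]
  have [measurable]: "u \<in> borel_measurable borel" by (rule h)
  have ff: "integrable lborel2 (\<lambda>p. norm (u (fst p)) ^ 2 * norm (u (snd p)) ^ 2)"
    by (rule integrable_lborel_product[OF h(2) h(2)])
  have ffi: "(LINT p|lborel2. norm (u (fst p)) ^ 2 * norm (u (snd p)) ^ 2) = mass u ^ 2"
    using lborel_pair.integral_fst'[OF ff] by (simp add: mass_def power2_eq_square)
  have maj: "integrable lborel2 (\<lambda>p. R powr (- (3 - 2 * s)) * (norm (u (fst p)) ^ 2 * norm (u (snd p)) ^ 2))"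
    using ff by simp
  have le: "(1 - near_wt R p) * har_dens s u p \<le> R powr (- (3 - 2 * s)) * (norm (u (fst p)) ^ 2 * norm (u (snd p)) ^ 2)" for p
  proof (cases "norm (fst p - snd p) < R")
    case False
    have "1 / norm (fst p - snd p) powr (3 - 2 * s) = norm (fst p - snd p) powr (- (3 - 2 * s))" by (rule powr_minus_divide[symmetric])
    also have "\<dots> \<le> R powr (- (3 - 2 * s))" using False R s by (intro powr_mono2') auto
    finally have "(norm (u (fst p)) ^ 2 * norm (u (snd p)) ^ 2) * (1 / norm (fst p - snd p) powr (3 - 2 * s))
        \<le> (norm (u (fst p)) ^ 2 * norm (u (snd p)) ^ 2) * R powr (- (3 - 2 * s))"
      by (intro mult_left_mono) auto
    then show ?thesis using False by (simp add: near_wt_def har_dens_def mult_ac)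
  qed (simp add: near_wt_def)
  have nn: "0 \<le> (1 - near_wt R p) * har_dens s u p" for p
    by (intro mult_nonneg_nonneg har_dens_nonneg) (simp add: near_wt_def)
  show i: "integrable lborel2 (\<lambda>p. (1 - near_wt R p) * har_dens s u p)"
    by (rule integrable_majorant_nonneg[OF maj _ nn le]) measurable
  have "(LINT p|lborel2. (1 - near_wt R p) * har_dens s u p)
      \<le> (LINT p|lborel2. R powr (- (3 - 2 * s)) * (norm (u (fst p)) ^ 2 * norm (u (snd p)) ^ 2))"
    by (rule integral_mono[OF i maj le])
  then show "(LINT p|lborel2. (1 - near_wt R p) * har_dens s u p) \<le> R powr (- (3 - 2 * s)) * mass u ^ 2"
    using ffi by simp
qed

lemma har_split:
  assumes s: "3 / 4 < s" "s < 1" and u: "(u :: R3 \<Rightarrow> 'k :: euclidean_space) \<in> Hs s" and R: "R > 0"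
  shows "integrable lborel2 (har_dens s u)"
    and "har s u = (LINT p|lborel2. near_wt R p * har_dens s u p) + (LINT p|lborel2. (1 - near_wt R p) * har_dens s u p)"
    and "integrable lborel2 (\<lambda>p. near_wt R p * har_dens s u p)"
proof -
  show n: "integrable lborel2 (\<lambda>p. near_wt R p * har_dens s u p)"
    using har_near[OF s, where 'k = 'k] u R zero_less_one by blast
  note f = har_far(1)[OF s(2) u R]
  have eq: "har_dens s u p = near_wt R p * har_dens s u p + (1 - near_wt R p) * har_dens s u p" for p by (simp add: algebra_simps)
  have "integrable lborel2 (\<lambda>p. near_wt R p * har_dens s u p + (1 - near_wt R p) * har_dens s u p)"
    using n f by (rule Bochner_Integration.integrable_add)
  then show "integrable lborel2 (har_dens s u)" by (simp add: algebra_simps)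
  have "har s u = (LINT p|lborel2. near_wt R p * har_dens s u p + (1 - near_wt R p) * har_dens s u p)"
    unfolding har_def by (rule Bochner_Integration.integral_cong[OF refl eq])
  then show "har s u = (LINT p|lborel2. near_wt R p * har_dens s u p) + (LINT p|lborel2. (1 - near_wt R p) * har_dens s u p)"
    using Bochner_Integration.integral_add[OF n f] by simp
qed

lemma har_nonneg: "0 \<le> har s u"
  unfolding har_def by (intro Bochner_Integration.integral_nonneg har_dens_nonneg)

text \<open>
  The exponent of \<open>R\<close> is positive exactly when \<open>s > 3/4\<close>: this is where the lower bound on \<open>s\<close> makes
  the Hartree interaction subcritical.
\<close>

lemma har_near_small:
  assumes s: "3 / 4 < s" "s < 1" and \<eta>: "\<eta> > 0" and m: "m > 0"
  shows "\<exists>R>0. \<forall>(u :: R3 \<Rightarrow> 'k :: euclidean_space) \<in> Hs s. mass u \<le> m \<longrightarrow>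
    (LINT p|lborel2. near_wt R p * har_dens s u p) \<le> \<eta> * lp (2 + 4 * s / 3) u"
proof -
  obtain C where C: "C > 0" "\<And>(u :: R3 \<Rightarrow> 'k) R l. u \<in> Hs s \<Longrightarrow> R > 0 \<Longrightarrow> l > 0 \<Longrightarrow>
    (LINT p|lborel2. near_wt R p * har_dens s u p) \<le>
      2 * (l * mass u + l powr (- ((1 - 2 * s / 3) / (2 * s / 3))) * (C * R powr (3 - (3 - 2 * s) / (2 * s / 3)))) * lp (2 + 4 * s / 3) u"
    using har_near[OF s, where 'k = 'k] by blast
  define e where "e = 3 - (3 - 2 * s) / (2 * s / 3)"
  have e: "e > 0" using s by (simp add: e_def field_simps)
  define l where "l = \<eta> / (4 * m)"
  have l: "l > 0" using \<eta> m by (simp add: l_def)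
  define L where "L = l powr (- ((1 - 2 * s / 3) / (2 * s / 3))) * C"
  have L: "L > 0" using l C(1) by (simp add: L_def)
  define R where "R = (\<eta> / (4 * L)) powr (1 / e)"
  have R: "R > 0" using \<eta> L by (simp add: R_def)
  have Re: "L * R powr e = \<eta> / 4" using \<eta> L e by (simp add: R_def powr_powr)
  show ?thesis
  proof (intro exI[of _ R] conjI R ballI impI)
    fix u :: "R3 \<Rightarrow> 'k" assume u: "u \<in> Hs s" and mu: "mass u \<le> m"
    have "l * mass u \<le> l * m" using mu l by (intro mult_left_mono) auto
    also have "\<dots> = \<eta> / 4" using m by (simp add: l_def)
    finally have a: "l * mass u + l powr (- ((1 - 2 * s / 3) / (2 * s / 3))) * (C * R powr (3 - (3 - 2 * s) / (2 * s / 3))) \<le> \<eta> / 2"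
      using Re by (simp add: L_def e_def mult.assoc)
    have "(LINT p|lborel2. near_wt R p * har_dens s u p) \<le>
      2 * (l * mass u + l powr (- ((1 - 2 * s / 3) / (2 * s / 3))) * (C * R powr (3 - (3 - 2 * s) / (2 * s / 3)))) * lp (2 + 4 * s / 3) u"
      by (rule C(2)[OF u R l])
    also have "\<dots> \<le> 2 * (\<eta> / 2) * lp (2 + 4 * s / 3) u"
      using a lp_nonneg by (intro mult_right_mono mult_left_mono) auto
    finally show "(LINT p|lborel2. near_wt R p * har_dens s u p) \<le> \<eta> * lp (2 + 4 * s / 3) u" by simp
  qed
qed

lemma har_bound:
  assumes s: "3 / 4 < s" "s < 1" and m: "m > 0"
  shows "\<eta> > 0 \<Longrightarrow> \<exists>K>0. \<forall>(u :: R3 \<Rightarrow> 'k :: euclidean_space) \<in> Hs s. mass u \<le> m \<longrightarrow> har s u \<le> \<eta> * lp (2 + 4 * s / 3) u + K"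
    and "\<eta> > 0 \<Longrightarrow> \<exists>K>0. \<forall>(u :: R3 \<Rightarrow> 'k :: euclidean_space) \<in> Hs s. mass u \<le> m \<longrightarrow> har s u \<le> K * lp (2 + 4 * s / 3) u + \<eta>"
proof -
  have far: "(LINT p|lborel2. (1 - near_wt R p) * har_dens s u p) \<le> R powr (- (3 - 2 * s)) * m ^ 2"
    if "u \<in> Hs s" "mass u \<le> m" "R > 0" for R and u :: "R3 \<Rightarrow> 'k"
  proof -
    have "(LINT p|lborel2. (1 - near_wt R p) * har_dens s u p) \<le> R powr (- (3 - 2 * s)) * mass u ^ 2"
      by (rule har_far(2)[OF s(2) that(1,3)])
    also have "\<dots> \<le> R powr (- (3 - 2 * s)) * m ^ 2"
      using that mass_nonneg[of u] by (intro mult_left_mono power_mono) auto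
    finally show ?thesis .
  qed
  show "\<exists>K>0. \<forall>(u :: R3 \<Rightarrow> 'k) \<in> Hs s. mass u \<le> m \<longrightarrow> har s u \<le> \<eta> * lp (2 + 4 * s / 3) u + K" if e: "\<eta> > 0"
  proof -
    obtain R where R: "R > 0" "\<And>u :: R3 \<Rightarrow> 'k. u \<in> Hs s \<Longrightarrow> mass u \<le> m \<Longrightarrow>
      (LINT p|lborel2. near_wt R p * har_dens s u p) \<le> \<eta> * lp (2 + 4 * s / 3) u"
      using har_near_small[OF s e m, where 'k = 'k] by blast
    show ?thesis
    proof (intro exI[of _ "R powr (- (3 - 2 * s)) * m ^ 2"] conjI ballI impI)
      show "R powr (- (3 - 2 * s)) * m ^ 2 > 0" using R m by simp
      fix u :: "R3 \<Rightarrow> 'k" assume u: "u \<in> Hs s" "mass u \<le> m"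
      show "har s u \<le> \<eta> * lp (2 + 4 * s / 3) u + R powr (- (3 - 2 * s)) * m ^ 2"
        unfolding har_split(2)[OF s u(1) R(1)] by (intro add_mono R(2) far u R(1))
    qed
  qed
  show "\<exists>K>0. \<forall>(u :: R3 \<Rightarrow> 'k) \<in> Hs s. mass u \<le> m \<longrightarrow> har s u \<le> K * lp (2 + 4 * s / 3) u + \<eta>" if e: "\<eta> > 0"
  proof -
    obtain C where C: "C > 0" "\<And>(u :: R3 \<Rightarrow> 'k) R l. u \<in> Hs s \<Longrightarrow> R > 0 \<Longrightarrow> l > 0 \<Longrightarrow>
      (LINT p|lborel2. near_wt R p * har_dens s u p) \<le>
        2 * (l * mass u + l powr (- ((1 - 2 * s / 3) / (2 * s / 3))) * (C * R powr (3 - (3 - 2 * s) / (2 * s / 3)))) * lp (2 + 4 * s / 3) u"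
      using har_near[OF s, where 'k = 'k] by blast
    define R where "R = (\<eta> / m ^ 2) powr (- (1 / (3 - 2 * s)))"
    have R: "R > 0" using e m by (simp add: R_def)
    have Re: "R powr (- (3 - 2 * s)) * m ^ 2 = \<eta>"
    proof -
      have "R powr (- (3 - 2 * s)) = (\<eta> / m ^ 2) powr 1"
        unfolding R_def powr_powr minus_mult_minus using s by simp
      then show ?thesis using e m by simp
    qed
    define K where "K = 2 * (m + C * R powr (3 - (3 - 2 * s) / (2 * s / 3)))"
    have K: "K > 0" using C(1) R m by (simp add: K_def add_pos_pos)
    show ?thesis
    proof (intro exI[of _ K] conjI K ballI impI)
      fix u :: "R3 \<Rightarrow> 'k" assume u: "u \<in> Hs s" "mass u \<le> m"
      have "(LINT p|lborel2. near_wt R p * har_dens s u p) \<le>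
        2 * (1 * mass u + 1 powr (- ((1 - 2 * s / 3) / (2 * s / 3))) * (C * R powr (3 - (3 - 2 * s) / (2 * s / 3)))) * lp (2 + 4 * s / 3) u"
        by (rule C(2)[OF u(1) R]) simp
      also have "\<dots> \<le> K * lp (2 + 4 * s / 3) u"
        using u(2) by (intro mult_right_mono lp_nonneg) (simp add: K_def)
      finally have "(LINT p|lborel2. near_wt R p * har_dens s u p) \<le> K * lp (2 + 4 * s / 3) u" .
      then show "har s u \<le> K * lp (2 + 4 * s / 3) u + \<eta>"
        unfolding har_split(2)[OF s u(1) R] using far[OF u R] Re by linarith
    qed
  qed
qed

section \<open>Coercivity\<close>

text \<open>
  The energy of a Borel function, with the kinetic term expressed through the Gagliardo seminorm and
  \<open>b\<close> in place of the coefficient \<open>2 * a powr (p - 2) / p\<close>.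
\<close>

definition en :: "real \<Rightarrow> (R3 \<Rightarrow> real) \<Rightarrow> real \<Rightarrow> real \<Rightarrow> (R3 \<Rightarrow> 'k :: euclidean_space) \<Rightarrow> real" where
  "en s V p b u = kin_const s * gag s u + (LINT x|lborel. V x * norm (u x) ^ 2) - har s u / 2 - b * lp p u"

lemma potential_integral:
  assumes u: "u \<in> Hs s" and V[measurable]: "V \<in> borel_measurable borel" and M: "\<And>x. \<bar>V x\<bar> \<le> M"
  shows "integrable lborel (\<lambda>x. V x * norm (u x) ^ 2)" "\<bar>LINT x|lborel. V x * norm (u x) ^ 2\<bar> \<le> M * mass u"
proof -
  note h = HsD[OF u]
  have [measurable]: "u \<in> borel_measurable borel" by (rule h)
  have maj: "integrable lborel (\<lambda>x. M * norm (u x) ^ 2)" using h(2) by simp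
  have le: "\<bar>V x * norm (u x) ^ 2\<bar> \<le> M * norm (u x) ^ 2" for x
    using M[of x] by (simp add: abs_mult mult_right_mono)
  show i: "integrable lborel (\<lambda>x. V x * norm (u x) ^ 2)"
    by (rule integrable_majorant[OF maj]) (use le in auto)
  have "\<bar>LINT x|lborel. V x * norm (u x) ^ 2\<bar> \<le> (LINT x|lborel. \<bar>V x * norm (u x) ^ 2\<bar>)" by (rule integral_abs_bound)
  also have "\<dots> \<le> (LINT x|lborel. M * norm (u x) ^ 2)" using i by (intro integral_mono maj le) auto
  finally show "\<bar>LINT x|lborel. V x * norm (u x) ^ 2\<bar> \<le> M * mass u" by (simp add: mass_def)
qed

text \<open>
  The attractive terms are at most an arbitrarily small multiple of the mass-critical power plus a
  constant, and at fixed mass the Gagliardo seminorm controls that power.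
\<close>

lemma energy_coercive:
  assumes s: "3 / 4 < s" "s < 1" and p: "2 < p" "p < 2 + 4 * s / 3" and b: "b > 0" and m: "m > 0"
    and V: "V \<in> borel_measurable borel" and M: "\<And>x. \<bar>V x\<bar> \<le> M"
  shows "\<exists>c. \<forall>(u :: R3 \<Rightarrow> 'k :: euclidean_space) \<in> Hs s. mass u = m \<longrightarrow> kin_const s / 2 * gag s u - c \<le> en s V p b u"
proof -
  have s0: "0 < s" using s by simp
  have k: "kin_const s > 0" using kin_const_pos[of s] s by simp
  obtain C where C: "C > 0" "\<And>u :: R3 \<Rightarrow> 'k. u \<in> Hs s \<Longrightarrow>
      (\<forall>x. (LINT y|lborel. indicator (ball x 1) y * norm (u y) ^ 2) \<le> m) \<Longrightarrow>
      lp (2 + 4 * s / 3) u \<le> C * m powr (2 * s / 3) * (gag s u + mass u)"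
    using critical_interpolation[OF s0, where 'k = 'k] m by blast
  define A where "A = C * m powr (2 * s / 3)"
  have A: "A > 0" using C(1) m by (simp add: A_def)
  have q: "lp (2 + 4 * s / 3) u \<le> A * (gag s u + m)" if "u \<in> Hs s" "mass u = m" for u :: "R3 \<Rightarrow> 'k"
    using C(2)[OF that(1)] local_mass_le(2)[OF that(1), of _ 1] that(2) by (simp add: A_def)
  define e1 where "e1 = kin_const s / (2 * A)"
  define e2 where "e2 = kin_const s / (4 * A * b)"
  have e: "e1 > 0" "e2 > 0" using k A b by (auto simp: e1_def e2_def)
  obtain K1 where K1: "\<And>u :: R3 \<Rightarrow> 'k. u \<in> Hs s \<Longrightarrow> mass u \<le> m \<Longrightarrow> har s u \<le> e1 * lp (2 + 4 * s / 3) u + K1"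
    using har_bound(1)[OF s m e(1), where 'k = 'k] by blast
  obtain K2 where K2: "\<And>u :: R3 \<Rightarrow> 'k. u \<in> Hs s \<Longrightarrow> lp p u \<le> e2 * lp (2 + 4 * s / 3) u + K2 * mass u"
    using lp_interpolation(2)[OF s0 p e(2), where 'k = 'k] by blast
  show ?thesis
  proof (intro exI[of _ "kin_const s / 2 * m + M * m + K1 / 2 + b * (K2 * m)"] ballI impI)
    fix u :: "R3 \<Rightarrow> 'k" assume u: "u \<in> Hs s" "mass u = m"
    define g where "g = gag s u + m"
    have h: "har s u \<le> e1 * (A * g) + K1"
    proof -
      have "har s u \<le> e1 * lp (2 + 4 * s / 3) u + K1" using K1[OF u(1)] u(2) by simp
      also have "e1 * lp (2 + 4 * s / 3) u \<le> e1 * (A * g)"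
        unfolding g_def using e by (intro mult_left_mono q u) simp
      finally show ?thesis by simp
    qed
    have e1A: "e1 * (A * g) = kin_const s / 2 * g" using A by (simp add: e1_def)
    have l: "lp p u \<le> e2 * (A * g) + K2 * m"
    proof -
      have "lp p u \<le> e2 * lp (2 + 4 * s / 3) u + K2 * m" using K2[OF u(1)] u(2) by simp
      also have "e2 * lp (2 + 4 * s / 3) u \<le> e2 * (A * g)"
        unfolding g_def using e by (intro mult_left_mono q u) simp
      finally show ?thesis by simp
    qed
    then have "b * lp p u \<le> b * (e2 * (A * g) + K2 * m)" using b by (intro mult_left_mono) auto
    also have "\<dots> = kin_const s / 4 * g + b * (K2 * m)" using A b by (simp add: e2_def field_simps)
    finally have l': "b * lp p u \<le> kin_const s / 4 * g + b * (K2 * m)" .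
    have v: "- (M * m) \<le> (LINT x|lborel. V x * norm (u x) ^ 2)"
      using potential_integral(2)[OF u(1) V M] u(2) by simp
    show "kin_const s / 2 * gag s u - (kin_const s / 2 * m + M * m + K1 / 2 + b * (K2 * m)) \<le> en s V p b u"
    proof -
      have g2: "kin_const s / 2 * g = kin_const s * gag s u / 2 + kin_const s / 2 * m"
        and g4: "kin_const s / 4 * g = kin_const s * gag s u / 4 + kin_const s / 2 * m / 2"
        by (simp_all add: g_def algebra_simps)
      have g1: "kin_const s / 2 * gag s u = kin_const s * gag s u / 2" by simp
      show ?thesis unfolding en_def g1 using h[unfolded e1A g2] l'[unfolded g4] v by linarith
    qed
  qed
qed

lemma nonlinear_terms_vanish:
  assumes s: "3 / 4 < s" "s < 1" and p: "2 < p" "p < 2 + 4 * s / 3" and m: "m > 0"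
    and u: "\<And>n. u n \<in> Hs s" "\<And>n. mass (u n :: R3 \<Rightarrow> 'k :: euclidean_space) \<le> m"
    and q: "(\<lambda>n. lp (2 + 4 * s / 3) (u n)) \<longlonglongrightarrow> 0"
  shows "(\<lambda>n. har s (u n)) \<longlonglongrightarrow> 0" "(\<lambda>n. lp p (u n)) \<longlonglongrightarrow> 0"
proof -
  have gen: "f \<longlonglongrightarrow> 0" if f0: "\<And>n. 0 \<le> f n" and fb: "\<And>\<eta>. \<eta> > 0 \<Longrightarrow> \<exists>K>0. \<forall>n. f n \<le> K * lp (2 + 4 * s / 3) (u n) + \<eta>" for f :: "nat \<Rightarrow> real"
  proof (rule LIMSEQ_I)
    fix r :: real assume r: "r > 0"
    obtain K where K: "K > 0" "\<And>n. f n \<le> K * lp (2 + 4 * s / 3) (u n) + r / 2" using fb[of "r / 2"] r by auto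
    have "\<forall>\<^sub>F n in sequentially. lp (2 + 4 * s / 3) (u n) < r / (2 * K)"
      using r K(1) by (intro order_tendstoD(2)[OF q]) auto
    then obtain N where N: "\<And>n. n \<ge> N \<Longrightarrow> lp (2 + 4 * s / 3) (u n) < r / (2 * K)" by (auto simp: eventually_sequentially)
    show "\<exists>no. \<forall>n\<ge>no. norm (f n - 0) < r"
    proof (intro exI[of _ N] allI impI)
      fix n assume "n \<ge> N"
      then have "K * lp (2 + 4 * s / 3) (u n) < r / 2" using N[of n] K(1) by (simp add: field_simps)
      then show "norm (f n - 0) < r" using K(2)[of n] f0[of n] by simp
    qed
  qed
  show "(\<lambda>n. har s (u n)) \<longlonglongrightarrow> 0"
  proof (rule gen[OF har_nonneg])
    fix \<eta> :: real assume "\<eta> > 0"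
    from har_bound(2)[OF s m this, where 'k = 'k] obtain K where K: "K > 0"
      "\<forall>(u :: R3 \<Rightarrow> 'k) \<in> Hs s. mass u \<le> m \<longrightarrow> har s u \<le> K * lp (2 + 4 * s / 3) u + \<eta>"
      by (elim exE conjE) (rule that)
    then show "\<exists>K>0. \<forall>n. har s (u n) \<le> K * lp (2 + 4 * s / 3) (u n) + \<eta>"
      using u by (intro exI[of _ K]) simp
  qed
  show "(\<lambda>n. lp p (u n)) \<longlonglongrightarrow> 0"
  proof (rule gen[OF lp_nonneg])
    fix \<eta> :: real assume e: "\<eta> > 0"
    have s0: "0 < s" using s by simp
    obtain K where K: "K > 0" "\<And>v :: R3 \<Rightarrow> 'k. v \<in> Hs s \<Longrightarrow> lp p v \<le> \<eta> / m * mass v + K * lp (2 + 4 * s / 3) v"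
      using lp_interpolation(3)[OF s0 p, of "\<eta> / m", where 'k = 'k] e m by auto
    show "\<exists>K>0. \<forall>n. lp p (u n) \<le> K * lp (2 + 4 * s / 3) (u n) + \<eta>"
    proof (intro exI[of _ K] conjI K(1) allI)
      fix n
      have "\<eta> / m * mass (u n) \<le> \<eta> / m * m" using u(2)[of n] e m by (intro mult_left_mono) auto
      then show "lp p (u n) \<le> K * lp (2 + 4 * s / 3) (u n) + \<eta>" using K(2)[OF u(1), of n] m by simp
    qed
  qed
qed

section \<open>The Brezis-Lieb lemma\<close>

lemma powr_difference_bound:
  fixes r h :: real
  assumes r: "r > 0" and e: "h > 0"
  shows "\<exists>K>0. \<forall>a\<ge>0. \<forall>b\<ge>0. \<forall>c\<ge>0. \<bar>c - b\<bar> \<le> a \<longrightarrow> \<bar>c powr r - b powr r\<bar> \<le> h * b powr r + K * a powr r"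
proof -
  have "((\<lambda>t. (1 + t) powr r) \<longlongrightarrow> (1 + 0) powr r) (at_right (0 :: real))"
    "((\<lambda>t. (1 - t) powr r) \<longlongrightarrow> (1 - 0) powr r) (at_right (0 :: real))"
    by (intro tendsto_intros; simp)+
  then have "\<forall>\<^sub>F t in at_right 0. (1 + t) powr r < 1 + h" "\<forall>\<^sub>F t in at_right 0. (1 - t) powr r > 1 - h"
    using e by (auto intro!: order_tendstoD)
  moreover have "\<forall>\<^sub>F t in at_right 0. t \<in> {0 <..< 1 :: real}" by (rule eventually_at_right_real) simp
  ultimately have "\<forall>\<^sub>F t in at_right 0. (1 + t) powr r < 1 + h \<and> (1 - t) powr r > 1 - h \<and> t \<in> {0 <..< 1}"
    by eventually_elim auto
  then obtain d where d: "(1 + d) powr r < 1 + h" "(1 - d) powr r > 1 - h" "0 < d" "d < 1"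
    using eventually_happens[of _ "at_right (0 :: real)"] by auto
  show ?thesis
  proof (intro exI[of _ "(1 + 1 / d) powr r"] conjI allI impI)
    show "(1 + 1 / d) powr r > 0" using add_pos_pos[OF zero_less_one divide_pos_pos[OF zero_less_one d(3)]] by simp
    fix a b c :: real assume a: "0 \<le> a" and b: "0 \<le> b" and c: "0 \<le> c" and abc: "\<bar>c - b\<bar> \<le> a"
    show "\<bar>c powr r - b powr r\<bar> \<le> h * b powr r + (1 + 1 / d) powr r * a powr r"
    proof (cases "a \<le> d * b")
      case True
      have "c \<le> (1 + d) * b" "(1 - d) * b \<le> c" using abc True by (auto simp: algebra_simps)
      then have "c powr r \<le> ((1 + d) * b) powr r" "((1 - d) * b) powr r \<le> c powr r"
        using r b c d by (auto intro!: powr_mono2)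
      then have "c powr r \<le> (1 + d) powr r * b powr r" "(1 - d) powr r * b powr r \<le> c powr r"
        by (simp_all add: powr_mult)
      moreover have "(1 + d) powr r * b powr r \<le> (1 + h) * b powr r" "(1 - h) * b powr r \<le> (1 - d) powr r * b powr r"
        using d by (auto intro!: mult_right_mono)
      ultimately have "\<bar>c powr r - b powr r\<bar> \<le> h * b powr r" by (simp add: abs_le_iff algebra_simps)
      then show ?thesis by (simp add: add_increasing2)
    next
      case False
      then have bd: "b \<le> a / d" using d by (simp add: field_simps)
      have e1: "(1 + 1 / d) * a = a + a / d" by (simp add: algebra_simps)
      have "c \<le> (1 + 1 / d) * a" "b \<le> (1 + 1 / d) * a" unfolding e1 using bd abc a by auto
      then have "c powr r \<le> ((1 + 1 / d) * a) powr r" "b powr r \<le> ((1 + 1 / d) * a) powr r"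
        using r b c by (auto intro!: powr_mono2)
      then have "c powr r \<le> (1 + 1 / d) powr r * a powr r" "b powr r \<le> (1 + 1 / d) powr r * a powr r"
        by (simp_all add: powr_mult)
      moreover have "0 \<le> c powr r" "0 \<le> b powr r" by auto
      ultimately have "\<bar>c powr r - b powr r\<bar> \<le> (1 + 1 / d) powr r * a powr r" by linarith
      then show ?thesis using e by (simp add: add_increasing)
    qed
  qed
qed

lemma fatou_bound:
  fixes f :: "nat \<Rightarrow> 'a \<Rightarrow> real"
  assumes i: "\<And>n. integrable M (f n)" and nn: "\<And>n x. 0 \<le> f n x" and [measurable]: "g \<in> borel_measurable M"
    and lim: "AE x in M. (\<lambda>n. f n x) \<longlonglongrightarrow> g x" and B: "\<And>n. (LINT x|M. f n x) \<le> B"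
  shows "integrable M g" "(LINT x|M. g x) \<le> B"
proof -
  have [measurable]: "f n \<in> borel_measurable M" for n using i by auto
  have g0: "AE x in M. 0 \<le> g x"
    using lim by eventually_elim (rule LIMSEQ_le_const, auto intro: nn)
  have "(\<integral>\<^sup>+x. ennreal (g x) \<partial>M) = (\<integral>\<^sup>+x. liminf (\<lambda>n. ennreal (f n x)) \<partial>M)"
  proof (rule nn_integral_cong_AE, use lim in eventually_elim)
    case (elim x)
    then have "(\<lambda>n. ennreal (f n x)) \<longlonglongrightarrow> ennreal (g x)" by (rule tendsto_ennrealI)
    then show ?case by (intro lim_imp_Liminf[symmetric]) auto
  qed
  also have "\<dots> \<le> liminf (\<lambda>n. \<integral>\<^sup>+x. ennreal (f n x) \<partial>M)" by (rule nn_integral_liminf) measurable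
  also have "\<dots> \<le> ennreal B"
  proof (rule Liminf_le)
    have "(\<integral>\<^sup>+x. ennreal (f n x) \<partial>M) \<le> ennreal B" for n
      using nn_integral_eq_integral[OF i[of n]] nn B[of n] by (simp add: ennreal_leI)
    then show "\<forall>\<^sub>F n in sequentially. (\<integral>\<^sup>+x. ennreal (f n x) \<partial>M) \<le> ennreal B" by simp
  qed simp
  finally have le: "(\<integral>\<^sup>+x. ennreal (g x) \<partial>M) \<le> ennreal B" .
  have B0: "0 \<le> B" using B[of 0] Bochner_Integration.integral_nonneg[of M "f 0"] nn by (meson order_trans)
  show "integrable M g" "(LINT x|M. g x) \<le> B"
    using integrable_from_nn_integral_le[OF _ g0 le B0] by auto
qed

text \<open>
  Up to \<open>d\<close> times the power of \<open>f n - g\<close>, whose integrals are bounded, the defect is dominated by a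
  multiple of the power of \<open>g\<close>; dominated convergence applies to the rest, and \<open>d\<close> is arbitrary.
\<close>

lemma brezis_lieb:
  fixes f :: "nat \<Rightarrow> 'a \<Rightarrow> 'b :: euclidean_space" and r :: real
  assumes r: "r > 0" and fm[measurable]: "\<And>n. f n \<in> borel_measurable M" and gm[measurable]: "g \<in> borel_measurable M"
    and fi: "\<And>n. integrable M (\<lambda>x. norm (f n x) powr r)" and gi: "integrable M (\<lambda>x. norm (g x) powr r)"
    and B: "\<And>n. (LINT x|M. norm (f n x) powr r) \<le> B" and lim: "AE x in M. (\<lambda>n. f n x) \<longlonglongrightarrow> g x"
  shows "\<And>n. integrable M (\<lambda>x. norm (f n x - g x) powr r)"
    and "(\<lambda>n. LINT x|M. \<bar>norm (f n x) powr r - norm (f n x - g x) powr r - norm (g x) powr r\<bar>) \<longlonglongrightarrow> 0"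
proof -
  have two: "norm (a - b) powr r \<le> 2 powr r * (norm a powr r + norm b powr r)" for a b :: 'b
  proof -
    have "norm (a - b) \<le> 2 * max (norm a) (norm b)" using norm_triangle_ineq4[of a b] by simp
    then have "norm (a - b) powr r \<le> (2 * max (norm a) (norm b)) powr r" using r by (intro powr_mono2) auto
    also have "\<dots> = 2 powr r * max (norm a) (norm b) powr r" by (simp add: powr_mult)
    also have "max (norm a) (norm b) powr r \<le> norm a powr r + norm b powr r" by (simp add: max_def)
    finally show ?thesis by simp
  qed
  have maj: "integrable M (\<lambda>x. 2 powr r * (norm (f n x) powr r + norm (g x) powr r))" for n using fi gi by simp
  show wi: "integrable M (\<lambda>x. norm (f n x - g x) powr r)" for n
    by (rule integrable_majorant_nonneg[OF maj[of n] _ powr_ge_zero two]) measurable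
  define D where "D = 2 powr r * (B + (LINT x|M. norm (g x) powr r))"
  have wD: "(LINT x|M. norm (f n x - g x) powr r) \<le> D" for n
  proof -
    have "(LINT x|M. norm (f n x - g x) powr r) \<le> (LINT x|M. 2 powr r * (norm (f n x) powr r + norm (g x) powr r))"
      by (rule integral_mono[OF wi maj two])
    also have "\<dots> \<le> D" using fi[of n] gi B[of n] by (simp add: D_def)
    finally show ?thesis .
  qed
  have D0: "D \<ge> 0" using wD[of 0] Bochner_Integration.integral_nonneg[of M "\<lambda>x. norm (f 0 x - g x) powr r"] by (meson order_trans powr_ge_zero)
  define h where "h n x = \<bar>norm (f n x) powr r - norm (f n x - g x) powr r - norm (g x) powr r\<bar>" for n x
  have hi: "integrable M (h n)" for n unfolding h_def using fi gi wi by (intro integrable_abs Bochner_Integration.integrable_diff)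
  have h0: "h n x \<ge> 0" for n x by (simp add: h_def)
  show "(\<lambda>n. LINT x|M. \<bar>norm (f n x) powr r - norm (f n x - g x) powr r - norm (g x) powr r\<bar>) \<longlonglongrightarrow> 0"
    unfolding h_def[symmetric]
  proof (rule LIMSEQ_I)
    fix e :: real assume e: "e > 0"
    define d where "d = (e / 2) / (D + 1)"
    have d: "d > 0" using e D0 by (simp add: d_def)
    have dD: "d * D < e / 2"
    proof -
      have "d * D < d * (D + 1)" using d by simp
      also have "\<dots> = e / 2"
        using nonzero_eq_divide_eq[of "D + 1" d "e / 2"] D0 by (simp only: d_def) auto
      finally show ?thesis .
    qed
    obtain K where K: "K > 0" "\<And>a b c. a \<ge> 0 \<Longrightarrow> b \<ge> 0 \<Longrightarrow> c \<ge> 0 \<Longrightarrow> \<bar>c - b\<bar> \<le> a \<Longrightarrow> \<bar>c powr r - b powr r\<bar> \<le> d * b powr r + K * a powr r"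
      using powr_difference_bound[OF r d] by blast
    define W where "W n x = max 0 (h n x - d * norm (f n x - g x) powr r)" for n x
    have hle: "h n x \<le> d * norm (f n x - g x) powr r + (K + 1) * norm (g x) powr r" for n x
    proof -
      have "\<bar>norm (f n x) - norm (f n x - g x)\<bar> \<le> norm (g x)" using norm_triangle_ineq3[of "f n x" "f n x - g x"] by simp
      then have "\<bar>norm (f n x) powr r - norm (f n x - g x) powr r\<bar> \<le> d * norm (f n x - g x) powr r + K * norm (g x) powr r"
        by (intro K) auto
      moreover have "0 \<le> norm (g x) powr r" by simp
      moreover have "(K + 1) * norm (g x) powr r = K * norm (g x) powr r + norm (g x) powr r" by (simp add: algebra_simps)
      ultimately show ?thesis unfolding h_def by linarith
    qed
    have Wb: "norm (W n x) \<le> (K + 1) * norm (g x) powr r" for n x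
      using hle[of n x] K(1) by (simp add: W_def)
    have Wi: "integrable M (W n)" for n unfolding W_def using hi wi by (intro integrable_max) auto
    have "(\<lambda>n. LINT x|M. W n x) \<longlonglongrightarrow> (LINT x|M. 0)"
    proof (rule integral_dominated_convergence)
      show "integrable M (\<lambda>x. (K + 1) * norm (g x) powr r)" using gi by simp
      show "AE x in M. norm (W n x) \<le> (K + 1) * norm (g x) powr r" for n by (rule AE_I2[OF Wb])
      show "AE x in M. (\<lambda>n. W n x) \<longlonglongrightarrow> 0"
        using lim
      proof eventually_elim
        case (elim x)
        have l1: "(\<lambda>n. norm (f n x) powr r) \<longlonglongrightarrow> norm (g x) powr r"
          using r by (intro tendsto_powr2 tendsto_norm elim tendsto_const) auto
        have "(\<lambda>n. norm (f n x - g x)) \<longlonglongrightarrow> norm (g x - g x)" by (intro tendsto_intros elim)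
        then have "(\<lambda>n. norm (f n x - g x) powr r) \<longlonglongrightarrow> norm (g x - g x) powr r"
          using r by (intro tendsto_powr2 tendsto_const) auto
        then have l2: "(\<lambda>n. norm (f n x - g x) powr r) \<longlonglongrightarrow> 0" by simp
        have "(\<lambda>n. W n x) \<longlonglongrightarrow> max 0 (\<bar>norm (g x) powr r - 0 - norm (g x) powr r\<bar> - d * 0)"
          unfolding W_def h_def by (intro tendsto_intros l1 l2)
        then show ?case by simp
      qed
    qed (use Wi in auto)
    then have "(\<lambda>n. LINT x|M. W n x) \<longlonglongrightarrow> 0" by simp
    then have "\<forall>\<^sub>F n in sequentially. (LINT x|M. W n x) < e / 2" using e by (intro order_tendstoD) auto
    then obtain N where N: "\<And>n. n \<ge> N \<Longrightarrow> (LINT x|M. W n x) < e / 2" by (auto simp: eventually_sequentially)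
    show "\<exists>no. \<forall>n\<ge>no. norm ((LINT x|M. h n x) - 0) < e"
    proof (intro exI[of _ N] allI impI)
      fix n assume n: "n \<ge> N"
      have "(LINT x|M. h n x) \<le> (LINT x|M. W n x + d * norm (f n x - g x) powr r)"
        using hi Wi wi by (intro integral_mono Bochner_Integration.integrable_add integrable_mult_right) (auto simp: W_def)
      also have "\<dots> = (LINT x|M. W n x) + d * (LINT x|M. norm (f n x - g x) powr r)" using Wi wi by simp
      also have "\<dots> < e / 2 + e / 2"
        using N[OF n] mult_left_mono[OF wD[of n], of d] d dD by linarith
      finally show "norm ((LINT x|M. h n x) - 0) < e" using h0 by (simp add: Bochner_Integration.integral_nonneg)
    qed
  qed
qed

lemma brezis_lieb_square:
  fixes f :: "nat \<Rightarrow> 'a \<Rightarrow> 'b :: euclidean_space"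
  assumes "\<And>n. f n \<in> borel_measurable M" "g \<in> borel_measurable M"
    and "\<And>n. integrable M (\<lambda>x. norm (f n x) ^ 2)" "integrable M (\<lambda>x. norm (g x) ^ 2)"
    and "\<And>n. (LINT x|M. norm (f n x) ^ 2) \<le> B" "AE x in M. (\<lambda>n. f n x) \<longlonglongrightarrow> g x"
  shows "\<And>n. integrable M (\<lambda>x. norm (f n x - g x) ^ 2)"
    and "(\<lambda>n. LINT x|M. \<bar>norm (f n x) ^ 2 - norm (f n x - g x) ^ 2 - norm (g x) ^ 2\<bar>) \<longlonglongrightarrow> 0"
  using brezis_lieb[of 2 f M g B] assms by simp_all

lemma integral_split_limit:
  fixes a b c :: "nat \<Rightarrow> 'a \<Rightarrow> real"
  assumes i: "\<And>n. integrable M (a n)" "\<And>n. integrable M (b n)" "integrable M c'"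
    and lim: "(\<lambda>n. LINT x|M. \<bar>a n x - b n x - c' x\<bar>) \<longlonglongrightarrow> 0"
  shows "(\<lambda>n. (LINT x|M. a n x) - (LINT x|M. b n x)) \<longlonglongrightarrow> (LINT x|M. c' x)"
proof -
  have "(\<lambda>n. ((LINT x|M. a n x) - (LINT x|M. b n x)) - (LINT x|M. c' x)) \<longlonglongrightarrow> 0"
  proof (rule Lim_null_comparison[OF always_eventually lim], rule allI)
    fix n
    have "((LINT x|M. a n x) - (LINT x|M. b n x)) - (LINT x|M. c' x) = (LINT x|M. a n x - b n x - c' x)" using i by simp
    then show "norm (((LINT x|M. a n x) - (LINT x|M. b n x)) - (LINT x|M. c' x)) \<le> (LINT x|M. \<bar>a n x - b n x - c' x\<bar>)"
      by (simp only: real_norm_def integral_abs_bound)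
  qed
  then show ?thesis by (rule LIM_zero_cancel)
qed

section \<open>Local compactness\<close>

text \<open>
  The half-open dyadic cube of side \<open>1/2\<^sup>k\<close> is named by any of its points instead of by a corner, so
  that the average over it is a function on the whole space.
\<close>

definition dyadic_cube :: "nat \<Rightarrow> R3 \<Rightarrow> R3 set" where
  "dyadic_cube k x = {y. \<forall>i. \<lfloor>2 ^ k * y $ i\<rfloor> = \<lfloor>2 ^ k * x $ i\<rfloor>}"

definition cube_avg :: "nat \<Rightarrow> (R3 \<Rightarrow> 'k :: euclidean_space) \<Rightarrow> R3 \<Rightarrow> 'k" where
  "cube_avg k u x = 8 ^ k *\<^sub>R (LINT y|lborel. indicator (dyadic_cube k x) y *\<^sub>R u y)"

lemma dyadic_cube_eq: "dyadic_cube k x = {y. \<forall>i. real_of_int \<lfloor>2 ^ k * x $ i\<rfloor> \<le> 2 ^ k * y $ i \<and> 2 ^ k * y $ i < real_of_int \<lfloor>2 ^ k * x $ i\<rfloor> + 1}"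
  by (auto simp: dyadic_cube_def floor_eq_iff)

lemma dyadic_cube_measurable[measurable]: "dyadic_cube k x \<in> sets borel"
proof -
  have "dyadic_cube k x = {y \<in> space borel. \<forall>i. real_of_int \<lfloor>2 ^ k * x $ i\<rfloor> \<le> 2 ^ k * y $ i \<and> 2 ^ k * y $ i < real_of_int \<lfloor>2 ^ k * x $ i\<rfloor> + 1}"
    by (simp add: dyadic_cube_eq)
  also have "\<dots> \<in> sets borel" by measurable
  finally show ?thesis .
qed

lemma dyadic_cube_emeasure: "emeasure lborel (dyadic_cube k x) = ennreal (1 / 8 ^ k)"
proof -
  define a :: R3 where "a = (\<chi> i. real_of_int \<lfloor>2 ^ k * x $ i\<rfloor> / 2 ^ k)"
  define b :: R3 where "b = (\<chi> i. (real_of_int \<lfloor>2 ^ k * x $ i\<rfloor> + 1) / 2 ^ k)"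
  have sub: "box a b \<subseteq> dyadic_cube k x" "dyadic_cube k x \<subseteq> cbox a b"
  proof -
    show "box a b \<subseteq> dyadic_cube k x"
      by (auto simp: dyadic_cube_eq mem_box_cart a_def b_def field_simps intro: less_imp_le)
    show "dyadic_cube k x \<subseteq> cbox a b"
    proof
      fix y assume y: "y \<in> dyadic_cube k x"
      have "a $ i \<le> y $ i \<and> y $ i \<le> b $ i" for i
      proof -
        have "real_of_int \<lfloor>2 ^ k * x $ i\<rfloor> \<le> 2 ^ k * y $ i" "2 ^ k * y $ i < real_of_int \<lfloor>2 ^ k * x $ i\<rfloor> + 1"
          using y by (auto simp: dyadic_cube_eq)
        then show ?thesis by (simp add: a_def b_def field_simps)
      qed
      then show "y \<in> cbox a b" by (simp add: mem_box_cart)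
    qed
  qed
  have ab: "b $ i - a $ i = 1 / 2 ^ k" for i by (simp add: a_def b_def diff_divide_distrib[symmetric])
  have le: "a \<bullet> i \<le> b \<bullet> i" if i: "i \<in> Basis" for i
  proof -
    obtain j where j: "i = axis j 1" using i by (auto simp: Basis_vec_def)
    have "0 \<le> b $ j - a $ j" unfolding ab by simp
    then show ?thesis by (simp add: j inner_axis)
  qed
  have prod: "(\<Prod>i\<in>Basis. (b - a) \<bullet> i) = 1 / 8 ^ k"
  proof -
    have "(\<Prod>i\<in>Basis. (b - a) \<bullet> i) = (\<Prod>i\<in>(Basis :: R3 set). 1 / 2 ^ k)"
    proof (rule prod.cong[OF refl])
      fix i :: R3 assume "i \<in> Basis"
      then obtain j where "i = axis j 1" by (auto simp: Basis_vec_def)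
      then show "(b - a) \<bullet> i = 1 / 2 ^ k" using ab[of j] by (simp add: inner_axis)
    qed
    also have "\<dots> = (1 / 2 ^ k) ^ 3" by simp
    also have "\<dots> = 1 / 8 ^ k" by (simp add: power_divide power_mult[symmetric] mult.commute[of k 3] power_mult)
    finally show ?thesis .
  qed
  have e1: "emeasure lborel (box a b) = ennreal (1 / 8 ^ k)" using le prod by (subst emeasure_lborel_box) auto
  have e2: "emeasure lborel (cbox a b) = ennreal (1 / 8 ^ k)" using le prod by (subst emeasure_lborel_cbox) auto
  show ?thesis
    using emeasure_mono[OF sub(1), of lborel] emeasure_mono[OF sub(2), of lborel] e1 e2 by (intro antisym) auto
qed

lemma dyadic_cube_dist:
  assumes "y \<in> dyadic_cube k x"
  shows "norm (x - y) \<le> 2 * (1 / 2 ^ k)"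
proof -
  have c: "\<bar>x $ i - y $ i\<bar> \<le> 1 / 2 ^ k" for i
  proof -
    have "\<lfloor>2 ^ k * y $ i\<rfloor> = \<lfloor>2 ^ k * x $ i\<rfloor>" using assms by (simp add: dyadic_cube_def)
    then have "\<bar>2 ^ k * x $ i - 2 ^ k * y $ i\<bar> \<le> 1" by linarith
    then have "2 ^ k * \<bar>x $ i - y $ i\<bar> \<le> 1" by (simp add: right_diff_distrib[symmetric] abs_mult)
    then show ?thesis by (simp add: field_simps)
  qed
  have "norm (x - y) ^ 2 = (\<Sum>i\<in>UNIV. \<bar>x $ i - y $ i\<bar> ^ 2)"
    by (simp add: norm_vec_def L2_set_def sum_nonneg)
  also have "\<dots> \<le> (\<Sum>i\<in>(UNIV :: 3 set). (1 / 2 ^ k) ^ 2)" by (intro sum_mono power_mono c) auto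
  also have "\<dots> = 3 * (1 / 2 ^ k) ^ 2" by simp
  also have "\<dots> \<le> 4 * (1 / 2 ^ k) ^ 2" by (intro mult_right_mono) auto
  also have "\<dots> = (2 * (1 / 2 ^ k)) ^ 2" unfolding power_mult_distrib by simp
  finally show ?thesis by (rule power2_le_imp_le) simp
qed

lemma cube_jensen:
  fixes w :: "R3 \<Rightarrow> 'k :: euclidean_space"
  assumes [measurable]: "w \<in> borel_measurable borel" and i: "integrable lborel (\<lambda>y. indicator (dyadic_cube k x) y * norm (w y) ^ 2)"
  shows "integrable lborel (\<lambda>y. indicator (dyadic_cube k x) y *\<^sub>R w y)"
    and "norm (8 ^ k *\<^sub>R (LINT y|lborel. indicator (dyadic_cube k x) y *\<^sub>R w y)) ^ 2 \<le> 8 ^ k * (LINT y|lborel. indicator (dyadic_cube k x) y * norm (w y) ^ 2)"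
proof -
  let ?Q = "dyadic_cube k x"
  define I where "I = (LINT y|lborel. indicator ?Q y * norm (w y) ^ 2)"
  have I0: "I \<ge> 0" unfolding I_def by (intro Bochner_Integration.integral_nonneg) (auto simp: indicator_def)
  have iQ: "integrable lborel (\<lambda>y. indicator ?Q y :: real)" "(LINT y|lborel. indicator ?Q y :: real) = 1 / 8 ^ k"
    by (auto intro!: integrable_real_indicator simp: dyadic_cube_emeasure measure_def)
  have le: "indicator ?Q y * norm (w y) \<le> t * (indicator ?Q y * norm (w y) ^ 2) / 2 + indicator ?Q y / (2 * t)" if t: "t > 0" for t y
    using mult_le_squares[OF t, of "norm (w y)" 1] by (auto simp: indicator_def)
  have maj: "integrable lborel (\<lambda>y. t * (indicator ?Q y * norm (w y) ^ 2) / 2 + indicator ?Q y / (2 * t))" for t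
    using i iQ(1) by (intro Bochner_Integration.integrable_add integrable_divide integrable_mult_right) auto
  have nI: "integrable lborel (\<lambda>y. indicator ?Q y * norm (w y))"
  proof (rule integrable_dominated[OF maj[of 1] _ AE_I2])
    show "norm (indicator ?Q y * norm (w y)) \<le> norm (1 * (indicator ?Q y * norm (w y) ^ 2) / 2 + indicator ?Q y / (2 * 1))" for y
      using le[of 1 y] by (auto simp: indicator_def)
  qed measurable
  show int: "integrable lborel (\<lambda>y. indicator ?Q y *\<^sub>R w y)"
    by (rule integrable_dominated[OF nI]) (auto intro!: AE_I2 simp: indicator_def)
  define N where "N = 8 ^ k * norm (LINT y|lborel. indicator ?Q y *\<^sub>R w y)"
  have Nle: "N \<le> 8 ^ k * (t * I / 2) + 1 / (2 * t)" if t: "t > 0" for t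
  proof -
    have "norm (LINT y|lborel. indicator ?Q y *\<^sub>R w y) \<le> (LINT y|lborel. norm (indicator ?Q y *\<^sub>R w y))" by (rule integral_norm_bound)
    also have "\<dots> = (LINT y|lborel. indicator ?Q y * norm (w y))" by simp
    also have "\<dots> \<le> (LINT y|lborel. t * (indicator ?Q y * norm (w y) ^ 2) / 2 + indicator ?Q y / (2 * t))"
      by (rule integral_mono[OF nI maj le[OF t]])
    also have "\<dots> = t * I / 2 + (1 / 8 ^ k) / (2 * t)" using i iQ by (simp add: I_def)
    finally have "N \<le> 8 ^ k * (t * I / 2 + (1 / 8 ^ k) / (2 * t))" unfolding N_def by (rule mult_left_mono) simp
    also have "\<dots> = 8 ^ k * (t * I / 2) + 1 / (2 * t)" by (simp add: distrib_left)
    finally show ?thesis .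
  qed
  have N0: "N \<ge> 0" by (simp add: N_def)
  have "N ^ 2 \<le> 8 ^ k * I"
  proof (cases "N = 0")
    case False
    with N0 have N: "N > 0" by simp
    have "N \<le> 8 ^ k * (1 / N * I / 2) + 1 / (2 * (1 / N))" using N by (intro Nle) simp
    then have "N \<le> 8 ^ k * I / (2 * N) + N / 2" by simp
    then have "N / 2 \<le> 8 ^ k * I / (2 * N)" by linarith
    then have "N / 2 * (2 * N) \<le> 8 ^ k * I" using N by (simp add: pos_le_divide_eq)
    then show ?thesis by (simp add: power2_eq_square)
  qed (simp add: I0)
  then show "norm (8 ^ k *\<^sub>R (LINT y|lborel. indicator ?Q y *\<^sub>R w y)) ^ 2 \<le> 8 ^ k * I" by (simp add: N_def)
qed

lemma cube_avg_bound:
  fixes u :: "R3 \<Rightarrow> 'k :: euclidean_space"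
  assumes u: "u \<in> Hs s"
  shows "integrable lborel (\<lambda>y. indicator (dyadic_cube k x) y *\<^sub>R u y)" "norm (cube_avg k u x) ^ 2 \<le> 8 ^ k * mass u"
proof -
  note h = HsD[OF u]
  have [measurable]: "u \<in> borel_measurable borel" by (rule h)
  have i: "integrable lborel (\<lambda>y. indicator (dyadic_cube k x) y * norm (u y) ^ 2)"
    by (rule integrable_dominated[OF h(2)]) (auto intro!: AE_I2 simp: indicator_def)
  have "(LINT y|lborel. indicator (dyadic_cube k x) y * norm (u y) ^ 2) \<le> mass u"
    unfolding mass_def by (intro integral_mono i h) (auto simp: indicator_def)
  with cube_jensen(2)[OF _ i] show "norm (cube_avg k u x) ^ 2 \<le> 8 ^ k * mass u"
    unfolding cube_avg_def by (meson \<open>u \<in> borel_measurable borel\<close> mult_left_mono order_trans zero_le_numeral zero_le_power)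
  show "integrable lborel (\<lambda>y. indicator (dyadic_cube k x) y *\<^sub>R u y)" by (rule cube_jensen(1)[OF _ i]) simp
qed

text \<open>
  Within a dyadic cube of side \<open>2\<^sup>-\<^sup>k\<close> the oscillation of \<open>u\<close> is controlled by the Gagliardo integrand,
  since the distance of two points of the cube bounds the singular kernel from below.
\<close>

lemma cube_poincare:
  assumes s: "0 < s" and u: "(u :: R3 \<Rightarrow> 'k :: euclidean_space) \<in> Hs s"
  shows "AE x in lborel. norm (u x - cube_avg k u x) ^ 2 \<le> 2 powr (3 + 2 * s) * (1 / 2 ^ k) powr (2 * s) * (LINT z|lborel. gag_dens s u (x, z))"
  using gag_via_modulus(3)[OF u]
proof eventually_elim
  case (elim x)
  note h = HsD[OF u]
  have [measurable]: "u \<in> borel_measurable borel" by (rule h)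
  let ?Q = "dyadic_cube k x"
  define r :: real where "r = 2 * (1 / 2 ^ k)"
  have r: "r > 0" by (simp add: r_def)
  have gm: "(\<lambda>z. gag_dens s u (x, z)) \<in> borel_measurable borel" using elim by (auto dest: borel_measurable_integrable)
  have gi: "integrable lborel (\<lambda>y. gag_dens s u (x, x - y))" and ge: "(LINT y|lborel. gag_dens s u (x, x - y)) = (LINT z|lborel. gag_dens s u (x, z))"
    using integral_lborel_shift(9)[OF gm, of x] integral_lborel_shift(4)[OF gm, of x] elim by auto
  have le: "indicator ?Q y * norm (u x - u y) ^ 2 \<le> r powr (3 + 2 * s) * gag_dens s u (x, x - y)" for y
  proof (cases "y \<in> ?Q \<and> y \<noteq> x")
    case True
    then have y: "norm (x - y) \<le> r" "norm (x - y) > 0" using dyadic_cube_dist[of y k x] by (auto simp: r_def)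
    have "1 \<le> (r / norm (x - y)) powr (3 + 2 * s)" using y s by (intro ge_one_powr_ge_zero) auto
    then have "norm (u x - u y) ^ 2 * 1 \<le> norm (u x - u y) ^ 2 * (r / norm (x - y)) powr (3 + 2 * s)" by (intro mult_left_mono) auto
    also have "(r / norm (x - y)) powr (3 + 2 * s) = r powr (3 + 2 * s) * norm (x - y) powr (- (3 + 2 * s))"
      by (simp only: powr_divide powr_minus_divide times_divide_eq_right mult_1_right)
    finally show ?thesis using True by (simp add: gag_dens_def mult_ac)
  next
    case False
    then show ?thesis by (cases "y = x") (auto simp: gag_dens_nonneg)
  qed
  have maj: "integrable lborel (\<lambda>y. r powr (3 + 2 * s) * gag_dens s u (x, x - y))" using gi by simp
  have i: "integrable lborel (\<lambda>y. indicator ?Q y * norm (u x - u y) ^ 2)"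
  proof (rule integrable_dominated[OF maj _ AE_I2])
    show "norm (indicator ?Q y * norm (u x - u y) ^ 2) \<le> norm (r powr (3 + 2 * s) * gag_dens s u (x, x - y))" for y
      using le[of y] by (simp add: abs_mult gag_dens_nonneg)
  qed measurable
  have mw: "(\<lambda>y. u x - u y) \<in> borel_measurable borel" by measurable
  have iQ: "integrable lborel (\<lambda>y. indicator ?Q y :: real)" "(LINT y|lborel. indicator ?Q y :: real) = 1 / 8 ^ k"
    by (auto intro!: integrable_real_indicator simp: dyadic_cube_emeasure measure_def)
  have "(LINT y|lborel. indicator ?Q y *\<^sub>R (u x - u y)) = (LINT y|lborel. indicator ?Q y *\<^sub>R u x) - (LINT y|lborel. indicator ?Q y *\<^sub>R u y)"
    unfolding scaleR_diff_right using iQ(1) cube_avg_bound(1)[OF u, of k x] by (intro Bochner_Integration.integral_diff) auto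
  also have "(LINT y|lborel. indicator ?Q y *\<^sub>R u x) = (1 / 8 ^ k) *\<^sub>R u x" using iQ by simp
  finally have "8 ^ k *\<^sub>R (LINT y|lborel. indicator ?Q y *\<^sub>R (u x - u y)) = u x - cube_avg k u x"
    by (simp add: scaleR_diff_right cube_avg_def)
  then have "norm (u x - cube_avg k u x) ^ 2 \<le> 8 ^ k * (LINT y|lborel. indicator ?Q y * norm (u x - u y) ^ 2)"
    using cube_jensen(2)[OF mw i] by simp
  also have "(LINT y|lborel. indicator ?Q y * norm (u x - u y) ^ 2) \<le> (LINT y|lborel. r powr (3 + 2 * s) * gag_dens s u (x, x - y))"
    by (rule integral_mono[OF i maj le])
  also have "\<dots> = r powr (3 + 2 * s) * (LINT z|lborel. gag_dens s u (x, z))" using ge by simp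
  also have "8 ^ k * (r powr (3 + 2 * s) * (LINT z|lborel. gag_dens s u (x, z)))
      = 2 powr (3 + 2 * s) * (1 / 2 ^ k) powr (2 * s) * (LINT z|lborel. gag_dens s u (x, z))"
  proof -
    have "r powr (3 + 2 * s) = 2 powr (3 + 2 * s) * ((1 / 2 ^ k) powr 3 * (1 / 2 ^ k) powr (2 * s))"
      unfolding r_def powr_mult powr_add[symmetric] by simp
    moreover have "(1 / 2 ^ k :: real) powr 3 = 1 / 8 ^ k"
      by (simp add: power_divide power_mult[symmetric] mult.commute[of k 3] power_mult)
    ultimately show ?thesis by simp
  qed
  finally show ?case by simp
qed

lemma cube_avg_measurable[measurable]:
  assumes [measurable]: "u \<in> borel_measurable borel"
  shows "cube_avg k u \<in> borel_measurable borel"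
proof -
  define F where "F i x = real_of_int \<lfloor>2 ^ k * x $ i\<rfloor>" for i and x :: R3
  have [measurable]: "F i \<in> borel_measurable borel" for i
    unfolding F_def[abs_def] by (rule measurable_compose[OF _ borel_measurable_real_floor]) measurable
  have eq: "cube_avg k u x = 8 ^ k *\<^sub>R (LINT y|lborel. (if \<forall>i. F i y = F i x then u y else 0))" for x
    unfolding cube_avg_def
    by (intro arg_cong[where f = "scaleR (8 ^ k)"] Bochner_Integration.integral_cong refl) (auto simp: dyadic_cube_def indicator_def F_def)
  have "(\<lambda>p. if \<forall>i. F i (snd p) = F i (fst p) then u (snd p) else 0) \<in> borel_measurable (borel \<Otimes>\<^sub>M lborel)"
    by measurable
  then have "(\<lambda>x. LINT y|lborel. (if \<forall>i. F i y = F i x then u y else 0)) \<in> borel_measurable borel"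
    by (intro lborel.borel_measurable_lebesgue_integral) (simp add: case_prod_beta')
  then show ?thesis unfolding eq[abs_def] by measurable
qed

text \<open>
  There are countably many dyadic cubes, and on each of them the averages form a bounded sequence, so
  a diagonal subsequence serves all cubes at once.
\<close>

lemma convergent_cube_averages:
  fixes u :: "nat \<Rightarrow> R3 \<Rightarrow> 'k :: euclidean_space"
  assumes u: "\<And>n. u n \<in> Hs s" and B: "\<And>n. mass (u n) \<le> B"
  shows "\<exists>r. strict_mono r \<and> (\<forall>k x. convergent (\<lambda>n. cube_avg k (u (r n)) x))"
proof -
  define pt :: "nat \<Rightarrow> nat \<times> int \<times> int \<times> int" where "pt = from_nat"
  define cor :: "nat \<times> int \<times> int \<times> int \<Rightarrow> R3" where
    "cor = (\<lambda>(k, a, b, c). (vector [real_of_int a / 2 ^ k, real_of_int b / 2 ^ k, real_of_int c / 2 ^ k]))"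
  define P where "P j q \<longleftrightarrow> convergent (\<lambda>n. cube_avg (fst (pt j)) (u (q n)) (cor (pt j)))" for j and q :: "nat \<Rightarrow> nat"
  interpret subseqs P
  proof
    fix j and q :: "nat \<Rightarrow> nat" assume "strict_mono q"
    define k where "k = fst (pt j)"
    define x where "x = cor (pt j)"
    have "bounded (range (\<lambda>n. cube_avg k (u (q n)) x))"
    proof (rule boundedI[of _ "sqrt (8 ^ k * B)"], safe)
      fix n
      have "norm (cube_avg k (u (q n)) x) ^ 2 \<le> 8 ^ k * mass (u (q n))" by (rule cube_avg_bound(2)[OF u])
      also have "\<dots> \<le> 8 ^ k * B" by (intro mult_left_mono B) simp
      finally show "norm (cube_avg k (u (q n)) x) \<le> sqrt (8 ^ k * B)" by (rule real_le_rsqrt)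
    qed
    from bounded_imp_convergent_subsequence[OF this] obtain l r where r: "strict_mono r" "((\<lambda>n. cube_avg k (u (q n)) x) \<circ> r) \<longlonglongrightarrow> l"
      by blast
    then have "P j (q \<circ> r)" unfolding P_def k_def[symmetric] x_def[symmetric] by (auto simp: convergent_def o_def)
    with r(1) show "\<exists>r'. strict_mono r' \<and> P j (q \<circ> r')" by blast
  qed
  have Pd: "P j diagseq" for j
  proof -
    have "P j (diagseq \<circ> (+) (Suc j))"
    proof (rule diagseq_holds)
      fix r q :: "nat \<Rightarrow> nat" and n assume "strict_mono r" "P n q"
      then show "P n (q \<circ> r)" unfolding P_def
        using convergent_subseq_convergent[of "\<lambda>i. cube_avg (fst (pt n)) (u (q i)) (cor (pt n))" r] by (simp add: o_def)
    qed
    then have "convergent (\<lambda>i. cube_avg (fst (pt j)) (u (diagseq (i + Suc j))) (cor (pt j)))"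
      unfolding P_def[of j "diagseq \<circ> (+) (Suc j)"] by (simp add: o_def add.commute)
    then have "convergent (\<lambda>i. cube_avg (fst (pt j)) (u (diagseq i)) (cor (pt j)))"
      by (rule convergent_ignore_initial_segment[THEN iffD1])
    then show "P j diagseq" by (rule P_def[of j diagseq, THEN iffD2])
  qed
  show ?thesis
  proof (intro exI[of _ diagseq] conjI allI subseq_diagseq)
    fix k and x :: R3
    define t where "t = (k, \<lfloor>2 ^ k * x $ 1\<rfloor>, \<lfloor>2 ^ k * x $ 2\<rfloor>, \<lfloor>2 ^ k * x $ 3\<rfloor>)"
    have "dyadic_cube k (cor t) = dyadic_cube k x"
      by (auto simp: dyadic_cube_def cor_def t_def forall_3)
    then have "cube_avg k v (cor t) = cube_avg k v x" for v :: "R3 \<Rightarrow> 'k" by (simp add: cube_avg_def)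
    moreover have "pt (to_nat t) = t" by (simp add: pt_def)
    moreover have "fst t = k" by (simp add: t_def)
    ultimately show "convergent (\<lambda>n. cube_avg k (u (diagseq n)) x)" using Pd[of "to_nat t"] by (simp add: P_def)
  qed
qed

lemma norm_sum3_square:
  fixes a b c :: "'b :: real_normed_vector"
  shows "norm (a + b + c) ^ 2 \<le> 3 * norm a ^ 2 + 3 * norm b ^ 2 + 3 * norm c ^ 2"
proof -
  have "norm (a + b + c) \<le> norm a + norm b + norm c" by (intro norm_triangle_le add_right_mono norm_triangle_ineq)
  then have "norm (a + b + c) ^ 2 \<le> (norm a + norm b + norm c) ^ 2" by (intro power_mono) auto
  also have "\<dots> \<le> 3 * norm a ^ 2 + 3 * norm b ^ 2 + 3 * norm c ^ 2"
    using zero_le_power2[of "norm a - norm b"] zero_le_power2[of "norm b - norm c"] zero_le_power2[of "norm a - norm c"]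
    by (simp add: power2_eq_square algebra_simps)
  finally show ?thesis .
qed

lemma AE_lborel_pair_shift:
  assumes "AE x in lborel. P (x :: R3)"
  shows "AE p in lborel2. P (fst p) \<and> P (fst p - snd p)"
proof -
  obtain N where N: "N \<in> null_sets lborel" "{x. \<not> P x} \<subseteq> N" using assms by (auto simp: eventually_ae_filter)
  have [measurable]: "N \<in> sets borel" using N(1) by auto
  have ae: "AE x in lborel. x \<notin> N" by (rule AE_not_in[OF N(1)])
  have "AE p in lborel2. fst p \<notin> N \<and> fst p - snd p \<notin> N"
  proof (rule lborel_pair.AE_pair_measure)
    show "{p \<in> space lborel2. fst p \<notin> N \<and> fst p - snd p \<notin> N} \<in> sets (lborel2 :: (R3 \<times> R3) measure)"
      by measurable
    have sh: "AE z in lborel. x - z \<notin> N" for x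
    proof -
      have "(\<integral>\<^sup>+z. indicator N (x - z) \<partial>lborel) = (\<integral>\<^sup>+z. indicator N z \<partial>lborel)"
        by (rule nn_integral_lborel_shift(4)) measurable
      also have "\<dots> = 0" using N(1) by (simp add: null_setsD1)
      finally have "AE z in lborel. indicator N (x - z) = (0 :: ennreal)" by (subst (asm) nn_integral_0_iff_AE) auto
      then show ?thesis by eventually_elim (auto simp: indicator_def split: if_splits)
    qed
    show "AE x in lborel. AE z in lborel. fst (x, z) \<notin> N \<and> fst (x, z) - snd (x, z) \<notin> N"
      by (rule eventually_mono[OF ae]) (use sh in simp)
  qed
  then show ?thesis by eventually_elim (use N(2) in auto)
qed

text \<open>
  Rellich's theorem for the space of finite Gagliardo seminorm. The weight makes one application of
  completeness cover all balls: the sequence is Cauchy in the weighted space because cube averages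
  converge everywhere and approximate uniformly in \<open>n\<close>.
\<close>

lemma local_compactness:
  fixes u :: "nat \<Rightarrow> R3 \<Rightarrow> 'k :: euclidean_space"
  assumes s: "0 < s" "s < 1" and u: "\<And>n. u n \<in> Hs s" and mB: "\<And>n. mass (u n) \<le> B" and gB: "\<And>n. gag s (u n) \<le> B"
  shows "\<exists>r v. strict_mono r \<and> v \<in> Hs s \<and> mass v \<le> B \<and> gag s v \<le> B \<and> (AE x in lborel. (\<lambda>n. u (r n) x) \<longlonglongrightarrow> v x) \<and>
    (\<forall>R. (\<lambda>n. LINT x|lborel. indicator (ball 0 R) x * norm (u (r n) x - v x) ^ 2) \<longlonglongrightarrow> 0)"
proof -
  have um[measurable]: "u n \<in> borel_measurable borel" for n by (rule HsD(1)[OF u])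
  have u2: "integrable lborel (\<lambda>x. norm (u n x) ^ 2)" for n by (rule HsD(2)[OF u])
  have B0: "B \<ge> 0" using mB[of 0] mass_nonneg[of "u 0"] by linarith
  obtain r0 where r0: "strict_mono r0" "\<And>k x. convergent (\<lambda>n. cube_avg k (u (r0 n)) x)"
    using convergent_cube_averages[of u s B, OF u mB] by blast
  define f where "f n = u (r0 n)" for n
  have fm[measurable]: "f n \<in> borel_measurable borel" for n by (simp add: f_def)
  have fH: "f n \<in> Hs s" for n unfolding f_def by (rule u)
  \<comment> \<open>The weight is integrable, bounded by one, and bounded below on every ball.\<close>
  define w where "w x = 1 * (1 + norm x) powr (- (4 + s))" for x :: R3
  have wi: "integrable lborel w" unfolding w_def[abs_def] using integral_error_kernel[OF s] by (metis zero_less_one)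
  have [measurable]: "w \<in> borel_measurable borel" unfolding w_def by measurable
  have w0: "w x > 0" for x unfolding w_def using norm_ge_zero[of x] by (simp add: add_nonneg_eq_0_iff)
  have w1: "w x \<le> 1" for x
    unfolding w_def using s powr_mono2'[of "- (4 + s)" 1 "1 + norm x"] by simp
  define M where "M = density lborel (\<lambda>x. ennreal (w x))"
  have nnM: "(\<integral>\<^sup>+x. g x \<partial>M) = (\<integral>\<^sup>+x. ennreal (w x) * g x \<partial>lborel)" if "g \<in> borel_measurable borel" for g
    unfolding M_def using that by (intro nn_integral_density) auto
  define p where "p k x = lim (\<lambda>n. cube_avg k (f n) x)" for k x
  have plim: "(\<lambda>n. cube_avg k (f n) x) \<longlonglongrightarrow> p k x" for k x
    unfolding p_def f_def using r0(2) by (simp add: convergent_LIMSEQ_iff)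
  have pm[measurable]: "p k \<in> borel_measurable borel" for k unfolding p_def by measurable
  let ?d = "\<lambda>k n x. norm (cube_avg k (f n) x - p k x) ^ 2"
  have cb: "norm (cube_avg k (f n) x) ^ 2 \<le> 8 ^ k * B" for k n x
  proof -
    have "norm (cube_avg k (f n) x) ^ 2 \<le> 8 ^ k * mass (f n)" by (rule cube_avg_bound(2)[OF fH])
    also have "\<dots> \<le> 8 ^ k * B" using mB by (simp add: f_def)
    finally show ?thesis .
  qed
  have pb: "norm (p k x) ^ 2 \<le> 8 ^ k * B" for k x
    by (rule LIMSEQ_le_const2[OF tendsto_power[OF tendsto_norm[OF plim]]]) (use cb in auto)
  have dlim: "(\<lambda>n. LINT x|lborel. w x * ?d k n x) \<longlonglongrightarrow> 0" for k
  proof -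
    have "(\<lambda>n. LINT x|lborel. w x * ?d k n x) \<longlonglongrightarrow> (LINT x|(lborel :: R3 measure). 0)"
    proof (rule integral_dominated_convergence)
      show "integrable lborel (\<lambda>x. 4 * (8 ^ k * B) * w x)" using wi by simp
      show "AE x in lborel. (\<lambda>n. w x * ?d k n x) \<longlonglongrightarrow> 0"
      proof (rule AE_I2)
        fix x
        have "(\<lambda>n. w x * ?d k n x) \<longlonglongrightarrow> w x * norm (p k x - p k x) ^ 2"
          by (intro tendsto_intros plim)
        then show "(\<lambda>n. w x * ?d k n x) \<longlonglongrightarrow> 0" by simp
      qed
      show "AE x in lborel. norm (w x * ?d k n x) \<le> 4 * (8 ^ k * B) * w x" for n
      proof (rule AE_I2)
        fix x
        have "?d k n x \<le> 4 * (8 ^ k * B)"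
          using norm_diff_square_le[of "cube_avg k (f n) x" "p k x"] cb[of k n x] pb[of k x] by linarith
        then show "norm (w x * ?d k n x) \<le> 4 * (8 ^ k * B) * w x"
          using w0[of x] by (simp add: abs_mult mult.commute)
      qed
    qed measurable
    then show ?thesis by simp
  qed
  have wdi: "integrable lborel (\<lambda>x. w x * ?d k n x)" for k n
  proof (rule integrable_majorant_nonneg)
    show "integrable lborel (\<lambda>x. 4 * (8 ^ k * B) * w x)" using wi by simp
    fix x
    have "?d k n x \<le> 4 * (8 ^ k * B)"
      using norm_diff_square_le[of "cube_avg k (f n) x" "p k x"] cb[of k n x] pb[of k x] by linarith
    then show "w x * ?d k n x \<le> 4 * (8 ^ k * B) * w x"
      using w0[of x] by (simp add: mult.commute)
  qed (simp_all add: less_imp_le[OF w0])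
  define c where "c k = 2 powr (3 + 2 * s) * (1 / 2 ^ k) powr (2 * s)" for k :: nat
  have c0: "c k \<ge> 0" for k by (simp add: c_def)
  have clim: "c \<longlonglongrightarrow> 0"
  proof -
    have "(\<lambda>k. (1 / 2 ^ k :: real)) \<longlonglongrightarrow> 0" using LIMSEQ_power_zero[of "1/2 :: real"] by (simp add: power_divide)
    then have "(\<lambda>k. (1 / 2 ^ k :: real) powr (2 * s)) \<longlonglongrightarrow> 0 powr (2 * s)"
      using s by (intro tendsto_powr2 tendsto_const always_eventually) auto
    then have "(\<lambda>k. 2 powr (3 + 2 * s) * (1 / 2 ^ k :: real) powr (2 * s)) \<longlonglongrightarrow> 2 powr (3 + 2 * s) * 0 powr (2 * s)"
      by (intro tendsto_mult tendsto_const)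
    then show ?thesis unfolding c_def[abs_def] by simp
  qed
  have poin: "AE x in lborel. norm (f n x - cube_avg k (f n) x) ^ 2 \<le> c k * (LINT z|lborel. gag_dens s (f n) (x, z))" for n k
    unfolding c_def by (rule cube_poincare[OF s(1) fH])
  have Cauchy: "(\<integral>\<^sup>+x. ennreal (norm (f m x - f n x) ^ 2) \<partial>M) \<le> ennreal (6 * c k * B
      + 6 * (LINT x|lborel. w x * ?d k m x) + 6 * (LINT x|lborel. w x * ?d k n x))" for m n k
  proof -
    define G where "G n x = (LINT z|lborel. gag_dens s (f n) (x, z))" for n x
    have Gi: "integrable lborel (G n)" "(LINT x|lborel. G n x) \<le> B" for n
      unfolding G_def using gag_via_modulus(4,5)[OF fH] gB by (auto simp: f_def)
    define F where "F x = 3 * c k * G m x + 3 * c k * G n x + (6 * (w x * ?d k m x) + 6 * (w x * ?d k n x))" for x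
    have Fi: "integrable lborel F" unfolding F_def using Gi(1) wdi by simp
    have G0: "G n x \<ge> 0" for n x unfolding G_def by (intro Bochner_Integration.integral_nonneg gag_dens_nonneg)
    have F0: "F x \<ge> 0" for x unfolding F_def using G0 c0 w0[of x] by (intro add_nonneg_nonneg mult_nonneg_nonneg) (auto intro: less_imp_le)
    have le: "AE x in lborel. w x * norm (f m x - f n x) ^ 2 \<le> F x"
      using poin[of m k] poin[of n k]
    proof eventually_elim
      case (elim x)
      have "f m x - f n x = (f m x - cube_avg k (f m) x) + (- (f n x - cube_avg k (f n) x)) + (cube_avg k (f m) x - cube_avg k (f n) x)" by simp
      then have "norm (f m x - f n x) ^ 2 \<le> 3 * norm (f m x - cube_avg k (f m) x) ^ 2 + 3 * norm (f n x - cube_avg k (f n) x) ^ 2 + 3 * norm (cube_avg k (f m) x - cube_avg k (f n) x) ^ 2"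
        using norm_sum3_square[of "f m x - cube_avg k (f m) x" "- (f n x - cube_avg k (f n) x)" "cube_avg k (f m) x - cube_avg k (f n) x"]
        by (simp add: norm_minus_commute)
      moreover have "norm (cube_avg k (f m) x - cube_avg k (f n) x) ^ 2 \<le> 2 * ?d k m x + 2 * ?d k n x"
        using norm_diff_square_le[of "cube_avg k (f m) x - p k x" "cube_avg k (f n) x - p k x"] by simp
      ultimately have a: "norm (f m x - f n x) ^ 2 \<le> (3 * c k * G m x + 3 * c k * G n x) + (6 * ?d k m x + 6 * ?d k n x)"
        using elim by (simp add: G_def)
      have b: "w x * (3 * c k * G m x + 3 * c k * G n x) \<le> 3 * c k * G m x + 3 * c k * G n x"
        using w1 c0 G0 by (intro mult_left_le_one_le) (auto intro!: add_nonneg_nonneg mult_nonneg_nonneg less_imp_le[OF w0])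
      have "w x * norm (f m x - f n x) ^ 2 \<le> w x * ((3 * c k * G m x + 3 * c k * G n x) + (6 * ?d k m x + 6 * ?d k n x))"
        using a w0[of x] by (intro mult_left_mono) auto
      also have "\<dots> = w x * (3 * c k * G m x + 3 * c k * G n x) + w x * (6 * ?d k m x + 6 * ?d k n x)"
        by (rule distrib_left)
      also have "w x * (6 * ?d k m x + 6 * ?d k n x)
        = 6 * (w x * ?d k m x) + 6 * (w x * ?d k n x)"
        by (simp add: algebra_simps)
      finally show ?case unfolding F_def using b by linarith
    qed
    have "(\<integral>\<^sup>+x. ennreal (norm (f m x - f n x) ^ 2) \<partial>M) = (\<integral>\<^sup>+x. ennreal (w x * norm (f m x - f n x) ^ 2) \<partial>lborel)"
      by (subst nnM) (auto simp: ennreal_mult less_imp_le[OF w0])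
    also have "\<dots> \<le> (\<integral>\<^sup>+x. ennreal (F x) \<partial>lborel)"
      by (rule nn_integral_mono_AE, use le in eventually_elim) (rule ennreal_leI)
    also have "\<dots> = ennreal (LINT x|lborel. F x)" by (rule nn_integral_eq_integral[OF Fi]) (simp add: F0)
    also have "(LINT x|lborel. F x) = 3 * c k * (LINT x|lborel. G m x) + 3 * c k * (LINT x|lborel. G n x)
       + (6 * (LINT x|lborel. w x * ?d k m x) + 6 * (LINT x|lborel. w x * ?d k n x))"
      unfolding F_def using Gi(1) wdi by simp
    also have "\<dots> \<le> 6 * c k * B
      + 6 * (LINT x|lborel. w x * ?d k m x) + 6 * (LINT x|lborel. w x * ?d k n x)"
      using mult_left_mono[OF Gi(2)[of m], of "3 * c k"] mult_left_mono[OF Gi(2)[of n], of "3 * c k"] c0[of k] by simp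
    finally show ?thesis by (simp add: ennreal_leI)
  qed
  obtain v r1 where v: "v \<in> borel_measurable M" "strict_mono r1" "AE x in M. (\<lambda>k. f (r1 k) x) \<longlonglongrightarrow> v x"
    "\<And>e. e > 0 \<Longrightarrow> \<exists>N. \<forall>n\<ge>N. (\<integral>\<^sup>+x. ennreal (norm (f n x - v x) ^ 2) \<partial>M) \<le> ennreal e"
  proof (rule L2_complete[of f M])
    show "f n \<in> borel_measurable M" for n by (simp add: M_def)
    fix e :: real assume e: "e > 0"
    have "(\<lambda>k. 6 * c k * B) \<longlonglongrightarrow> 6 * 0 * B" by (intro tendsto_intros clim)
    then have "\<forall>\<^sub>F k in sequentially. 6 * c k * B < e / 3" using e by (intro order_tendstoD) auto
    then obtain k where k: "6 * c k * B < e / 3" by (auto simp: eventually_sequentially)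
    have "\<forall>\<^sub>F n in sequentially. (LINT x|lborel. w x * ?d k n x) < e / 18"
      using e by (intro order_tendstoD(2)[OF dlim]) auto
    then obtain N where N: "\<And>n. n \<ge> N \<Longrightarrow> (LINT x|lborel. w x * ?d k n x) < e / 18"
      by (auto simp: eventually_sequentially)
    show "\<exists>N. \<forall>m\<ge>N. \<forall>n\<ge>N. (\<integral>\<^sup>+x. ennreal (norm (f m x - f n x) ^ 2) \<partial>M) \<le> ennreal e"
    proof (intro exI[of _ N] allI impI)
      fix m n assume "m \<ge> N" "n \<ge> N"
      then show "(\<integral>\<^sup>+x. ennreal (norm (f m x - f n x) ^ 2) \<partial>M) \<le> ennreal e"
        using N[of m] N[of n] k by (intro order_trans[OF Cauchy[of m n k]] ennreal_leI) linarith
    qed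
  qed (rule that, assumption+)
  have vm[measurable]: "v \<in> borel_measurable borel" using v(1) by (simp add: M_def)
  have aev: "AE x in lborel. (\<lambda>k. f (r1 k) x) \<longlonglongrightarrow> v x"
  proof -
    have "AE x in lborel. 0 < ennreal (w x) \<longrightarrow> (\<lambda>k. f (r1 k) x) \<longlonglongrightarrow> v x"
      using v(3) unfolding M_def by (subst (asm) AE_density) auto
    then show ?thesis using w0 by simp
  qed
  define r where "r = r0 \<circ> r1"
  have r: "strict_mono r" unfolding r_def using r0(1) v(2) by (rule strict_mono_o)
  have fr: "f (r1 n) = u (r n)" for n by (simp add: f_def r_def)
  have ae: "AE x in lborel. (\<lambda>n. u (r n) x) \<longlonglongrightarrow> v x" using aev unfolding fr .
  have vmass: "integrable lborel (\<lambda>x. norm (v x) ^ 2)" "mass v \<le> B"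
  proof -
    have l: "AE x in lborel. (\<lambda>n. norm (u (r n) x) ^ 2) \<longlonglongrightarrow> norm (v x) ^ 2"
      using ae by eventually_elim (intro tendsto_intros)
    show "integrable lborel (\<lambda>x. norm (v x) ^ 2)" "mass v \<le> B"
      unfolding mass_def using fatou_bound[OF u2 _ _ l, of B] mB by (auto simp: mass_def)
  qed
  have vgag: "integrable lborel2 (gag_dens s v)" "gag s v \<le> B"
  proof -
    have l: "AE q in lborel2. (\<lambda>n. gag_dens s (u (r n)) q) \<longlonglongrightarrow> gag_dens s v q"
      using AE_lborel_pair_shift[OF ae]
    proof eventually_elim
      case (elim q)
      then show ?case unfolding gag_dens_def by (intro tendsto_intros) auto
    qed
    show "integrable lborel2 (gag_dens s v)" "gag s v \<le> B"
      unfolding gag_def using fatou_bound[OF HsD(3)[OF u] gag_dens_nonneg _ l, of B] gB by (auto simp: gag_def)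
  qed
  have vH: "v \<in> Hs s" using vmass vgag by (simp add: Hs_def)
  have loc: "(\<lambda>n. LINT x|lborel. indicator (ball 0 R) x * norm (u (r n) x - v x) ^ 2) \<longlonglongrightarrow> 0" for R
  proof (rule LIMSEQ_I)
    fix e :: real assume e: "e > 0"
    define wR where "wR = (1 + \<bar>R\<bar>) powr (- (4 + s))"
    have wR: "wR > 0" by (simp add: wR_def)
    have wRl: "wR \<le> w x" if "norm x < R" for x
      unfolding wR_def w_def using that s by (simp, intro powr_mono2') (auto intro: add_pos_nonneg)
    obtain N where N: "\<And>n. n \<ge> N \<Longrightarrow> (\<integral>\<^sup>+x. ennreal (norm (f n x - v x) ^ 2) \<partial>M) \<le> ennreal (wR * e / 2)"
      using v(4)[of "wR * e / 2"] e wR by auto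
    show "\<exists>no. \<forall>n\<ge>no. norm ((LINT x|lborel. indicator (ball 0 R) x * norm (u (r n) x - v x) ^ 2) - 0) < e"
    proof (intro exI[of _ N] allI impI)
      fix n assume n: "n \<ge> N"
      then have "r1 n \<ge> N" using seq_suble[OF v(2), of n] by simp
      from N[OF this] have "(\<integral>\<^sup>+x. ennreal (w x * norm (f (r1 n) x - v x) ^ 2) \<partial>lborel) \<le> ennreal (wR * e / 2)"
        by (subst (asm) nnM) (auto simp: ennreal_mult less_imp_le[OF w0])
      moreover have "(\<integral>\<^sup>+x. ennreal (wR * (indicator (ball 0 R) x * norm (u (r n) x - v x) ^ 2)) \<partial>lborel)
          \<le> (\<integral>\<^sup>+x. ennreal (w x * norm (f (r1 n) x - v x) ^ 2) \<partial>lborel)"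
        unfolding fr by (intro nn_integral_mono ennreal_leI) (use wRl w0 in \<open>auto simp: indicator_def less_imp_le intro!: mult_right_mono\<close>)
      ultimately have le: "(\<integral>\<^sup>+x. ennreal (wR * (indicator (ball 0 R) x * norm (u (r n) x - v x) ^ 2)) \<partial>lborel) \<le> ennreal (wR * e / 2)"
        by (rule order_trans[rotated])
      have [measurable]: "ball (0 :: R3) R \<in> sets borel" by simp
      have [measurable]: "(\<lambda>x. norm (u (r n) x - v x) ^ 2) \<in> borel_measurable borel" by measurable
      have gm: "(\<lambda>x. wR * (indicator (ball 0 R) x * norm (u (r n) x - v x) ^ 2)) \<in> borel_measurable lborel" by measurable
      have "(LINT x|lborel. wR * (indicator (ball 0 R) x * norm (u (r n) x - v x) ^ 2)) \<le> wR * e / 2"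
        by (rule integrable_from_nn_integral_le(2)[OF gm _ le]) (use wR e in auto)
      then have "(LINT x|lborel. indicator (ball 0 R) x * norm (u (r n) x - v x) ^ 2) \<le> e / 2"
        using wR by simp
      moreover have "0 \<le> (LINT x|lborel. indicator (ball 0 R) x * norm (u (r n) x - v x) ^ 2)"
        by (intro Bochner_Integration.integral_nonneg) auto
      ultimately show "norm ((LINT x|lborel. indicator (ball 0 R) x * norm (u (r n) x - v x) ^ 2) - 0) < e" using e by simp
    qed
  qed
  show ?thesis using r vH vmass(2) vgag(2) ae loc by blast
qed

section \<open>Symmetries of the energy\<close>

lemma nn_gag:
  fixes u :: "R3 \<Rightarrow> 'k :: euclidean_space"
  assumes [measurable]: "u \<in> borel_measurable borel"
  shows "(\<integral>\<^sup>+x. (\<integral>\<^sup>+y. ennreal (norm (u x - u y) ^ 2 / norm (x - y) powr (3 + 2 * s)) \<partial>lborel) \<partial>lborel)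
    = (\<integral>\<^sup>+p. ennreal (gag_dens s u p) \<partial>lborel2)"
proof -
  have "(\<integral>\<^sup>+y. ennreal (norm (u x - u y) ^ 2 / norm (x - y) powr (3 + 2 * s)) \<partial>lborel) = (\<integral>\<^sup>+z. ennreal (gag_dens s u (x, z)) \<partial>lborel)" for x
  proof -
    have "(\<integral>\<^sup>+y. ennreal (norm (u x - u y) ^ 2 / norm (x - y) powr (3 + 2 * s)) \<partial>lborel)
        = (\<integral>\<^sup>+z. ennreal (norm (u x - u (x - z)) ^ 2 / norm (x - (x - z)) powr (3 + 2 * s)) \<partial>lborel)"
      by (rule nn_integral_lborel_shift(4)[symmetric]) measurable
    also have "\<dots> = (\<integral>\<^sup>+z. ennreal (gag_dens s u (x, z)) \<partial>lborel)"
      by (rule nn_integral_cong) (simp only: gag_dens_def powr_minus_divide times_divide_eq_right mult_1_right fst_conv snd_conv diff_diff_eq2 add_diff_cancel_left')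
    finally show ?thesis .
  qed
  moreover have "(\<integral>\<^sup>+x. \<integral>\<^sup>+z. ennreal (gag_dens s u (x, z)) \<partial>lborel \<partial>lborel) = (\<integral>\<^sup>+p. ennreal (gag_dens s u p) \<partial>lborel2)"
    by (rule lborel.nn_integral_fst) measurable
  ultimately show ?thesis by simp
qed

lemma Hs_iff_nn:
  fixes u :: "R3 \<Rightarrow> 'k :: euclidean_space"
  shows "u \<in> Hs s \<longleftrightarrow> u \<in> borel_measurable borel \<and> integrable lborel (\<lambda>x. norm (u x) ^ 2) \<and>
    (\<integral>\<^sup>+x. (\<integral>\<^sup>+y. ennreal (norm (u x - u y) ^ 2 / norm (x - y) powr (3 + 2 * s)) \<partial>lborel) \<partial>lborel) < \<infinity>"
proof -
  have "integrable lborel2 (gag_dens s u) \<longleftrightarrow> (\<integral>\<^sup>+p. ennreal (gag_dens s u p) \<partial>lborel2) < \<infinity>"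
    if [measurable]: "u \<in> borel_measurable borel"
    unfolding integrable_iff_bounded by (simp add: gag_dens_nonneg)
  then show ?thesis unfolding Hs_def using nn_gag[of u s] by auto
qed

lemma gag_nn:
  assumes u: "u \<in> Hs s"
  shows "(\<integral>\<^sup>+x. (\<integral>\<^sup>+y. ennreal (norm (u x - u y) ^ 2 / norm (x - y) powr (3 + 2 * s)) \<partial>lborel) \<partial>lborel) = ennreal (gag s u)"
  unfolding nn_gag[OF HsD(1)[OF u]] gag_def
  by (rule nn_integral_eq_integral[OF HsD(3)[OF u]]) (simp add: gag_dens_nonneg)

lemma Hs_from_nn:
  fixes u :: "R3 \<Rightarrow> 'k :: euclidean_space"
  assumes um: "u \<in> borel_measurable borel" and u2: "integrable lborel (\<lambda>x. norm (u x) ^ 2)" and c: "c \<ge> 0"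
    and eq: "(\<integral>\<^sup>+x. (\<integral>\<^sup>+y. ennreal (norm (u x - u y) ^ 2 / norm (x - y) powr (3 + 2 * s)) \<partial>lborel) \<partial>lborel) = ennreal c"
  shows "u \<in> Hs s" "gag s u = c"
proof -
  show u: "u \<in> Hs s" unfolding Hs_iff_nn using um u2 eq by simp
  show "gag s u = c" using gag_nn[OF u] eq c gag_nonneg[of s u] by simp
qed

lemma har_iterated:
  assumes s: "3 / 4 < s" "s < 1" and u: "(u :: R3 \<Rightarrow> 'k :: euclidean_space) \<in> Hs s"
  shows "har s u = (LINT x|lborel. LINT y|lborel. norm (u x) ^ 2 * norm (u y) ^ 2 / norm (x - y) powr (3 - 2 * s))"
  unfolding har_def using lborel_pair.integral_fst'[OF har_split(1)[OF s u zero_less_one]] by (simp add: har_dens_def)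

lemma translate_Hs:
  fixes u :: "R3 \<Rightarrow> 'k :: euclidean_space"
  assumes u: "u \<in> Hs s"
  shows "(\<lambda>x. u (x + a)) \<in> Hs s" "mass (\<lambda>x. u (x + a)) = mass u" "gag s (\<lambda>x. u (x + a)) = gag s u"
    "lp p (\<lambda>x. u (x + a)) = lp p u" "3 / 4 < s \<Longrightarrow> s < 1 \<Longrightarrow> har s (\<lambda>x. u (x + a)) = har s u"
proof -
  note h = HsD[OF u]
  have [measurable]: "u \<in> borel_measurable borel" by (rule h)
  have u2: "integrable lborel (\<lambda>x. norm (u (x + a)) ^ 2)"
    using integral_lborel_shift(7)[of "\<lambda>x. norm (u x) ^ 2" a] h(2) by simp
  have inner: "(\<integral>\<^sup>+y. ennreal (norm (u (x + a) - u (y + a)) ^ 2 / norm (x - y) powr (3 + 2 * s)) \<partial>lborel)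
      = (\<integral>\<^sup>+y. ennreal (norm (u (x + a) - u y) ^ 2 / norm (x + a - y) powr (3 + 2 * s)) \<partial>lborel)" for x
    using nn_integral_lborel_shift(2)[of "\<lambda>y. ennreal (norm (u (x + a) - u y) ^ 2 / norm (x + a - y) powr (3 + 2 * s))" a] by simp
  have "(\<integral>\<^sup>+x. (\<integral>\<^sup>+y. ennreal (norm (u (x + a) - u (y + a)) ^ 2 / norm (x - y) powr (3 + 2 * s)) \<partial>lborel) \<partial>lborel)
      = (\<integral>\<^sup>+x. (\<integral>\<^sup>+y. ennreal (norm (u x - u y) ^ 2 / norm (x - y) powr (3 + 2 * s)) \<partial>lborel) \<partial>lborel)"
    unfolding inner
    by (rule nn_integral_lborel_shift(2)[of "\<lambda>x. \<integral>\<^sup>+y. ennreal (norm (u x - u y) ^ 2 / norm (x - y) powr (3 + 2 * s)) \<partial>lborel" a]) measurable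
  then have nn: "(\<integral>\<^sup>+x. (\<integral>\<^sup>+y. ennreal (norm (u (x + a) - u (y + a)) ^ 2 / norm (x - y) powr (3 + 2 * s)) \<partial>lborel) \<partial>lborel) = ennreal (gag s u)"
    using gag_nn[OF u] by simp
  have um: "(\<lambda>x. u (x + a)) \<in> borel_measurable borel" by measurable
  show H: "(\<lambda>x. u (x + a)) \<in> Hs s" and "gag s (\<lambda>x. u (x + a)) = gag s u"
    using Hs_from_nn[OF um u2 gag_nonneg nn] by auto
  show "mass (\<lambda>x. u (x + a)) = mass u" unfolding mass_def
    using integral_lborel_shift(2)[of "\<lambda>x. norm (u x) ^ 2" a] by simp
  show "lp p (\<lambda>x. u (x + a)) = lp p u" unfolding lp_def
    using integral_lborel_shift(2)[of "\<lambda>x. norm (u x) powr p" a] by simp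
  show "har s (\<lambda>x. u (x + a)) = har s u" if s: "3 / 4 < s" "s < 1"
  proof -
    have inner: "(LINT y|lborel. norm (u (x + a)) ^ 2 * norm (u (y + a)) ^ 2 / norm (x - y) powr (3 - 2 * s))
      = (LINT y|lborel. norm (u (x + a)) ^ 2 * norm (u y) ^ 2 / norm (x + a - y) powr (3 - 2 * s))" for x
      using integral_lborel_shift(2)[of "\<lambda>y. norm (u (x + a)) ^ 2 * norm (u y) ^ 2 / norm (x + a - y) powr (3 - 2 * s)" a] by simp
    show ?thesis unfolding har_iterated[OF s H] har_iterated[OF s u] inner
      by (rule integral_lborel_shift(2)[of "\<lambda>x. LINT y|lborel. norm (u x) ^ 2 * norm (u y) ^ 2 / norm (x - y) powr (3 - 2 * s)" a]) measurable
  qed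
qed

lemma scale_Hs:
  fixes u :: "R3 \<Rightarrow> 'k :: euclidean_space"
  assumes u: "u \<in> Hs s" and c: "c > 0"
  shows "(\<lambda>x. c *\<^sub>R u x) \<in> Hs s" "mass (\<lambda>x. c *\<^sub>R u x) = c ^ 2 * mass u" "gag s (\<lambda>x. c *\<^sub>R u x) = c ^ 2 * gag s u"
    "lp p (\<lambda>x. c *\<^sub>R u x) = c powr p * lp p u" "har s (\<lambda>x. c *\<^sub>R u x) = c ^ 4 * har s u"
    "(LINT x|lborel. V x * norm (c *\<^sub>R u x) ^ 2) = c ^ 2 * (LINT x|lborel. V x * norm (u x) ^ 2)"
proof -
  note h = HsD[OF u]
  have [measurable]: "u \<in> borel_measurable borel" by (rule h)
  have g: "gag_dens s (\<lambda>x. c *\<^sub>R u x) = (\<lambda>p. c ^ 2 * gag_dens s u p)"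
    by (auto simp: gag_dens_def scaleR_diff_right[symmetric] power_mult_distrib)
  have hd: "har_dens s (\<lambda>x. c *\<^sub>R u x) = (\<lambda>p. c ^ 4 * har_dens s u p)"
    by (auto simp: har_dens_def power_mult_distrib power4_eq_xxxx power2_eq_square)
  have "integrable lborel2 (gag_dens s (\<lambda>x. c *\<^sub>R u x))"
    unfolding g by (rule integrable_mult_right[OF h(3)])
  then show "(\<lambda>x. c *\<^sub>R u x) \<in> Hs s"
    unfolding Hs_def using h(2) by (simp add: power_mult_distrib)
  show "mass (\<lambda>x. c *\<^sub>R u x) = c ^ 2 * mass u" unfolding mass_def by (simp add: power_mult_distrib)
  show "gag s (\<lambda>x. c *\<^sub>R u x) = c ^ 2 * gag s u" unfolding gag_def g by simp
  show "lp p (\<lambda>x. c *\<^sub>R u x) = c powr p * lp p u" unfolding lp_def using c by (simp add: powr_mult)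
  show "har s (\<lambda>x. c *\<^sub>R u x) = c ^ 4 * har s u" unfolding har_def hd by simp
  show "(LINT x|lborel. V x * norm (c *\<^sub>R u x) ^ 2) = c ^ 2 * (LINT x|lborel. V x * norm (u x) ^ 2)"
    by (subst integral_mult_right_zero[symmetric]) (simp add: power_mult_distrib mult.left_commute)
qed

lemma dilate_Hs:
  fixes u :: "R3 \<Rightarrow> 'k :: euclidean_space"
  assumes u: "u \<in> Hs s" and t: "t > 0"
  shows "(\<lambda>x. u (t *\<^sub>R x)) \<in> Hs s" "mass (\<lambda>x. u (t *\<^sub>R x)) = mass u / t ^ 3"
    "gag s (\<lambda>x. u (t *\<^sub>R x)) = t powr (2 * s - 3) * gag s u" "lp p (\<lambda>x. u (t *\<^sub>R x)) = lp p u / t ^ 3"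
proof -
  note h = HsD[OF u]
  have [measurable]: "u \<in> borel_measurable borel" by (rule h)
  have um: "(\<lambda>x. u (t *\<^sub>R x)) \<in> borel_measurable borel" by measurable
  have t3: "1 / t ^ 3 > 0" using t by simp
  have m: "(\<integral>\<^sup>+x. ennreal (norm (u (t *\<^sub>R x)) ^ 2) \<partial>lborel) = ennreal (mass u / t ^ 3)"
  proof -
    have "(\<integral>\<^sup>+x. ennreal (norm (u (t *\<^sub>R x)) ^ 2) \<partial>lborel) = ennreal (1 / t ^ 3) * (\<integral>\<^sup>+x. ennreal (norm (u x) ^ 2) \<partial>lborel)"
      using nn_integral_lborel_scale[of "\<lambda>x. ennreal (norm (u x) ^ 2)" t] t by simp
    also have "(\<integral>\<^sup>+x. ennreal (norm (u x) ^ 2) \<partial>lborel) = ennreal (mass u)"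
      unfolding mass_def by (rule nn_integral_eq_integral[OF h(2)]) simp
    finally show ?thesis using t mass_nonneg[of u] by (simp add: ennreal_mult[symmetric])
  qed
  have mm: "(\<lambda>x. norm (u (t *\<^sub>R x)) ^ 2) \<in> borel_measurable lborel" by measurable
  have u2: "integrable lborel (\<lambda>x. norm (u (t *\<^sub>R x)) ^ 2)"
    by (rule integrable_from_nn_integral_le(1)[OF mm _ eq_refl[OF m]]) (use t mass_nonneg[of u] in auto)
  have sc: "(LINT x|lborel. f (t *\<^sub>R x)) = (LINT x|lborel. f x) / t ^ 3" if "f \<in> borel_measurable borel" for f :: "R3 \<Rightarrow> real"
    using integral_lborel_scale[OF that t] t by simp
  show "mass (\<lambda>x. u (t *\<^sub>R x)) = mass u / t ^ 3" unfolding mass_def using sc[of "\<lambda>x. norm (u x) ^ 2"] by simp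
  show "lp p (\<lambda>x. u (t *\<^sub>R x)) = lp p u / t ^ 3" unfolding lp_def using sc[of "\<lambda>x. norm (u x) powr p"] by simp
  define K where "K x y = ennreal (norm (u x - u y) ^ 2 / norm (x - y) powr (3 + 2 * s))" for x y
  have Km[measurable]: "(\<lambda>q. K (fst q) (snd q)) \<in> borel_measurable (borel \<Otimes>\<^sub>M lborel)" unfolding K_def by measurable
  have Ky[measurable]: "K x \<in> borel_measurable borel" for x unfolding K_def[abs_def] by measurable
  have Ki[measurable]: "(\<lambda>x. \<integral>\<^sup>+y. K x y \<partial>lborel) \<in> borel_measurable borel"
    by (rule lborel.borel_measurable_nn_integral) (simp add: case_prod_beta')
  define T where "T = t powr (3 + 2 * s)"
  have T: "T > 0" using t by (simp add: T_def)
  have ker: "ennreal (norm (u (t *\<^sub>R x) - u (t *\<^sub>R y)) ^ 2 / norm (x - y) powr (3 + 2 * s)) = ennreal T * K (t *\<^sub>R x) (t *\<^sub>R y)" for x y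
  proof -
    have "norm (t *\<^sub>R x - t *\<^sub>R y) powr (3 + 2 * s) = T * norm (x - y) powr (3 + 2 * s)"
      using t by (simp add: scaleR_diff_right[symmetric] powr_mult T_def)
    then show ?thesis unfolding K_def using T by (simp add: ennreal_mult[symmetric])
  qed
  have "(\<integral>\<^sup>+x. (\<integral>\<^sup>+y. ennreal (norm (u (t *\<^sub>R x) - u (t *\<^sub>R y)) ^ 2 / norm (x - y) powr (3 + 2 * s)) \<partial>lborel) \<partial>lborel)
      = (\<integral>\<^sup>+x. ennreal T * (ennreal (1 / t ^ 3) * (\<integral>\<^sup>+y. K (t *\<^sub>R x) y \<partial>lborel)) \<partial>lborel)"
  proof (rule nn_integral_cong)
    fix x
    have "(\<integral>\<^sup>+y. ennreal (norm (u (t *\<^sub>R x) - u (t *\<^sub>R y)) ^ 2 / norm (x - y) powr (3 + 2 * s)) \<partial>lborel)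
        = ennreal T * (\<integral>\<^sup>+y. K (t *\<^sub>R x) (t *\<^sub>R y) \<partial>lborel)"
      unfolding ker by (rule nn_integral_cmult) measurable
    also have "(\<integral>\<^sup>+y. K (t *\<^sub>R x) (t *\<^sub>R y) \<partial>lborel) = ennreal (1 / t ^ 3) * (\<integral>\<^sup>+y. K (t *\<^sub>R x) y \<partial>lborel)"
      using nn_integral_lborel_scale[of "K (t *\<^sub>R x)" t] t by simp
    finally show "(\<integral>\<^sup>+y. ennreal (norm (u (t *\<^sub>R x) - u (t *\<^sub>R y)) ^ 2 / norm (x - y) powr (3 + 2 * s)) \<partial>lborel)
      = ennreal T * (ennreal (1 / t ^ 3) * (\<integral>\<^sup>+y. K (t *\<^sub>R x) y \<partial>lborel))" .
  qed
  also have "\<dots> = ennreal T * (ennreal (1 / t ^ 3) * (\<integral>\<^sup>+x. (\<integral>\<^sup>+y. K (t *\<^sub>R x) y \<partial>lborel) \<partial>lborel))"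
  proof -
    have [measurable]: "(\<lambda>x. \<integral>\<^sup>+y. K (t *\<^sub>R x) y \<partial>lborel) \<in> borel_measurable borel"
      by (rule measurable_compose[OF _ Ki]) measurable
    show ?thesis by (simp add: nn_integral_cmult)
  qed
  also have "(\<integral>\<^sup>+x. (\<integral>\<^sup>+y. K (t *\<^sub>R x) y \<partial>lborel) \<partial>lborel) = ennreal (1 / t ^ 3) * (\<integral>\<^sup>+x. (\<integral>\<^sup>+y. K x y \<partial>lborel) \<partial>lborel)"
    using nn_integral_lborel_scale[OF Ki t] by simp
  also have "(\<integral>\<^sup>+x. (\<integral>\<^sup>+y. K x y \<partial>lborel) \<partial>lborel) = ennreal (gag s u)" unfolding K_def by (rule gag_nn[OF u])
  also have "ennreal T * (ennreal (1 / t ^ 3) * (ennreal (1 / t ^ 3) * ennreal (gag s u))) = ennreal (T * (1 / t ^ 3 * (1 / t ^ 3 * gag s u)))"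
    using T t3 gag_nonneg[of s u] by (simp add: ennreal_mult[symmetric])
  also have "T * (1 / t ^ 3 * (1 / t ^ 3 * gag s u)) = t powr (2 * s - 3) * gag s u"
  proof -
    have "T = t powr (2 * s - 3) * t powr 3 * t powr 3"
      unfolding T_def powr_add[symmetric] by (rule arg_cong[where f = "\<lambda>e. t powr e"]) simp
    then have "T = t powr (2 * s - 3) * t ^ 3 * t ^ 3" using t by simp
    then have "T * (1 / t ^ 3 * (1 / t ^ 3 * gag s u)) = t powr (2 * s - 3) * (t ^ 3 * (1 / t ^ 3)) * (t ^ 3 * (1 / t ^ 3)) * gag s u"
      by (simp only: mult_ac)
    also have "t ^ 3 * (1 / t ^ 3) = 1" using t by simp
    finally show ?thesis by simp
  qed
  finally have nn: "(\<integral>\<^sup>+x. (\<integral>\<^sup>+y. ennreal (norm (u (t *\<^sub>R x) - u (t *\<^sub>R y)) ^ 2 / norm (x - y) powr (3 + 2 * s)) \<partial>lborel) \<partial>lborel)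
     = ennreal (t powr (2 * s - 3) * gag s u)" .
  show "(\<lambda>x. u (t *\<^sub>R x)) \<in> Hs s" "gag s (\<lambda>x. u (t *\<^sub>R x)) = t powr (2 * s - 3) * gag s u"
    using Hs_from_nn[OF um u2 _ nn] gag_nonneg[of s u] by auto
qed

lemma diff_Hs:
  fixes u v :: "R3 \<Rightarrow> 'k :: euclidean_space"
  assumes u: "u \<in> Hs s" and v: "v \<in> Hs s"
  shows "(\<lambda>x. u x - v x) \<in> Hs s" "mass (\<lambda>x. u x - v x) \<le> 2 * mass u + 2 * mass v" "gag s (\<lambda>x. u x - v x) \<le> 2 * gag s u + 2 * gag s v"
proof -
  note hu = HsD[OF u] and hv = HsD[OF v]
  have [measurable]: "u \<in> borel_measurable borel" "v \<in> borel_measurable borel" using hu hv by auto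
  have m1: "integrable lborel (\<lambda>x. 2 * norm (u x) ^ 2 + 2 * norm (v x) ^ 2)" using hu hv by simp
  have i1: "integrable lborel (\<lambda>x. norm (u x - v x) ^ 2)"
    by (rule integrable_dominated[OF m1]) (auto intro!: AE_I2 norm_diff_square_le)
  have m2: "integrable lborel2 (\<lambda>p. 2 * gag_dens s u p + 2 * gag_dens s v p)" using hu hv by simp
  have le: "gag_dens s (\<lambda>x. u x - v x) p \<le> 2 * gag_dens s u p + 2 * gag_dens s v p" for p
  proof -
    have "norm (u (fst p) - v (fst p) - (u (fst p - snd p) - v (fst p - snd p))) ^ 2
        \<le> 2 * norm (u (fst p) - u (fst p - snd p)) ^ 2 + 2 * norm (v (fst p) - v (fst p - snd p)) ^ 2"
      using norm_diff_square_le[of "u (fst p) - u (fst p - snd p)" "v (fst p) - v (fst p - snd p)"] by (simp add: algebra_simps)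
    then have "gag_dens s (\<lambda>x. u x - v x) p \<le> (2 * norm (u (fst p) - u (fst p - snd p)) ^ 2 + 2 * norm (v (fst p) - v (fst p - snd p)) ^ 2) * norm (snd p) powr (- (3 + 2 * s))"
      unfolding gag_dens_def by (rule mult_right_mono) simp
    then show ?thesis by (simp add: gag_dens_def algebra_simps)
  qed
  have i2: "integrable lborel2 (gag_dens s (\<lambda>x. u x - v x))"
  proof (rule integrable_dominated[OF m2 _ AE_I2])
    show "norm (gag_dens s (\<lambda>x. u x - v x) p) \<le> norm (2 * gag_dens s u p + 2 * gag_dens s v p)" for p
      unfolding real_norm_def abs_of_nonneg[OF gag_dens_nonneg] by (rule order_trans[OF le abs_ge_self])
  qed measurable
  show "(\<lambda>x. u x - v x) \<in> Hs s" using i1 i2 by (simp add: Hs_def)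
  have "mass (\<lambda>x. u x - v x) \<le> (LINT x|lborel. 2 * norm (u x) ^ 2 + 2 * norm (v x) ^ 2)"
    unfolding mass_def by (intro integral_mono i1 m1 norm_diff_square_le)
  then show "mass (\<lambda>x. u x - v x) \<le> 2 * mass u + 2 * mass v" using hu hv by (simp add: mass_def)
  have "gag s (\<lambda>x. u x - v x) \<le> (LINT p|lborel2. 2 * gag_dens s u p + 2 * gag_dens s v p)"
    unfolding gag_def by (intro integral_mono i2 m2 le)
  then show "gag s (\<lambda>x. u x - v x) \<le> 2 * gag s u + 2 * gag s v" using hu hv by (simp add: gag_def)
qed

lemma zero_mass:
  fixes u :: "R3 \<Rightarrow> 'k :: euclidean_space"
  assumes u: "u \<in> Hs s"
  shows "mass u = 0 \<longleftrightarrow> (AE x in lborel. u x = 0)" "mass u = 0 \<Longrightarrow> lp p u = 0"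
    "mass u > 0 \<Longrightarrow> integrable lborel (\<lambda>x. norm (u x) powr p) \<Longrightarrow> lp p u > 0"
    "mass u = 0 \<Longrightarrow> 3 / 4 < s \<Longrightarrow> s < 1 \<Longrightarrow> har s u = 0"
proof -
  note h = HsD[OF u]
  have [measurable]: "u \<in> borel_measurable borel" by (rule h)
  show iff: "mass u = 0 \<longleftrightarrow> (AE x in lborel. u x = 0)"
    unfolding mass_def using integral_nonneg_eq_0_iff_AE[OF h(2)] by simp
  show l0: "lp p u = 0" if "mass u = 0" for p
  proof -
    have "AE x in lborel. norm (u x) powr p = 0" using that unfolding iff by eventually_elim simp
    then have "lp p u = (LINT x|(lborel :: R3 measure). 0)" unfolding lp_def by (intro integral_cong_AE) auto
    then show ?thesis by simp
  qed
  show "lp p u > 0" if m: "mass u > 0" and i: "integrable lborel (\<lambda>x. norm (u x) powr p)"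
  proof (rule ccontr)
    assume "\<not> lp p u > 0"
    then have "lp p u = 0" using lp_nonneg[of p u] by linarith
    then have "AE x in lborel. norm (u x) powr p = 0" unfolding lp_def using integral_nonneg_eq_0_iff_AE[OF i] by simp
    then have "AE x in lborel. u x = 0" by eventually_elim simp
    then show False using m iff by simp
  qed
  show "har s u = 0" if m: "mass u = 0" and s: "3 / 4 < s" "s < 1"
  proof -
    obtain C where C: "(LINT p|lborel2. near_wt 1 p * har_dens s u p) \<le>
      2 * (1 * mass u + 1 powr (- ((1 - 2 * s / 3) / (2 * s / 3))) * (C * 1 powr (3 - (3 - 2 * s) / (2 * s / 3)))) * lp (2 + 4 * s / 3) u"
      using har_near[OF s, where 'k = 'k] u zero_less_one by blast
    have "har s u \<le> 0"
      unfolding har_split(2)[OF s u zero_less_one] using C har_far(2)[OF s(2) u zero_less_one] l0[OF m] m by simp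
    then show ?thesis using har_nonneg[of s u] by linarith
  qed
qed

text \<open>
  Multiplying the mass by \<open>t > 1\<close> multiplies the quadratic terms by \<open>t\<close> and the attractive terms by
  the larger factors \<open>t\<^sup>2\<close> and \<open>t powr (p/2)\<close>. This is what rules out that a minimizing sequence splits.
\<close>

lemma energy_amplify:
  fixes u :: "R3 \<Rightarrow> 'k :: euclidean_space"
  assumes u: "u \<in> Hs s" and p: "2 < p" and b: "b > 0" and t: "t \<ge> 1"
  shows "(\<lambda>x. sqrt t *\<^sub>R u x) \<in> Hs s" "mass (\<lambda>x. sqrt t *\<^sub>R u x) = t * mass u"
    "en s V p b (\<lambda>x. sqrt t *\<^sub>R u x) \<le> t * en s V p b u"
    "t > 1 \<Longrightarrow> lp p u > 0 \<Longrightarrow> en s V p b (\<lambda>x. sqrt t *\<^sub>R u x) < t * en s V p b u"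
proof -
  have c: "sqrt t > 0" using t by simp
  have c2: "sqrt t ^ 2 = t" using t by simp
  have c4: "sqrt t ^ 4 = t ^ 2"
  proof -
    have "sqrt t ^ 4 = (sqrt t ^ 2) ^ 2" by (simp add: power_mult[symmetric])
    then show ?thesis using c2 by simp
  qed
  have cp: "sqrt t powr p = t powr (p / 2)" using t by (simp add: powr_half_sqrt[symmetric] powr_powr)
  note sc = scale_Hs[OF u c]
  show "(\<lambda>x. sqrt t *\<^sub>R u x) \<in> Hs s" by (rule sc)
  show "mass (\<lambda>x. sqrt t *\<^sub>R u x) = t * mass u" using sc(2) c2 by simp
  have eq: "en s V p b (\<lambda>x. sqrt t *\<^sub>R u x) = t * en s V p b u - (t ^ 2 - t) * har s u / 2 - b * (t powr (p / 2) - t) * lp p u"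
    unfolding en_def sc c2 c4 cp by (simp add: algebra_simps diff_divide_distrib)
  have t2: "t ^ 2 - t \<ge> 0" using t by (simp add: power2_eq_square)
  then have a: "(t ^ 2 - t) * har s u / 2 \<ge> 0" using har_nonneg[of s u] by simp
  have tp: "t powr (p / 2) \<ge> t" using powr_mono[of 1 "p / 2" t] t p by simp
  have "b * (t powr (p / 2) - t) * lp p u \<ge> 0" using tp b lp_nonneg[of p u] by simp
  then show "en s V p b (\<lambda>x. sqrt t *\<^sub>R u x) \<le> t * en s V p b u" unfolding eq using a by linarith
  show "en s V p b (\<lambda>x. sqrt t *\<^sub>R u x) < t * en s V p b u" if "t > 1" "lp p u > 0"
  proof -
    have "t powr (p / 2) > t" using powr_less_mono[of 1 "p / 2" t] that p by simp
    then have "b * (t powr (p / 2) - t) * lp p u > 0" using that b by simp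
    then show ?thesis unfolding eq using a by linarith
  qed
qed

text \<open>
  Spreading a bump out makes the energy negative: under mass preserving dilations the \<open>L\<^sup>p\<close> term
  decays more slowly than the kinetic energy because the power is mass-subcritical.
\<close>

lemma negative_energy:
  assumes s: "3 / 4 < s" "s < 1" and p: "2 < p" "p < 2 + 4 * s / 3" and b: "b > 0" and m: "m > 0"
  shows "\<exists>u :: R3 \<Rightarrow> 'k :: {real_normed_field, euclidean_space}. u \<in> Hs s \<and> mass u = m \<and> en s (\<lambda>_. 0) p b u < 0"
proof -
  have s0: "0 < s" using s by simp
  let ?v = "bump :: R3 \<Rightarrow> 'k"
  have vH: "?v \<in> Hs s" by (rule bump_in_Hs[OF s0 s(2)])
  have vm: "mass ?v > 0"
  proof (rule ccontr)
    assume "\<not> mass ?v > 0"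
    then have "mass ?v = 0" using mass_nonneg[of ?v] by linarith
    then have "AE x in lborel. ?v x = 0" using zero_mass(1)[OF vH] by simp
    then have "AE x in lborel. x \<notin> ball (0 :: R3) 1"
    proof eventually_elim
      case (elim x)
      then have "norm (?v x) = 0" by simp
      then show ?case unfolding norm_bump by auto
    qed
    then have "ball (0 :: R3) 1 \<in> null_sets lborel" by (subst AE_iff_null_sets) auto
    then have "emeasure lborel (ball (0 :: R3) 1) = 0" by (rule null_setsD1)
    then show False using content_ball_gt_0_iff[of "0 :: R3" 1] by (simp add: measure_def)
  qed
  have vl: "lp p ?v > 0" by (rule zero_mass(3)[OF vH vm lp_interpolation(1)[OF s0 p vH]])
  define c where "c = sqrt (m / mass ?v)"
  have c: "c > 0" using m vm by (simp add: c_def)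
  have c2: "c ^ 2 * mass ?v = m" using m vm by (simp add: c_def)
  define u where "u t x = (c * t powr (3 / 2)) *\<^sub>R ?v (t *\<^sub>R x)" for t x
  have ut: "u t \<in> Hs s" "mass (u t) = m" "gag s (u t) = c ^ 2 * t powr (2 * s) * gag s ?v"
    "lp p (u t) = c powr p * t powr (3 * p / 2 - 3) * lp p ?v" if t: "t > 0" for t
  proof -
    have ct: "c * t powr (3 / 2) > 0" using c t by simp
    note d = dilate_Hs[OF vH t]
    note sc = scale_Hs[OF d(1) ct]
    have t32: "(t powr (3 / 2)) ^ 2 = t ^ 3" using t by (simp add: powr_power)
    show "u t \<in> Hs s" unfolding u_def[abs_def] by (rule sc)
    show "mass (u t) = m" unfolding u_def[abs_def] sc d using t c2 by (simp add: power_mult_distrib t32)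
    have "t ^ 3 * t powr (2 * s - 3) = t powr 3 * t powr (2 * s - 3)" using t by simp
    also have "\<dots> = t powr (2 * s)" unfolding powr_add[symmetric] by simp
    finally have "t ^ 3 * t powr (2 * s - 3) = t powr (2 * s)" .
    then show "gag s (u t) = c ^ 2 * t powr (2 * s) * gag s ?v" unfolding u_def[abs_def] sc d by (simp add: power_mult_distrib t32 mult.assoc[symmetric])
    have "t powr (3 * p / 2) / t ^ 3 = t powr (3 * p / 2) / t powr 3" using t by simp
    also have "\<dots> = t powr (3 * p / 2 - 3)" by (rule powr_diff[symmetric])
    finally have tp: "t powr (3 * p / 2) / t ^ 3 = t powr (3 * p / 2 - 3)" .
    show "lp p (u t) = c powr p * t powr (3 * p / 2 - 3) * lp p ?v" unfolding u_def[abs_def] sc d tp[symmetric]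
      using c t by (simp add: powr_mult powr_powr)
  qed
  define e where "e = 2 * s - (3 * p / 2 - 3)"
  have e: "e > 0" using p by (simp add: e_def)
  define A where "A = kin_const s * (c ^ 2 * gag s ?v) + 1"
  have kp: "kin_const s > 0" by (rule kin_const_pos[OF s0 s(2)])
  have A: "A > 0" "kin_const s * (c ^ 2 * gag s ?v) < A" using kp gag_nonneg[of s ?v] by (auto simp: A_def add_nonneg_pos)
  define B where "B = b * (c powr p * lp p ?v)"
  have B: "B > 0" using b c vl by (simp add: B_def)
  define t where "t = (B / A) powr (1 / e)"
  have t: "t > 0" using A B by (simp add: t_def)
  have te: "t powr e = B / A" using A B e by (simp add: t_def powr_powr)
  have "en s (\<lambda>_. 0) p b (u t) \<le> kin_const s * gag s (u t) - b * lp p (u t)"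
    unfolding en_def using har_nonneg[of s "u t"] by simp
  also have "\<dots> = t powr (2 * s) * (kin_const s * (c ^ 2 * gag s ?v)) - t powr (3 * p / 2 - 3) * B"
    unfolding ut(3)[OF t] ut(4)[OF t] B_def by (simp add: mult_ac)
  also have "\<dots> < t powr (2 * s) * A - t powr (3 * p / 2 - 3) * B" using A t by simp
  also have "t powr (2 * s) = t powr (3 * p / 2 - 3) * t powr e" unfolding powr_add[symmetric] e_def by simp
  also have "t powr (3 * p / 2 - 3) * t powr e * A - t powr (3 * p / 2 - 3) * B = 0" using te A by simp
  finally show ?thesis using ut(1,2)[OF t] by blast
qed

section \<open>Splitting of the energy along a locally convergent sequence\<close>

text \<open>
  A bounded sequence together with a limit in the sense of \<open>local_compactness\<close>. Each term of the
  energy splits asymptotically into the contributions of the limit \<open>v\<close> and of the remainder \<open>w n\<close>,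
  except that the remainder escapes from every ball and feels no potential.
\<close>

locale splitting =
  fixes s :: real and u :: "nat \<Rightarrow> R3 \<Rightarrow> 'k :: euclidean_space" and v :: "R3 \<Rightarrow> 'k" and B :: real
  assumes s: "3 / 4 < s" "s < 1" and u: "\<And>n. u n \<in> Hs s" and mB: "\<And>n. mass (u n) \<le> B" and gB: "\<And>n. gag s (u n) \<le> B"
    and B: "B > 0" and v: "v \<in> Hs s" and vB: "mass v \<le> B" "gag s v \<le> B"
    and ae: "AE x in lborel. (\<lambda>n. u n x) \<longlonglongrightarrow> v x"
    and loc: "\<And>R. (\<lambda>n. LINT x|lborel. indicator (ball 0 R) x * norm (u n x - v x) ^ 2) \<longlonglongrightarrow> 0"
begin

definition w where "w n x = u n x - v x"

lemma s0: "0 < s" using s by simp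

lemma measurability[measurable]: "u n \<in> borel_measurable borel" "v \<in> borel_measurable borel" "w n \<in> borel_measurable borel"
proof -
  show [measurable]: "u n \<in> borel_measurable borel" "v \<in> borel_measurable borel" using HsD(1)[OF u] HsD(1)[OF v] by auto
  show "w n \<in> borel_measurable borel" unfolding w_def[abs_def] by measurable
qed

lemma w_Hs: "w n \<in> Hs s" "mass (w n) \<le> 4 * B" "gag s (w n) \<le> 4 * B"
proof -
  note d = diff_Hs[OF u v, of n, folded w_def]
  have e: "w n = (\<lambda>x. w n x)" by simp
  show "w n \<in> Hs s" "mass (w n) \<le> 4 * B" "gag s (w n) \<le> 4 * B"
    using d mB[of n] gB[of n] vB by auto
qed

lemma mass_split_L1: "(\<lambda>n. LINT x|lborel. \<bar>norm (u n x) ^ 2 - norm (w n x) ^ 2 - norm (v x) ^ 2\<bar>) \<longlonglongrightarrow> 0"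
  unfolding w_def
  by (rule brezis_lieb_square(2)[where B = B]) (use HsD(2)[OF u] HsD(2)[OF v] mB ae in \<open>auto simp: mass_def\<close>)

lemma mass_split: "(\<lambda>n. mass (u n) - mass (w n)) \<longlonglongrightarrow> mass v"
  unfolding mass_def
  by (rule integral_split_limit[OF HsD(2)[OF u] HsD(2)[OF w_Hs(1)] HsD(2)[OF v] mass_split_L1])

lemma gag_split: "(\<lambda>n. gag s (u n) - gag s (w n)) \<longlonglongrightarrow> gag s v"
proof -
  define F :: "(R3 \<Rightarrow> 'k) \<Rightarrow> R3 \<times> R3 \<Rightarrow> 'k" where
    "F f p = norm (snd p) powr (- (3 + 2 * s) / 2) *\<^sub>R (f (fst p) - f (fst p - snd p))" for f p
  have sq: "norm (F f p) ^ 2 = gag_dens s f p" for f p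
  proof -
    have "(norm (snd p) powr (- (3 + 2 * s) / 2)) ^ 2 = norm (snd p) powr (- (3 + 2 * s) / 2 + - (3 + 2 * s) / 2)"
      by (simp only: power2_eq_square powr_add[symmetric])
    also have "- (3 + 2 * s) / 2 + - (3 + 2 * s) / 2 = - (3 + 2 * s)" by simp
    finally show ?thesis by (simp add: F_def gag_dens_def power_mult_distrib mult.commute)
  qed
  have Fw: "F (u n) p - F v p = F (w n) p" for n p
    by (simp add: F_def w_def scaleR_diff_right[symmetric])
  have Fm: "F f \<in> borel_measurable lborel2" if [measurable]: "f \<in> borel_measurable borel" for f
    unfolding F_def by measurable
  have l: "AE p in lborel2. (\<lambda>n. F (u n) p) \<longlonglongrightarrow> F v p"
    using AE_lborel_pair_shift[OF ae]
  proof eventually_elim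
    case (elim p)
    then show ?case unfolding F_def by (intro tendsto_intros) auto
  qed
  have "(\<lambda>n. LINT p|lborel2. \<bar>norm (F (u n) p) ^ 2 - norm (F (u n) p - F v p) ^ 2 - norm (F v p) ^ 2\<bar>) \<longlonglongrightarrow> 0"
    by (rule brezis_lieb_square(2)[where B = B, OF Fm Fm _ _ _ l])
       (use HsD(3)[OF u] HsD(3)[OF v] gB in \<open>auto simp: sq gag_def\<close>)
  then have "(\<lambda>n. LINT p|lborel2. \<bar>gag_dens s (u n) p - gag_dens s (w n) p - gag_dens s v p\<bar>) \<longlonglongrightarrow> 0"
    unfolding Fw sq .
  then show ?thesis unfolding gag_def
    by (rule integral_split_limit[OF HsD(3)[OF u] HsD(3)[OF w_Hs(1)] HsD(3)[OF v]])
qed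

lemma critical_bound: "\<exists>Q>0. \<forall>f :: R3 \<Rightarrow> 'k. f \<in> Hs s \<longrightarrow> mass f \<le> 4 * B \<longrightarrow> gag s f \<le> 4 * B \<longrightarrow> lp (2 + 4 * s / 3) f \<le> Q"
proof -
  obtain C where C: "C > 0" "\<And>f :: R3 \<Rightarrow> 'k. f \<in> Hs s \<Longrightarrow>
      (\<forall>x. (LINT y|lborel. indicator (ball x 1) y * norm (f y) ^ 2) \<le> 4 * B) \<Longrightarrow>
      lp (2 + 4 * s / 3) f \<le> C * (4 * B) powr (2 * s / 3) * (gag s f + mass f)"
  proof -
    obtain C where C: "C > 0" "\<forall>f :: R3 \<Rightarrow> 'k \<in> Hs s. integrable lborel (\<lambda>x. norm (f x) powr (2 + 4 * s / 3)) \<and>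
      (\<forall>d>0. (\<forall>x. (LINT y|lborel. indicator (ball x 1) y * norm (f y) ^ 2) \<le> d) \<longrightarrow>
        lp (2 + 4 * s / 3) f \<le> C * d powr (2 * s / 3) * (gag s f + mass f))"
      using critical_interpolation[OF s0, where 'k = 'k] by (elim exE conjE) (rule that)
    show thesis by (rule that[OF C(1)]) (use C(2) B in auto)
  qed
  show ?thesis
  proof (intro exI[of _ "C * (4 * B) powr (2 * s / 3) * (8 * B)"] conjI allI impI)
    show "C * (4 * B) powr (2 * s / 3) * (8 * B) > 0" using C(1) B by simp
    fix f :: "R3 \<Rightarrow> 'k" assume f: "f \<in> Hs s" "mass f \<le> 4 * B" "gag s f \<le> 4 * B"
    have "\<forall>x. (LINT y|lborel. indicator (ball x 1) y * norm (f y) ^ 2) \<le> 4 * B"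
      using local_mass_le(2)[OF f(1), of _ 1] f(2) by (meson order_trans)
    then have "lp (2 + 4 * s / 3) f \<le> C * (4 * B) powr (2 * s / 3) * (gag s f + mass f)" by (rule C(2)[OF f(1)])
    also have "\<dots> \<le> C * (4 * B) powr (2 * s / 3) * (8 * B)" using f C(1) by (intro mult_left_mono) auto
    finally show "lp (2 + 4 * s / 3) f \<le> C * (4 * B) powr (2 * s / 3) * (8 * B)" .
  qed
qed

lemma lp_split:
  assumes p: "2 < p" "p < 2 + 4 * s / 3"
  shows "(\<lambda>n. lp p (u n) - lp p (w n)) \<longlonglongrightarrow> lp p v"
proof -
  note i = lp_interpolation(1)[OF s0 p]
  obtain Q where Q: "Q > 0" "\<And>f :: R3 \<Rightarrow> 'k. f \<in> Hs s \<Longrightarrow> mass f \<le> 4 * B \<Longrightarrow> gag s f \<le> 4 * B \<Longrightarrow> lp (2 + 4 * s / 3) f \<le> Q"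
    using critical_bound by blast
  obtain K where K: "K > 0" "\<And>f :: R3 \<Rightarrow> 'k. f \<in> Hs s \<Longrightarrow> lp p f \<le> 1 * lp (2 + 4 * s / 3) f + K * mass f"
    using lp_interpolation(2)[OF s0 p zero_less_one, where 'k = 'k] by blast
  have pB: "lp p (u n) \<le> Q + K * B" for n
  proof -
    have "lp p (u n) \<le> lp (2 + 4 * s / 3) (u n) + K * mass (u n)" using K(2)[OF u, of n] by simp
    also have "\<dots> \<le> Q + K * B"
      using Q(2)[OF u, of n] mB[of n] gB[of n] B K(1) by (intro add_mono mult_left_mono) auto
    finally show ?thesis .
  qed
  have "(\<lambda>n. LINT x|lborel. \<bar>norm (u n x) powr p - norm (u n x - v x) powr p - norm (v x) powr p\<bar>) \<longlonglongrightarrow> 0"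
    by (rule brezis_lieb(2)[where B = "Q + K * B"]) (use p i[OF u] i[OF v] pB ae in \<open>auto simp: lp_def\<close>)
  then show ?thesis unfolding lp_def w_def[symmetric]
    by (rule integral_split_limit[OF i[OF u] i[OF w_Hs(1)] i[OF v]])
qed

text \<open>
  Outside a large ball \<open>V\<close> is small, and on the ball \<open>w n\<close> tends to zero in mean square.
\<close>

lemma potential_vanishes:
  assumes V[measurable]: "V \<in> borel_measurable borel" and M: "\<And>x. \<bar>V x\<bar> \<le> M" and lim: "(V \<longlongrightarrow> 0) at_infinity"
  shows "(\<lambda>n. LINT x|lborel. V x * norm (w n x) ^ 2) \<longlonglongrightarrow> 0"
proof (rule LIMSEQ_I)
  fix e :: real assume e: "e > 0"
  have M0: "M \<ge> 0" using M[of 0] by (meson abs_ge_zero order_trans)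
  define \<eta> where "\<eta> = e / (16 * B)"
  have \<eta>: "\<eta> > 0" using e B by (simp add: \<eta>_def)
  have "\<forall>\<^sub>F x in at_infinity. dist (V x) 0 < \<eta>" using lim \<eta> by (rule tendstoD)
  then obtain R where R: "\<And>x. norm x \<ge> R \<Longrightarrow> \<bar>V x\<bar> < \<eta>" by (auto simp: eventually_at_infinity)
  have "\<forall>\<^sub>F n in sequentially. (LINT x|lborel. indicator (ball 0 R) x * norm (u n x - v x) ^ 2) < e / (2 * (M + 1))"
    using e M0 by (intro order_tendstoD(2)[OF loc]) auto
  then obtain N where N: "\<And>n. n \<ge> N \<Longrightarrow> (LINT x|lborel. indicator (ball 0 R) x * norm (w n x) ^ 2) < e / (2 * (M + 1))"
    by (auto simp: eventually_sequentially w_def)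
  show "\<exists>no. \<forall>n\<ge>no. norm ((LINT x|lborel. V x * norm (w n x) ^ 2) - 0) < e"
  proof (intro exI[of _ N] allI impI)
    fix n assume n: "n \<ge> N"
    note li = local_mass_le(1)[OF w_Hs(1), of 0 R n]
    note pi = potential_integral(1)[OF w_Hs(1) V M, of n]
    have "\<bar>LINT x|lborel. V x * norm (w n x) ^ 2\<bar> \<le> (LINT x|lborel. \<bar>V x * norm (w n x) ^ 2\<bar>)" by (rule integral_abs_bound)
    also have "\<dots> \<le> (LINT x|lborel. M * (indicator (ball 0 R) x * norm (w n x) ^ 2) + \<eta> * norm (w n x) ^ 2)"
    proof (rule integral_mono)
      show "integrable lborel (\<lambda>x. \<bar>V x * norm (w n x) ^ 2\<bar>)" using pi by simp
      show "integrable lborel (\<lambda>x. M * (indicator (ball 0 R) x * norm (w n x) ^ 2) + \<eta> * norm (w n x) ^ 2)"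
        using li HsD(2)[OF w_Hs(1), of n] by simp
      fix x
      have "\<bar>V x\<bar> \<le> M * indicator (ball 0 R) x + \<eta>"
        using M[of x] R[of x] \<eta> by (cases "norm x < R") auto
      then have "\<bar>V x\<bar> * norm (w n x) ^ 2 \<le> (M * indicator (ball 0 R) x + \<eta>) * norm (w n x) ^ 2" by (rule mult_right_mono) simp
      then show "\<bar>V x * norm (w n x) ^ 2\<bar> \<le> M * (indicator (ball 0 R) x * norm (w n x) ^ 2) + \<eta> * norm (w n x) ^ 2"
        by (simp add: abs_mult distrib_right mult.assoc)
    qed
    also have "\<dots> = M * (LINT x|lborel. indicator (ball 0 R) x * norm (w n x) ^ 2) + \<eta> * mass (w n)"
      using li HsD(2)[OF w_Hs(1), of n] by (simp add: mass_def)
    also have "\<dots> < e / 2 + e / 2"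
    proof (rule add_less_le_mono)
      define L where "L = (LINT x|lborel. indicator (ball 0 R) x * norm (w n x) ^ 2)"
      have L0: "L \<ge> 0" unfolding L_def by (intro Bochner_Integration.integral_nonneg) auto
      have "M * L \<le> (M + 1) * L" using L0 by (intro mult_right_mono) auto
      also have "\<dots> < e / 2" using N[OF n] M0 by (simp add: L_def field_simps)
      finally show "M * L < e / 2" .
      have "\<eta> * mass (w n) \<le> \<eta> * (4 * B)" using w_Hs(2) \<eta> by (intro mult_left_mono) auto
      also have "\<dots> \<le> e / 2" using B e by (simp add: \<eta>_def)
      finally show "\<eta> * mass (w n) \<le> e / 2" .
    qed
    finally show "norm ((LINT x|lborel. V x * norm (w n x) ^ 2) - 0) < e" by simp
  qed
qed

lemma potential_limit:
  assumes V[measurable]: "V \<in> borel_measurable borel" and M: "\<And>x. \<bar>V x\<bar> \<le> M" and lim: "(V \<longlongrightarrow> 0) at_infinity"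
  shows "(\<lambda>n. LINT x|lborel. V x * norm (u n x) ^ 2) \<longlonglongrightarrow> (LINT x|lborel. V x * norm (v x) ^ 2)"
proof -
  note pu = potential_integral(1)[OF u V M] and pw = potential_integral(1)[OF w_Hs(1) V M] and pv = potential_integral(1)[OF v V M]
  have M0: "M \<ge> 0" using M[of 0] by (meson abs_ge_zero order_trans)
  have h: "integrable lborel (\<lambda>x. \<bar>norm (u n x) ^ 2 - norm (w n x) ^ 2 - norm (v x) ^ 2\<bar>)" for n
    using HsD(2)[OF u, of n] HsD(2)[OF w_Hs(1), of n] HsD(2)[OF v] by simp
  have "(\<lambda>n. LINT x|lborel. \<bar>V x * norm (u n x) ^ 2 - V x * norm (w n x) ^ 2 - V x * norm (v x) ^ 2\<bar>) \<longlonglongrightarrow> 0"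
  proof (rule tendsto_sandwich[OF always_eventually always_eventually tendsto_const])
    show "(\<lambda>n. M * (LINT x|lborel. \<bar>norm (u n x) ^ 2 - norm (w n x) ^ 2 - norm (v x) ^ 2\<bar>)) \<longlonglongrightarrow> 0"
      using tendsto_mult_left[OF mass_split_L1, of M] by simp
    show "\<forall>n. 0 \<le> (LINT x|lborel. \<bar>V x * norm (u n x) ^ 2 - V x * norm (w n x) ^ 2 - V x * norm (v x) ^ 2\<bar>)"
      by (auto intro: Bochner_Integration.integral_nonneg)
    show "\<forall>n. (LINT x|lborel. \<bar>V x * norm (u n x) ^ 2 - V x * norm (w n x) ^ 2 - V x * norm (v x) ^ 2\<bar>)
        \<le> M * (LINT x|lborel. \<bar>norm (u n x) ^ 2 - norm (w n x) ^ 2 - norm (v x) ^ 2\<bar>)"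
    proof
      fix n
      have "(LINT x|lborel. \<bar>V x * norm (u n x) ^ 2 - V x * norm (w n x) ^ 2 - V x * norm (v x) ^ 2\<bar>)
        \<le> (LINT x|lborel. M * \<bar>norm (u n x) ^ 2 - norm (w n x) ^ 2 - norm (v x) ^ 2\<bar>)"
      proof (rule integral_mono)
        show "integrable lborel (\<lambda>x. \<bar>V x * norm (u n x) ^ 2 - V x * norm (w n x) ^ 2 - V x * norm (v x) ^ 2\<bar>)"
          using pu[of n] pw[of n] pv by simp
        show "integrable lborel (\<lambda>x. M * \<bar>norm (u n x) ^ 2 - norm (w n x) ^ 2 - norm (v x) ^ 2\<bar>)" using h[of n] by (rule integrable_mult_right)
        fix x
        have "\<bar>V x * norm (u n x) ^ 2 - V x * norm (w n x) ^ 2 - V x * norm (v x) ^ 2\<bar> = \<bar>V x\<bar> * \<bar>norm (u n x) ^ 2 - norm (w n x) ^ 2 - norm (v x) ^ 2\<bar>"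
          by (simp add: abs_mult[symmetric] right_diff_distrib)
        then show "\<bar>V x * norm (u n x) ^ 2 - V x * norm (w n x) ^ 2 - V x * norm (v x) ^ 2\<bar> \<le> M * \<bar>norm (u n x) ^ 2 - norm (w n x) ^ 2 - norm (v x) ^ 2\<bar>"
          using mult_right_mono[OF M[of x], of "\<bar>norm (u n x) ^ 2 - norm (w n x) ^ 2 - norm (v x) ^ 2\<bar>"] by simp
      qed
      then show "(LINT x|lborel. \<bar>V x * norm (u n x) ^ 2 - V x * norm (w n x) ^ 2 - V x * norm (v x) ^ 2\<bar>)
        \<le> M * (LINT x|lborel. \<bar>norm (u n x) ^ 2 - norm (w n x) ^ 2 - norm (v x) ^ 2\<bar>)" by simp
    qed
  qed
  then have "(\<lambda>n. (LINT x|lborel. V x * norm (u n x) ^ 2) - (LINT x|lborel. V x * norm (w n x) ^ 2)) \<longlonglongrightarrow> (LINT x|lborel. V x * norm (v x) ^ 2)"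
    by (rule integral_split_limit[OF pu pw pv])
  from tendsto_add[OF this potential_vanishes[OF V M lim]] show ?thesis by simp
qed

text \<open>
  For a bounded interaction kernel of finite range the mixed term of \<open>\<bar>v\<bar>\<^sup>2\<close> and \<open>\<bar>w\<^sub>n\<bar>\<^sup>2\<close> vanishes,
  since \<open>\<bar>v\<bar>\<^sup>2\<close> is concentrated on a ball and \<open>w\<^sub>n\<close> tends to zero in mean square on every ball.
\<close>

lemma mixed_term_vanishes:
  assumes K: "K \<ge> 0" and e: "e > 0"
  shows "\<exists>N. \<forall>n\<ge>N. (LINT p|lborel2. K * near_wt R p * (norm (v (fst p)) ^ 2 * norm (w n (snd p)) ^ 2)) \<le> e"
proof -
  define K1 where "K1 = K + 1"
  have K1: "K1 > 0" using K by (simp add: K1_def)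
  have tail: "(\<lambda>T. LINT x|lborel. indicator (- ball 0 (real T)) x * norm (v x) ^ 2) \<longlonglongrightarrow> 0"
  proof -
    have "(\<lambda>T. LINT x|lborel. indicator (- ball 0 (real T)) x * norm (v x) ^ 2) \<longlonglongrightarrow> (LINT x|(lborel :: R3 measure). 0)"
    proof (rule integral_dominated_convergence[OF _ _ HsD(2)[OF v]])
      show "AE x in lborel. (\<lambda>T. indicator (- ball 0 (real T)) x * norm (v x) ^ 2) \<longlonglongrightarrow> 0"
      proof (rule AE_I2)
        fix x :: R3
        obtain T0 where "norm x < real T0" using reals_Archimedean2 by blast
        then have "\<forall>\<^sub>F T in sequentially. indicator (- ball 0 (real T)) x * norm (v x) ^ 2 = 0"
          by (intro eventually_sequentiallyI[of T0]) (auto simp: indicator_def)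
        then show "(\<lambda>T. indicator (- ball 0 (real T)) x * norm (v x) ^ 2) \<longlonglongrightarrow> 0" by (rule tendsto_eventually)
      qed
      show "AE x in lborel. norm (indicator (- ball 0 (real T)) x * norm (v x) ^ 2) \<le> norm (v x) ^ 2" for T
        by (rule AE_I2) (auto simp: indicator_def)
    qed measurable
    then show ?thesis by simp
  qed
  have "\<forall>\<^sub>F T in sequentially. (LINT x|lborel. indicator (- ball 0 (real T)) x * norm (v x) ^ 2) < e / (2 * K1 * (4 * B))"
    using e K1 B by (intro order_tendstoD(2)[OF tail]) auto
  then obtain T where T: "(LINT x|lborel. indicator (- ball 0 (real T)) x * norm (v x) ^ 2) < e / (2 * K1 * (4 * B))"
    by (auto simp: eventually_sequentially)
  have "\<forall>\<^sub>F n in sequentially. (LINT x|lborel. indicator (ball 0 (real T + R)) x * norm (u n x - v x) ^ 2) < e / (2 * K1 * B)"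
    using e K1 B by (intro order_tendstoD(2)[OF loc]) auto
  then obtain N where N: "\<And>n. n \<ge> N \<Longrightarrow> (LINT x|lborel. indicator (ball 0 (real T + R)) x * norm (w n x) ^ 2) < e / (2 * K1 * B)"
    by (auto simp: eventually_sequentially w_def)
  show ?thesis
  proof (intro exI[of _ N] allI impI)
    fix n assume n: "n \<ge> N"
    define a where "a x = indicator (- ball 0 (real T)) x * norm (v x) ^ 2" for x
    define c where "c x = indicator (ball 0 (real T + R)) x * norm (w n x) ^ 2" for x
    let ?f = "\<lambda>p. K * near_wt R p * (norm (v (fst p)) ^ 2 * norm (w n (snd p)) ^ 2)"
    let ?g = "\<lambda>p. K1 * (a (fst p) * norm (w n (snd p)) ^ 2) + K1 * (norm (v (fst p)) ^ 2 * c (snd p))"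
    have it: "integrable lborel a" unfolding a_def[abs_def]
      by (rule integrable_majorant[OF HsD(2)[OF v]]) (auto simp: indicator_def)
    note iw = HsD(2)[OF w_Hs(1), of n] and iv = HsD(2)[OF v] and il = local_mass_le(1)[OF w_Hs(1), of 0 "real T + R" n, folded c_def]
    note P1 = integrable_lborel_product[OF it iw] and P2 = integrable_lborel_product[OF iv il]
    have le: "?f p \<le> ?g p" for p
    proof -
      have "near_wt R p \<le> indicator (- ball 0 (real T)) (fst p) + indicator (ball 0 (real T + R)) (snd p)"
      proof (cases "norm (fst p - snd p) < R \<and> norm (fst p) < real T")
        case True
        then have "norm (snd p) < real T + R" using norm_triangle_ineq2[of "snd p" "fst p"] by (simp add: norm_minus_commute)
        then show ?thesis by (auto simp: near_wt_def indicator_def)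
      qed (auto simp: near_wt_def indicator_def)
      then have "K * near_wt R p \<le> K1 * (indicator (- ball 0 (real T)) (fst p) + indicator (ball 0 (real T + R)) (snd p))"
        using K by (intro mult_mono) (auto simp: K1_def near_wt_def)
      then have "?f p \<le> K1 * (indicator (- ball 0 (real T)) (fst p) + indicator (ball 0 (real T + R)) (snd p)) * (norm (v (fst p)) ^ 2 * norm (w n (snd p)) ^ 2)"
        by (rule mult_right_mono) simp
      also have "\<dots> = ?g p" by (simp add: a_def c_def distrib_left distrib_right mult_ac)
      finally show ?thesis .
    qed
    have maj: "integrable lborel2 ?g"
      using P1 P2 by (intro Bochner_Integration.integrable_add integrable_mult_right)
    have nn: "0 \<le> ?f p" for p using K by (simp add: near_wt_def)
    have "integrable lborel2 ?f" by (rule integrable_majorant_nonneg[OF maj _ nn le]) measurable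
    then have "(LINT p|lborel2. ?f p) \<le> (LINT p|lborel2. ?g p)" by (rule integral_mono[OF _ maj le])
    also have "\<dots> = K1 * (LINT p|lborel2. a (fst p) * norm (w n (snd p)) ^ 2) + K1 * (LINT p|lborel2. norm (v (fst p)) ^ 2 * c (snd p))"
      using P1 P2 by (subst Bochner_Integration.integral_add) (auto intro!: integrable_mult_right)
    also have "(LINT p|lborel2. a (fst p) * norm (w n (snd p)) ^ 2) = (LINT x|lborel. a x) * mass (w n)"
      using lborel_pair.integral_fst'[OF P1] by (simp add: mass_def)
    also have "(LINT p|lborel2. norm (v (fst p)) ^ 2 * c (snd p)) = mass v * (LINT x|lborel. c x)"
      using lborel_pair.integral_fst'[OF P2] by (simp add: mass_def)
    also have "K1 * ((LINT x|lborel. a x) * mass (w n)) + K1 * (mass v * (LINT x|lborel. c x))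
        \<le> K1 * (e / (2 * K1 * (4 * B)) * (4 * B)) + K1 * (B * (e / (2 * K1 * B)))"
      using T N[OF n] w_Hs(2)[of n] vB(1) K1 B e mass_nonneg[of "w n"] mass_nonneg[of v] unfolding a_def c_def
      by (intro add_mono mult_left_mono mult_mono) (auto intro!: Bochner_Integration.integral_nonneg)
    also have "\<dots> = e" using K1 B by (simp add: field_simps)
    finally show "(LINT p|lborel2. ?f p) \<le> e" .
  qed
qed

text \<open>
  The middle range of the Hartree interaction: there the kernel is bounded and of finite range, and
  the \<open>L\<^sup>1\<close> splitting of \<open>\<bar>u\<^sub>n\<bar>\<^sup>2\<close> leaves only mixed terms.
\<close>

lemma middle_range_split:
  fixes R :: real
  assumes \<rho>: "\<rho> > 0" and e: "e > 0"
  defines "mid \<equiv> \<lambda>f. LINT p|lborel2. (1 - near_wt \<rho> p) * near_wt R p * har_dens s f p"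
  shows "\<exists>N. \<forall>n\<ge>N. mid (u n) - mid (w n) - mid v \<le> e \<and> - e \<le> mid (u n) - mid (w n) - mid v"
proof -
  define K where "K = \<rho> powr (- (3 - 2 * s))"
  have K: "K > 0" using \<rho> by (simp add: K_def)
  define k where "k p = (1 - near_wt \<rho> p) * near_wt R p / norm (fst p - snd p) powr (3 - 2 * s)" for p
  have [measurable]: "k \<in> borel_measurable lborel2" unfolding k_def by measurable
  have k0: "0 \<le> k p" for p by (simp add: k_def near_wt_def)
  have kle: "k p \<le> K * near_wt R p" for p
  proof (cases "norm (fst p - snd p) < \<rho>")
    case False
    have "1 / norm (fst p - snd p) powr (3 - 2 * s) = norm (fst p - snd p) powr (- (3 - 2 * s))" by (rule powr_minus_divide[symmetric])
    also have "\<dots> \<le> K" unfolding K_def using False \<rho> s by (intro powr_mono2') auto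
    finally show ?thesis by (simp add: k_def near_wt_def less_imp_le[OF K])
  qed (simp add: k_def near_wt_def less_imp_le[OF K])
  have kK: "k p \<le> K" for p using kle[of p] K by (simp add: near_wt_def split: if_splits)
  define S where "S f p = norm (f (fst p)) ^ 2 * norm (f (snd p)) ^ 2" for f :: "R3 \<Rightarrow> 'k" and p :: "R3 \<times> R3"
  have mid: "mid f = (LINT p|lborel2. k p * S f p)" for f
    unfolding mid_def k_def S_def har_dens_def by (rule Bochner_Integration.integral_cong) auto
  have Si: "integrable lborel2 (S f)" if "f \<in> Hs s" for f
    unfolding S_def by (rule integrable_lborel_product[OF HsD(2)[OF that] HsD(2)[OF that]])
  have kSi: "integrable lborel2 (\<lambda>p. k p * g p)" if g: "integrable lborel2 g" for g
  proof (rule integrable_dominated)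
    show "integrable lborel2 (\<lambda>p. K * g p)" using g by simp
    show "AE p in lborel2. norm (k p * g p) \<le> norm (K * g p)"
      using k0 kK K by (intro AE_I2) (auto simp: abs_mult intro!: mult_right_mono)
    have [measurable]: "g \<in> borel_measurable lborel2" using g by auto
    show "(\<lambda>p. k p * g p) \<in> borel_measurable lborel2" by measurable
  qed
  define h where "h n x = norm (u n x) ^ 2 - norm (w n x) ^ 2 - norm (v x) ^ 2" for n x
  have hi: "integrable lborel (h n)" for n
    unfolding h_def using HsD(2)[OF u, of n] HsD(2)[OF w_Hs(1), of n] HsD(2)[OF v] by simp
  have h0: "(\<lambda>n. LINT x|lborel. \<bar>h n x\<bar>) \<longlonglongrightarrow> 0" unfolding h_def by (rule mass_split_L1)
  have "\<forall>\<^sub>F n in sequentially. (LINT x|lborel. \<bar>h n x\<bar>) < e / (2 * K * (6 * B))"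
    using e K B by (intro order_tendstoD(2)[OF h0]) auto
  then obtain N1 where N1: "\<And>n. n \<ge> N1 \<Longrightarrow> (LINT x|lborel. \<bar>h n x\<bar>) < e / (2 * K * (6 * B))"
    by (auto simp: eventually_sequentially)
  obtain N2 where N2: "\<And>n. n \<ge> N2 \<Longrightarrow> (LINT p|lborel2. K * near_wt R p * (norm (v (fst p)) ^ 2 * norm (w n (snd p)) ^ 2)) \<le> e / 4"
    using mixed_term_vanishes[of K "e / 4" R] K e by auto
  show ?thesis
  proof (intro exI[of _ "max N1 N2"] allI impI)
    fix n assume n: "max N1 N2 \<le> n"
    let ?f = "\<lambda>x. norm (u n x) ^ 2" and ?g = "\<lambda>x. norm (w n x) ^ 2" and ?v = "\<lambda>x. norm (v x) ^ 2"
    note fi = HsD(2)[OF u, of n] and gi = HsD(2)[OF w_Hs(1), of n] and vi = HsD(2)[OF v]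
    have hai: "integrable lborel (\<lambda>x. \<bar>h n x\<bar>)" using hi by simp
    have vgi: "integrable lborel (\<lambda>x. ?v x + ?g x)" using gi vi by simp
    note Q1 = integrable_lborel_product[OF vi gi] and Q2 = integrable_lborel_product[OF gi vi]
      and Q3 = integrable_lborel_product[OF hai fi] and Q4 = integrable_lborel_product[OF vgi hai]
    define m1 where "m1 = (LINT p|lborel2. k p * (?v (fst p) * ?g (snd p)))"
    define m2 where "m2 = (LINT p|lborel2. k p * (?g (fst p) * ?v (snd p)))"
    have ksym: "k (y, x) = k (x, y)" for x y by (simp add: k_def near_wt_def norm_minus_commute)
    have m12: "m2 = m1"
    proof -
      have "m1 = (LINT x|lborel. LINT y|lborel. k (x, y) * (?v x * ?g y))"
        unfolding m1_def using lborel_pair.integral_fst'[OF kSi[OF Q1]] by simp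
      also have "\<dots> = (LINT y|lborel. LINT x|lborel. k (x, y) * (?v x * ?g y))"
        using lborel_pair.Fubini_integral[of "\<lambda>x y. k (x, y) * (?v x * ?g y)"] kSi[OF Q1] by (simp add: case_prod_beta')
      also have "\<dots> = (LINT y|lborel. LINT x|lborel. k (y, x) * (?g y * ?v x))"
        by (simp add: ksym mult_ac)
      also have "\<dots> = m2" unfolding m2_def using lborel_pair.integral_fst'[OF kSi[OF Q2]] by simp
      finally show ?thesis by simp
    qed
    have m1le: "m1 \<le> e / 4"
    proof -
      have KRi: "integrable lborel2 (\<lambda>p. K * near_wt R p * (?v (fst p) * ?g (snd p)))"
      proof (rule integrable_dominated)
        show "integrable lborel2 (\<lambda>p. K * (?v (fst p) * ?g (snd p)))" using Q1 by simp
        show "AE p in lborel2. norm (K * near_wt R p * (?v (fst p) * ?g (snd p))) \<le> norm (K * (?v (fst p) * ?g (snd p)))"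
          by (rule AE_I2) (auto simp: near_wt_def)
      qed measurable
      have "m1 \<le> (LINT p|lborel2. K * near_wt R p * (?v (fst p) * ?g (snd p)))"
        unfolding m1_def by (intro integral_mono kSi Q1 KRi mult_right_mono kle) auto
      also have "\<dots> \<le> e / 4" using N2[of n] n by simp
      finally show ?thesis .
    qed
    have m10: "m1 \<ge> 0" unfolding m1_def by (intro Bochner_Integration.integral_nonneg mult_nonneg_nonneg k0) auto
    define r where "r p = h n (fst p) * ?f (snd p) + (?v (fst p) + ?g (fst p)) * h n (snd p)" for p
    have ri: "integrable lborel2 r"
      unfolding r_def by (intro Bochner_Integration.integrable_add integrable_lborel_product hi fi vgi)
    have alg: "k p * S (u n) p - k p * S (w n) p - k p * S v p = k p * (?v (fst p) * ?g (snd p)) + k p * (?g (fst p) * ?v (snd p)) + k p * r p" for p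
      unfolding S_def r_def h_def by (simp add: algebra_simps)
    have "mid (u n) - mid (w n) - mid v = (LINT p|lborel2. k p * S (u n) p - k p * S (w n) p - k p * S v p)"
      unfolding mid using kSi[OF Si[OF u]] kSi[OF Si[OF w_Hs(1)]] kSi[OF Si[OF v]] by simp
    also have "\<dots> = m1 + m2 + (LINT p|lborel2. k p * r p)"
      unfolding alg m1_def m2_def using kSi[OF Q1] kSi[OF Q2] kSi[OF ri] by simp
    finally have eq: "mid (u n) - mid (w n) - mid v = 2 * m1 + (LINT p|lborel2. k p * r p)" using m12 by simp
    have "\<bar>LINT p|lborel2. k p * r p\<bar> \<le> (LINT p|lborel2. \<bar>k p * r p\<bar>)" by (rule integral_abs_bound)
    also have "\<dots> \<le> (LINT p|lborel2. K * (\<bar>h n (fst p)\<bar> * ?f (snd p)) + K * ((?v (fst p) + ?g (fst p)) * \<bar>h n (snd p)\<bar>))"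
    proof (rule integral_mono)
      show "integrable lborel2 (\<lambda>p. \<bar>k p * r p\<bar>)" using kSi[OF ri] by simp
      show "integrable lborel2 (\<lambda>p. K * (\<bar>h n (fst p)\<bar> * ?f (snd p)) + K * ((?v (fst p) + ?g (fst p)) * \<bar>h n (snd p)\<bar>))"
        using Q3 Q4 by (intro Bochner_Integration.integrable_add integrable_mult_right)
      fix p
      have "\<bar>r p\<bar> \<le> \<bar>h n (fst p)\<bar> * ?f (snd p) + (?v (fst p) + ?g (fst p)) * \<bar>h n (snd p)\<bar>"
        unfolding r_def by (rule order_trans[OF abs_triangle_ineq]) (simp add: abs_mult)
      then have "k p * \<bar>r p\<bar> \<le> K * (\<bar>h n (fst p)\<bar> * ?f (snd p) + (?v (fst p) + ?g (fst p)) * \<bar>h n (snd p)\<bar>)"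
        using kK k0 K by (intro mult_mono) auto
      then show "\<bar>k p * r p\<bar> \<le> K * (\<bar>h n (fst p)\<bar> * ?f (snd p)) + K * ((?v (fst p) + ?g (fst p)) * \<bar>h n (snd p)\<bar>)"
        using k0[of p] by (simp add: abs_mult distrib_left)
    qed
    also have "\<dots> = K * (LINT p|lborel2. \<bar>h n (fst p)\<bar> * ?f (snd p)) + K * (LINT p|lborel2. (?v (fst p) + ?g (fst p)) * \<bar>h n (snd p)\<bar>)"
      using Q3 Q4 by (subst Bochner_Integration.integral_add) (auto intro!: integrable_mult_right)
    also have "(LINT p|lborel2. \<bar>h n (fst p)\<bar> * ?f (snd p)) = (LINT x|lborel. \<bar>h n x\<bar>) * mass (u n)"
      using lborel_pair.integral_fst'[OF Q3] by (simp add: mass_def)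
    also have "(LINT p|lborel2. (?v (fst p) + ?g (fst p)) * \<bar>h n (snd p)\<bar>) = (mass v + mass (w n)) * (LINT x|lborel. \<bar>h n x\<bar>)"
      using lborel_pair.integral_fst'[OF Q4] vi gi by (simp add: mass_def)
    also have "K * ((LINT x|lborel. \<bar>h n x\<bar>) * mass (u n)) + K * ((mass v + mass (w n)) * (LINT x|lborel. \<bar>h n x\<bar>))
        = K * ((LINT x|lborel. \<bar>h n x\<bar>) * (mass (u n) + mass v + mass (w n)))"
      by (simp add: algebra_simps)
    also have "\<dots> \<le> K * (e / (2 * K * (6 * B)) * (6 * B))"
      using N1[of n] n K mB[of n] vB(1) w_Hs(2)[of n] e B mass_nonneg[of "u n"] mass_nonneg[of v] mass_nonneg[of "w n"]
      by (intro mult_left_mono mult_mono) auto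
    also have "\<dots> = e / 2" using K B by simp
    finally have "\<bar>LINT p|lborel2. k p * r p\<bar> \<le> e / 2" .
    then show "mid (u n) - mid (w n) - mid v \<le> e \<and> - e \<le> mid (u n) - mid (w n) - mid v"
      unfolding eq using m1le m10 e by linarith
  qed
qed

text \<open>
  Three ranges of the distance \<open>norm (x - y)\<close>: short distances contribute little uniformly in \<open>n\<close> by
  \<open>har_near_small\<close>, long ones because the kernel decays, and the middle range splits.
\<close>

lemma har_split_limit: "(\<lambda>n. har s (u n) - har s (w n)) \<longlonglongrightarrow> har s v"
proof (rule LIMSEQ_I)
  fix e :: real assume e: "e > 0"
  obtain Q where Q: "Q > 0" "\<And>f :: R3 \<Rightarrow> 'k. f \<in> Hs s \<Longrightarrow> mass f \<le> 4 * B \<Longrightarrow> gag s f \<le> 4 * B \<Longrightarrow> lp (2 + 4 * s / 3) f \<le> Q"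
    using critical_bound by blast
  define \<eta> where "\<eta> = e / (12 * Q)"
  have \<eta>: "\<eta> > 0" using e Q by (simp add: \<eta>_def)
  have B4: "4 * B > 0" using B by simp
  obtain \<rho> where \<rho>: "\<rho> > 0" "\<And>f :: R3 \<Rightarrow> 'k. f \<in> Hs s \<Longrightarrow> mass f \<le> 4 * B \<Longrightarrow>
      (LINT p|lborel2. near_wt \<rho> p * har_dens s f p) \<le> \<eta> * lp (2 + 4 * s / 3) f"
    using har_near_small[OF s \<eta> B4, where 'k = 'k] by blast
  define R0 where "R0 = (e / (12 * (4 * B) ^ 2)) powr (- (1 / (3 - 2 * s)))"
  define R where "R = max \<rho> R0"
  have ss: "3 - 2 * s > 0" using s by simp
  have R0: "R0 > 0" using e B by (simp add: R0_def)
  have R: "R > 0" "\<rho> \<le> R" "R0 \<le> R" using \<rho>(1) by (auto simp: R_def)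
  have RB: "R powr (- (3 - 2 * s)) * (4 * B) ^ 2 \<le> e / 12"
  proof -
    have "R powr (- (3 - 2 * s)) \<le> R0 powr (- (3 - 2 * s))" using R R0 ss by (intro powr_mono2') auto
    also have "\<dots> = e / (12 * (4 * B) ^ 2)" unfolding R0_def powr_powr minus_mult_minus using ss e B by simp
    finally have "R powr (- (3 - 2 * s)) * (4 * B) ^ 2 \<le> e / (12 * (4 * B) ^ 2) * (4 * B) ^ 2" by (rule mult_right_mono) simp
    also have "\<dots> = e / 12" using B by simp
    finally show ?thesis .
  qed
  define mid where "mid f = (LINT p|lborel2. (1 - near_wt \<rho> p) * near_wt R p * har_dens s f p)" for f :: "R3 \<Rightarrow> 'k"
  have tri: "mid f \<le> har s f \<and> har s f \<le> mid f + e / 6"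
    if f: "f \<in> Hs s" "mass f \<le> 4 * B" "gag s f \<le> 4 * B" for f :: "R3 \<Rightarrow> 'k"
  proof -
    define a where "a = (LINT p|lborel2. near_wt \<rho> p * har_dens s f p)"
    define c where "c = (LINT p|lborel2. (1 - near_wt R p) * har_dens s f p)"
    note i1 = har_split(3)[OF s f(1) \<rho>(1)] and i2 = har_split(3)[OF s f(1) R(1)] and i3 = har_far(1)[OF s(2) f(1) R(1)]
    have pw: "near_wt R p = near_wt \<rho> p + (1 - near_wt \<rho> p) * near_wt R p" for p
      using R(2) by (auto simp: near_wt_def)
    have ieq: "(1 - near_wt \<rho> p) * near_wt R p * har_dens s f p = near_wt R p * har_dens s f p - near_wt \<rho> p * har_dens s f p" for p
      by (subst (2) pw) (simp add: algebra_simps)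
    have "mid f = (LINT p|lborel2. near_wt R p * har_dens s f p) - a"
      unfolding mid_def a_def ieq using i1 i2 by simp
    then have h: "har s f = a + mid f + c" unfolding har_split(2)[OF s f(1) R(1)] c_def by simp
    have a0: "a \<ge> 0" "c \<ge> 0" unfolding a_def c_def
      by (intro Bochner_Integration.integral_nonneg mult_nonneg_nonneg har_dens_nonneg; simp add: near_wt_def)+
    have "a \<le> \<eta> * lp (2 + 4 * s / 3) f" unfolding a_def by (rule \<rho>(2)[OF f(1,2)])
    also have "\<dots> \<le> \<eta> * Q" using \<eta> Q(2)[OF f] by (intro mult_left_mono) auto
    also have "\<dots> = e / 12" using Q by (simp add: \<eta>_def)
    finally have a: "a \<le> e / 12" .
    have "c \<le> R powr (- (3 - 2 * s)) * mass f ^ 2" unfolding c_def by (rule har_far(2)[OF s(2) f(1) R(1)])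
    also have "\<dots> \<le> R powr (- (3 - 2 * s)) * (4 * B) ^ 2"
      using f(2) mass_nonneg[of f] by (intro mult_left_mono power_mono) auto
    also have "\<dots> \<le> e / 12" by (rule RB)
    finally show ?thesis using a a0 h by linarith
  qed
  obtain N where N: "\<And>n. n \<ge> N \<Longrightarrow> mid (u n) - mid (w n) - mid v \<le> e / 6 \<and> - (e / 6) \<le> mid (u n) - mid (w n) - mid v"
    using middle_range_split[OF \<rho>(1), of "e / 6" R] e unfolding mid_def by auto
  show "\<exists>no. \<forall>n\<ge>no. norm (har s (u n) - har s (w n) - har s v) < e"
  proof (intro exI[of _ N] allI impI)
    fix n assume "n \<ge> N"
    note this = N[OF this]
    moreover have "mid (u n) \<le> har s (u n) \<and> har s (u n) \<le> mid (u n) + e / 6" using mB[of n] gB[of n] B by (intro tri u) auto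
    moreover have "mid (w n) \<le> har s (w n) \<and> har s (w n) \<le> mid (w n) + e / 6" by (intro tri w_Hs)
    moreover have "mid v \<le> har s v \<and> har s v \<le> mid v + e / 6" using vB B by (intro tri v) auto
    ultimately show "norm (har s (u n) - har s (w n) - har s v) < e" unfolding real_norm_def using e by linarith
  qed
qed

lemma energy_split:
  assumes p: "2 < p" "p < 2 + 4 * s / 3" and V: "V \<in> borel_measurable borel" "\<And>x. \<bar>V x\<bar> \<le> M" "(V \<longlongrightarrow> 0) at_infinity"
  shows "(\<lambda>n. en s V p b (u n) - en s (\<lambda>_. 0) p b (w n)) \<longlonglongrightarrow> en s V p b v"
proof -
  have "(\<lambda>n. kin_const s * (gag s (u n) - gag s (w n)) + (LINT x|lborel. V x * norm (u n x) ^ 2)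
      - (har s (u n) - har s (w n)) / 2 - b * (lp p (u n) - lp p (w n)))
    \<longlonglongrightarrow> kin_const s * gag s v + (LINT x|lborel. V x * norm (v x) ^ 2) - har s v / 2 - b * lp p v"
    by (intro tendsto_intros gag_split har_split_limit lp_split p potential_limit[OF V]) auto
  then show ?thesis unfolding en_def by (simp add: algebra_simps diff_divide_distrib)
qed

end

section \<open>Existence of minimizers among Borel functions\<close>

text \<open>The remainder \<open>w\<close> left behind by the weak limit carries mass \<open>m - mass v\<close> and feels no
  potential. Since \<open>V \<le> 0\<close>, its energy is at least \<open>(m - mass v) / m\<close> times the infimum, by
  scaling it up to full mass; the limit therefore satisfies \<open>en v \<le> (mass v / m) I\<close>. Scaling
  \<open>v\<close> itself up to full mass would strictly lower the energy below \<open>I\<close>, unless nothing was lost.\<close>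

lemma minimizer_of_nonzero_limit:
  fixes u :: "nat \<Rightarrow> R3 \<Rightarrow> 'k :: {real_normed_field, euclidean_space}"
  assumes s: "3 / 4 < s" "s < 1" and p: "2 < p" "p < 2 + 4 * s / 3" and b: "b > 0"
    and V: "V \<in> borel_measurable borel" "\<And>x. \<bar>V x\<bar> \<le> M" "(V \<longlongrightarrow> 0) at_infinity" and Vneg: "\<And>x. V x \<le> 0"
    and u: "\<And>n. u n \<in> Hs s" and mu: "\<And>n. mass (u n) \<le> B" "\<And>n. mass (u n) = m" and gB: "\<And>n. gag s (u n) \<le> B" and m: "m > 0"
    and v: "v \<in> Hs s" and vB: "mass v \<le> B" "gag s v \<le> B" and ae: "AE x in lborel. (\<lambda>n. u n x) \<longlonglongrightarrow> v x"
    and loc: "\<And>R. (\<lambda>n. LINT x|lborel. indicator (ball 0 R) x * norm (u n x - v x) ^ 2) \<longlonglongrightarrow> 0"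
    and inf: "\<And>f :: R3 \<Rightarrow> 'k. f \<in> Hs s \<Longrightarrow> mass f = m \<Longrightarrow> I \<le> en s V p b f"
    and min: "(\<lambda>n. en s V p b (u n)) \<longlonglongrightarrow> I"
    and nz: "mass v > 0"
  shows "mass v = m" "en s V p b v \<le> I"
proof -
  have B: "B > 0" using mu(1)[of 0] mu(2)[of 0] m by simp
  interpret splitting s u v B
    by unfold_locales (fact s u mu gB B v vB ae loc)+
  have muw: "(\<lambda>n. mass (w n)) \<longlonglongrightarrow> m - mass v"
  proof -
    have "(\<lambda>n. m - (mass (u n) - mass (w n))) \<longlonglongrightarrow> m - mass v" by (intro tendsto_intros mass_split)
    then show ?thesis using mu(2) by simp
  qed
  have vm: "mass v \<le> m" using LIMSEQ_le_const[OF muw, of 0] mass_nonneg[of "w _"] by auto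
  have ampl: "t * en s V p b f \<ge> I" if "f \<in> Hs s" "t * mass f = m" "t \<ge> 1" for f :: "R3 \<Rightarrow> 'k" and t
    using energy_amplify(1,2)[OF that(1) p(1) b that(3)] energy_amplify(3)[OF that(1) p(1) b that(3), where V = V] inf[of "\<lambda>x. sqrt t *\<^sub>R f x"] that(2) by (auto intro: order_trans)
  have drop: "en s V p b f \<le> en s (\<lambda>_. 0) p b f" if f: "f \<in> Hs s" for f :: "R3 \<Rightarrow> 'k"
  proof -
    have "0 \<le> (LINT x|lborel. - (V x * norm (f x) ^ 2))"
      by (intro Bochner_Integration.integral_nonneg) (simp add: Vneg mult_nonpos_nonneg)
    then have "(LINT x|lborel. V x * norm (f x) ^ 2) \<le> 0" by simp
    then show ?thesis unfolding en_def by simp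
  qed
  have low: "mass (w n) / m * I \<le> en s (\<lambda>_. 0) p b (w n)" if lt: "mass (w n) \<le> m" for n
  proof (cases "mass (w n) = 0")
    case True
    have "en s (\<lambda>_. 0) p b (w n) = kin_const s * gag s (w n)"
      unfolding en_def using zero_mass(2,4)[OF w_Hs(1) True] s by simp
    then show ?thesis using True kin_const_pos[of s] gag_nonneg[of s "w n"] s by simp
  next
    case False
    then have pos: "mass (w n) > 0" using mass_nonneg[of "w n"] by simp
    have "I \<le> m / mass (w n) * en s V p b (w n)" using pos lt by (intro ampl w_Hs) auto
    then have "mass (w n) / m * I \<le> mass (w n) / m * (m / mass (w n) * en s V p b (w n))"
      using pos m by (intro mult_left_mono) auto
    also have "\<dots> = en s V p b (w n)" using pos m by simp
    also have "\<dots> \<le> en s (\<lambda>_. 0) p b (w n)" by (rule drop[OF w_Hs(1)])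
    finally show ?thesis .
  qed
  have "\<forall>\<^sub>F n in sequentially. mass (w n) < m" using nz by (intro order_tendstoD(2)[OF muw]) auto
  then have ev: "\<forall>\<^sub>F n in sequentially. en s V p b (u n) - en s (\<lambda>_. 0) p b (w n) \<le> en s V p b (u n) - mass (w n) / m * I"
  proof eventually_elim
    case (elim n)
    then show ?case using low[of n] by simp
  qed
  have "(\<lambda>n. en s V p b (u n) - mass (w n) / m * I) \<longlonglongrightarrow> I - (m - mass v) / m * I"
    using m by (intro tendsto_intros min muw) auto
  from tendsto_le[OF sequentially_bot this energy_split[OF p V] ev]
  have "en s V p b v \<le> I - (m - mass v) / m * I" .
  also have "\<dots> = mass v / m * I" using m by (simp add: field_simps)
  finally have le: "en s V p b v \<le> mass v / m * I" .
  show eq: "mass v = m"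
  proof (rule ccontr)
    assume "mass v \<noteq> m"
    then have lt: "mass v < m" using vm by simp
    have lp: "lp p v > 0" by (rule zero_mass(3)[OF v nz lp_interpolation(1)[OF s0 p v]])
    have t: "m / mass v > 1" using lt nz by simp
    have "I \<le> en s V p b (\<lambda>x. sqrt (m / mass v) *\<^sub>R v x)"
      using energy_amplify(1,2)[OF v p(1) b less_imp_le[OF t]] nz by (intro inf) auto
    also have "\<dots> < m / mass v * en s V p b v" by (rule energy_amplify(4)[OF v p(1) b less_imp_le[OF t] t lp])
    also have "\<dots> \<le> m / mass v * (mass v / m * I)" using nz m by (intro mult_left_mono le) auto
    also have "\<dots> = I" using nz m by simp
    finally show False by simp
  qed
  show "en s V p b v \<le> I" using le eq m by simp
qed

lemma minimizing_sequence:
  assumes s: "3 / 4 < s" "s < 1" and p: "2 < p" "p < 2 + 4 * s / 3" and b: "b > 0" and m: "m > 0"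
    and V: "V \<in> borel_measurable borel" "\<And>x. \<bar>V x\<bar> \<le> M"
  shows "\<exists>I B. \<exists>u :: nat \<Rightarrow> R3 \<Rightarrow> 'k :: {real_normed_field, euclidean_space}.
    (\<forall>f :: R3 \<Rightarrow> 'k. f \<in> Hs s \<longrightarrow> mass f = m \<longrightarrow> I \<le> en s V p b f) \<and>
    (\<forall>n. u n \<in> Hs s \<and> mass (u n) = m \<and> mass (u n) \<le> B \<and> gag s (u n) \<le> B) \<and> (\<lambda>n. en s V p b (u n)) \<longlonglongrightarrow> I"
proof -
  define E where "E = {en s V p b f |f :: R3 \<Rightarrow> 'k. f \<in> Hs s \<and> mass f = m}"
  define I where "I = Inf E"
  have k: "kin_const s > 0" using kin_const_pos[of s] s by simp
  obtain c where c: "\<And>f :: R3 \<Rightarrow> 'k. f \<in> Hs s \<Longrightarrow> mass f = m \<Longrightarrow> kin_const s / 2 * gag s f - c \<le> en s V p b f"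
    using energy_coercive[OF s p b m V, where 'k = 'k] by blast
  have "- c \<le> e" if e: "e \<in> E" for e
  proof -
    obtain f :: "R3 \<Rightarrow> 'k" where f: "f \<in> Hs s" "mass f = m" "e = en s V p b f" using e unfolding E_def by blast
    have "0 \<le> kin_const s / 2 * gag s f" using k gag_nonneg[of s f] by simp
    then show ?thesis using c[OF f(1,2)] f(3) by linarith
  qed
  then have bdd: "bdd_below E" by (rule bdd_belowI)
  have ne: "E \<noteq> {}" using negative_energy[OF s p b m, where 'k = 'k] unfolding E_def by blast
  have "\<exists>f :: R3 \<Rightarrow> 'k. f \<in> Hs s \<and> mass f = m \<and> en s V p b f < I + 1 / real (Suc n)" for n
  proof -
    have "Inf E < I + 1 / real (Suc n)" by (simp add: I_def)
    then obtain e where "e \<in> E" "e < I + 1 / real (Suc n)" using cInf_lessD[OF ne] by blast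
    then show ?thesis unfolding E_def by blast
  qed
  then obtain u :: "nat \<Rightarrow> R3 \<Rightarrow> 'k" where u: "\<And>n. u n \<in> Hs s" "\<And>n. mass (u n) = m" "\<And>n. en s V p b (u n) < I + 1 / real (Suc n)"
    by metis
  have inf: "I \<le> en s V p b f" if "f \<in> Hs s" "mass f = m" for f :: "R3 \<Rightarrow> 'k"
    unfolding I_def by (rule cInf_lower[OF _ bdd]) (use that in \<open>auto simp: E_def\<close>)
  have lim: "(\<lambda>n. en s V p b (u n)) \<longlonglongrightarrow> I"
  proof (rule tendsto_sandwich[of "\<lambda>_. I" _ _ "\<lambda>n. I + 1 / real (Suc n)"])
    have "(\<lambda>n. I + 1 / real (Suc n)) \<longlonglongrightarrow> I + 0" by (intro tendsto_intros lim_1_over_n[THEN LIMSEQ_Suc])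
    then show "(\<lambda>n. I + 1 / real (Suc n)) \<longlonglongrightarrow> I" by simp
  qed (use inf u in \<open>auto intro!: always_eventually less_imp_le\<close>)
  define B where "B = max m ((I + 1 + c) / (kin_const s / 2))"
  have "gag s (u n) \<le> B" for n
  proof -
    have "kin_const s / 2 * gag s (u n) \<le> I + 1 / real (Suc n) + c" using c[OF u(1,2)[of n]] u(3)[of n] by linarith
    also have "\<dots> \<le> I + 1 + c" by simp
    finally have "gag s (u n) \<le> (I + 1 + c) / (kin_const s / 2)" using k by (simp add: pos_le_divide_eq mult.commute)
    then show ?thesis by (simp add: B_def)
  qed
  then have bnd: "\<forall>n. u n \<in> Hs s \<and> mass (u n) = m \<and> mass (u n) \<le> B \<and> gag s (u n) \<le> B" using u by (simp add: B_def)
  have inf': "\<forall>f :: R3 \<Rightarrow> 'k. f \<in> Hs s \<longrightarrow> mass f = m \<longrightarrow> I \<le> en s V p b f" using inf by simp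
  show ?thesis by (rule exI[of _ I], rule exI[of _ B], rule exI[of _ u]) (intro conjI inf' bnd lim)
qed

text \<open>Without potential the infimum is negative, so a minimizing sequence cannot vanish: some unit
  ball carries a fixed amount of mass. Translating it to the origin costs nothing.\<close>

lemma free_minimizer:
  assumes s: "3 / 4 < s" "s < 1" and p: "2 < p" "p < 2 + 4 * s / 3" and b: "b > 0" and m: "m > 0"
  shows "\<exists>v :: R3 \<Rightarrow> 'k :: {real_normed_field, euclidean_space}. v \<in> Hs s \<and> mass v = m \<and>
    en s (\<lambda>_. 0) p b v < 0 \<and> (\<forall>f :: R3 \<Rightarrow> 'k. f \<in> Hs s \<longrightarrow> mass f = m \<longrightarrow> en s (\<lambda>_. 0) p b v \<le> en s (\<lambda>_. 0) p b f)"
proof -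
  let ?q = "2 + 4 * s / 3"
  have s0: "0 < s" using s by simp
  have k: "kin_const s > 0" using kin_const_pos[of s] s by simp
  obtain I B and u :: "nat \<Rightarrow> R3 \<Rightarrow> 'k" where
    inf': "\<forall>f :: R3 \<Rightarrow> 'k. f \<in> Hs s \<longrightarrow> mass f = m \<longrightarrow> I \<le> en s (\<lambda>_. 0) p b f" and
    u': "\<forall>n. u n \<in> Hs s \<and> mass (u n) = m \<and> mass (u n) \<le> B \<and> gag s (u n) \<le> B" and
    lim: "(\<lambda>n. en s (\<lambda>_. 0) p b (u n)) \<longlonglongrightarrow> I"
    using minimizing_sequence[OF s p b m, of "\<lambda>_. 0" 0, OF borel_measurable_const, where 'k = 'k, simplified] by (elim exE conjE) (rule that)
  have inf: "I \<le> en s (\<lambda>_. 0) p b f" if "f \<in> Hs s" "mass f = m" for f :: "R3 \<Rightarrow> 'k" using inf' that by blast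
  have u: "u n \<in> Hs s" "mass (u n) = m" "mass (u n) \<le> B" "gag s (u n) \<le> B" for n using u' by auto
  have B: "B > 0" using u(3)[of 0] u(2)[of 0] m by simp
  have I0: "I < 0"
  proof -
    obtain f :: "R3 \<Rightarrow> 'k" where "f \<in> Hs s" "mass f = m" "en s (\<lambda>_. 0) p b f < 0"
      using negative_energy[OF s p b m, where 'k = 'k] by blast
    then show ?thesis using inf[of f] by linarith
  qed
  have "\<not> (\<lambda>n. lp ?q (u n)) \<longlonglongrightarrow> 0"
  proof
    assume q: "(\<lambda>n. lp ?q (u n)) \<longlonglongrightarrow> 0"
    note z = nonlinear_terms_vanish[OF s p m u(1) eq_refl[OF u(2)] q]
    have "(\<lambda>n. - har s (u n) / 2 - b * lp p (u n)) \<longlonglongrightarrow> - 0 / 2 - b * 0" by (intro tendsto_intros z) auto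
    then have "(\<lambda>n. - har s (u n) / 2 - b * lp p (u n)) \<longlonglongrightarrow> 0" by simp
    then have "0 \<le> I"
    proof (rule LIMSEQ_le[OF _ lim])
      have "- har s (u n) / 2 - b * lp p (u n) \<le> en s (\<lambda>_. 0) p b (u n)" for n
        using k gag_nonneg[of s "u n"] unfolding en_def by simp
      then show "\<exists>N. \<forall>n\<ge>N. - har s (u n) / 2 - b * lp p (u n) \<le> en s (\<lambda>_. 0) p b (u n)" by blast
    qed
    then show False using I0 by simp
  qed
  then obtain e where e: "e > 0" "\<not> (\<exists>N. \<forall>n\<ge>N. dist (lp ?q (u n)) 0 < e)"
    unfolding lim_sequentially by blast
  then have often: "\<exists>n\<ge>N. e \<le> lp ?q (u n)" for N by (auto simp: not_less lp_nonneg)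
  have "\<exists>r :: nat \<Rightarrow> nat. strict_mono r \<and> (\<forall>n. e \<le> lp ?q (u (r n)))"
  proof -
    have "\<forall>N. \<exists>n>N. e \<le> lp ?q (u n)" using often by (metis Suc_le_lessD)
    then have "infinite {n. e \<le> lp ?q (u n)}" unfolding infinite_nat_iff_unbounded by auto
    then show ?thesis using enumerate_in_set[of "{n. e \<le> lp ?q (u n)}"] strict_mono_enumerate[of "{n. e \<le> lp ?q (u n)}"] by blast
  qed
  then obtain r where r: "strict_mono (r :: nat \<Rightarrow> nat)" and r_le: "\<forall>n. e \<le> lp ?q (u (r n))" by (elim exE conjE) (rule that)
  obtain C where C: "C > 0" "\<And>(f :: R3 \<Rightarrow> 'k) h. f \<in> Hs s \<Longrightarrow> h > 0 \<Longrightarrow>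
      (\<forall>x. (LINT y|lborel. indicator (ball x 1) y * norm (f y) ^ 2) \<le> h) \<Longrightarrow>
      lp ?q f \<le> C * h powr (2 * s / 3) * (gag s f + mass f)"
    using critical_interpolation[OF s0, where 'k = 'k] by blast
  \<comment> \<open>If no unit ball carried more mass than this, the mass-critical power would be at most \<open>e / 2\<close>.\<close>
  define h where "h = (e / (C * (4 * B))) powr (3 / (2 * s))"
  have h: "h > 0" using e(1) C(1) B by (simp add: h_def)
  have hp: "h powr (2 * s / 3) = e / (C * (4 * B))"
    unfolding h_def powr_powr using s0 e(1) C(1) B by simp
  have "\<forall>n. \<exists>x. h < (LINT y|lborel. indicator (ball x 1) y * norm (u (r n) y) ^ 2)"
  proof (rule allI, rule ccontr)
    fix n
    assume "\<not> (\<exists>x. h < (LINT y|lborel. indicator (ball x 1) y * norm (u (r n) y) ^ 2))"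
    then have "\<forall>x. (LINT y|lborel. indicator (ball x 1) y * norm (u (r n) y) ^ 2) \<le> h" by (simp add: not_less)
    from C(2)[OF u(1) h this] have "lp ?q (u (r n)) \<le> C * h powr (2 * s / 3) * (gag s (u (r n)) + mass (u (r n)))" .
    also have "\<dots> \<le> C * h powr (2 * s / 3) * (B + B)"
      using u(3,4)[of "r n"] C(1) by (intro mult_left_mono add_mono) auto
    also have "\<dots> = e / 2" unfolding hp using C(1) B by simp
    finally show False using r_le[rule_format, of n] e(1) by linarith
  qed
  then obtain y where y: "\<forall>n. h < (LINT x|lborel. indicator (ball (y n) 1) x * norm (u (r n) x) ^ 2)"
    by (elim choice[THEN exE]) (rule that)
  define f where "f n x = u (r n) (x + y n)" for n x
  have fH: "f n \<in> Hs s" "mass (f n) = m" "mass (f n) \<le> B" "gag s (f n) \<le> B" "en s (\<lambda>_. 0) p b (f n) = en s (\<lambda>_. 0) p b (u (r n))" for n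
    using translate_Hs[OF u(1)[of "r n"], where a = "y n"] u(2-4)[of "r n"] s unfolding f_def[abs_def] en_def by auto
  have fh: "h < (LINT x|lborel. indicator (ball 0 1) x * norm (f n x) ^ 2)" for n
  proof -
    have [measurable]: "u (r n) \<in> borel_measurable borel" by (rule HsD(1)[OF u(1)])
    have "(LINT x|lborel. indicator (ball (y n) 1) x * norm (u (r n) x) ^ 2)
        = (LINT x|lborel. indicator (ball (y n) 1) (x + y n) * norm (u (r n) (x + y n)) ^ 2)"
      by (rule integral_lborel_shift(2)[symmetric]) (use borel_measurable_integrable[OF local_mass_le(1)[OF u(1)]] in simp)
    also have "\<dots> = (LINT x|lborel. indicator (ball 0 1) x * norm (f n x) ^ 2)"
      by (rule Bochner_Integration.integral_cong) (auto simp: f_def indicator_def dist_norm)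
    finally show ?thesis using y[rule_format, of n] by simp
  qed
  obtain r' v where r': "strict_mono r'" and v: "v \<in> Hs s" "mass v \<le> B" "gag s v \<le> B" and
    ae: "AE x in lborel. (\<lambda>n. f (r' n) x) \<longlonglongrightarrow> v x" and
    loc': "\<forall>R. (\<lambda>n. LINT x|lborel. indicator (ball 0 R) x * norm (f (r' n) x - v x) ^ 2) \<longlonglongrightarrow> 0"
    using local_compactness[of s f B, OF s0 s(2) fH(1,3,4)] by (elim exE conjE) (rule that)
  have loc: "(\<lambda>n. LINT x|lborel. indicator (ball 0 R) x * norm (f (r' n) x - v x) ^ 2) \<longlonglongrightarrow> 0" for R using loc' by blast
  have lim': "(\<lambda>n. en s (\<lambda>_. 0) p b (f (r' n))) \<longlonglongrightarrow> I"
    unfolding fH(5) using LIMSEQ_subseq_LIMSEQ[OF LIMSEQ_subseq_LIMSEQ[OF lim r] r'] by (simp add: o_def)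
  have nz: "mass v > 0"
  proof -
    have le: "h \<le> 2 * (LINT x|lborel. indicator (ball 0 1) x * norm (f (r' n) x - v x) ^ 2) + 2 * mass v" for n
    proof -
      note d = diff_Hs(1)[OF fH(1)[of "r' n"] v(1)]
      note i1 = local_mass_le(1)[OF d, of 0 1] and i2 = local_mass_le(1)[OF v(1), of 0 1] and i3 = local_mass_le(1)[OF fH(1)[of "r' n"], of 0 1]
      have "(LINT x|lborel. indicator (ball 0 1) x * norm (f (r' n) x) ^ 2)
        \<le> (LINT x|lborel. 2 * (indicator (ball 0 1) x * norm (f (r' n) x - v x) ^ 2) + 2 * (indicator (ball 0 1) x * norm (v x) ^ 2))"
      proof (rule integral_mono[OF i3])
        fix x
        have "norm (f (r' n) x) ^ 2 \<le> 2 * norm (f (r' n) x - v x) ^ 2 + 2 * norm (v x) ^ 2"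
          using norm_diff_square_le[of "f (r' n) x - v x" "- v x"] by simp
        then show "indicator (ball 0 1) x * norm (f (r' n) x) ^ 2
          \<le> 2 * (indicator (ball 0 1) x * norm (f (r' n) x - v x) ^ 2) + 2 * (indicator (ball 0 1) x * norm (v x) ^ 2)"
          by (simp add: indicator_def)
      qed (use i1 i2 in auto)
      also have "\<dots> = 2 * (LINT x|lborel. indicator (ball 0 1) x * norm (f (r' n) x - v x) ^ 2) + 2 * (LINT x|lborel. indicator (ball 0 1) x * norm (v x) ^ 2)"
        using i1 i2 by simp
      finally show ?thesis using fh[of "r' n"] local_mass_le(2)[OF v(1), of 0 1] by linarith
    qed
    have "(\<lambda>n. 2 * (LINT x|lborel. indicator (ball 0 1) x * norm (f (r' n) x - v x) ^ 2) + 2 * mass v) \<longlonglongrightarrow> 2 * 0 + 2 * mass v"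
      by (intro tendsto_intros loc)
    from LIMSEQ_le_const[OF this] le have "h \<le> 2 * mass v" by auto
    then show ?thesis using h by simp
  qed
  have "mass v = m" "en s (\<lambda>_. 0) p b v \<le> I"
    by (rule minimizer_of_nonzero_limit[OF s p b _ _ _ _ fH(1) fH(3) fH(2) fH(4) m v ae loc inf lim' nz, of 0]; simp)+
  then show ?thesis using v(1) I0 inf by (intro exI[of _ v]) (auto intro: order_trans)
qed

text \<open>If \<open>V\<close> is negative somewhere, then it is negative on a ball; some translate of the minimizer of
  the free problem has mass there, which puts the infimum strictly below the free one. A minimizing
  sequence with zero limit would not feel \<open>V\<close> and so would have at least the free energy.\<close>

lemma minimizer_nonpositive_potential:
  assumes s: "3 / 4 < s" "s < 1" and p: "2 < p" "p < 2 + 4 * s / 3" and b: "b > 0" and m: "m > 0"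
    and V: "continuous_on UNIV V" "\<And>x. \<bar>V x\<bar> \<le> M" "(V \<longlongrightarrow> 0) at_infinity" and Vneg: "\<And>x. V x \<le> 0"
  shows "\<exists>v :: R3 \<Rightarrow> 'k :: {real_normed_field, euclidean_space}. v \<in> Hs s \<and> mass v = m \<and>
    (\<forall>f :: R3 \<Rightarrow> 'k. f \<in> Hs s \<longrightarrow> mass f = m \<longrightarrow> en s V p b v \<le> en s V p b f)"
proof -
  have s0: "0 < s" using s by simp
  obtain \<psi> :: "R3 \<Rightarrow> 'k" where \<psi>: "\<psi> \<in> Hs s" "mass \<psi> = m"
    "\<And>f :: R3 \<Rightarrow> 'k. f \<in> Hs s \<Longrightarrow> mass f = m \<Longrightarrow> en s (\<lambda>_. 0) p b \<psi> \<le> en s (\<lambda>_. 0) p b f"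
    using free_minimizer[OF s p b m, where 'k = 'k] by blast
  show ?thesis
  proof (cases "\<forall>x. V x = 0")
    case True
    then have "V = (\<lambda>_. 0)" by auto
    then show ?thesis using \<psi> by blast
  next
    case False
    then obtain x0 where x0: "V x0 < 0" using Vneg by (metis less_le)
    have Vm[measurable]: "V \<in> borel_measurable borel" using V(1) by (rule borel_measurable_continuous_onI)
    have "open {x. V x < V x0 / 2}" by (rule open_Collect_less[OF V(1) continuous_on_const])
    moreover have "x0 \<in> {x. V x < V x0 / 2}" using x0 by simp
    ultimately obtain \<rho> where \<rho>: "\<rho> > 0" "ball x0 \<rho> \<subseteq> {x. V x < V x0 / 2}"
      by (rule openE)
    have [measurable]: "\<psi> \<in> borel_measurable borel" by (rule HsD(1)[OF \<psi>(1)])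
    have "\<exists>a. 0 < (LINT x|lborel. indicator (ball x0 \<rho>) x * norm (\<psi> (x + a)) ^ 2)"
    proof (rule ccontr)
      assume "\<not> ?thesis"
      then have z: "(LINT x|lborel. indicator (ball x0 \<rho>) x * norm (\<psi> (x + a)) ^ 2) \<le> 0" for a by (simp add: not_less)
      have az: "AE x in lborel. x \<in> ball c \<rho> \<longrightarrow> \<psi> x = 0" for c
      proof -
        have i: "integrable lborel (\<lambda>x. indicator (ball c \<rho>) x * norm (\<psi> x) ^ 2)" by (rule local_mass_le(1)[OF \<psi>(1)])
        have "(LINT x|lborel. indicator (ball c \<rho>) x * norm (\<psi> x) ^ 2)
            = (LINT x|lborel. indicator (ball c \<rho>) (x + (c - x0)) * norm (\<psi> (x + (c - x0))) ^ 2)"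
          by (rule integral_lborel_shift(2)[symmetric]) (use borel_measurable_integrable[OF i] in simp)
        also have "\<dots> = (LINT x|lborel. indicator (ball x0 \<rho>) x * norm (\<psi> (x + (c - x0))) ^ 2)"
          by (rule Bochner_Integration.integral_cong) (auto simp: indicator_def dist_norm algebra_simps)
        finally have "(LINT x|lborel. indicator (ball c \<rho>) x * norm (\<psi> x) ^ 2) = 0"
          using z[of "c - x0"] by (intro antisym Bochner_Integration.integral_nonneg) auto
        then have "AE x in lborel. indicator (ball c \<rho>) x * norm (\<psi> x) ^ 2 = 0"
          using integral_nonneg_eq_0_iff_AE[OF i] by simp
        then show ?thesis by eventually_elim (auto simp: indicator_def)
      qed
      obtain D :: "R3 set" where D: "countable D" "\<And>X. open X \<Longrightarrow> X \<noteq> {} \<Longrightarrow> \<exists>d\<in>D. d \<in> X"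
        using countable_dense_setE by blast
      have "AE x in lborel. \<forall>c\<in>D. x \<in> ball c \<rho> \<longrightarrow> \<psi> x = 0" unfolding AE_ball_countable[OF D(1)] using az by blast
      then have "AE x in lborel. \<psi> x = 0"
      proof eventually_elim
        case (elim x)
        obtain d where "d \<in> D" "d \<in> ball x \<rho>" using D(2)[of "ball x \<rho>"] \<rho>(1) by auto
        then show ?case using elim by (auto simp: dist_commute)
      qed
      then have "mass \<psi> = 0" using zero_mass(1)[OF \<psi>(1)] by blast
      then show False using \<psi>(2) m by simp
    qed
    then obtain a where a: "0 < (LINT x|lborel. indicator (ball x0 \<rho>) x * norm (\<psi> (x + a)) ^ 2)" by blast
    note tr = translate_Hs[OF \<psi>(1), where a = a]
    have strict: "en s V p b (\<lambda>x. \<psi> (x + a)) < en s (\<lambda>_. 0) p b \<psi>"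
    proof -
      note i1 = local_mass_le(1)[OF tr(1), of x0 \<rho>] and i2 = potential_integral(1)[OF tr(1) Vm V(2)]
      have "(LINT x|lborel. V x * norm (\<psi> (x + a)) ^ 2) \<le> (LINT x|lborel. V x0 / 2 * (indicator (ball x0 \<rho>) x * norm (\<psi> (x + a)) ^ 2))"
      proof (rule integral_mono[OF i2 integrable_mult_right[OF i1]])
        fix x
        show "V x * norm (\<psi> (x + a)) ^ 2 \<le> V x0 / 2 * (indicator (ball x0 \<rho>) x * norm (\<psi> (x + a)) ^ 2)"
        proof (cases "x \<in> ball x0 \<rho>")
          case True
          then have "V x < V x0 / 2" using \<rho>(2) by blast
          then show ?thesis using True mult_right_mono[of "V x" "V x0 / 2" "norm (\<psi> (x + a)) ^ 2"] by simp
        next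
          case False
          then show ?thesis using Vneg[of x] by (simp add: mult_nonpos_nonneg)
        qed
      qed
      also have "\<dots> = V x0 / 2 * (LINT x|lborel. indicator (ball x0 \<rho>) x * norm (\<psi> (x + a)) ^ 2)" by simp
      also have "\<dots> < 0" using x0 a by (intro mult_neg_pos) auto
      finally have "(LINT x|lborel. V x * norm (\<psi> (x + a)) ^ 2) < 0" .
      then show ?thesis unfolding en_def using tr(3,4) tr(5)[OF s] by simp
    qed
    obtain I B and u :: "nat \<Rightarrow> R3 \<Rightarrow> 'k" where
      inf': "\<forall>f :: R3 \<Rightarrow> 'k. f \<in> Hs s \<longrightarrow> mass f = m \<longrightarrow> I \<le> en s V p b f" and
      u': "\<forall>n. u n \<in> Hs s \<and> mass (u n) = m \<and> mass (u n) \<le> B \<and> gag s (u n) \<le> B" and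
      lim: "(\<lambda>n. en s V p b (u n)) \<longlonglongrightarrow> I"
      using minimizing_sequence[OF s p b m Vm V(2), where 'k = 'k] by (elim exE conjE) (rule that)
    have inf: "I \<le> en s V p b f" if "f \<in> Hs s" "mass f = m" for f :: "R3 \<Rightarrow> 'k" using inf' that by blast
    have u: "u n \<in> Hs s" "mass (u n) = m" "mass (u n) \<le> B" "gag s (u n) \<le> B" for n using u' by auto
    have lt: "I < en s (\<lambda>_. 0) p b \<psi>" using inf[OF tr(1)] tr(2) \<psi>(2) strict by simp
    have B: "B > 0" using u(3)[of 0] u(2)[of 0] m by simp
    obtain r v where r: "strict_mono r" and v: "v \<in> Hs s" "mass v \<le> B" "gag s v \<le> B" and
      ae: "AE x in lborel. (\<lambda>n. u (r n) x) \<longlonglongrightarrow> v x" and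
      loc': "\<forall>R. (\<lambda>n. LINT x|lborel. indicator (ball 0 R) x * norm (u (r n) x - v x) ^ 2) \<longlonglongrightarrow> 0"
      using local_compactness[of s u B, OF s0 s(2) u(1,3,4)] by (elim exE conjE) (rule that)
    have loc: "(\<lambda>n. LINT x|lborel. indicator (ball 0 R) x * norm (u (r n) x - v x) ^ 2) \<longlonglongrightarrow> 0" for R using loc' by blast
    have lim': "(\<lambda>n. en s V p b (u (r n))) \<longlonglongrightarrow> I" using LIMSEQ_subseq_LIMSEQ[OF lim r] by (simp add: o_def)
    have nz: "mass v > 0"
    proof (rule ccontr)
      assume "\<not> mass v > 0"
      then have v0: "mass v = 0" using mass_nonneg[of v] by simp
      interpret sp: splitting s "\<lambda>n. u (r n)" v B
        by unfold_locales (fact s u B v ae loc)+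
      have "AE x in lborel. v x = 0" using zero_mass(1)[OF v(1)] v0 by blast
      then have "(LINT x|lborel. V x * norm (v x) ^ 2) = 0" by (intro integral_eq_zero_AE) auto
      then have pl: "(\<lambda>n. LINT x|lborel. V x * norm (u (r n) x) ^ 2) \<longlonglongrightarrow> 0"
        using sp.potential_limit[OF Vm V(2,3)] by simp
      have "(\<lambda>n. en s V p b (u (r n)) - (LINT x|lborel. V x * norm (u (r n) x) ^ 2)) \<longlonglongrightarrow> I - 0"
        by (intro tendsto_intros lim' pl)
      moreover have "en s (\<lambda>_. 0) p b \<psi> \<le> en s V p b (u (r n)) - (LINT x|lborel. V x * norm (u (r n) x) ^ 2)" for n
        using \<psi>(3)[OF u(1,2), of "r n"] unfolding en_def by simp
      ultimately have "en s (\<lambda>_. 0) p b \<psi> \<le> I - 0" by (intro LIMSEQ_le_const) auto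
      then show False using lt by simp
    qed
    have "mass v = m" "en s V p b v \<le> I"
      by (rule minimizer_of_nonzero_limit[OF s p b Vm V(2,3) Vneg u(1) u(3) u(2) u(4) m v ae loc inf lim' nz]; assumption)+
    then show ?thesis using v(1) inf by (intro exI[of _ v]) (auto intro: order_trans)
  qed
qed

section \<open>Passage to Lebesgue measurable functions\<close>

lemma Hs_space_representative:
  fixes v :: "R3 \<Rightarrow> 'k :: {real_normed_field, euclidean_space}"
  assumes v: "v \<in> mass_sphere s m"
  shows "v \<in> borel_measurable lebesgue" "\<exists>u \<in> Hs s. mass u = m \<and> (AE x in lborel. v x = u x)"
proof -
  from v have vm: "v \<in> borel_measurable lebesgue" and v2: "integrable lebesgue (\<lambda>x. norm (v x) ^ 2)"
    and fin: "(\<integral>\<^sup>+x. (\<integral>\<^sup>+y. ennreal (norm (v x - v y) ^ 2 / norm (x - y) powr (3 + 2 * s)) \<partial>lebesgue) \<partial>lebesgue) < \<infinity>"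
    and mv: "(LINT x|lebesgue. norm (v x) ^ 2) = m"
    by (auto simp: mass_sphere_def Hs_space_def)
  obtain u where u[measurable]: "u \<in> borel_measurable borel" and ae: "AE x in lborel. v x = u x"
    using lebesgue_borel_representative[OF vm] by blast
  have m: "mass u = m" unfolding mass_def mv[symmetric]
    by (rule integral_lebesgue_cong[symmetric]) (measurable, use ae in eventually_elim, simp)
  have aeL: "AE x in lebesgue. norm (v x) ^ 2 = norm (u x) ^ 2"
    by (rule AE_completion) (use ae in eventually_elim, simp)
  have "integrable lebesgue (\<lambda>x. norm (u x) ^ 2)"
    by (rule integrable_cong_AE_imp[OF v2 _ aeL]) (rule measurable_completion, measurable)
  then have u2: "integrable lborel (\<lambda>x. norm (u x) ^ 2)" by (subst (asm) integrable_completion) auto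
  have "(\<integral>\<^sup>+x. (\<integral>\<^sup>+y. ennreal (norm (u x - u y) ^ 2 / norm (x - y) powr (3 + 2 * s)) \<partial>lborel) \<partial>lborel)
      = (\<integral>\<^sup>+x. (\<integral>\<^sup>+y. ennreal (norm (v x - v y) ^ 2 / norm (x - y) powr (3 + 2 * s)) \<partial>lebesgue) \<partial>lebesgue)"
    unfolding nn_integral_completion
  proof (rule nn_integral_cong_AE)
    show "AE x in lborel. (\<integral>\<^sup>+y. ennreal (norm (u x - u y) ^ 2 / norm (x - y) powr (3 + 2 * s)) \<partial>lborel)
        = (\<integral>\<^sup>+y. ennreal (norm (v x - v y) ^ 2 / norm (x - y) powr (3 + 2 * s)) \<partial>lborel)"
      using ae
    proof eventually_elim
      case (elim x)
      show ?case
        by (rule nn_integral_cong_AE) (use ae in eventually_elim, simp add: elim)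
    qed
  qed
  then have "u \<in> Hs s" unfolding Hs_iff_nn using u2 fin by simp
  then show "v \<in> borel_measurable lebesgue" "\<exists>u \<in> Hs s. mass u = m \<and> (AE x in lborel. v x = u x)"
    using vm m ae by blast+
qed

lemma Hs_mass_sphere:
  fixes u :: "R3 \<Rightarrow> 'k :: {real_normed_field, euclidean_space}"
  assumes u: "u \<in> Hs s"
  shows "u \<in> mass_sphere s (mass u)"
proof -
  note h = HsD[OF u]
  have [measurable]: "u \<in> borel_measurable borel" by (rule h)
  have "u \<in> borel_measurable lebesgue" by (rule measurable_completion) simp
  moreover have "integrable lebesgue (\<lambda>x. norm (u x) ^ 2)" by (subst integrable_completion) (auto simp: h)
  moreover have "(LINT x|lebesgue. norm (u x) ^ 2) = mass u" unfolding mass_def by (rule integral_lebesgue_cong) auto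
  ultimately show ?thesis using u unfolding mass_sphere_def Hs_space_def Hs_iff_nn nn_integral_completion by simp
qed

text \<open>
  Changing \<open>v\<close> on a null set changes neither the double integral nor, by \<open>frac_laplace_of_Hs\<close>, the
  fractional Laplacian up to a null set.
\<close>

lemma energy_representative:
  fixes u v :: "R3 \<Rightarrow> 'k :: {real_normed_field, euclidean_space}"
  assumes s: "3 / 4 < s" "s < 1" and u: "u \<in> Hs s" and vu: "AE x in lborel. v x = u x" and vm: "v \<in> borel_measurable lebesgue"
    and V[measurable]: "V \<in> borel_measurable borel" and M: "\<And>x. \<bar>V x\<bar> \<le> M"
  shows "energy s V p a v = en s V p (2 * a powr (p - 2) / p) u"
proof -
  have s0: "0 < s" using s by simp
  have [measurable]: "u \<in> borel_measurable borel" by (rule HsD(1)[OF u])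
  obtain D where D[measurable]: "D \<in> borel_measurable borel" and D2: "integrable lborel (\<lambda>x. norm (D x) ^ 2)"
    "(LINT x|lborel. norm (D x) ^ 2) = kin_const s * gag s u" and ae: "AE x in lborel. frac_laplace (s / 2) v x = D x"
    using frac_laplace_of_Hs[OF s0 s(2) u vu vm] by blast
  have "(LINT x|lebesgue. norm (frac_laplace (s / 2) v x) ^ 2 + V x * norm (v x) ^ 2)
      = (LINT x|lborel. norm (D x) ^ 2 + V x * norm (u x) ^ 2)"
    by (rule integral_lebesgue_cong) (measurable, use ae vu in eventually_elim, simp)
  also have "\<dots> = kin_const s * gag s u + (LINT x|lborel. V x * norm (u x) ^ 2)"
    using D2 potential_integral(1)[OF u V M] by simp
  finally have 1: "(LINT x|lebesgue. norm (frac_laplace (s / 2) v x) ^ 2 + V x * norm (v x) ^ 2)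
      = kin_const s * gag s u + (LINT x|lborel. V x * norm (u x) ^ 2)" .
  have "(LINT y|lebesgue. norm (v x) ^ 2 * norm (v y) ^ 2 / norm (x - y) powr (3 - 2 * s))
      = (LINT y|lborel. norm (v x) ^ 2 * norm (u y) ^ 2 / norm (x - y) powr (3 - 2 * s))" for x
    by (rule integral_lebesgue_cong) (measurable, use vu in eventually_elim, simp)
  then have "(LINT x|lebesgue. LINT y|lebesgue. norm (v x) ^ 2 * norm (v y) ^ 2 / norm (x - y) powr (3 - 2 * s))
      = (LINT x|lebesgue. LINT y|lborel. norm (v x) ^ 2 * norm (u y) ^ 2 / norm (x - y) powr (3 - 2 * s))" by simp
  also have "\<dots> = har s u" unfolding har_iterated[OF s u]
    by (rule integral_lebesgue_cong) (measurable, use vu in eventually_elim, simp)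
  finally have 2: "(LINT x|lebesgue. LINT y|lebesgue. norm (v x) ^ 2 * norm (v y) ^ 2 / norm (x - y) powr (3 - 2 * s)) = har s u" .
  have 3: "(LINT x|lebesgue. norm (v x) powr p) = lp p u" unfolding lp_def
    by (rule integral_lebesgue_cong) (measurable, use vu in eventually_elim, simp)
  show ?thesis unfolding energy_def 1 2 3 en_def by simp
qed

section \<open>Existence of a minimizer\<close>

lemma holder_continuous_imp_continuous:
  assumes \<alpha>: "0 < \<alpha>" and V: "holder_continuous \<alpha> V"
  shows "continuous_on UNIV V"
proof -
  obtain K where K: "\<And>x y. \<bar>V x - V y\<bar> \<le> K * norm (x - y) powr \<alpha>" using V unfolding holder_continuous_def by blast
  have "V \<midarrow>x\<rightarrow> V x" for x
  proof (rule Lim_null[THEN iffD2], rule Lim_null_comparison)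
    show "\<forall>\<^sub>F y in at x. norm (V y - V x) \<le> K * norm (y - x) powr \<alpha>" using K by simp
    have "((\<lambda>y. norm (y - x) powr \<alpha>) \<longlongrightarrow> 0) (at x)"
    proof (rule tendsto_zero_powrI)
      show "((\<lambda>y. norm (y - x)) \<longlongrightarrow> 0) (at x)" by (intro tendsto_norm_zero LIM_zero tendsto_ident_at)
    qed (use \<alpha> in auto)
    then show "((\<lambda>y. K * norm (y - x) powr \<alpha>) \<longlongrightarrow> 0) (at x)" by (rule tendsto_mult_right_zero)
  qed
  then show ?thesis by (simp add: continuous_on_def)
qed

lemma continuous_limit_imp_bounded:
  fixes V :: "R3 \<Rightarrow> real"
  assumes c: "continuous_on UNIV V" and l: "(V \<longlongrightarrow> l) at_infinity"
  shows "\<exists>M. \<forall>x. \<bar>V x\<bar> \<le> M"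
proof -
  have "\<forall>\<^sub>F x in at_infinity. dist (V x) l < 1" using l by (rule tendstoD) simp
  then obtain R where R: "\<And>x. R \<le> norm x \<Longrightarrow> dist (V x) l < 1" unfolding eventually_at_infinity by blast
  have "compact (V ` cball 0 R)" by (intro compact_continuous_image continuous_on_subset[OF c]) auto
  then have "bounded (V ` cball 0 R)" by (rule compact_imp_bounded)
  then obtain K where "\<forall>y \<in> V ` cball 0 R. norm y \<le> K" unfolding bounded_iff by blast
  then have K: "\<bar>V x\<bar> \<le> K" if "norm x \<le> R" for x using that by auto
  have "\<bar>V x\<bar> \<le> max K (\<bar>l\<bar> + 1)" for x
  proof (cases "norm x \<le> R")
    case True
    then show ?thesis using K[OF True] by simp
  next
    case False
    then have "dist (V x) l < 1" by (intro R) simp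
    then show ?thesis by (simp add: dist_real_def)
  qed
  then show ?thesis by blast
qed

theorem theorem1p1:
  fixes s p a \<alpha> m V_inf :: real and V :: "real ^ 3 \<Rightarrow> real"
  assumes "3 / 4 < s" and "s < 1"
    and "2 < p" and "p < 2 + 4 * s / 3"
    and "0 < a"
    and "0 < \<alpha>" and "\<alpha> < 1"
    and "V \<in> L_infinity" and "holder_continuous \<alpha> V"
    and "(V \<longlongrightarrow> V_inf) at_infinity" and "V_inf = (SUP x. V x)"
    and "0 < m"
  shows "\<exists>u \<in> (mass_sphere s m :: (real ^ 3 \<Rightarrow> 'k :: {real_normed_field, euclidean_space}) set).
           ereal (energy s V p a u) = energy_inf TYPE('k) s V p a m"
proof -
  note s = assms(1,2) and p = assms(3,4)
  define b where "b = 2 * a powr (p - 2) / p"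
  have b: "b > 0" using assms(3,5) by (simp add: b_def)
  have Vc: "continuous_on UNIV V" by (rule holder_continuous_imp_continuous[OF assms(6,9)])
  have Vm: "V \<in> borel_measurable borel" by (rule borel_measurable_continuous_onI[OF Vc])
  obtain M where M: "\<And>x. \<bar>V x\<bar> \<le> M" using continuous_limit_imp_bounded[OF Vc assms(10)] by blast
  have "bdd_above (range V)" using M by (intro bdd_aboveI[of _ M]) (auto intro: order_trans[OF abs_ge_self])
  then have sup: "V x \<le> V_inf" for x unfolding assms(11) by (rule cSUP_upper[OF UNIV_I])
  \<comment> \<open>At fixed mass, subtracting \<open>V_inf\<close> from the potential shifts all energies by the same constant.\<close>
  define W where "W x = V x - V_inf" for x
  have Wc: "continuous_on UNIV W" unfolding W_def by (intro continuous_intros Vc)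
  have W0: "W x \<le> 0" for x using sup[of x] by (simp add: W_def)
  have WM: "\<bar>W x\<bar> \<le> M + \<bar>V_inf\<bar>" for x using M[of x] by (simp add: W_def)
  have Wl: "(W \<longlongrightarrow> 0) at_infinity" unfolding W_def using Lim_null[of V V_inf] assms(10) by simp
  have shift: "en s V p b f = en s W p b f + V_inf * mass f" if f: "f \<in> Hs s" for f :: "R3 \<Rightarrow> 'k"
  proof -
    have "(LINT x|lborel. W x * norm (f x) ^ 2) = (LINT x|lborel. V x * norm (f x) ^ 2) - V_inf * mass f"
      unfolding W_def mass_def left_diff_distrib using potential_integral(1)[OF f Vm M] HsD(2)[OF f] by simp
    then show ?thesis unfolding en_def by simp
  qed
  obtain u :: "R3 \<Rightarrow> 'k" where u: "u \<in> Hs s" "mass u = m"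
    and min: "\<And>f :: R3 \<Rightarrow> 'k. f \<in> Hs s \<Longrightarrow> mass f = m \<Longrightarrow> en s W p b u \<le> en s W p b f"
    using minimizer_nonpositive_potential[OF s p b assms(12) Wc WM Wl W0, where 'k = 'k] by blast
  have uS: "u \<in> mass_sphere s m" using Hs_mass_sphere[OF u(1)] u(2) by simp
  have eu: "energy s V p a u = en s V p b u" unfolding b_def
    by (rule energy_representative[OF s u(1) _ Hs_space_representative(1)[OF uS] Vm M]) simp
  have "energy s V p a u \<le> energy s V p a v" if v: "v \<in> mass_sphere s m" for v :: "R3 \<Rightarrow> 'k"
  proof -
    obtain f where f: "f \<in> Hs s" "mass f = m" "AE x in lborel. v x = f x" using Hs_space_representative(2)[OF v] by blast
    have "energy s V p a v = en s V p b f" unfolding b_def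
      by (rule energy_representative[OF s f(1,3) Hs_space_representative(1)[OF v] Vm M])
    then show ?thesis using min[OF f(1,2)] eu shift[OF u(1)] shift[OF f(1)] u(2) f(2) by simp
  qed
  then have "ereal (energy s V p a u) = energy_inf TYPE('k) s V p a m"
    unfolding energy_inf_def by (intro antisym INF_greatest INF_lower uS) simp
  then show ?thesis using uS by blast
qed

end
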